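(* Let $G$ be a finite group and $K$ a field. If $V,W$ are simple $K\Sigma_n^G$-modules with apexes $X,Y\in\Pi_n$, respectively, then $\operatorname{Ext}^r_{K\Sigma_n^G}(V,W)=0$ unless $X\leq Y$ and $r\geq |X|-|Y|$, in which case $$\operatorname{Ext}^r_{K\Sigma_n^G}(V,W)\cong \operatorname{Ext}^{r-|X|+|Y|}_{KG_Y}(V,W),$$ where $W$ is a simple $KG_Y$-module, $V$ is a simple $KG_X$-module and $G_Y\leq G_X$. In particular, if the characteristic of $K$ does not divide $|G|$, then $\operatorname{Ext}^r_{K\Sigma_n^G}(V,W)=0$ unless $X\leq Y$ and $r=|X|-|Y|$, in which case $\operatorname{Ext}^r_{K\Sigma_n^G}(V,W)\cong \operatorname{Hom}_{KG_Y}(V,W)$.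
   Context: Modules are left modules. $\Sigma_n$ is the monoid of ordered set partitions of $\{1,\ldots,n\}$ with product $(P_1,\ldots,P_r)(Q_1,\ldots,Q_s)=(P_1\cap Q_1,\ldots,P_1\cap Q_s,P_2\cap Q_1,\ldots,P_r\cap Q_s)^{\wedge}$, where $\wedge$ means omit empty intersections; the identity is the one-block partition. $\Pi_n$ is the lattice of set partitions of $\{1,\ldots,n\}$, ordered so that coarser partitions are larger; $|X|$ is the number of blocks of $X\in\Pi_n$. For $\pi\in\Sigma_n$, $\sigma(\pi)\in\Pi_n$ is the underlying set partition. For a finite group $G$, Hsiao's monoid of ordered $G$-partitions $\Sigma_n^G$ is the submonoid of $\Sigma_n\times G^n$ consisting of all pairs $(\pi,g)$ such that $g_i=g_j$ whenever $i,j$ are in the same block of $\sigma(\pi)$. For $X\in\Pi_n$, $G_X$ is the subgroup of $G^n$ of all $g$ with $g_i=g_j$ whenever $i,j$ are in the same block of $X$; so $G_X\cong G^{|X|}$, and $X\leq Y$ implies $G_Y\leq G_X$. Each simple $KG_X$-module $V$ becomes a simple $K\Sigma_n^G$-module by letting $(\pi,g)$ act as $g$ if $X\leq\sigma(\pi)$ (then $g\in G_{\sigma(\pi)}\le G_X$) and as $0$ otherwise. Every simple $K\Sigma_n^G$-module arises in this way from a unique $X\in\Pi_n$, called its apex, and a simple $KG_X$-module, unique up to isomorphism. *)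

theory Defs
  imports "HOL-Algebra.Module" "HOL-Algebra.AbelCoset" "HOL-Algebra.Product_Groups"
    "HOL-Algebra.Multiplicative_Group" "HOL-Library.Disjoint_Sets"
begin

section \<open>Left modules over a ring\<close>

text \<open>The library locale \<^locale>\<open>module\<close> requires a commutative ring of scalars. As there, the
  fields \<^const>\<open>mult\<close> and \<^const>\<open>one\<close> of the record of a module carry no meaning.\<close>

locale left_module = R?: ring R + M?: abelian_group M
  for R :: "('r, 'e) ring_scheme" (structure) and M :: "('r, 'a, 'f) module_scheme" (structure) +
  assumes smult_closed [simp, intro]:
      "\<lbrakk>a \<in> carrier R; x \<in> carrier M\<rbrakk> \<Longrightarrow> a \<odot>\<^bsub>M\<^esub> x \<in> carrier M"
    and smult_l_distr:
      "\<lbrakk>a \<in> carrier R; b \<in> carrier R; x \<in> carrier M\<rbrakk> \<Longrightarrow>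
        (a \<oplus>\<^bsub>R\<^esub> b) \<odot>\<^bsub>M\<^esub> x = a \<odot>\<^bsub>M\<^esub> x \<oplus>\<^bsub>M\<^esub> b \<odot>\<^bsub>M\<^esub> x"
    and smult_r_distr:
      "\<lbrakk>a \<in> carrier R; x \<in> carrier M; y \<in> carrier M\<rbrakk> \<Longrightarrow>
        a \<odot>\<^bsub>M\<^esub> (x \<oplus>\<^bsub>M\<^esub> y) = a \<odot>\<^bsub>M\<^esub> x \<oplus>\<^bsub>M\<^esub> a \<odot>\<^bsub>M\<^esub> y"
    and smult_assoc1:
      "\<lbrakk>a \<in> carrier R; b \<in> carrier R; x \<in> carrier M\<rbrakk> \<Longrightarrow>
        (a \<otimes>\<^bsub>R\<^esub> b) \<odot>\<^bsub>M\<^esub> x = a \<odot>\<^bsub>M\<^esub> (b \<odot>\<^bsub>M\<^esub> x)"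
    and smult_one [simp]: "x \<in> carrier M \<Longrightarrow> \<one>\<^bsub>R\<^esub> \<odot>\<^bsub>M\<^esub> x = x"

text \<open>Homomorphisms are extensional functions, so that they form a module themselves.\<close>

definition mod_hom ::
  "('r, 'e) ring_scheme \<Rightarrow> ('r, 'a, 'f) module_scheme \<Rightarrow> ('r, 'b, 'h) module_scheme \<Rightarrow> ('a \<Rightarrow> 'b) set"
where
  "mod_hom R M N = {f \<in> carrier M \<rightarrow>\<^sub>E carrier N.
     (\<forall>x\<in>carrier M. \<forall>y\<in>carrier M. f (x \<oplus>\<^bsub>M\<^esub> y) = f x \<oplus>\<^bsub>N\<^esub> f y) \<and>
     (\<forall>a\<in>carrier R. \<forall>x\<in>carrier M. f (a \<odot>\<^bsub>M\<^esub> x) = a \<odot>\<^bsub>N\<^esub> f x)}"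

definition mod_iso ::
  "('r, 'e) ring_scheme \<Rightarrow> ('r, 'a, 'f) module_scheme \<Rightarrow> ('r, 'b, 'h) module_scheme \<Rightarrow> bool"
where
  "mod_iso R M N \<longleftrightarrow> (\<exists>f\<in>mod_hom R M N. bij_betw f (carrier M) (carrier N))"

definition simple_module :: "('r, 'e) ring_scheme \<Rightarrow> ('r, 'a, 'f) module_scheme \<Rightarrow> bool" where
  "simple_module R M \<longleftrightarrow> left_module R M \<and> carrier M \<noteq> {\<zero>\<^bsub>M\<^esub>} \<and>
     (\<forall>N. submodule N R M \<longrightarrow> N = {\<zero>\<^bsub>M\<^esub>} \<or> N = carrier M)"

definition quot_module :: "('r, 'a, 'f) module_scheme \<Rightarrow> 'a set \<Rightarrow> ('r, 'a set) module" where
  "quot_module M B = \<lparr>carrier = a_rcosets\<^bsub>M\<^esub> B, monoid.mult = undefined, one = undefined,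
     ring.zero = B, ring.add = set_add M, smult = (\<lambda>a C. \<Union>c\<in>C. B +>\<^bsub>M\<^esub> (a \<odot>\<^bsub>M\<^esub> c))\<rparr>"

definition supp :: "('r, 'e) ring_scheme \<Rightarrow> ('i \<Rightarrow> 'r) \<Rightarrow> 'i set" where
  "supp R f = {i. f i \<noteq> \<zero>\<^bsub>R\<^esub>}"

definition finsupp :: "('r, 'e) ring_scheme \<Rightarrow> 'i set \<Rightarrow> ('i \<Rightarrow> 'r) set" where
  "finsupp R I = {f. (\<forall>i. f i \<in> carrier R) \<and> finite (supp R f) \<and> supp R f \<subseteq> I}"

definition free_module :: "('r, 'e) ring_scheme \<Rightarrow> 'i set \<Rightarrow> ('r, 'i \<Rightarrow> 'r) module" where
  "free_module R I = \<lparr>carrier = finsupp R I, monoid.mult = undefined, one = undefined,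
     ring.zero = (\<lambda>_. \<zero>\<^bsub>R\<^esub>), ring.add = (\<lambda>f g i. f i \<oplus>\<^bsub>R\<^esub> g i), smult = (\<lambda>a f i. a \<otimes>\<^bsub>R\<^esub> f i)\<rparr>"

text \<open>Projective means direct summand of a free module. That the basis \<open>I\<close> consists of elements of the
  type of \<open>P\<close> is no restriction, since a projective \<open>P\<close> is a direct summand of the free module on
  the set \<^term>\<open>carrier P\<close>.\<close>

definition projective_module :: "('r, 'e) ring_scheme \<Rightarrow> ('r, 'a, 'f) module_scheme \<Rightarrow> bool" where
  "projective_module R P \<longleftrightarrow> left_module R P \<and>
     (\<exists>(I :: 'a set) i p. i \<in> mod_hom R P (free_module R I) \<and> p \<in> mod_hom R (free_module R I) P \<and>
        (\<forall>x\<in>carrier P. p (i x) = x))"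

text \<open>\<open>\<dots> \<rightarrow> P 2 \<rightarrow> P 1 \<rightarrow> P 0 \<rightarrow> V \<rightarrow> 0\<close> exact, with \<open>d r\<close> from \<open>P (Suc r)\<close> to \<open>P r\<close>
  and augmentation \<open>e\<close>.\<close>

definition projective_resolution ::
  "('r, 'e) ring_scheme \<Rightarrow> (nat \<Rightarrow> ('r, 'p) module) \<Rightarrow> (nat \<Rightarrow> 'p \<Rightarrow> 'p) \<Rightarrow> ('p \<Rightarrow> 'v) \<Rightarrow>
    ('r, 'v, 'f) module_scheme \<Rightarrow> bool"
where
  "projective_resolution R P d e V \<longleftrightarrow>
     (\<forall>r. projective_module R (P r)) \<and>
     (\<forall>r. d r \<in> mod_hom R (P (Suc r)) (P r)) \<and>
     e \<in> mod_hom R (P 0) V \<and> e ` carrier (P 0) = carrier V \<and>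
     a_kernel (P 0) V e = d 0 ` carrier (P (Suc 0)) \<and>
     (\<forall>r. a_kernel (P (Suc r)) (P r) (d r) = d (Suc r) ` carrier (P (Suc (Suc r))))"


section \<open>Monoid algebras, Hom and Ext\<close>

text \<open>Elements of \<open>KM\<close> are functions that vanish outside \<^term>\<open>carrier M\<close>. Consequently, if \<open>N\<close> is
  a submonoid of \<open>M\<close> (with the operations of \<open>M\<close>), then \<open>KN\<close> is literally a subset of \<open>KM\<close>, and
  the restriction of a \<open>KM\<close>-module to \<open>KN\<close> is given by the same record.\<close>

definition monoid_algebra :: "('k, 'e) ring_scheme \<Rightarrow> ('m, 'f) monoid_scheme \<Rightarrow> ('m \<Rightarrow> 'k) ring" where
  "monoid_algebra K M = \<lparr>carrier = finsupp K (carrier M),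
     monoid.mult = (\<lambda>a b z. \<Oplus>\<^bsub>K\<^esub>p\<in>{p \<in> supp K a \<times> supp K b. fst p \<otimes>\<^bsub>M\<^esub> snd p = z}. a (fst p) \<otimes>\<^bsub>K\<^esub> b (snd p)),
     one = (\<lambda>z. if z = \<one>\<^bsub>M\<^esub> then \<one>\<^bsub>K\<^esub> else \<zero>\<^bsub>K\<^esub>),
     ring.zero = (\<lambda>_. \<zero>\<^bsub>K\<^esub>),
     ring.add = (\<lambda>a b z. a z \<oplus>\<^bsub>K\<^esub> b z)\<rparr>"

definition single :: "('k, 'e) ring_scheme \<Rightarrow> 'm \<Rightarrow> 'k \<Rightarrow> 'm \<Rightarrow> 'k" where
  "single K x k = (\<lambda>z. if z = x then k else \<zero>\<^bsub>K\<^esub>)"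

text \<open>\<open>Hom\<^bsub>KM\<^esub>(P, W)\<close> as a \<open>K\<close>-vector space; \<open>K\<close> acts on \<open>W\<close> through \<open>K\<one> \<subseteq> KM\<close>.\<close>

definition hom_module ::
  "('k, 'e) ring_scheme \<Rightarrow> ('m, 'f) monoid_scheme \<Rightarrow> ('m \<Rightarrow> 'k, 'p, 'h) module_scheme \<Rightarrow>
    ('m \<Rightarrow> 'k, 'w, 'j) module_scheme \<Rightarrow> ('k, 'p \<Rightarrow> 'w) module"
where
  "hom_module K M P W = \<lparr>carrier = mod_hom (monoid_algebra K M) P W,
     monoid.mult = undefined, one = undefined,
     ring.zero = (\<lambda>x\<in>carrier P. \<zero>\<^bsub>W\<^esub>),
     ring.add = (\<lambda>f g. \<lambda>x\<in>carrier P. f x \<oplus>\<^bsub>W\<^esub> g x),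
     smult = (\<lambda>k f. \<lambda>x\<in>carrier P. single K \<one>\<^bsub>M\<^esub> k \<odot>\<^bsub>W\<^esub> f x)\<rparr>"

text \<open>The cochain complex \<open>Hom\<^bsub>KM\<^esub>(P r, W)\<close> and its cohomology. If \<open>P, d\<close> (with some augmentation)
  is a projective resolution of \<open>V\<close>, this cohomology is \<open>Ext\<^sup>r\<^bsub>KM\<^esub>(V, W)\<close>.\<close>

definition cocycles ::
  "('k, 'e) ring_scheme \<Rightarrow> ('m, 'f) monoid_scheme \<Rightarrow> (nat \<Rightarrow> ('m \<Rightarrow> 'k, 'p) module) \<Rightarrow>
    (nat \<Rightarrow> 'p \<Rightarrow> 'p) \<Rightarrow> ('m \<Rightarrow> 'k, 'w, 'j) module_scheme \<Rightarrow> nat \<Rightarrow> ('p \<Rightarrow> 'w) set"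
where
  "cocycles K M P d W r = {f \<in> carrier (hom_module K M (P r) W).
     compose (carrier (P (Suc r))) f (d r) = \<zero>\<^bsub>hom_module K M (P (Suc r)) W\<^esub>}"

fun coboundaries ::
  "('k, 'e) ring_scheme \<Rightarrow> ('m, 'f) monoid_scheme \<Rightarrow> (nat \<Rightarrow> ('m \<Rightarrow> 'k, 'p) module) \<Rightarrow>
    (nat \<Rightarrow> 'p \<Rightarrow> 'p) \<Rightarrow> ('m \<Rightarrow> 'k, 'w, 'j) module_scheme \<Rightarrow> nat \<Rightarrow> ('p \<Rightarrow> 'w) set"
where
  "coboundaries K M P d W 0 = {\<zero>\<^bsub>hom_module K M (P 0) W\<^esub>}"
| "coboundaries K M P d W (Suc r) =
     (\<lambda>f. compose (carrier (P (Suc r))) f (d r)) ` carrier (hom_module K M (P r) W)"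

definition Ext ::
  "('k, 'e) ring_scheme \<Rightarrow> ('m, 'f) monoid_scheme \<Rightarrow> (nat \<Rightarrow> ('m \<Rightarrow> 'k, 'p) module) \<Rightarrow>
    (nat \<Rightarrow> 'p \<Rightarrow> 'p) \<Rightarrow> ('m \<Rightarrow> 'k, 'w, 'j) module_scheme \<Rightarrow> nat \<Rightarrow> ('k, ('p \<Rightarrow> 'w) set) module"
where
  "Ext K M P d W r =
     quot_module (hom_module K M (P r) W \<lparr>carrier := cocycles K M P d W r\<rparr>) (coboundaries K M P d W r)"

text \<open>The additive order of \<open>\<one>\<close>; \<^const>\<open>group.ord\<close> is \<open>0\<close> for elements of infinite order.\<close>

definition characteristic :: "('k, 'e) ring_scheme \<Rightarrow> nat" where
  "characteristic K = group.ord (add_monoid K) \<one>\<^bsub>K\<^esub>"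


section \<open>Ordered set partitions and ordered G-partitions\<close>

text \<open>The underlying set partition of an ordered set partition \<open>ps\<close> is \<^term>\<open>set ps\<close>. The
  identity is the one-block partition for \<open>n \<ge> 1\<close> and the empty list for \<open>n = 0\<close>.\<close>

definition omit_empty :: "'a set list \<Rightarrow> 'a set list" where
  "omit_empty ps = filter (\<lambda>B. B \<noteq> {}) ps"

definition ordered_partitions :: "nat \<Rightarrow> nat set list monoid" where
  "ordered_partitions n = \<lparr>carrier = {ps. distinct ps \<and> partition_on {1..n} (set ps)},
     monoid.mult = (\<lambda>ps qs. omit_empty (concat (map (\<lambda>P. map (\<lambda>Q. P \<inter> Q) qs) ps))),
     one = omit_empty [{1..n}]\<rparr>"

definition const_on_blocks :: "nat set set \<Rightarrow> (nat \<Rightarrow> 'g) \<Rightarrow> bool" where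
  "const_on_blocks X g \<longleftrightarrow> (\<forall>B\<in>X. \<forall>i\<in>B. \<forall>j\<in>B. g i = g j)"

definition block_group :: "nat \<Rightarrow> ('g, 'f) monoid_scheme \<Rightarrow> nat set set \<Rightarrow> (nat \<Rightarrow> 'g) monoid" where
  "block_group n G X = product_group {1..n} (\<lambda>_. G)
     \<lparr>carrier := {g \<in> carrier (product_group {1..n} (\<lambda>_. G)). const_on_blocks X g}\<rparr>"

definition hsiao_monoid :: "nat \<Rightarrow> ('g, 'f) monoid_scheme \<Rightarrow> (nat set list \<times> (nat \<Rightarrow> 'g)) monoid" where
  "hsiao_monoid n G = (ordered_partitions n \<times>\<times> product_group {1..n} (\<lambda>_. G))
     \<lparr>carrier := {(ps, g) \<in> carrier (ordered_partitions n \<times>\<times> product_group {1..n} (\<lambda>_. G)).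
        const_on_blocks (set ps) g}\<rparr>"

text \<open>The \<open>K\<Sigma>\<^sub>n\<^sup>G\<close>-module obtained from a \<open>KG\<^sub>X\<close>-module \<open>V\<close>: \<open>(ps, g)\<close> acts as \<open>g\<close>
  if \<open>X \<le> set ps\<close> and as \<open>0\<close> otherwise, extended linearly. The order on
  partitions, with coarser ones larger, is \<^const>\<open>refines\<close>.\<close>

definition inflate ::
  "nat \<Rightarrow> ('k, 'e) ring_scheme \<Rightarrow> nat set set \<Rightarrow> ((nat \<Rightarrow> 'g) \<Rightarrow> 'k, 'v) module \<Rightarrow>
    (nat set list \<times> (nat \<Rightarrow> 'g) \<Rightarrow> 'k, 'v) module"
where
  "inflate n K X V = \<lparr>carrier = carrier V, monoid.mult = monoid.mult V, one = \<one>\<^bsub>V\<^esub>, ring.zero = \<zero>\<^bsub>V\<^esub>, ring.add = add V,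
     smult = (\<lambda>a v. \<Oplus>\<^bsub>V\<^esub>p\<in>{p \<in> supp K a. refines {1..n} X (set (fst p))}. single K (snd p) (a p) \<odot>\<^bsub>V\<^esub> v)\<rparr>"

text \<open>\<open>V\<close> is a simple \<open>K\<Sigma>\<^sub>n\<^sup>G\<close>-module with apex \<open>X\<close>, arising from the simple
  \<open>KG\<^sub>X\<close>-module \<open>V'\<close>.\<close>

definition simple_with_apex ::
  "nat \<Rightarrow> ('k, 'e) ring_scheme \<Rightarrow> ('g, 'f) monoid_scheme \<Rightarrow> nat set set \<Rightarrow>
    ((nat \<Rightarrow> 'g) \<Rightarrow> 'k, 'u) module \<Rightarrow> (nat set list \<times> (nat \<Rightarrow> 'g) \<Rightarrow> 'k, 'v) module \<Rightarrow> bool"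
where
  "simple_with_apex n K G X V' V \<longleftrightarrow>
     partition_on {1..n} X \<and>
     simple_module (monoid_algebra K (block_group n G X)) V' \<and>
     simple_module (monoid_algebra K (hsiao_monoid n G)) V \<and>
     mod_iso (monoid_algebra K (hsiao_monoid n G)) V (inflate n K X V')"

end

theory Submission imports Defs begin

text \<open>Let \<open>A\<close> be the algebra of \<open>\<Sigma>\<^sub>n\<^sup>G\<close> and \<open>l\<close> an ordered partition of \<open>X\<close>. From a projective resolution \<open>P\<close> of \<open>V\<close> over
  \<open>A\<close> one gets the complex of the \<open>U j = (l, \<one>) P j\<close>. It is exact because \<open>(l, \<one>)\<close> is idempotent, it resolves \<open>V\<close> as a
  module over \<open>K G\<^sub>X\<close>, and since left translations by \<open>G\<^sub>Z\<close> are free, its terms are projective over \<open>K G\<^sub>Z\<close> for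
  all \<open>Z \<ge> X\<close> (\<open>projective_fixed_part\<close>).

  The ordered partitions that coarsen \<open>X\<close> are the faces of a permutohedron, on which \<open>\<Sigma>\<^sub>n\<close> acts by partial maps that
  commute with the cellular boundary. Tensoring the cellular chain complex with the complex \<open>U\<close> gives the total complex \<open>Tot\<close>
  of \<open>A\<close>-modules. It is again a resolution of \<open>V\<close>, because the permutohedron is contractible (an explicit
  contracting homotopy is defined by extracting blocks). It is projective, because a homomorphism out of it amounts to
  a family of \<open>K G\<^sub>Z\<close>-homomorphisms, one for every \<open>Z \<ge> X\<close>, and these can be lifted (\<open>tot_hom_extension\<close>, \<open>projective_Tot\<close>).

  If \<open>W\<close> has apex \<open>Y\<close>, only the faces with underlying partition \<open>Y\<close> contribute to \<open>Hom(Tot r, W)\<close>. They have dimension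
  \<open>|X| - |Y|\<close>, are permuted transitively, and the boundary of such a face involves no other face of this kind. So
  \<open>Hom(Tot r, W)\<close> is \<open>Hom(U (r - |X| + |Y|), W)\<close> over \<open>K G\<^sub>Y\<close>, compatibly with the differentials (\<open>Ext_Tot_iso\<close>). The comparison
  theorem, used over \<open>A\<close> and over \<open>K G\<^sub>Y\<close>, replaces the two special resolutions by arbitrary ones. If the characteristic
  does not divide \<open>|G|\<close>, Maschke's theorem makes \<open>V\<close> projective over \<open>K G\<^sub>Y\<close>, and only degree \<open>0\<close> survives there.\<close>

text \<open>Short forms: a subscript without brackets selects the structure of an algebraic operation.\<close>

syntax "_index" :: "logic => index" ("\<^sub>_" [1000])

abbreviation car where "car \<equiv> carrier"

abbreviation OP where "OP \<equiv> ordered_partitions"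

abbreviation free where "free \<equiv> free_module"

lemmas ag_monoid = abelian_group.axioms(1)

abbreviation alg where "alg \<equiv> monoid_algebra"

section \<open>Left modules and their homomorphisms\<close>

lemma left_moduleI:
 fixes R (structure) and M (structure)
 assumes "ring R" "abelian_group M"
  and "!!a x. [|a : car R; x : car M|] ==> a \<odot>\<^sub>M x : car M"
  and "!!a b x. [|a : car R; b : car R; x : car M|] ==>
    (a \<oplus>\<^sub>R b) \<odot>\<^sub>M x = a \<odot>\<^sub>M x \<oplus>\<^sub>M b \<odot>\<^sub>M x"
  and "!!a x y. [|a : car R; x : car M; y : car M|] ==>
    a \<odot>\<^sub>M (x \<oplus>\<^sub>M y) = a \<odot>\<^sub>M x \<oplus>\<^sub>M a \<odot>\<^sub>M y"
  and "!!a b x. [|a : car R; b : car R; x : car M|] ==>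
    (a \<otimes>\<^sub>R b) \<odot>\<^sub>M x = a \<odot>\<^sub>M (b \<odot>\<^sub>M x)"
  and "!!x. x : car M ==> \<one>\<^sub>R \<odot>\<^sub>M x = x"
 shows "left_module R M"
 using assms by (intro left_module.intro left_module_axioms.intro) auto

lemma left_module_group: "left_module R M ==> abelian_group M"
 by (simp add: left_module_def)

context left_module
begin

lemma smult_l_null [simp]: "x : car M ==> \<zero>\<^sub>R \<odot>\<^sub>M x = \<zero>\<^sub>M"
 using smult_l_distr[of "\<zero>\<^sub>R" "\<zero>\<^sub>R" x]
 by (metis M.add.r_cancel_one' R.r_zero R.zero_closed smult_closed)

lemma smult_r_null [simp]: "a : car R ==> a \<odot>\<^sub>M \<zero>\<^sub>M = \<zero>\<^sub>M"
 using smult_r_distr[of a "\<zero>\<^sub>M" "\<zero>\<^sub>M"]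
 by (metis M.add.r_cancel_one' M.r_zero M.zero_closed smult_closed)

lemma smult_r_minus: "[|a : car R; x : car M|] ==> a \<odot>\<^sub>M (\<ominus>\<^sub>M x) = \<ominus>\<^sub>M (a \<odot>\<^sub>M x)"
 using smult_r_distr[of a "\<ominus>\<^sub>M x" x]
 by (metis M.add.inv_closed M.l_neg M.minus_equality smult_closed smult_r_null)

lemma smult_r_diff:
 "[|a : car R; x : car M; y : car M|] ==>
  a \<odot>\<^sub>M (x \<ominus>\<^sub>M y) = a \<odot>\<^sub>M x \<ominus>\<^sub>M a \<odot>\<^sub>M y"
 by (simp add: M.minus_eq smult_r_distr smult_r_minus)

lemma finsum_smult:
 "[|a : car R; f : I \<rightarrow> car M|] ==>
  a \<odot>\<^sub>M (\<Oplus>\<^bsub>M\<^esub>i\<in>I. f i) = (\<Oplus>\<^bsub>M\<^esub>i\<in>I. a \<odot>\<^sub>M f i)"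
proof (induction I rule: infinite_finite_induct)
 case (insert x F)
 thus ?case by (simp add: Pi_def smult_r_distr)
qed auto

end

lemma mod_homI:
 assumes "f : car M \<rightarrow>\<^sub>E car N"
  and "!!x y. [|x : car M; y : car M|] ==> f (x \<oplus>\<^sub>M y) = f x \<oplus>\<^sub>N f y"
  and "!!a x. [|a : car R; x : car M|] ==> f (a \<odot>\<^sub>M x) = a \<odot>\<^sub>N f x"
 shows "f : mod_hom R M N"
 using assms by (simp add: mod_hom_def)

lemma
 assumes "f : mod_hom R M N"
 shows mod_hom_closed: "x : car M ==> f x : car N"
  and mod_hom_add: "[|x : car M; y : car M|] ==> f (x \<oplus>\<^sub>M y) = f x \<oplus>\<^sub>N f y"
  and mod_hom_smult: "[|a : car R; x : car M|] ==> f (a \<odot>\<^sub>M x) = a \<odot>\<^sub>N f x"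
  and mod_hom_extensional: "f : extensional (car M)"
 using assms by (auto simp: mod_hom_def PiE_iff)

lemma mod_hom_ext:
 assumes "f : mod_hom R M N" "g : mod_hom R M L" "!!x. x : car M ==> f x = g x"
 shows "f = g"
 using assms by (meson extensionalityI mod_hom_extensional)

lemma mod_hom_group_hom:
 assumes "f : mod_hom R M N" "abelian_group M" "abelian_group N"
 shows "group_hom (add_monoid M) (add_monoid N) f"
 using assms by (auto simp: group_hom_def group_hom_axioms_def abelian_group.a_group hom_def
   mod_hom_closed mod_hom_add)

lemma
 assumes "f : mod_hom R M N" "abelian_group M" "abelian_group N"
 shows mod_hom_zero: "f \<zero>\<^sub>M = \<zero>\<^sub>N"
  and mod_hom_minus: "x : car M ==> f (\<ominus>\<^sub>M x) = \<ominus>\<^sub>N f x"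
  and mod_hom_diff: "[|x : car M; y : car M|] ==> f (x \<ominus>\<^sub>M y) = f x \<ominus>\<^sub>N f y"
proof -
 interpret M: abelian_group M by fact
 interpret N: abelian_group N by fact
 interpret f: group_hom "add_monoid M" "add_monoid N" f
  using mod_hom_group_hom[OF assms] .
 show "f \<zero>\<^sub>M = \<zero>\<^sub>N" using f.hom_one by simp
 show m: "f (\<ominus>\<^sub>M x) = \<ominus>\<^sub>N f x" if "x : car M" for x
  using f.hom_inv[of x] that by (simp add: a_inv_def)
 show "f (x \<ominus>\<^sub>M y) = f x \<ominus>\<^sub>N f y" if "x : car M" "y : car M"
  using that by (simp add: M.minus_eq N.minus_eq m mod_hom_add[OF assms(1)])
qed

lemma mod_hom_finsum:
 assumes f: "f : mod_hom R M N" and M: "abelian_group M" and N: "abelian_group N"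
  and x: "x : I \<rightarrow> car M"
 shows "f (\<Oplus>\<^bsub>M\<^esub>i\<in>I. x i) = (\<Oplus>\<^bsub>N\<^esub>i\<in>I. f (x i))"
proof -
 interpret M: abelian_group M by fact
 interpret N: abelian_group N by fact
 show ?thesis
  using x
 proof (induction I rule: infinite_finite_induct)
  case (insert i I)
  thus ?case
   by (simp add: Pi_def mod_hom_add[OF f] mod_hom_closed[OF f])
 qed (simp_all add: mod_hom_zero[OF f M N])
qed

lemma mod_hom_compose:
 assumes "f : mod_hom R M N" "g : mod_hom R N L" "left_module R M"
 shows "compose (car M) g f : mod_hom R M L"
proof -
 interpret left_module R M by fact
 show ?thesis
  using assms(1,2) by (auto simp: mod_hom_def PiE_iff compose_def)
qed

lemma mod_hom_restrict_diff:
 assumes "f : mod_hom R M N" "g : mod_hom R M N" "left_module R M" "left_module R N"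
 shows "(\<lambda>x\<in>car M. f x \<ominus>\<^sub>N g x) : mod_hom R M N"
proof -
 interpret M: left_module R M by fact
 interpret N: left_module R N by fact
 note fg = mod_hom_closed[OF assms(1)] mod_hom_closed[OF assms(2)] mod_hom_add[OF assms(1)]
  mod_hom_add[OF assms(2)] mod_hom_smult[OF assms(1)] mod_hom_smult[OF assms(2)]
 show ?thesis
  by (intro mod_homI) (auto simp: fg N.smult_r_distr N.smult_r_minus N.M.minus_eq N.M.minus_add N.M.a_ac)
qed

lemma mod_hom_id: "left_module R M ==> (\<lambda>x\<in>car M. x) : mod_hom R M M"
proof -
 assume "left_module R M"
 then interpret left_module R M .
 show ?thesis by (intro mod_homI) auto
qed

lemma mod_iso_trans:
 assumes "mod_iso R M N" "mod_iso R N L" "left_module R M"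
 shows "mod_iso R M L"
proof -
 obtain f g where f: "f : mod_hom R M N" "bij_betw f (car M) (car N)"
  and g: "g : mod_hom R N L" "bij_betw g (car N) (car L)"
  using assms by (auto simp: mod_iso_def)
 have "bij_betw (compose (car M) g f) (car M) (car L)"
  using f(2) g(2) by (rule bij_betw_compose)
 with mod_hom_compose[OF f(1) g(1) assms(3)] show ?thesis by (auto simp: mod_iso_def)
qed

section \<open>Free and projective modules\<close>

lemma finsuppI:
 "[|!!i. f i : car R; finite S; S <= I; !!i. i ~: S ==> f i = \<zero>\<^sub>R|] ==> f : finsupp R I"
 by (auto simp: finsupp_def supp_def intro: finite_subset[of _ S])

lemma
 assumes "f : finsupp R I"
 shows finsupp_closed [intro]: "f i : car R"
  and finite_supp: "finite (supp R f)"
  and supp_subset: "supp R f <= I"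
  and finsupp_zero: "i ~: I ==> f i = \<zero>\<^sub>R"
 using assms by (auto simp: finsupp_def supp_def)

context ring
begin

lemma zero_finsupp: "(%_. \<zero>) : finsupp R I"
 by (rule finsuppI[of _ _ "{}"]) auto

lemma single_finsupp: "[|i : I; k : car R|] ==> single R i k : finsupp R I"
 by (rule finsuppI[of _ _ "{i}"]) (auto simp: single_def)

lemma add_finsupp: "[|f : finsupp R I; g : finsupp R I|] ==> (%i. f i \<oplus> g i) : finsupp R I"
 by (rule finsuppI[of _ _ "supp R f Un supp R g"])
  (auto simp: finsupp_closed finite_supp dest: supp_subset, auto simp: supp_def)

lemma smult_finsupp: "[|k : car R; f : finsupp R I|] ==> (%i. k \<otimes> f i) : finsupp R I"
 by (rule finsuppI[of _ _ "supp R f"])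
  (auto simp: finsupp_closed finite_supp dest: supp_subset, auto simp: supp_def)

lemma uminus_finsupp: "f : finsupp R I ==> (%i. \<ominus> f i) : finsupp R I"
 by (rule finsuppI[of _ _ "supp R f"])
  (auto simp: finsupp_closed finite_supp dest: supp_subset, auto simp: supp_def)

lemma finsupp_induct [consumes 1, case_names zero single add]:
 assumes f: "f : finsupp R I"
  and zero: "P (%_. \<zero>)"
  and single: "!!i k. [|i : I; k : car R|] ==> P (single R i k)"
  and add: "!!f g. [|f : finsupp R I; g : finsupp R I; P f; P g|] ==> P (%i. f i \<oplus> g i)"
 shows "P f"
proof -
 have "finite S ==> f : finsupp R I ==> supp R f = S ==> P f" for S f
 proof (induction S arbitrary: f rule: finite_induct)
  case empty
  hence "f = (%_. \<zero>)" by (auto simp: supp_def)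
  thus ?case using zero by simp
 next
  case (insert s S)
  let ?g = "f(s := \<zero>)"
  have g: "?g : finsupp R I"
   using insert.prems(1) insert.hyps(1)
   by (intro finsuppI[of _ _ S]) (use insert in "auto simp: finsupp_closed dest: supp_subset, auto simp: supp_def")
  have "supp R ?g = S" using insert by (auto simp: supp_def)
  hence "P ?g" using g insert.IH by blast
  have s: "s : I" "f s : car R"
   using insert.prems by (auto dest: supp_subset simp: finsupp_closed)
  have "f = (%i. single R s (f s) i \<oplus> ?g i)"
   using finsupp_closed[OF insert.prems(1)] by (auto simp: single_def fun_eq_iff)
  moreover have "P (%i. single R s (f s) i \<oplus> ?g i)"
   using add[OF single_finsupp[OF s] g single[OF s] \<open>P ?g\<close>] .
  ultimately show ?case by simp
 qed
 with f finite_supp[OF f] show ?thesis by blast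
qed

lemma left_module_free_module: "left_module R (free R I)"
proof (rule left_moduleI)
 show "abelian_group (free R I)"
 proof (rule abelian_groupI)
  fix f assume f: "f : car (free R I)"
  show "\<exists>g\<in>car (free R I). g \<oplus>\<^sub>(free R I) f = \<zero>\<^sub>(free R I)"
   using f by (intro bexI[of _ "%i. \<ominus> f i"])
    (auto simp: free_module_def uminus_finsupp finsupp_closed l_neg)
 qed (auto simp: free_module_def zero_finsupp add_finsupp finsupp_closed a_ac fun_eq_iff)
qed (auto simp: free_module_def ring_axioms smult_finsupp finsupp_closed l_distr r_distr m_assoc)

end

text \<open>The universal property of a free module: \<open>lincomb R M \<phi>\<close> is the homomorphism that sends
  the basis vector \<open>i\<close> to \<open>\<phi> i\<close>.\<close>

definition lincomb ::
 "('r, 'e) ring_scheme => ('r, 'a, 'f) module_scheme => ('i => 'a) => ('i => 'r) => 'a" where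
 "lincomb R M \<phi> a = (\<Oplus>\<^bsub>M\<^esub>i\<in>supp R a. a i \<odot>\<^sub>M \<phi> i)"

context left_module
begin

lemma lincomb_closed:
 "[|a : finsupp R I; \<phi> : I \<rightarrow> car M|] ==> lincomb R M \<phi> a : car M"
 unfolding lincomb_def by (intro M.finsum_closed) (auto dest: supp_subset simp: finsupp_closed Pi_iff)

lemma lincomb_superset:
 assumes a: "a : finsupp R I" and \<phi>: "\<phi> : I \<rightarrow> car M" and S: "finite S" "supp R a <= S" "S <= I"
 shows "lincomb R M \<phi> a = (\<Oplus>\<^bsub>M\<^esub>i\<in>S. a i \<odot>\<^sub>M \<phi> i)"
 unfolding lincomb_def
proof (rule M.add.finprod_mono_neutral_cong_left)
 show "a i \<odot>\<^sub>M \<phi> i = \<zero>\<^sub>M" if "i : S - supp R a" for i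
 proof -
  have "a i = \<zero>\<^sub>R" "\<phi> i : car M" using that \<phi> S by (auto simp: supp_def)
  thus ?thesis by simp
 qed
qed (use a \<phi> S in "auto simp: finsupp_closed Pi_iff")

lemma lincomb_add:
 assumes a: "a : finsupp R I" and b: "b : finsupp R I" and \<phi>: "\<phi> : I \<rightarrow> car M"
 shows "lincomb R M \<phi> (%i. a i \<oplus>\<^sub>R b i) = lincomb R M \<phi> a \<oplus>\<^sub>M lincomb R M \<phi> b"
proof -
 let ?S = "supp R a Un supp R b"
 have S: "finite ?S" "?S <= I" using a b by (auto simp: finite_supp dest: supp_subset)
 have "supp R (%i. a i \<oplus>\<^sub>R b i) <= ?S" by (auto simp: supp_def)
 hence "lincomb R M \<phi> (%i. a i \<oplus>\<^sub>R b i) = (\<Oplus>\<^bsub>M\<^esub>i\<in>?S. (a i \<oplus>\<^sub>R b i) \<odot>\<^sub>M \<phi> i)"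
  by (intro lincomb_superset[OF R.add_finsupp[OF a b] \<phi>] S)
 also have "... = (\<Oplus>\<^bsub>M\<^esub>i\<in>?S. a i \<odot>\<^sub>M \<phi> i \<oplus>\<^sub>M b i \<odot>\<^sub>M \<phi> i)"
  using \<phi> S by (intro M.finsum_cong') (auto simp: smult_l_distr finsupp_closed[OF a] finsupp_closed[OF b] Pi_iff)
 also have "... = (\<Oplus>\<^bsub>M\<^esub>i\<in>?S. a i \<odot>\<^sub>M \<phi> i) \<oplus>\<^sub>M (\<Oplus>\<^bsub>M\<^esub>i\<in>?S. b i \<odot>\<^sub>M \<phi> i)"
  using \<phi> S by (intro M.finsum_addf) (auto simp: finsupp_closed[OF a] finsupp_closed[OF b] Pi_iff)
 also have "... = lincomb R M \<phi> a \<oplus>\<^sub>M lincomb R M \<phi> b"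
  using lincomb_superset[OF a \<phi> S(1) _ S(2)] lincomb_superset[OF b \<phi> S(1) _ S(2)] by simp
 finally show ?thesis .
qed

lemma lincomb_zero: "lincomb R M \<phi> (%_. \<zero>\<^sub>R) = \<zero>\<^sub>M"
 by (simp add: lincomb_def supp_def)

lemma lincomb_single:
 assumes "k : car R" "\<phi> i : car M"
 shows "lincomb R M \<phi> (single R i k) = k \<odot>\<^sub>M \<phi> i"
proof (cases "k = \<zero>\<^sub>R")
 case True
 hence "single R i k = (%_. \<zero>\<^sub>R)" by (auto simp: single_def)
 with True assms show ?thesis by (simp add: lincomb_zero)
next
 case False
 hence "supp R (single R i k) = {i}" by (auto simp: supp_def single_def)
 with assms show ?thesis by (simp add: lincomb_def single_def)
qed

lemma lincomb_smult:
 assumes a: "a : finsupp R I" and k: "k : car R" and \<phi>: "\<phi> : I \<rightarrow> car M"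
 shows "lincomb R M \<phi> (%i. k \<otimes>\<^sub>R a i) = k \<odot>\<^sub>M lincomb R M \<phi> a"
proof -
 have sub: "supp R (%i. k \<otimes>\<^sub>R a i) <= supp R a" using k by (auto simp: supp_def)
 have "lincomb R M \<phi> (%i. k \<otimes>\<^sub>R a i) = (\<Oplus>\<^bsub>M\<^esub>i\<in>supp R a. (k \<otimes>\<^sub>R a i) \<odot>\<^sub>M \<phi> i)"
  by (rule lincomb_superset[OF R.smult_finsupp[OF k a] \<phi> finite_supp[OF a] sub supp_subset[OF a]])
 also have "... = (\<Oplus>\<^bsub>M\<^esub>i\<in>supp R a. k \<odot>\<^sub>M (a i \<odot>\<^sub>M \<phi> i))"
  using \<phi> supp_subset[OF a] k
  by (intro M.finsum_cong') (auto simp: finsupp_closed[OF a] smult_assoc1 Pi_iff subset_iff)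
 also have "... = k \<odot>\<^sub>M lincomb R M \<phi> a"
  unfolding lincomb_def using \<phi> supp_subset[OF a]
  by (intro finsum_smult[symmetric] k) (auto simp: finsupp_closed[OF a] Pi_iff subset_iff)
 finally show ?thesis .
qed

lemma lincomb_hom:
 assumes "\<phi> : I \<rightarrow> car M"
 shows "(\<lambda>a\<in>car (free R I). lincomb R M \<phi> a) : mod_hom R (free R I) M"
proof -
 interpret F: left_module R "free R I" by (rule R.left_module_free_module)
 show ?thesis
  using assms F.M.add.m_closed F.smult_closed
  by (intro mod_homI) (auto simp: free_module_def lincomb_closed lincomb_add lincomb_smult)
qed

lemma free_module_hom_eq:
 assumes f: "f : mod_hom R (free R I) M" and g: "g : mod_hom R (free R I) M"
  and eq: "!!i. i : I ==> f (single R i \<one>\<^sub>R) = g (single R i \<one>\<^sub>R)"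
  and a: "a : finsupp R I"
 shows "f a = g a"
 using a
proof (induction a rule: R.finsupp_induct)
 case zero
 interpret F: left_module R "free R I" by (rule R.left_module_free_module)
 have "f \<zero>\<^sub>(free R I) = g \<zero>\<^sub>(free R I)"
  using mod_hom_zero[OF f] mod_hom_zero[OF g] F.M.abelian_group_axioms M.abelian_group_axioms by simp
 thus ?case by (simp add: free_module_def)
next
 case (single i k)
 have "single R i k = k \<odot>\<^sub>(free R I) single R i \<one>\<^sub>R"
  using single by (auto simp: free_module_def single_def)
 moreover have "single R i \<one>\<^sub>R : car (free R I)"
  using single by (simp add: free_module_def R.single_finsupp)
 ultimately show ?case
  using single eq[of i] mod_hom_smult[OF f] mod_hom_smult[OF g] by simp
next
 case (add a b)
 have "(%i. a i \<oplus>\<^sub>R b i) = a \<oplus>\<^sub>(free R I) b"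
  by (simp add: free_module_def)
 moreover have "a : car (free R I)" "b : car (free R I)"
  using add by (simp_all add: free_module_def)
 ultimately show ?case
  using add mod_hom_add[OF f] mod_hom_add[OF g] by simp
qed

end

lemma projective_module_left_module: "projective_module R P ==> left_module R P"
 by (simp add: projective_module_def)

text \<open>Homomorphisms from a projective module lift; it suffices that the homomorphism to be lifted
  takes values in the image of \<open>q\<close>.\<close>

lemma projective_lift:
 fixes P :: "('r, 'p, 'f) module_scheme"
 assumes P: "projective_module R P" and M: "left_module R M" and N: "left_module R N"
  and q: "q : mod_hom R M N" and u: "u : mod_hom R P N"
  and im: "!!x. x : car P ==> u x : q ` car M"
 shows "\<exists>h\<in>mod_hom R P M. \<forall>x\<in>car P. q (h x) = u x"
proof -
 interpret M: left_module R M by fact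
 interpret N: left_module R N by fact
 interpret P: left_module R P using P by (rule projective_module_left_module)
 from P obtain I :: "'p set" and i p where i: "i : mod_hom R P (free R I)"
  and p: "p : mod_hom R (free R I) P" and pi: "!!x. x : car P ==> p (i x) = x"
  unfolding projective_module_def by blast
 interpret F: left_module R "free R I" by (rule M.R.left_module_free_module)
 have b: "single R j \<one>\<^sub>R : car (free R I)" if "j : I" for j
  using that by (simp add: free_module_def M.R.single_finsupp)
 have "\<exists>m. m : car M & q m = u (p (single R j \<one>\<^sub>R))" if "j : I" for j
  using im[OF mod_hom_closed[OF p b[OF that]]] by auto
 then obtain m where m: "!!j. j : I ==> m j : car M"
  "!!j. j : I ==> q (m j) = u (p (single R j \<one>\<^sub>R))" by metis
 define f where "f = (\<lambda>a\<in>car (free R I). lincomb R M m a)"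
 have f: "f : mod_hom R (free R I) M"
  unfolding f_def using m by (intro M.lincomb_hom) auto
 have "compose (car (free R I)) q f a = compose (car (free R I)) u p a"
  if "a : finsupp R I" for a
 proof (rule N.free_module_hom_eq[OF _ _ _ that])
  show "compose (car (free R I)) q f : mod_hom R (free R I) N"
   by (rule mod_hom_compose[OF f q F.left_module_axioms])
  show "compose (car (free R I)) u p : mod_hom R (free R I) N"
   by (rule mod_hom_compose[OF p u F.left_module_axioms])
  show "compose (car (free R I)) q f (single R j \<one>\<^sub>R)
    = compose (car (free R I)) u p (single R j \<one>\<^sub>R)" if "j : I" for j
   using b[OF that] m[OF that] that by (simp add: compose_def f_def M.lincomb_single)
 qed
 hence qf: "q (f a) = u (p a)" if "a : car (free R I)" for a
  using that by (simp add: compose_def free_module_def)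
 show ?thesis
 proof (intro bexI[of _ "compose (car P) f i"] ballI)
  show "compose (car P) f i : mod_hom R P M"
   by (rule mod_hom_compose[OF i f P.left_module_axioms])
  show "q (compose (car P) f i x) = u x" if "x : car P" for x
   using that qf[OF mod_hom_closed[OF i that]] pi by (simp add: compose_def)
 qed
qed

text \<open>Every module \<open>P\<close> is the image of the free module on its own elements; \<open>P\<close> is projective as
  soon as this particular epimorphism splits.\<close>

definition taut_cover ::
 "('r, 'e) ring_scheme => ('r, 'a, 'f) module_scheme => ('a => 'r) => 'a" where
 "taut_cover R P =
   (\<lambda>a\<in>car (free R (car P)). lincomb R P (%x. x) a)"

lemma taut_cover_hom:
 "left_module R P ==> taut_cover R P : mod_hom R (free R (car P)) P"
 unfolding taut_cover_def by (intro left_module.lincomb_hom) auto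

lemma taut_cover_single:
 assumes "left_module R P" "x : car P" "a : car R"
 shows "single R x a : car (free R (car P))"
  and "taut_cover R P (single R x a) = a \<odot>\<^sub>P x"
proof -
 interpret left_module R P by fact
 show 1: "single R x a : car (free R (car P))"
  using assms by (simp add: free_module_def R.single_finsupp)
 with assms show "taut_cover R P (single R x a) = a \<odot>\<^sub>P x"
  by (simp add: taut_cover_def lincomb_single)
qed

lemma taut_cover_surj:
 assumes "left_module R P" "x : car P"
 shows "x : taut_cover R P ` car (free R (car P))"
proof -
 interpret left_module R P by fact
 show ?thesis
  using taut_cover_single[OF assms(1,2) R.one_closed] assms(2)
  by (metis image_eqI smult_one)
qed

text \<open>Conversely to \<open>projective_lift\<close>, lifting the identity along the tautological cover is enough.\<close>

lemma projective_moduleI: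
 assumes "left_module R P" "s : mod_hom R P (free R (car P))"
  "!!x. x : car P ==> taut_cover R P (s x) = x"
 shows "projective_module R P"
 using assms taut_cover_hom[OF assms(1)] unfolding projective_module_def by blast

lemma retract_free_projective:
 assumes P: "left_module R P" and i: "i : mod_hom R P (free R J)"
  and p: "p : mod_hom R (free R J) P" and pi: "!!x. x : car P ==> p (i x) = x"
 shows "projective_module R P"
proof -
 interpret P: left_module R P by fact
 let ?F = "free R (car P)" and ?FJ = "free R J"
 interpret F: left_module R ?F by (rule P.R.left_module_free_module)
 interpret FJ: left_module R ?FJ by (rule P.R.left_module_free_module)
 have b: "single R j \<one>\<^sub>R : car ?FJ" if "j : J" for j
  using that by (simp add: free_module_def P.R.single_finsupp)
 define \<phi> where "\<phi> j = single R (p (single R j \<one>\<^sub>R)) \<one>\<^sub>R" for j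
 have \<phi>: "\<phi> : J \<rightarrow> car ?F"
  unfolding \<phi>_def using taut_cover_single(1)[OF P] mod_hom_closed[OF p] b by auto
 define f where "f = (\<lambda>a\<in>car ?FJ. lincomb R ?F \<phi> a)"
 have f: "f : mod_hom R ?FJ ?F" unfolding f_def by (rule F.lincomb_hom[OF \<phi>])
 have "compose (car ?FJ) (taut_cover R P) f a = p a" if "a : finsupp R J" for a
 proof (rule P.free_module_hom_eq[OF mod_hom_compose[OF f taut_cover_hom[OF P] FJ.left_module_axioms] p _ that])
  fix j assume j: "j : J"
  have "f (single R j \<one>\<^sub>R) = \<phi> j"
   using b[OF j] \<phi> j by (simp add: f_def F.lincomb_single Pi_iff)
  thus "compose (car ?FJ) (taut_cover R P) f (single R j \<one>\<^sub>R) = p (single R j \<one>\<^sub>R)"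
   using b[OF j] mod_hom_closed[OF p b[OF j]] taut_cover_single(2)[OF P]
   by (simp add: compose_def \<phi>_def)
 qed
 hence cov: "taut_cover R P (f a) = p a" if "a : car ?FJ" for a
  using that by (simp add: compose_def free_module_def)
 show ?thesis
 proof (rule projective_moduleI[OF P])
  show "compose (car P) f i : mod_hom R P ?F" by (rule mod_hom_compose[OF i f P])
  show "taut_cover R P (compose (car P) f i x) = x" if "x : car P" for x
   using that cov[OF mod_hom_closed[OF i that]] pi by (simp add: compose_def)
 qed
qed

section \<open>Quotient modules\<close>

lemma submodule_additive_subgroup: "submodule B K Z ==> additive_subgroup B Z"
 by (simp add: submodule_def additive_subgroup_def)

context
 fixes K :: "('k, 'e) ring_scheme" and Z :: "('k, 'z, 'f) module_scheme" and B
 assumes Z: "left_module K Z" and B: "submodule B K Z"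
begin

interpretation Z: left_module K Z by (rule Z)
interpretation B: submodule B K Z by (rule B)
interpretation AB: abelian_subgroup B Z
 using submodule_additive_subgroup[OF B] Z.M.abelian_group_axioms by (rule abelian_subgroupI3)

lemma coset_eq_iff:
 "[|x : car Z; y : car Z|] ==> B +>\<^bsub>Z\<^esub> x = B +>\<^bsub>Z\<^esub> y \<longleftrightarrow> x \<ominus>\<^sub>Z y : B"
proof
 assume x: "x : car Z" and y: "y : car Z"
 show "x \<ominus>\<^sub>Z y : B" if "B +>\<^bsub>Z\<^esub> x = B +>\<^bsub>Z\<^esub> y"
  using Z.M.a_coset_add_inv2[OF that x y AB.a_subset] x y
   Z.M.a_coset_join1[OF _ _ AB.a_subgroup, of "x \<ominus>\<^sub>Z y"] by (simp add: Z.M.minus_eq)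
 show "B +>\<^bsub>Z\<^esub> x = B +>\<^bsub>Z\<^esub> y" if "x \<ominus>\<^sub>Z y : B"
  using Z.M.a_coset_add_inv1[OF _ x y AB.a_subset] x y that
   Z.M.a_coset_join2[OF _ AB.a_subgroup that] by (simp add: Z.M.minus_eq)
qed

lemma coset_eq_subgroup_iff: "x : car Z ==> B +>\<^bsub>Z\<^esub> x = B \<longleftrightarrow> x : B"
 using Z.M.a_coset_join1[OF _ _ AB.a_subgroup] Z.M.a_coset_join2[OF _ AB.a_subgroup] by auto

lemma carrier_quot_module: "car (quot_module Z B) = (%x. B +>\<^bsub>Z\<^esub> x) ` car Z"
 by (auto simp: quot_module_def A_RCOSETS_def')

lemma zero_quot_module: "\<zero>\<^sub>(quot_module Z B) = B"
 by (simp add: quot_module_def)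

lemma add_quot_module:
 "[|x : car Z; y : car Z|] ==>
  (B +>\<^bsub>Z\<^esub> x) \<oplus>\<^sub>(quot_module Z B) (B +>\<^bsub>Z\<^esub> y) = B +>\<^bsub>Z\<^esub> (x \<oplus>\<^sub>Z y)"
 by (simp add: quot_module_def AB.a_rcos_sum)

lemma smult_quot_module:
 assumes a: "a : car K" and x: "x : car Z"
 shows "a \<odot>\<^sub>(quot_module Z B) (B +>\<^bsub>Z\<^esub> x) = B +>\<^bsub>Z\<^esub> (a \<odot>\<^sub>Z x)"
proof -
 have "B +>\<^bsub>Z\<^esub> (a \<odot>\<^sub>Z c) = B +>\<^bsub>Z\<^esub> (a \<odot>\<^sub>Z x)" if "c : B +>\<^bsub>Z\<^esub> x" for c
 proof -
  from that obtain b where b: "b : B" "c = b \<oplus>\<^sub>Z x" by (auto simp: a_r_coset_def')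
  hence bc: "b : car Z" using AB.a_subset by auto
  have "a \<odot>\<^sub>Z c \<ominus>\<^sub>Z a \<odot>\<^sub>Z x = a \<odot>\<^sub>Z b"
   using a x bc b(2) by (simp add: Z.smult_r_distr Z.M.minus_eq Z.M.a_assoc Z.M.r_neg)
  moreover have "c : car Z" using b bc x by simp
  ultimately show ?thesis
   using coset_eq_iff[of "a \<odot>\<^sub>Z c" "a \<odot>\<^sub>Z x"] a x B.smult_closed[OF a b(1)] by simp
 qed
 hence "(\<Union>c\<in>B +>\<^bsub>Z\<^esub> x. B +>\<^bsub>Z\<^esub> (a \<odot>\<^sub>Z c)) = (\<Union>c\<in>B +>\<^bsub>Z\<^esub> x. B +>\<^bsub>Z\<^esub> (a \<odot>\<^sub>Z x))"
  by (rule SUP_cong[OF refl])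
 moreover have "B +>\<^bsub>Z\<^esub> x ~= {}" using AB.a_rcos_self[OF x] by blast
 ultimately show ?thesis by (simp add: quot_module_def)
qed

lemma left_module_quot_module: "left_module K (quot_module Z B)"
proof (rule left_moduleI)
 have z: "B = B +>\<^bsub>Z\<^esub> \<zero>\<^sub>Z" using AB.a_subset by simp
 show "abelian_group (quot_module Z B)"
 proof (rule abelian_groupI)
  fix C assume "C : car (quot_module Z B)"
  then obtain x where x: "x : car Z" "C = B +>\<^bsub>Z\<^esub> x" by (auto simp: carrier_quot_module)
  show "\<zero>\<^sub>(quot_module Z B) \<oplus>\<^sub>(quot_module Z B) C = C"
   using x z add_quot_module[of "\<zero>\<^sub>Z" x] by (simp add: zero_quot_module)
  show "\<exists>D\<in>car (quot_module Z B). D \<oplus>\<^sub>(quot_module Z B) C = \<zero>\<^sub>(quot_module Z B)"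
   using x z add_quot_module[of "\<ominus>\<^sub>Z x" x]
   by (intro bexI[of _ "B +>\<^bsub>Z\<^esub> (\<ominus>\<^sub>Z x)"]) (auto simp: zero_quot_module carrier_quot_module Z.M.l_neg)
 next
  show "\<zero>\<^sub>(quot_module Z B) : car (quot_module Z B)"
   using z by (auto simp: zero_quot_module carrier_quot_module)
 qed (auto simp: carrier_quot_module add_quot_module Z.M.a_ac)
qed (auto simp: carrier_quot_module add_quot_module smult_quot_module Z.smult_l_distr Z.smult_r_distr
  Z.smult_assoc1 Z.R.ring_axioms)

lemma quot_module_projection: "(\<lambda>x\<in>car Z. B +>\<^bsub>Z\<^esub> x) : mod_hom K Z (quot_module Z B)"
proof (rule mod_homI)
 show "(\<lambda>x\<in>car Z. B +>\<^bsub>Z\<^esub> x) : car Z \<rightarrow>\<^sub>E car (quot_module Z B)"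
  by (simp add: carrier_quot_module)
next
 fix x y assume "x : car Z" "y : car Z"
 thus "(\<lambda>x\<in>car Z. B +>\<^bsub>Z\<^esub> x) (x \<oplus>\<^sub>Z y) =
   (\<lambda>x\<in>car Z. B +>\<^bsub>Z\<^esub> x) x \<oplus>\<^sub>(quot_module Z B) (\<lambda>x\<in>car Z. B +>\<^bsub>Z\<^esub> x) y"
  by (simp only: restrict_apply' Z.M.a_closed add_quot_module)
next
 fix a x assume "a : car K" "x : car Z"
 thus "(\<lambda>x\<in>car Z. B +>\<^bsub>Z\<^esub> x) (a \<odot>\<^sub>Z x) = a \<odot>\<^sub>(quot_module Z B) (\<lambda>x\<in>car Z. B +>\<^bsub>Z\<^esub> x) x"
  by (simp only: restrict_apply' Z.smult_closed smult_quot_module)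
qed

text \<open>The first isomorphism theorem.\<close>

lemma quot_module_iso:
 assumes \<Phi>: "\<Phi> : mod_hom K Z N" and surj: "car N <= \<Phi> ` car Z"
  and ker: "!!x y. [|x : car Z; y : car Z|] ==> \<Phi> x = \<Phi> y \<longleftrightarrow> x \<ominus>\<^sub>Z y : B"
 shows "mod_iso K (quot_module Z B) N"
proof -
 define f where "f = (\<lambda>C\<in>car (quot_module Z B). \<Phi> (SOME x. x : car Z & C = B +>\<^bsub>Z\<^esub> x))"
 have f: "f (B +>\<^bsub>Z\<^esub> x) = \<Phi> x" if x: "x : car Z" for x
 proof -
  let ?y = "SOME y. y : car Z & B +>\<^bsub>Z\<^esub> x = B +>\<^bsub>Z\<^esub> y"
  have y: "?y : car Z & B +>\<^bsub>Z\<^esub> x = B +>\<^bsub>Z\<^esub> ?y"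
   by (rule someI_ex) (use x in blast)
  hence "\<Phi> x = \<Phi> ?y" using ker[OF x] coset_eq_iff[OF x] by blast
  thus ?thesis using x by (simp add: f_def carrier_quot_module)
 qed
 have "f : mod_hom K (quot_module Z B) N"
 proof (rule mod_homI)
  have "f : extensional (car (quot_module Z B))" by (simp add: f_def)
  thus "f : car (quot_module Z B) \<rightarrow>\<^sub>E car N"
   unfolding PiE_iff carrier_quot_module using mod_hom_closed[OF \<Phi>] by (simp add: f)
 next
  fix C D assume "C : car (quot_module Z B)" "D : car (quot_module Z B)"
  then obtain x y where "x : car Z" "C = B +>\<^bsub>Z\<^esub> x" "y : car Z" "D = B +>\<^bsub>Z\<^esub> y"
   unfolding carrier_quot_module by blast
  thus "f (C \<oplus>\<^sub>(quot_module Z B) D) = f C \<oplus>\<^sub>N f D"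
   by (simp add: add_quot_module f mod_hom_add[OF \<Phi>])
 next
  fix a C assume "a : car K" "C : car (quot_module Z B)"
  moreover from this obtain x where "x : car Z" "C = B +>\<^bsub>Z\<^esub> x"
   unfolding carrier_quot_module by blast
  ultimately show "f (a \<odot>\<^sub>(quot_module Z B) C) = a \<odot>\<^sub>N f C"
   by (simp add: smult_quot_module f mod_hom_smult[OF \<Phi>])
 qed
 moreover have "bij_betw f (car (quot_module Z B)) (car N)"
  unfolding bij_betw_def inj_on_def carrier_quot_module
 proof (intro conjI ballI impI)
  fix C D assume "C : (%x. B +>\<^bsub>Z\<^esub> x) ` car Z" "D : (%x. B +>\<^bsub>Z\<^esub> x) ` car Z" and eq: "f C = f D"
  then obtain x y where x: "x : car Z" "C = B +>\<^bsub>Z\<^esub> x" and y: "y : car Z" "D = B +>\<^bsub>Z\<^esub> y"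
   by blast
  thus "C = D" using eq f[OF x(1)] f[OF y(1)] ker[OF x(1) y(1)] coset_eq_iff[OF x(1) y(1)] by simp
 next
  have "f ` (%x. B +>\<^bsub>Z\<^esub> x) ` car Z = \<Phi> ` car Z"
   unfolding image_image using f by (rule image_cong[OF refl])
  thus "f ` (%x. B +>\<^bsub>Z\<^esub> x) ` car Z = car N"
   using surj mod_hom_closed[OF \<Phi>] by auto
 qed
 ultimately show ?thesis by (auto simp: mod_iso_def)
qed

end

text \<open>A homomorphism induces an isomorphism of quotients if it is injective and surjective modulo
  the submodules; this is how cohomology groups are compared.\<close>

lemma quot_module_iso_quot_module:
 assumes Z: "left_module K Z" "submodule B K Z" and Z': "left_module K Z'" "submodule B' K Z'"
  and \<Phi>: "\<Phi> : mod_hom K Z Z'"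
  and inj: "!!z. z : car Z ==> \<Phi> z : B' \<longleftrightarrow> z : B"
  and surj: "!!y. y : car Z' ==> \<exists>z\<in>car Z. y \<ominus>\<^sub>Z' \<Phi> z : B'"
 shows "mod_iso K (quot_module Z B) (quot_module Z' B')"
proof (rule quot_module_iso[OF Z])
 interpret Z: left_module K Z by fact
 interpret Z': left_module K Z' by fact
 let ?\<Psi> = "compose (car Z) (\<lambda>x\<in>car Z'. B' +>\<^bsub>Z'\<^esub> x) \<Phi>"
 show "?\<Psi> : mod_hom K Z (quot_module Z' B')"
  by (rule mod_hom_compose[OF \<Phi> quot_module_projection[OF Z'] Z(1)])
 note c = mod_hom_closed[OF \<Phi>]
 show "car (quot_module Z' B') <= ?\<Psi> ` car Z"
 proof
  fix C assume "C : car (quot_module Z' B')"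
  then obtain y where y: "y : car Z'" "C = B' +>\<^bsub>Z'\<^esub> y" unfolding carrier_quot_module[OF Z'] by blast
  with surj obtain z where z: "z : car Z" "y \<ominus>\<^sub>Z' \<Phi> z : B'" by blast
  hence "C = ?\<Psi> z"
   using y c[OF z(1)] coset_eq_iff[OF Z' y(1) c[OF z(1)]] by (simp add: compose_def)
  with z(1) show "C : ?\<Psi> ` car Z" by blast
 qed
 show "?\<Psi> x = ?\<Psi> y \<longleftrightarrow> x \<ominus>\<^sub>Z y : B" if "x : car Z" "y : car Z" for x y
  using that c inj[of "x \<ominus>\<^sub>Z y"] mod_hom_diff[OF \<Phi> Z.M.abelian_group_axioms Z'.M.abelian_group_axioms, of x y]
  by (simp add: compose_def coset_eq_iff[OF Z'])
qed

section \<open>The comparison theorem for projective resolutions\<close>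

lemma a_kernel_iff: "x : a_kernel M N f \<longleftrightarrow> x : car M & f x = \<zero>\<^sub>N"
 by (simp add: a_kernel_def kernel_def)

lemma
 assumes "projective_resolution R P d e V"
 shows resolution_projective: "projective_module R (P r)"
  and resolution_module: "left_module R (P r)"
  and resolution_diff: "d r : mod_hom R (P (Suc r)) (P r)"
  and resolution_aug: "e : mod_hom R (P 0) V"
  and resolution_aug_surj: "e ` car (P 0) = car V"
  and resolution_exact0: "x : car (P 0) ==> e x = \<zero>\<^sub>V \<longleftrightarrow> x : d 0 ` car (P (Suc 0))"
  and resolution_exact: "y : car (P (Suc r)) ==>
   d r y = \<zero>\<^sub>(P r) \<longleftrightarrow> y : d (Suc r) ` car (P (Suc (Suc r)))"
proof -
 show "projective_module R (P r)" "d r : mod_hom R (P (Suc r)) (P r)" "e : mod_hom R (P 0) V"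
  "e ` car (P 0) = car V"
  using assms by (auto simp: projective_resolution_def)
 thus "left_module R (P r)" by (simp add: projective_module_left_module)
 have "a_kernel (P 0) V e = d 0 ` car (P (Suc 0))"
  "a_kernel (P (Suc r)) (P r) (d r) = d (Suc r) ` car (P (Suc (Suc r)))"
  using assms by (auto simp: projective_resolution_def)
 thus "x : car (P 0) ==> e x = \<zero>\<^sub>V \<longleftrightarrow> x : d 0 ` car (P (Suc 0))"
  and "y : car (P (Suc r)) ==>
   d r y = \<zero>\<^sub>(P r) \<longleftrightarrow> y : d (Suc r) ` car (P (Suc (Suc r)))"
  by (metis a_kernel_iff)+
qed

text \<open>Chain maps that cover the identity of \<open>V\<close>.\<close>

definition lifts_identity where
 "lifts_identity R P d e Q d' e' \<alpha> \<longleftrightarrow>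
   (\<forall>r. \<alpha> r : mod_hom R (P r) (Q r)) \<and>
   (\<forall>x\<in>car (P 0). e' (\<alpha> 0 x) = e x) \<and>
   (\<forall>r. \<forall>x\<in>car (P (Suc r)). d' r (\<alpha> (Suc r) x) = \<alpha> r (d r x))"

context
 fixes R :: "('r, 'e) ring_scheme" and V :: "('r, 'v, 'f) module_scheme"
  and P :: "nat => ('r, 'p) module" and d e
  and Q :: "nat => ('r, 'q) module" and d' e'
 assumes V: "left_module R V"
  and P: "projective_resolution R P d e V" and Q: "projective_resolution R Q d' e' V"
begin

interpretation V: left_module R V by (rule V)
interpretation P: left_module R "P r" for r by (rule resolution_module[OF P])
interpretation Q: left_module R "Q r" for r by (rule resolution_module[OF Q])

text \<open>Step by step, exactness of the target puts the image of the next differential into the range of the differential that has to be lifted along.\<close>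

lemma comparison_map_exists: "\<exists>\<alpha>. lifts_identity R P d e Q d' e' \<alpha>"
proof -
 let ?Inv = "%n a. a : mod_hom R (P n) (Q n) & (n = 0 --> (\<forall>x\<in>car (P 0). e' (a x) = e x)) \<and>
  (\<forall>x\<in>car (P (Suc n)). a (d n x) : d' n ` car (Q (Suc n)))"
 have "\<exists>\<alpha>. \<forall>n. ?Inv n (\<alpha> n) & (\<forall>x\<in>car (P (Suc n)). d' n (\<alpha> (Suc n) x) = \<alpha> n (d n x))"
 proof (rule dependent_nat_choice)
  have "e x : e' ` car (Q 0)" if "x : car (P 0)" for x
   using mod_hom_closed[OF resolution_aug[OF P] that] resolution_aug_surj[OF Q] by simp
  from projective_lift[OF resolution_projective[OF P] Q.left_module_axioms V resolution_aug[OF Q] resolution_aug[OF P] this]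
  obtain a where a: "a : mod_hom R (P 0) (Q 0)" "!!x. x : car (P 0) ==> e' (a x) = e x" by auto
  have "a (d 0 x) : d' 0 ` car (Q (Suc 0))" if x: "x : car (P (Suc 0))" for x
  proof -
   have dx: "d 0 x : car (P 0)" by (rule mod_hom_closed[OF resolution_diff[OF P] x])
   hence "e (d 0 x) = \<zero>\<^sub>V" using x resolution_exact0[OF P dx] by blast
   thus ?thesis
    using a(2)[OF dx] resolution_exact0[OF Q mod_hom_closed[OF a(1) dx]] by simp
  qed
  with a show "\<exists>a. ?Inv 0 a" by auto
 next
  fix a n assume a: "?Inv n a"
  hence ah: "a : mod_hom R (P n) (Q n)" by blast
  let ?u = "compose (car (P (Suc n))) a (d n)"
  have u: "?u : mod_hom R (P (Suc n)) (Q n)"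
   by (rule mod_hom_compose[OF resolution_diff[OF P] ah P.left_module_axioms])
  have "!!x. x : car (P (Suc n)) ==> ?u x : d' n ` car (Q (Suc n))"
   using a by (simp add: compose_def)
  from projective_lift[OF resolution_projective[OF P] Q.left_module_axioms Q.left_module_axioms resolution_diff[OF Q] u this]
  obtain b where b: "b : mod_hom R (P (Suc n)) (Q (Suc n))"
   "!!x. x : car (P (Suc n)) ==> d' n (b x) = ?u x" by auto
  have "b (d (Suc n) x) : d' (Suc n) ` car (Q (Suc (Suc n)))" if x: "x : car (P (Suc (Suc n)))" for x
  proof -
   have dx: "d (Suc n) x : car (P (Suc n))" by (rule mod_hom_closed[OF resolution_diff[OF P] x])
   hence "d n (d (Suc n) x) = \<zero>\<^sub>(P n)" using x resolution_exact[OF P dx] by blast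
   hence "d' n (b (d (Suc n) x)) = \<zero>\<^sub>(Q n)"
    using b(2)[OF dx] dx mod_hom_zero[OF ah P.M.abelian_group_axioms Q.M.abelian_group_axioms]
    by (simp add: compose_def)
   thus ?thesis using resolution_exact[OF Q mod_hom_closed[OF b(1) dx]] by simp
  qed
  with b show "\<exists>b. ?Inv (Suc n) b & (\<forall>x\<in>car (P (Suc n)). d' n (b x) = a (d n x))"
   by (intro exI[of _ b]) (auto simp: compose_def)
 qed
 then obtain \<alpha> where \<alpha>: "\<forall>n. ?Inv n (\<alpha> n) & (\<forall>x\<in>car (P (Suc n)). d' n (\<alpha> (Suc n) x) = \<alpha> n (d n x))" ..
 have "lifts_identity R P d e Q d' e' \<alpha>"
  unfolding lifts_identity_def using \<alpha> by simp
 thus ?thesis by (intro exI[of _ \<alpha>])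
qed

text \<open>Two such chain maps \<open>a\<close> and \<open>b\<close> are homotopic.\<close>

lemma comparison_homotopy:
 assumes a: "lifts_identity R P d e Q d' e' a" and b: "lifts_identity R P d e Q d' e' b"
 obtains h where "!!n. h n : mod_hom R (P n) (Q (Suc n))"
  "!!x. x : car (P 0) ==> a 0 x \<ominus>\<^sub>(Q 0) b 0 x = d' 0 (h 0 x)"
  "!!n x. x : car (P (Suc n)) ==>
   a (Suc n) x \<ominus>\<^sub>(Q (Suc n)) b (Suc n) x = d' (Suc n) (h (Suc n) x) \<oplus>\<^sub>(Q (Suc n)) h n (d n x)"
proof -
 have ah: "a n : mod_hom R (P n) (Q n)" and bh: "b n : mod_hom R (P n) (Q n)" for n
  using a b by (auto simp: lifts_identity_def)
 have ac: "d' n (a (Suc n) x) = a n (d n x)" "d' n (b (Suc n) x) = b n (d n x)"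
  if "x : car (P (Suc n))" for n x
  using a b that by (auto simp: lifts_identity_def)
 define c where "c n = (\<lambda>x\<in>car (P n). a n x \<ominus>\<^sub>(Q n) b n x)" for n
 have c: "c n : mod_hom R (P n) (Q n)" for n
  unfolding c_def by (rule mod_hom_restrict_diff[OF ah bh P.left_module_axioms Q.left_module_axioms])
 have cc: "d' n (c (Suc n) x) = c n (d n x)" if x: "x : car (P (Suc n))" for n x
  using x mod_hom_closed[OF resolution_diff[OF P] x] ac[OF x]
   mod_hom_diff[OF resolution_diff[OF Q] Q.M.abelian_group_axioms Q.M.abelian_group_axioms
    mod_hom_closed[OF ah x] mod_hom_closed[OF bh x]]
  by (simp add: c_def)
 have dd: "d n (d (Suc n) x) = \<zero>\<^sub>(P n)" if "x : car (P (Suc (Suc n)))" for n x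
  using that resolution_exact[OF P mod_hom_closed[OF resolution_diff[OF P] that]] by blast
 have c0: "c n \<zero>\<^sub>(P n) = \<zero>\<^sub>(Q n)" for n
  by (rule mod_hom_zero[OF c P.M.abelian_group_axioms Q.M.abelian_group_axioms])
 let ?Inv = "%n h. h : mod_hom R (P n) (Q (Suc n)) & (n = 0 --> (\<forall>x\<in>car (P 0). c 0 x = d' 0 (h x))) \<and>
  (\<forall>x\<in>car (P (Suc n)). c n (d n x) = d' n (h (d n x)))"
 have "\<exists>h. \<forall>n. ?Inv n (h n) & (\<forall>x\<in>car (P (Suc n)).
   c (Suc n) x \<ominus>\<^sub>(Q (Suc n)) h n (d n x) = d' (Suc n) (h (Suc n) x))"
 proof (rule dependent_nat_choice)
  have "c 0 x : d' 0 ` car (Q (Suc 0))" if x: "x : car (P 0)" for x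
  proof -
   have "e' (c 0 x) = e' (a 0 x) \<ominus>\<^sub>V e' (b 0 x)"
    using x mod_hom_diff[OF resolution_aug[OF Q] Q.M.abelian_group_axioms V.M.abelian_group_axioms
    mod_hom_closed[OF ah x] mod_hom_closed[OF bh x]] by (simp add: c_def)
   also have "... = \<zero>\<^sub>V"
    using a b x mod_hom_closed[OF resolution_aug[OF P] x] by (auto simp: lifts_identity_def V.M.minus_eq V.M.r_neg)
   finally show ?thesis using resolution_exact0[OF Q mod_hom_closed[OF c x]] by simp
  qed
  from projective_lift[OF resolution_projective[OF P] Q.left_module_axioms Q.left_module_axioms resolution_diff[OF Q] c this]
  obtain h where "h : mod_hom R (P 0) (Q (Suc 0))" "!!x. x : car (P 0) ==> d' 0 (h x) = c 0 x" by auto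
  thus "\<exists>h. ?Inv 0 h"
   using mod_hom_closed[OF resolution_diff[OF P, of 0]] by (intro exI[of _ h]) auto
 next
  fix h n assume h: "?Inv n h"
  hence hh: "h : mod_hom R (P n) (Q (Suc n))" by blast
  let ?u = "\<lambda>x\<in>car (P (Suc n)). c (Suc n) x \<ominus>\<^sub>(Q (Suc n)) compose (car (P (Suc n))) h (d n) x"
  have u: "?u : mod_hom R (P (Suc n)) (Q (Suc n))"
   by (rule mod_hom_restrict_diff[OF c mod_hom_compose[OF resolution_diff[OF P] hh P.left_module_axioms]
    P.left_module_axioms Q.left_module_axioms])
  have "?u x : d' (Suc n) ` car (Q (Suc (Suc n)))" if x: "x : car (P (Suc n))" for x
  proof -
   have dx: "d n x : car (P n)" by (rule mod_hom_closed[OF resolution_diff[OF P] x])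
   have "d' n (?u x) = d' n (c (Suc n) x) \<ominus>\<^sub>(Q n) d' n (h (d n x))"
    using x mod_hom_diff[OF resolution_diff[OF Q] Q.M.abelian_group_axioms Q.M.abelian_group_axioms
    mod_hom_closed[OF c x] mod_hom_closed[OF hh dx]] by (simp add: compose_def)
   also have "... = \<zero>\<^sub>(Q n)"
    using h x cc[OF x] mod_hom_closed[OF c dx] by (simp add: Q.M.minus_eq Q.M.r_neg)
   finally show ?thesis using resolution_exact[OF Q mod_hom_closed[OF u x]] by simp
  qed
  from projective_lift[OF resolution_projective[OF P] Q.left_module_axioms Q.left_module_axioms resolution_diff[OF Q] u this]
  obtain k where k: "k : mod_hom R (P (Suc n)) (Q (Suc (Suc n)))"
   "!!x. x : car (P (Suc n)) ==> d' (Suc n) (k x) = ?u x" by auto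
  have "c (Suc n) (d (Suc n) x) = d' (Suc n) (k (d (Suc n) x))" if x: "x : car (P (Suc (Suc n)))" for x
  proof -
   have dx: "d (Suc n) x : car (P (Suc n))" by (rule mod_hom_closed[OF resolution_diff[OF P] x])
   have "h \<zero>\<^sub>(P n) = \<zero>\<^sub>(Q (Suc n))" by (rule mod_hom_zero[OF hh P.M.abelian_group_axioms Q.M.abelian_group_axioms])
   thus ?thesis
    using k(2)[OF dx] dx dd[OF x] mod_hom_closed[OF c dx] by (simp add: compose_def Q.M.minus_eq)
  qed
  with k show "\<exists>k. ?Inv (Suc n) k & (\<forall>x\<in>car (P (Suc n)).
    c (Suc n) x \<ominus>\<^sub>(Q (Suc n)) h (d n x) = d' (Suc n) (k x))"
   by (intro exI[of _ k]) (auto simp: compose_def)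
 qed
 then obtain h where hI: "\<forall>n. ?Inv n (h n) & (\<forall>x\<in>car (P (Suc n)).
   c (Suc n) x \<ominus>\<^sub>(Q (Suc n)) h n (d n x) = d' (Suc n) (h (Suc n) x))" ..
 hence h: "!!n. ?Inv n (h n)"
  "!!n x. x : car (P (Suc n)) ==> c (Suc n) x \<ominus>\<^sub>(Q (Suc n)) h n (d n x) = d' (Suc n) (h (Suc n) x)"
  by auto
 show thesis
 proof (rule that)
  show hh: "h n : mod_hom R (P n) (Q (Suc n))" for n using h(1) by blast
  show "a 0 x \<ominus>\<^sub>(Q 0) b 0 x = d' 0 (h 0 x)" if "x : car (P 0)" for x
   using h(1)[of 0] that by (simp add: c_def)
  show "a (Suc n) x \<ominus>\<^sub>(Q (Suc n)) b (Suc n) x = d' (Suc n) (h (Suc n) x) \<oplus>\<^sub>(Q (Suc n)) h n (d n x)"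
   if x: "x : car (P (Suc n))" for n x
  proof -
   have "c (Suc n) x : car (Q (Suc n))" "h n (d n x) : car (Q (Suc n))"
    using x mod_hom_closed[OF c x] mod_hom_closed[OF hh mod_hom_closed[OF resolution_diff[OF P] x]] by auto
   hence "c (Suc n) x = d' (Suc n) (h (Suc n) x) \<oplus>\<^sub>(Q (Suc n)) h n (d n x)"
    by (simp add: h(2)[OF x, symmetric] Q.M.minus_eq Q.M.a_assoc Q.M.l_neg)
   thus ?thesis using x by (simp add: c_def)
  qed
 qed
qed

end

section \<open>Monoid algebras and their modules\<close>

lemma
 shows carrier_alg: "car (alg K M) = finsupp K (car M)"
  and zero_alg: "\<zero>\<^sub>(alg K M) = (%_. \<zero>\<^sub>K)"
  and one_alg: "\<one>\<^sub>(alg K M) = single K \<one>\<^sub>M \<one>\<^sub>K"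
  and add_alg: "a \<oplus>\<^sub>(alg K M) b = (%z. a z \<oplus>\<^sub>K b z)"
 by (simp_all add: monoid_algebra_def single_def)

context
 fixes K :: "('k, 'e) ring_scheme" and M :: "('m, 'f) monoid_scheme"
 assumes K: "ring K" and M: "monoid M"
begin

interpretation K: ring K by (rule K)
interpretation M: monoid M by (rule M)

lemma mult_alg:
 assumes a: "a : finsupp K C" and b: "b : finsupp K C'"
  and S: "finite S" "supp K a <= S" and T: "finite T" "supp K b <= T"
 shows "(a \<otimes>\<^sub>(alg K M) b) z =
  (\<Oplus>\<^bsub>K\<^esub>p\<in>{p : S \<times> T. fst p \<otimes>\<^sub>M snd p = z}. a (fst p) \<otimes>\<^sub>K b (snd p))"
proof -
 have "(\<Oplus>\<^bsub>K\<^esub>p\<in>{p : supp K a \<times> supp K b. fst p \<otimes>\<^sub>M snd p = z}. a (fst p) \<otimes>\<^sub>K b (snd p))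
   = (\<Oplus>\<^bsub>K\<^esub>p\<in>{p : S \<times> T. fst p \<otimes>\<^sub>M snd p = z}. a (fst p) \<otimes>\<^sub>K b (snd p))"
 proof (rule K.add.finprod_mono_neutral_cong_left)
  show "finite {p : S \<times> T. fst p \<otimes>\<^sub>M snd p = z}" using S T by simp
  show "{p : supp K a \<times> supp K b. fst p \<otimes>\<^sub>M snd p = z} <= {p : S \<times> T. fst p \<otimes>\<^sub>M snd p = z}"
   using S T by auto
  fix p assume p: "p : {p : S \<times> T. fst p \<otimes>\<^sub>M snd p = z} - {p : supp K a \<times> supp K b. fst p \<otimes>\<^sub>M snd p = z}"
  hence "a (fst p) = \<zero>\<^sub>K \<or> b (snd p) = \<zero>\<^sub>K" by (auto simp: supp_def)
  thus "a (fst p) \<otimes>\<^sub>K b (snd p) = \<zero>\<^sub>K"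
   using finsupp_closed[OF a] finsupp_closed[OF b] by auto
 qed (use finsupp_closed[OF a] finsupp_closed[OF b] in auto)
 thus ?thesis by (simp add: monoid_algebra_def)
qed

lemma mult_single_single:
 assumes "k : car K" "l : car K"
 shows "single K x k \<otimes>\<^sub>(alg K M) single K y l = single K (x \<otimes>\<^sub>M y) (k \<otimes>\<^sub>K l)"
proof
 fix z
 have "(single K x k \<otimes>\<^sub>(alg K M) single K y l) z =
   (\<Oplus>\<^bsub>K\<^esub>p\<in>{p : {x} \<times> {y}. fst p \<otimes>\<^sub>M snd p = z}. single K x k (fst p) \<otimes>\<^sub>K single K y l (snd p))"
  using assms by (intro mult_alg[of _ "{x}" _ "{y}"] K.single_finsupp) (auto simp: supp_def single_def)
 also have "... = single K (x \<otimes>\<^sub>M y) (k \<otimes>\<^sub>K l) z"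
 proof (cases "x \<otimes>\<^sub>M y = z")
  case True
  hence "{p : {x} \<times> {y}. fst p \<otimes>\<^sub>M snd p = z} = {(x, y)}" by auto
  thus ?thesis using True assms by (simp add: single_def)
 next
  case False
  hence empty: "{p : {x} \<times> {y}. fst p \<otimes>\<^sub>M snd p = z} = {}" by auto
  show ?thesis unfolding empty using False by (simp add: single_def)
 qed
 finally show "(single K x k \<otimes>\<^sub>(alg K M) single K y l) z = single K (x \<otimes>\<^sub>M y) (k \<otimes>\<^sub>K l) z" .
qed

lemma mult_closed_alg:
 assumes a: "a : finsupp K (car M)" and b: "b : finsupp K (car M)"
 shows "a \<otimes>\<^sub>(alg K M) b : finsupp K (car M)"
proof (rule finsuppI)
 let ?S = "(%p. fst p \<otimes>\<^sub>M snd p) ` (supp K a \<times> supp K b)"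
 show "finite ?S" using a b by (simp add: finite_supp)
 show "?S <= car M" 
  using supp_subset[OF a] supp_subset[OF b] by (auto intro!: M.m_closed dest: subsetD)
 show "(a \<otimes>\<^sub>(alg K M) b) z : car K" for z
  unfolding mult_alg[OF a b finite_supp[OF a] order_refl finite_supp[OF b] order_refl]
  by (rule K.finsum_closed) (auto simp: finsupp_closed[OF a] finsupp_closed[OF b])
 show "(a \<otimes>\<^sub>(alg K M) b) z = \<zero>\<^sub>K" if "z ~: ?S" for z
 proof -
  have empty: "{p : supp K a \<times> supp K b. fst p \<otimes>\<^sub>M snd p = z} = {}" using that by force
  show ?thesis
   unfolding mult_alg[OF a b finite_supp[OF a] order_refl finite_supp[OF b] order_refl] empty by simp
 qed
qed

lemma alg_l_distr:
 assumes a: "a : finsupp K (car M)" and a': "a' : finsupp K (car M)" and b: "b : finsupp K (car M)"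
 shows "(%z. a z \<oplus>\<^sub>K a' z) \<otimes>\<^sub>(alg K M) b =
  (%z. (a \<otimes>\<^sub>(alg K M) b) z \<oplus>\<^sub>K (a' \<otimes>\<^sub>(alg K M) b) z)"
proof
 fix z
 let ?S = "supp K a Un supp K a'" and ?T = "supp K b"
 have f: "finite ?S" "finite ?T" using a a' b by (simp_all add: finite_supp)
 have s: "supp K (%z. a z \<oplus>\<^sub>K a' z) <= ?S" by (auto simp: supp_def)
 show "((%z. a z \<oplus>\<^sub>K a' z) \<otimes>\<^sub>(alg K M) b) z =
   (a \<otimes>\<^sub>(alg K M) b) z \<oplus>\<^sub>K (a' \<otimes>\<^sub>(alg K M) b) z"
  unfolding mult_alg[OF K.add_finsupp[OF a a'] b f(1) s f(2) order_refl]
   mult_alg[OF a b f(1) _ f(2) order_refl, simplified]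
   mult_alg[OF a' b f(1) _ f(2) order_refl, simplified]
  by (subst K.finsum_addf[symmetric])
   (auto simp: finsupp_closed[OF a] finsupp_closed[OF a'] finsupp_closed[OF b] K.l_distr intro!: K.finsum_cong')
qed

lemma alg_r_distr:
 assumes a: "a : finsupp K (car M)" and b: "b : finsupp K (car M)" and b': "b' : finsupp K (car M)"
 shows "a \<otimes>\<^sub>(alg K M) (%z. b z \<oplus>\<^sub>K b' z) =
  (%z. (a \<otimes>\<^sub>(alg K M) b) z \<oplus>\<^sub>K (a \<otimes>\<^sub>(alg K M) b') z)"
proof
 fix z
 let ?T = "supp K b Un supp K b'" and ?S = "supp K a"
 have f: "finite ?S" "finite ?T" using a b b' by (simp_all add: finite_supp)
 have s: "supp K (%z. b z \<oplus>\<^sub>K b' z) <= ?T" by (auto simp: supp_def)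
 show "(a \<otimes>\<^sub>(alg K M) (%z. b z \<oplus>\<^sub>K b' z)) z =
   (a \<otimes>\<^sub>(alg K M) b) z \<oplus>\<^sub>K (a \<otimes>\<^sub>(alg K M) b') z"
  unfolding mult_alg[OF a K.add_finsupp[OF b b'] f(1) order_refl f(2) s]
   mult_alg[OF a b f(1) order_refl f(2), simplified]
   mult_alg[OF a b' f(1) order_refl f(2), simplified]
  by (subst K.finsum_addf[symmetric])
   (auto simp: finsupp_closed[OF a] finsupp_closed[OF b'] finsupp_closed[OF b] K.r_distr intro!: K.finsum_cong')
qed

lemma mult_zero_alg:
 "(%_. \<zero>\<^sub>K) \<otimes>\<^sub>(alg K M) b = (%_. \<zero>\<^sub>K)"
 "a \<otimes>\<^sub>(alg K M) (%_. \<zero>\<^sub>K) = (%_. \<zero>\<^sub>K)"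
 by (simp_all add: monoid_algebra_def supp_def)

lemma ring_alg: "ring (alg K M)"
proof (rule ringI)
 let ?A = "alg K M"
 show "abelian_group ?A"
 proof (rule abelian_groupI)
  fix a assume a: "a : car ?A"
  show "\<exists>b\<in>car ?A. b \<oplus>\<^sub>?A a = \<zero>\<^sub>?A"
   using a by (intro bexI[of _ "%i. \<ominus>\<^sub>K a i"])
    (auto simp: carrier_alg add_alg zero_alg K.uminus_finsupp finsupp_closed K.l_neg)
 qed (auto simp: carrier_alg add_alg zero_alg K.zero_finsupp K.add_finsupp
   finsupp_closed K.a_ac fun_eq_iff)
 have assoc: "a \<otimes>\<^sub>?A b \<otimes>\<^sub>?A c = a \<otimes>\<^sub>?A (b \<otimes>\<^sub>?A c)"
  if a: "a : finsupp K (car M)" and b: "b : finsupp K (car M)" and c: "c : finsupp K (car M)" for a b c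
  using a
 proof (induction a rule: K.finsupp_induct)
  case (single x k)
  note s = K.single_finsupp[OF single]
  show ?case using b
  proof (induction b rule: K.finsupp_induct)
   case (single y l)
   note s' = K.single_finsupp[OF single]
   show ?case using c
   proof (induction c rule: K.finsupp_induct)
    case (single z m)
    thus ?case using \<open>x : car M\<close> \<open>k : car K\<close> \<open>y : car M\<close> \<open>l : car K\<close>
    by (simp add: mult_single_single M.m_assoc K.m_assoc)
   qed (simp_all add: mult_zero_alg alg_r_distr s s' mult_closed_alg)
  qed (simp_all add: mult_zero_alg alg_r_distr alg_l_distr s c mult_closed_alg)
 qed (simp_all add: mult_zero_alg alg_l_distr b c mult_closed_alg)
 have l_one: "single K \<one>\<^sub>M \<one>\<^sub>K \<otimes>\<^sub>?A a = a" and r_one: "a \<otimes>\<^sub>?A single K \<one>\<^sub>M \<one>\<^sub>K = a"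
  if "a : finsupp K (car M)" for a
  using that by (induction a rule: K.finsupp_induct)
   (simp_all add: mult_single_single mult_zero_alg alg_r_distr alg_l_distr K.single_finsupp)
 show "monoid ?A"
  by (rule monoidI) (simp_all add: carrier_alg one_alg mult_closed_alg
    K.single_finsupp assoc l_one r_one)
qed (simp_all add: carrier_alg add_alg alg_l_distr alg_r_distr)

lemma single_closed: "[|x : car M; k : car K|] ==> single K x k : car (alg K M)"
 by (simp add: carrier_alg K.single_finsupp)

text \<open>Homomorphisms of \<open>KM\<close>-modules need to commute with the elements \<open>k \<cdot> x\<close> only.\<close>

lemma mod_hom_algI:
 assumes V: "left_module (alg K M) V" and W: "left_module (alg K M) W"
  and f: "f : car V \<rightarrow>\<^sub>E car W"
  and add: "!!x y. [|x : car V; y : car V|] ==> f (x \<oplus>\<^sub>V y) = f x \<oplus>\<^sub>W f y"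
  and smult: "!!m k v. [|m : car M; k : car K; v : car V|] ==>
   f (single K m k \<odot>\<^sub>V v) = single K m k \<odot>\<^sub>W f v"
 shows "f : mod_hom (alg K M) V W"
proof (rule mod_homI[OF f add])
 interpret V: left_module "alg K M" V by fact
 interpret W: left_module "alg K M" W by fact
 fix a v assume v: "v : car V"
 from f have fc: "f v : car W" if "v : car V" for v using that by (auto simp: PiE_iff)
 have f0: "f \<zero>\<^sub>V = \<zero>\<^sub>W"
  using add[of "\<zero>\<^sub>V" "\<zero>\<^sub>V"] fc[of "\<zero>\<^sub>V"] by (simp add: W.M.add.r_cancel_one')
 assume "a : car (alg K M)"
 hence "a : finsupp K (car M)" by (simp add: carrier_alg)
 thus "f (a \<odot>\<^sub>V v) = a \<odot>\<^sub>W f v"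
 proof (induction a rule: K.finsupp_induct)
  case zero
  thus ?case using v fc f0 V.smult_l_null[OF v] W.smult_l_null[OF fc[OF v]]
   by (simp add: zero_alg)
 next
  case (single i k)
  thus ?case using smult v by simp
 next
  case (add a b)
  hence "a : car (alg K M)" "b : car (alg K M)"
   by (simp_all add: carrier_alg)
  thus ?case
   using add v fc V.smult_l_distr[of a b v] W.smult_l_distr[of a b "f v"] assms(4)[of "a \<odot>\<^sub>V v" "b \<odot>\<^sub>V v"]
   by (simp add: add_alg)
 qed
qed

end

lemma abelian_group_cong:
 fixes U :: "('a, 'e) ring_scheme" and N :: "('a, 'f) ring_scheme"
 assumes "abelian_group U" "car N = car U" "\<zero>\<^sub>N = \<zero>\<^sub>U" "add N = add U"
 shows "abelian_group N"
proof -
 interpret U: abelian_group U by fact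
 show ?thesis
 proof (rule abelian_groupI)
  fix x assume "x : car N"
  thus "\<exists>y\<in>car N. y \<oplus>\<^sub>N x = \<zero>\<^sub>N"
   using assms by (intro bexI[of _ "\<ominus>\<^sub>U x"]) (auto simp: U.l_neg)
 qed (use assms in "auto simp: U.a_ac")
qed

text \<open>The \<open>KM\<close>-module given by a \<open>K\<close>-linear action \<open>rh\<close> of a monoid \<open>M\<close> on a \<open>K\<close>-module.\<close>

definition rep_module ::
 "('k, 'e) ring_scheme => ('k, 'u, 'f) module_scheme => ('m => 'u => 'u) => ('m => 'k, 'u) module" where
 "rep_module K U rh = \<lparr>carrier = car U, monoid.mult = undefined, one = undefined,
   ring.zero = \<zero>\<^sub>U, ring.add = add U, smult = (%a u. lincomb K U (%m. rh m u) a)\<rparr>"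

lemma
 shows carrier_rep_module: "car (rep_module K U rh) = car U"
  and zero_rep_module: "\<zero>\<^bsub>rep_module K U rh\<^esub> = \<zero>\<^sub>U"
  and add_rep_module: "u \<oplus>\<^bsub>rep_module K U rh\<^esub> v = u \<oplus>\<^sub>U v"
 by (simp_all add: rep_module_def)

lemma
 fixes K :: "('k, 'e) ring_scheme" and M :: "('m, 'f) monoid_scheme" and U :: "('k, 'u, 'h) module_scheme"
 assumes K: "cring K" and M: "monoid M" and U: "left_module K U"
  and closed: "!!m u. [|m : car M; u : car U|] ==> rh m u : car U"
  and add: "!!m u v. [|m : car M; u : car U; v : car U|] ==> rh m (u \<oplus>\<^sub>U v) = rh m u \<oplus>\<^sub>U rh m v"
  and smult: "!!m k u. [|m : car M; k : car K; u : car U|] ==> rh m (k \<odot>\<^sub>U u) = k \<odot>\<^sub>U rh m u"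
  and mult: "!!m m' u. [|m : car M; m' : car M; u : car U|] ==> rh (m \<otimes>\<^sub>M m') u = rh m (rh m' u)"
  and one: "!!u. u : car U ==> rh \<one>\<^sub>M u = u"
 shows rep_module_single: "!!m k u. [|m : car M; k : car K; u : car U|] ==>
   single K m k \<odot>\<^bsub>rep_module K U rh\<^esub> u = k \<odot>\<^sub>U rh m u"
  and left_module_rep_module: "left_module (alg K M) (rep_module K U rh)"
proof -
 interpret K: cring K by fact
 interpret M: monoid M by fact
 interpret U: left_module K U by fact
 let ?N = "rep_module K U rh"
 have sm: "a \<odot>\<^sub>?N u = lincomb K U (%m. rh m u) a" for a u by (simp add: rep_module_def)
 have pi: "(%m. rh m u) : car M \<rightarrow> car U" if "u : car U" for u using closed that by simp
 show single: "single K m k \<odot>\<^sub>?N u = k \<odot>\<^sub>U rh m u"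
  if "m : car M" "k : car K" "u : car U" for m k u
  using that closed by (simp add: sm U.lincomb_single)
 have cl: "a \<odot>\<^sub>?N u : car U" if "a : finsupp K (car M)" "u : car U" for a u
  using that by (simp add: sm U.lincomb_closed[OF _ pi])
 have zero_l: "(%_. \<zero>\<^sub>K) \<odot>\<^sub>?N u = \<zero>\<^sub>U" for u by (simp add: sm U.lincomb_zero)
 have l_distr: "(%z. a z \<oplus>\<^sub>K b z) \<odot>\<^sub>?N u = a \<odot>\<^sub>?N u \<oplus>\<^sub>U b \<odot>\<^sub>?N u"
  if "a : finsupp K (car M)" "b : finsupp K (car M)" "u : car U" for a b u
  using that by (simp add: sm U.lincomb_add[OF _ _ pi])
 have r_distr: "a \<odot>\<^sub>?N (u \<oplus>\<^sub>U v) = a \<odot>\<^sub>?N u \<oplus>\<^sub>U a \<odot>\<^sub>?N v"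
  if a: "a : finsupp K (car M)" and u: "u : car U" and v: "v : car U" for a u v
  using a
 proof (induction a rule: K.finsupp_induct)
  case (add a b)
  thus ?case using u v cl by (simp add: l_distr U.M.a_ac)
 qed (use u v closed in "simp_all add: zero_l single assms(5) U.smult_r_distr")
 have assoc: "(a \<otimes>\<^sub>(alg K M) b) \<odot>\<^sub>?N u = a \<odot>\<^sub>?N (b \<odot>\<^sub>?N u)"
  if a: "a : finsupp K (car M)" and b: "b : finsupp K (car M)" and u: "u : car U" for a b u
  using a
 proof (induction a rule: K.finsupp_induct)
  case (single m k)
  note mk = single
  note s = K.single_finsupp[OF single]
  show ?case using b
  proof (induction b rule: K.finsupp_induct)
   case zero
   have "single K m k \<odot>\<^sub>?N \<zero>\<^sub>U = \<zero>\<^sub>U"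
    using r_distr[OF s, of "\<zero>\<^sub>U" "\<zero>\<^sub>U"] cl[OF s, of "\<zero>\<^sub>U"] by (simp add: U.M.add.r_cancel_one')
   thus ?case by (simp add: mult_zero_alg K.ring_axioms M zero_l)
  next
   case (single m' l)
   with mk u closed show ?case
    by (simp add: mult_single_single K.ring_axioms M \<open>!!m k u. [|m : car M; k : car K; u : car U|] ==>
   single K m k \<odot>\<^bsub>rep_module K U rh\<^esub> u = k \<odot>\<^sub>U rh m u\<close> mult smult U.smult_assoc1)
  next
   case (add b b')
   thus ?case
    using s u cl by (simp add: alg_r_distr K.ring_axioms M l_distr r_distr mult_closed_alg)
  qed
 next
  case (add a a')
  thus ?case
   using u b cl by (simp add: alg_l_distr K.ring_axioms M l_distr mult_closed_alg)
 qed (simp add: mult_zero_alg K.ring_axioms M zero_l)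
 show "left_module (alg K M) ?N"
 proof (rule left_moduleI)
  show "abelian_group ?N"
   by (rule abelian_group_cong[OF U.M.abelian_group_axioms]) (simp_all add: rep_module_def)
  show "\<one>\<^sub>(alg K M) \<odot>\<^sub>?N u = u" if "u : car ?N" for u
   using that single[of "\<one>\<^sub>M" "\<one>\<^sub>K" u] one[of u] closed[of "\<one>\<^sub>M" u]
   by (simp add: one_alg carrier_rep_module)
 qed (simp_all add: ring_alg[OF K.ring_axioms M] carrier_alg carrier_rep_module add_rep_module
   add_alg cl l_distr r_distr assoc)
qed

text \<open>Restriction of scalars along a ring homomorphism \<open>h\<close> that need not preserve \<open>\<one>\<close>, to
  a subgroup \<open>C\<close> on which \<open>h \<one>\<close> acts as the identity.\<close>

definition restrict_scalars ::
 "('a, 'r) module => 'r set => ('s => 'a) => ('s, 'r) module" where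
 "restrict_scalars W C h = \<lparr>carrier = C, monoid.mult = undefined, one = undefined, ring.zero = \<zero>\<^sub>W,
   ring.add = add W, smult = (%a x. h a \<odot>\<^sub>W x)\<rparr>"

lemma restrict_scalars_simps [simp]:
 "car (restrict_scalars W C h) = C"
 "\<zero>\<^sub>(restrict_scalars W C h) = \<zero>\<^sub>W"
 "x \<oplus>\<^sub>(restrict_scalars W C h) y = x \<oplus>\<^sub>W y"
 "a \<odot>\<^sub>(restrict_scalars W C h) x = h a \<odot>\<^sub>W x"
 by (simp_all add: restrict_scalars_def)

lemma left_module_restrict_scalars:
 fixes R :: "('a, 'e) ring_scheme" and R' :: "('s, 'f) ring_scheme"
 assumes W: "left_module R W" and R': "ring R'"
  and h: "!!a. a : car R' ==> h a : car R"
  and h_add: "!!a b. [|a : car R'; b : car R'|] ==> h (a \<oplus>\<^sub>R' b) = h a \<oplus>\<^sub>R h b"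
  and h_mult: "!!a b. [|a : car R'; b : car R'|] ==> h (a \<otimes>\<^sub>R' b) = h a \<otimes>\<^sub>R h b"
  and C: "C <= car W" "\<zero>\<^sub>W : C" "!!x y. [|x : C; y : C|] ==> x \<oplus>\<^sub>W y : C" "!!x. x : C ==> \<ominus>\<^sub>W x : C"
  and smult: "!!a x. [|a : car R'; x : C|] ==> h a \<odot>\<^sub>W x : C"
  and one: "!!x. x : C ==> h \<one>\<^sub>R' \<odot>\<^sub>W x = x"
 shows "left_module R' (restrict_scalars W C h)"
proof -
 interpret W: left_module R W by fact
 have cw: "x : car W" if "x : C" for x using that C(1) by auto
 show ?thesis
 proof (rule left_moduleI[OF R'])
  show "abelian_group (restrict_scalars W C h)"
  proof (rule abelian_groupI)
   fix x assume "x : car (restrict_scalars W C h)"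
   thus "\<exists>y\<in>car (restrict_scalars W C h). y \<oplus>\<^sub>(restrict_scalars W C h) x = \<zero>\<^sub>(restrict_scalars W C h)"
    using C(4) by (intro bexI[of _ "\<ominus>\<^sub>W x"]) (auto simp: W.M.l_neg cw)
  qed (use C in "auto simp: cw W.M.a_ac")
 qed (use C in "auto simp: cw smult one h h_add h_mult W.smult_l_distr W.smult_r_distr W.smult_assoc1")
qed

text \<open>The algebra homomorphism induced by a map \<open>\<iota>\<close> between monoids that preserves products.\<close>

definition alg_map ::
 "('k, 'e) ring_scheme => ('m, 'f) monoid_scheme => ('h => 'm) => ('h => 'k) => 'm => 'k" where
 "alg_map K M \<iota> b = lincomb K (free K (car M)) (%h. single K (\<iota> h) \<one>\<^sub>K) b"

context
 fixes K :: "('k, 'e) ring_scheme" and M :: "('m, 'f) monoid_scheme" and H :: "('h, 'j) monoid_scheme"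
  and \<iota> :: "'h => 'm"
 assumes K: "ring K" and M: "monoid M" and H: "monoid H"
  and \<iota>: "!!h. h : car H ==> \<iota> h : car M"
  and \<iota>_mult: "!!h h'. [|h : car H; h' : car H|] ==> \<iota> (h \<otimes>\<^sub>H h') = \<iota> h \<otimes>\<^sub>M \<iota> h'"
begin

interpretation K: ring K by (rule K)
interpretation F: left_module K "free K (car M)" by (rule K.left_module_free_module)

lemma alg_map_basis: "(%h. single K (\<iota> h) \<one>\<^sub>K) : car H \<rightarrow> car (free K (car M))"
 using \<iota> by (auto simp: free_module_def K.single_finsupp)

lemma alg_map_closed:
 assumes "b : car (alg K H)" shows "alg_map K M \<iota> b : car (alg K M)"
proof -
 have "alg_map K M \<iota> b : car (free K (car M))"
  unfolding alg_map_def using assms by (intro F.lincomb_closed[OF _ alg_map_basis]) (simp add: carrier_alg)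
 thus ?thesis by (simp add: free_module_def carrier_alg)
qed

lemma alg_map_add:
 assumes "b : finsupp K (car H)" "c : finsupp K (car H)"
 shows "alg_map K M \<iota> (%z. b z \<oplus>\<^sub>K c z) = (%z. alg_map K M \<iota> b z \<oplus>\<^sub>K alg_map K M \<iota> c z)"
 using F.lincomb_add[OF assms alg_map_basis] by (simp add: alg_map_def free_module_def)

lemma alg_map_single:
 assumes "h : car H" "k : car K"
 shows "alg_map K M \<iota> (single K h k) = single K (\<iota> h) k"
proof -
 have "alg_map K M \<iota> (single K h k) = k \<odot>\<^sub>(free K (car M)) single K (\<iota> h) \<one>\<^sub>K"
  unfolding alg_map_def using assms alg_map_basis by (intro F.lincomb_single) auto
 also have "... = single K (\<iota> h) k" using assms by (auto simp: free_module_def single_def)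
 finally show ?thesis .
qed

lemma alg_map_zero: "alg_map K M \<iota> (%_. \<zero>\<^sub>K) = (%_. \<zero>\<^sub>K)"
 using F.lincomb_zero by (simp add: alg_map_def free_module_def)

lemma alg_map_mult:
 assumes a: "a : finsupp K (car H)" and b: "b : finsupp K (car H)"
 shows "alg_map K M \<iota> (a \<otimes>\<^sub>(alg K H) b) =
  alg_map K M \<iota> a \<otimes>\<^sub>(alg K M) alg_map K M \<iota> b"
proof -
 have cl: "alg_map K M \<iota> b : finsupp K (car M)" if "b : finsupp K (car H)" for b
  using alg_map_closed[of b] that by (simp add: carrier_alg)
 interpret H: monoid H by (rule H)
 show ?thesis using a
 proof (induction a rule: K.finsupp_induct)
  case zero
  thus ?case by (simp add: mult_zero_alg K M H alg_map_zero)
 next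
  case (single x k)
  note xk = single
  note s = K.single_finsupp[OF single]
  show ?case using b
  proof (induction b rule: K.finsupp_induct)
   case zero
   thus ?case by (simp add: mult_zero_alg K M H alg_map_zero)
  next
   case (single y l)
   with xk show ?case by (simp add: mult_single_single K M H alg_map_single \<iota>_mult)
  next
   case (add b c)
   thus ?case
    using s by (simp add: alg_r_distr K M H alg_map_add mult_closed_alg cl)
  qed
 next
  case (add a c)
  thus ?case
   using b by (simp add: alg_l_distr K M H alg_map_add mult_closed_alg cl)
 qed
qed

end

section \<open>Cohomology of Hom complexes\<close>

lemma left_submoduleI:
 assumes Z: "left_module K Z" and B: "B <= car Z" "\<zero>\<^sub>Z : B"
  and add: "!!x y. [|x : B; y : B|] ==> x \<oplus>\<^sub>Z y : B"
  and smult: "!!a x. [|a : car K; x : B|] ==> a \<odot>\<^sub>Z x : B"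
 shows "submodule B K Z"
proof -
 interpret Z: left_module K Z by fact
 have "\<ominus>\<^sub>Z x : B" if x: "x : B" for x
 proof -
  have xc: "x : car Z" using x B by auto
  have "(\<ominus>\<^sub>K \<one>\<^sub>K) \<odot>\<^sub>Z x \<oplus>\<^sub>Z x = (\<ominus>\<^sub>K \<one>\<^sub>K \<oplus>\<^sub>K \<one>\<^sub>K) \<odot>\<^sub>Z x"
   using xc by (simp add: Z.smult_l_distr)
  also have "... = \<zero>\<^sub>Z" using xc by (simp add: Z.R.l_neg)
  finally have "\<ominus>\<^sub>Z x = (\<ominus>\<^sub>K \<one>\<^sub>K) \<odot>\<^sub>Z x"
   using xc by (intro Z.M.minus_equality) auto
  thus ?thesis using smult x by simp
 qed
 thus ?thesis
  using B add smult by (intro submodule.intro subgroup.intro submodule_axioms.intro) (auto simp: a_inv_def[symmetric])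
qed

lemma left_module_submodule:
 assumes Z: "left_module K Z" and C: "submodule C K Z"
 shows "left_module K (Z\<lparr>carrier := C\<rparr>)"
proof -
 interpret Z: left_module K Z by fact
 interpret C: submodule C K Z by fact
 interpret AC: additive_subgroup C Z by (rule submodule_additive_subgroup[OF C])
 have c: "x : car Z" if "x : C" for x using that AC.a_subset by auto
 show ?thesis
 proof (rule left_moduleI[OF Z.R.ring_axioms])
  show "abelian_group (Z\<lparr>carrier := C\<rparr>)"
  proof (rule abelian_groupI)
   fix x assume "x : car (Z\<lparr>carrier := C\<rparr>)"
   thus "\<exists>y\<in>car (Z\<lparr>carrier := C\<rparr>). y \<oplus>\<^bsub>Z\<lparr>carrier := C\<rparr>\<^esub> x = \<zero>\<^bsub>Z\<lparr>carrier := C\<rparr>\<^esub>"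
    by (intro bexI[of _ "\<ominus>\<^sub>Z x"]) (auto simp: c Z.M.l_neg)
  qed (auto simp: c Z.M.a_ac)
 qed (auto simp: c Z.smult_l_distr Z.smult_r_distr Z.smult_assoc1)
qed

lemma minus_submodule:
 assumes Z: "left_module K Z" and C: "submodule C K Z" and x: "x : C" "y : C"
 shows "x \<ominus>\<^bsub>Z\<lparr>carrier := C\<rparr>\<^esub> y = x \<ominus>\<^sub>Z y"
proof -
 interpret Z: left_module K Z by fact
 interpret AC: additive_subgroup C Z by (rule submodule_additive_subgroup[OF C])
 interpret ZC: left_module K "Z\<lparr>carrier := C\<rparr>" by (rule left_module_submodule[OF Z C])
 have "\<ominus>\<^bsub>Z\<lparr>carrier := C\<rparr>\<^esub> y = \<ominus>\<^sub>Z y"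
  using x AC.a_subset by (intro ZC.M.minus_equality) (auto simp: Z.M.l_neg)
 thus ?thesis by (simp add: a_minus_def)
qed

lemma submodule_kernel:
 assumes Z: "left_module K Z" and N: "left_module K N" and f: "f : mod_hom K Z N"
 shows "submodule {z : car Z. f z = \<zero>\<^sub>N} K Z"
proof -
 interpret Z: left_module K Z by fact
 interpret N: left_module K N by fact
 show ?thesis
  using mod_hom_zero[OF f Z.M.abelian_group_axioms N.M.abelian_group_axioms]
  by (intro left_submoduleI[OF Z]) (auto simp: mod_hom_add[OF f] mod_hom_smult[OF f])
qed

lemma submodule_image:
 assumes Z: "left_module K Z" and N: "left_module K N" and f: "f : mod_hom K Z N"
 shows "submodule (f ` car Z) K N"
proof -
 interpret Z: left_module K Z by fact
 interpret N: left_module K N by fact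
 show ?thesis
 proof (rule left_submoduleI[OF N])
  show "\<zero>\<^sub>N : f ` car Z"
   using mod_hom_zero[OF f Z.M.abelian_group_axioms N.M.abelian_group_axioms, symmetric] by auto
 qed (auto simp: mod_hom_closed[OF f] mod_hom_add[OF f, symmetric] mod_hom_smult[OF f, symmetric])
qed

definition chain_complex where
 "chain_complex R P d \<longleftrightarrow> (\<forall>r. left_module R (P r)) & (\<forall>r. d r : mod_hom R (P (Suc r)) (P r)) \<and>
   (\<forall>r. \<forall>x\<in>car (P (Suc (Suc r))). d r (d (Suc r) x) = \<zero>\<^sub>(P r))"

lemma
 assumes "chain_complex R P d"
 shows chain_complex_module: "left_module R (P r)"
  and chain_complex_diff: "d r : mod_hom R (P (Suc r)) (P r)"
  and chain_complex_sq: "x : car (P (Suc (Suc r))) ==> d r (d (Suc r) x) = \<zero>\<^sub>(P r)"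
 using assms by (auto simp: chain_complex_def)

lemma projective_resolution_chain_complex:
 assumes P: "projective_resolution R P d e V"
 shows "chain_complex R P d"
 unfolding chain_complex_def
proof (intro conjI allI ballI)
 show "d r (d (Suc r) x) = \<zero>\<^sub>(P r)" if x: "x : car (P (Suc (Suc r)))" for r x
  using resolution_exact[OF P mod_hom_closed[OF resolution_diff[OF P] x]] x by simp
qed (use resolution_module[OF P] resolution_diff[OF P] in simp_all)

lemma hom_module_simps [simp]:
 "car (hom_module K M P W) = mod_hom (alg K M) P W"
 "\<zero>\<^sub>(hom_module K M P W) = (\<lambda>x\<in>car P. \<zero>\<^sub>W)"
 "f \<oplus>\<^sub>(hom_module K M P W) g = (\<lambda>x\<in>car P. f x \<oplus>\<^sub>W g x)"
 "k \<odot>\<^sub>(hom_module K M P W) f = (\<lambda>x\<in>car P. single K \<one>\<^sub>M k \<odot>\<^sub>W f x)"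
 by (simp_all add: hom_module_def)

lemma mem_cocycles_iff:
 "f : cocycles K M P d W r \<longleftrightarrow>
  f : mod_hom (alg K M) (P r) W & (\<forall>x\<in>car (P (Suc r)). f (d r x) = \<zero>\<^sub>W)"
 by (auto simp: cocycles_def compose_def fun_eq_iff restrict_def)

lemma coboundaries_Suc:
 "coboundaries K M P d W (Suc r) =
  (%f. compose (car (P (Suc r))) f (d r)) ` mod_hom (alg K M) (P r) W"
 by simp

context
 fixes K :: "('k, 'e) ring_scheme" and M :: "('m, 'f) monoid_scheme" and W :: "('m => 'k, 'w, 'j) module_scheme"
 assumes K: "cring K" and M: "monoid M" and W: "left_module (alg K M) W"
begin

interpretation K: cring K by (rule K)
interpretation M: monoid M by (rule M)
interpretation W: left_module "alg K M" W by (rule W)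

lemma single_one_central:
 assumes a: "a : car (alg K M)" and k: "k : car K"
 shows "single K \<one>\<^sub>M k \<otimes>\<^sub>(alg K M) a = a \<otimes>\<^sub>(alg K M) single K \<one>\<^sub>M k"
proof -
 note s = K.single_finsupp[OF M.one_closed k]
 have "a : finsupp K (car M)" using a by (simp add: carrier_alg)
 thus ?thesis
  by (induction a rule: K.finsupp_induct)
   (simp_all add: mult_zero_alg mult_single_single alg_l_distr alg_r_distr
    K.ring_axioms M s k K.m_comm)
qed

lemma scalar_closed: "k : car K ==> single K \<one>\<^sub>M k : car (alg K M)"
 by (simp add: carrier_alg K.single_finsupp)

lemma scalar_smult_commute:
 assumes a: "a : car (alg K M)" and k: "k : car K" and w: "w : car W"
 shows "single K \<one>\<^sub>M k \<odot>\<^sub>W (a \<odot>\<^sub>W w) = a \<odot>\<^sub>W (single K \<one>\<^sub>M k \<odot>\<^sub>W w)"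
 using W.smult_assoc1[OF scalar_closed[OF k] a w] W.smult_assoc1[OF a scalar_closed[OF k] w]
 by (simp add: single_one_central[OF a k])

lemma left_module_hom_module:
 assumes P: "left_module (alg K M) P"
 shows "left_module K (hom_module K M P W)"
proof -
 interpret P: left_module "alg K M" P by fact
 let ?A = "alg K M"
 let ?H = "hom_module K M P W"
 have zero: "(\<lambda>x\<in>car P. \<zero>\<^sub>W) : mod_hom ?A P W"
  by (rule mod_homI) auto
 have add: "(\<lambda>x\<in>car P. f x \<oplus>\<^sub>W g x) : mod_hom ?A P W" if f: "f : mod_hom ?A P W" and g: "g : mod_hom ?A P W" for f g
  by (rule mod_homI)
   (auto simp: mod_hom_closed[OF f] mod_hom_closed[OF g] mod_hom_add[OF f] mod_hom_add[OF g]
    mod_hom_smult[OF f] mod_hom_smult[OF g] W.smult_r_distr W.M.a_ac)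
 have smult: "(\<lambda>x\<in>car P. a \<odot>\<^sub>W f x) : mod_hom ?A P W"
  if f: "f : mod_hom ?A P W" and a: "a : car ?A"
   "!!b w. b : car ?A ==> w : car W ==> a \<odot>\<^sub>W (b \<odot>\<^sub>W w) = b \<odot>\<^sub>W (a \<odot>\<^sub>W w)" for f a
  by (rule mod_homI) (auto simp: a mod_hom_closed[OF f] mod_hom_add[OF f] mod_hom_smult[OF f] W.smult_r_distr)
 have neg: "(\<lambda>x\<in>car P. \<ominus>\<^sub>W f x) : mod_hom ?A P W" if f: "f : mod_hom ?A P W" for f
  by (rule mod_homI)
   (auto simp: mod_hom_closed[OF f] mod_hom_add[OF f] mod_hom_smult[OF f] W.smult_r_minus W.M.minus_add)
 have ext: "f = g" if "f : extensional (car P)" "g : extensional (car P)" "!!x. x : car P ==> f x = g x" for f g :: "_ => 'w"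
  using that by (rule extensionalityI)
 have s_add: "single K \<one>\<^sub>M (k \<oplus>\<^sub>K l) = single K \<one>\<^sub>M k \<oplus>\<^sub>?A single K \<one>\<^sub>M l"
  if "k : car K" "l : car K" for k l
  using that by (auto simp: single_def add_alg fun_eq_iff)
 have s_mult: "single K \<one>\<^sub>M (k \<otimes>\<^sub>K l) = single K \<one>\<^sub>M k \<otimes>\<^sub>?A single K \<one>\<^sub>M l"
  if "k : car K" "l : car K" for k l
  using that by (simp add: mult_single_single K.ring_axioms M)
 show ?thesis
 proof (rule left_moduleI[OF K.ring_axioms])
  show "abelian_group ?H"
  proof (rule abelian_groupI)
   fix f assume "f : car ?H"
   thus "\<exists>g\<in>car ?H. g \<oplus>\<^sub>?H f = \<zero>\<^sub>?H"
    using neg[of f] by (intro bexI[of _ "\<lambda>x\<in>car P. \<ominus>\<^sub>W f x"])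
    (auto intro!: ext simp: W.M.l_neg mod_hom_closed)
  next
   fix f assume f: "f : car ?H"
   thus "\<zero>\<^sub>?H \<oplus>\<^sub>?H f = f"
    by (intro ext) (auto simp: mod_hom_closed mod_hom_extensional[of f ?A P W])
  qed (use zero add in "auto intro!: ext simp: mod_hom_closed W.M.a_ac")
  fix f assume f: "f : car ?H"
  show "\<one>\<^sub>K \<odot>\<^sub>?H f = f"
   using f W.smult_one
   by (intro ext) (auto simp: mod_hom_closed mod_hom_extensional[of f ?A P W] one_alg[symmetric])
  fix k assume k: "k : car K"
  show "k \<odot>\<^sub>?H f : car ?H"
   using smult[of f "single K \<one>\<^sub>M k"] f k scalar_closed scalar_smult_commute by simp
  fix l assume l: "l : car K"
  show "(k \<oplus>\<^sub>K l) \<odot>\<^sub>?H f = k \<odot>\<^sub>?H f \<oplus>\<^sub>?H l \<odot>\<^sub>?H f"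
   using f k l by (intro ext) (auto simp: s_add W.smult_l_distr scalar_closed mod_hom_closed)
  show "(k \<otimes>\<^sub>K l) \<odot>\<^sub>?H f = k \<odot>\<^sub>?H (l \<odot>\<^sub>?H f)"
   using f k l by (intro ext) (auto simp: s_mult W.smult_assoc1 scalar_closed mod_hom_closed)
 next
  fix k f g assume "k : car K" "f : car ?H" "g : car ?H"
  thus "k \<odot>\<^sub>?H (f \<oplus>\<^sub>?H g) = k \<odot>\<^sub>?H f \<oplus>\<^sub>?H k \<odot>\<^sub>?H g"
   by (intro ext) (auto simp: W.smult_r_distr scalar_closed mod_hom_closed)
 qed
qed

lemma hom_module_diff:
 assumes P: "left_module (alg K M) P"
  and f: "f : mod_hom (alg K M) P W" and g: "g : mod_hom (alg K M) P W"
 shows "f \<ominus>\<^sub>(hom_module K M P W) g = (\<lambda>x\<in>car P. f x \<ominus>\<^sub>W g x)"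
proof -
 interpret P: left_module "alg K M" P by fact
 interpret H: left_module K "hom_module K M P W" by (rule left_module_hom_module[OF P])
 let ?d = "\<lambda>x\<in>car P. f x \<ominus>\<^sub>W g x"
 have d: "?d : car (hom_module K M P W)"
  using mod_hom_restrict_diff[OF f g P W] by simp
 have "?d \<oplus>\<^sub>(hom_module K M P W) g = f"
  by (rule extensionalityI[of _ "car P"])
   (auto simp: mod_hom_extensional[OF f] mod_hom_closed[OF f] mod_hom_closed[OF g] W.M.minus_eq W.M.a_assoc W.M.l_neg)
 hence "f \<ominus>\<^sub>(hom_module K M P W) g = (?d \<oplus>\<^sub>(hom_module K M P W) g) \<ominus>\<^sub>(hom_module K M P W) g" by simp
 also have "... = ?d"
  using d g H.M.a_assoc[of ?d g "\<ominus>\<^sub>(hom_module K M P W) g"] H.M.r_neg[of g] H.M.r_zero[of ?d] H.M.a_inv_closed[of g]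
  by (simp only: H.M.minus_eq hom_module_simps(1))
 finally show ?thesis .
qed

lemma precompose_hom:
 assumes P: "left_module (alg K M) P" and Q: "left_module (alg K M) Q"
  and \<alpha>: "\<alpha> : mod_hom (alg K M) P Q"
 shows "(\<lambda>f\<in>car (hom_module K M Q W). compose (car P) f \<alpha>)
  : mod_hom K (hom_module K M Q W) (hom_module K M P W)"
proof -
 interpret H: left_module K "hom_module K M Q W" by (rule left_module_hom_module[OF Q])
 show ?thesis
 proof (rule mod_homI)
  show "(\<lambda>f\<in>car (hom_module K M Q W). compose (car P) f \<alpha>)
   : car (hom_module K M Q W) \<rightarrow>\<^sub>E car (hom_module K M P W)"
   using mod_hom_compose[OF \<alpha> _ P] by (auto intro!: restrict_PiE_iff[THEN iffD2])
 next
  fix f g assume "f : car (hom_module K M Q W)" "g : car (hom_module K M Q W)"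
  moreover from this have "f \<oplus>\<^sub>(hom_module K M Q W) g : car (hom_module K M Q W)" by (rule H.M.a_closed)
  ultimately show "(\<lambda>f\<in>car (hom_module K M Q W). compose (car P) f \<alpha>) (f \<oplus>\<^sub>(hom_module K M Q W) g) =
   (\<lambda>f\<in>car (hom_module K M Q W). compose (car P) f \<alpha>) f \<oplus>\<^sub>(hom_module K M P W)
   (\<lambda>f\<in>car (hom_module K M Q W). compose (car P) f \<alpha>) g"
   by (auto simp: compose_def mod_hom_closed[OF \<alpha>] fun_eq_iff restrict_def)
 next
  fix k f assume "k : car K" "f : car (hom_module K M Q W)"
  moreover from this have "k \<odot>\<^sub>(hom_module K M Q W) f : car (hom_module K M Q W)" by (rule H.smult_closed)
  ultimately show "(\<lambda>f\<in>car (hom_module K M Q W). compose (car P) f \<alpha>) (k \<odot>\<^sub>(hom_module K M Q W) f) =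
   k \<odot>\<^sub>(hom_module K M P W) (\<lambda>f\<in>car (hom_module K M Q W). compose (car P) f \<alpha>) f"
   by (auto simp: compose_def mod_hom_closed[OF \<alpha>] fun_eq_iff restrict_def)
 qed
qed

context
 fixes P :: "nat => ('m => 'k, 'p) module" and d
 assumes P: "chain_complex (alg K M) P d"
begin

lemmas P_module = chain_complex_module[OF P] and P_diff = chain_complex_diff[OF P]
 and P_sq = chain_complex_sq[OF P]

lemma submodule_cocycles: "submodule (cocycles K M P d W r) K (hom_module K M (P r) W)"
proof -
 let ?\<delta> = "\<lambda>f\<in>car (hom_module K M (P r) W). compose (car (P (Suc r))) f (d r)"
 have eq: "cocycles K M P d W r =
   {f : car (hom_module K M (P r) W). ?\<delta> f = \<zero>\<^sub>(hom_module K M (P (Suc r)) W)}"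
  unfolding cocycles_def by (rule Collect_cong) (simp del: hom_module_simps cong: conj_cong)
 show ?thesis
  unfolding eq
  by (rule submodule_kernel[OF left_module_hom_module[OF P_module]
    left_module_hom_module[OF P_module]
    precompose_hom[OF P_module P_module P_diff]])
qed

lemma coboundaries_subset_cocycles: "coboundaries K M P d W r <= cocycles K M P d W r"
proof
 fix f assume f: "f : coboundaries K M P d W r"
 interpret H: left_module K "hom_module K M (P r) W" by (rule left_module_hom_module[OF P_module])
 show "f : cocycles K M P d W r"
 proof (cases r)
  case 0
  hence "f = \<zero>\<^sub>(hom_module K M (P r) W)" using f by simp
  thus ?thesis
   using H.M.zero_closed mod_hom_closed[OF P_diff] by (simp add: mem_cocycles_iff)
 next
  case (Suc s)
  then obtain g where g: "g : mod_hom (alg K M) (P s) W" "f = compose (car (P r)) g (d s)"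
   using f by (auto simp: coboundaries_Suc)
  have "g \<zero>\<^sub>(P s) = \<zero>\<^sub>W"
   by (rule mod_hom_zero[OF g(1) left_module_group[OF P_module] left_module_group[OF W]])
  thus ?thesis
   using g mod_hom_compose[OF P_diff g(1) P_module] Suc
    mod_hom_closed[OF P_diff] P_sq
   by (simp add: mem_cocycles_iff compose_def)
 qed
qed

lemma submodule_coboundaries:
 "submodule (coboundaries K M P d W r) K (hom_module K M (P r) W\<lparr>carrier := cocycles K M P d W r\<rparr>)"
proof -
 have H: "left_module K (hom_module K M (P s) W)" for s by (rule left_module_hom_module[OF P_module])
 have "submodule (coboundaries K M P d W r) K (hom_module K M (P r) W)"
 proof (cases r)
  case 0
  interpret H: left_module K "hom_module K M (P 0) W" by (rule H)
  show ?thesis unfolding 0 coboundaries.simps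
   by (rule left_submoduleI[OF H]) (simp_all del: hom_module_simps)
 next
  case (Suc s)
  have "coboundaries K M P d W r = (\<lambda>f\<in>car (hom_module K M (P s) W). compose (car (P r)) f (d s))
    ` car (hom_module K M (P s) W)"
   unfolding Suc by (simp add: coboundaries_Suc)
  thus ?thesis
   unfolding Suc
   by (simp only: submodule_image[OF H H precompose_hom[OF P_module P_module P_diff]])
 qed
 then interpret B: submodule "coboundaries K M P d W r" K "hom_module K M (P r) W" .
 interpret AB: additive_subgroup "coboundaries K M P d W r" "hom_module K M (P r) W"
  by (rule submodule_additive_subgroup) unfold_locales
 show ?thesis
 proof (rule left_submoduleI[OF left_module_submodule[OF H submodule_cocycles]])
  show "coboundaries K M P d W r <= car (hom_module K M (P r) W\<lparr>carrier := cocycles K M P d W r\<rparr>)"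
   using coboundaries_subset_cocycles by simp
  show "\<zero>\<^bsub>hom_module K M (P r) W\<lparr>carrier := cocycles K M P d W r\<rparr>\<^esub> : coboundaries K M P d W r"
   using AB.zero_closed by simp
  show "x \<oplus>\<^bsub>hom_module K M (P r) W\<lparr>carrier := cocycles K M P d W r\<rparr>\<^esub> y : coboundaries K M P d W r"
   if "x : coboundaries K M P d W r" "y : coboundaries K M P d W r" for x y
   using AB.a_closed[OF that] by simp
  show "k \<odot>\<^bsub>hom_module K M (P r) W\<lparr>carrier := cocycles K M P d W r\<rparr>\<^esub> x : coboundaries K M P d W r"
   if "k : car K" "x : coboundaries K M P d W r" for k x
   using B.smult_closed[OF that] by simp
 qed
qed

lemma left_module_cocycles: "left_module K (hom_module K M (P r) W\<lparr>carrier := cocycles K M P d W r\<rparr>)"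
 by (rule left_module_submodule[OF left_module_hom_module[OF P_module] submodule_cocycles])

lemma left_module_Ext: "left_module K (Ext K M P d W r)"
 unfolding Ext_def by (rule left_module_quot_module[OF left_module_cocycles submodule_coboundaries])

lemma cocycles_diff:
 assumes "f : cocycles K M P d W r" "g : cocycles K M P d W r"
 shows "f \<ominus>\<^bsub>hom_module K M (P r) W\<lparr>carrier := cocycles K M P d W r\<rparr>\<^esub> g = (\<lambda>x\<in>car (P r). f x \<ominus>\<^sub>W g x)"
proof -
 have "f \<ominus>\<^bsub>hom_module K M (P r) W\<lparr>carrier := cocycles K M P d W r\<rparr>\<^esub> g = f \<ominus>\<^sub>(hom_module K M (P r) W) g"
  by (rule minus_submodule[OF left_module_hom_module[OF P_module] submodule_cocycles assms])
 thus ?thesis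
  using hom_module_diff[OF P_module, of f r g] assms by (simp add: mem_cocycles_iff)
qed

lemma Ext_trivialI:
 assumes "cocycles K M P d W r <= coboundaries K M P d W r"
 shows "car (Ext K M P d W r) = {\<zero>\<^sub>(Ext K M P d W r)}"
proof -
 note Z = left_module_cocycles[of r] and B = submodule_coboundaries[of r]
 let ?Z = "hom_module K M (P r) W\<lparr>carrier := cocycles K M P d W r\<rparr>"
 interpret Z: left_module K ?Z by (rule Z)
 have "coboundaries K M P d W r +>\<^bsub>?Z\<^esub> f = coboundaries K M P d W r" if "f : car ?Z" for f
  using coset_eq_subgroup_iff[OF Z B that] assms that by auto
 hence "(%x. coboundaries K M P d W r +>\<^bsub>?Z\<^esub> x) ` car ?Z = {coboundaries K M P d W r}"
  using Z.M.zero_closed by blast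
 thus ?thesis
  unfolding Ext_def carrier_quot_module[OF Z B] zero_quot_module[OF Z B] .
qed

end

text \<open>A cocycle changes by a coboundary when it is composed with a chain map over the identity.\<close>

lemma cocycle_lifts_identity:
 fixes P :: "nat => ('m => 'k, 'p) module"
 assumes V: "left_module (alg K M) V"
  and P': "projective_resolution (alg K M) P d e V"
  and g: "lifts_identity (alg K M) P d e P d e \<gamma>"
  and f: "f : cocycles K M P d W r"
 shows "\<exists>h. h : coboundaries K M P d W r & (\<forall>x\<in>car (P r). f x \<ominus>\<^sub>W f (\<gamma> r x) = h x)"
proof -
 let ?A = "alg K M"
 note cP = projective_resolution_chain_complex[OF P']
 note Pm = chain_complex_module[OF cP] and Pd = chain_complex_diff[OF cP]
 have fh: "f : mod_hom ?A (P r) W" and fz: "!!x. x : car (P (Suc r)) ==> f (d r x) = \<zero>\<^sub>W"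
  using f by (auto simp: mem_cocycles_iff)
 note ag = left_module_group[OF Pm] left_module_group[OF W]
 have gh: "\<gamma> s : mod_hom ?A (P s) (P s)" for s using g by (simp add: lifts_identity_def)
 have i: "lifts_identity ?A P d e P d e (%r. \<lambda>x\<in>car (P r). x)"
  using mod_hom_id[OF Pm] mod_hom_closed[OF Pd] by (simp add: lifts_identity_def)
 obtain h where h: "!!n. h n : mod_hom ?A (P n) (P (Suc n))"
  and h0: "!!x. x : car (P 0) ==> x \<ominus>\<^sub>(P 0) \<gamma> 0 x = d 0 (h 0 x)"
  and hS: "!!n x. x : car (P (Suc n)) ==>
   x \<ominus>\<^sub>(P (Suc n)) \<gamma> (Suc n) x = d (Suc n) (h (Suc n) x) \<oplus>\<^sub>(P (Suc n)) h n (d n x)"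
  using comparison_homotopy[OF V P' P' i g] by (metis (no_types, lifting) restrict_apply')
 show ?thesis
 proof (cases r)
  case 0
  have "f x \<ominus>\<^sub>W f (\<gamma> r x) = \<zero>\<^sub>W" if x: "x : car (P r)" for x
   using mod_hom_diff[OF fh ag x mod_hom_closed[OF gh x]] h0[of x] fz[OF mod_hom_closed[OF h x]] x 0 by simp
  thus ?thesis using 0 by simp
 next
  case (Suc s)
  let ?k = "compose (car (P s)) f (h s)"
  have k: "?k : mod_hom ?A (P s) W"
   using mod_hom_compose[OF h fh[unfolded Suc] Pm] .
  have "f x \<ominus>\<^sub>W f (\<gamma> r x) = compose (car (P r)) ?k (d s) x" if x: "x : car (P r)" for x
  proof -
   have dx: "d s x : car (P s)" using mod_hom_closed[OF Pd] x Suc by simp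
   have hx: "h r x : car (P (Suc r))" "h s (d s x) : car (P r)"
    using mod_hom_closed[OF h x] mod_hom_closed[OF h dx] Suc by simp_all
   have "f x \<ominus>\<^sub>W f (\<gamma> r x) = f (x \<ominus>\<^sub>(P r) \<gamma> r x)"
    using mod_hom_diff[OF fh ag x mod_hom_closed[OF gh x]] by simp
   also have "... = f (d r (h r x) \<oplus>\<^sub>(P r) h s (d s x))" using hS[of x s] x Suc by simp
   also have "... = f (h s (d s x))"
    using mod_hom_add[OF fh mod_hom_closed[OF Pd hx(1)] hx(2)] fz[OF hx(1)] mod_hom_closed[OF fh hx(2)] by simp
   finally show ?thesis using x dx by (simp add: compose_def)
  qed
  thus ?thesis
   using k Suc by (intro exI[of _ "compose (car (P r)) ?k (d s)"]) (auto simp: coboundaries_Suc)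
 qed
qed

lemma pull_cocycle:
 assumes cP: "chain_complex (alg K M) P d" and g: "!!r. \<gamma> r : mod_hom (alg K M) (P r) (Q r)"
  and gd: "!!r x. x : car (P (Suc r)) ==> d' r (\<gamma> (Suc r) x) = \<gamma> r (d r x)"
  and f: "f : cocycles K M Q d' W r"
 shows "compose (car (P r)) f (\<gamma> r) : cocycles K M P d W r"
proof -
 have fh: "f : mod_hom (alg K M) (Q r) W" using f by (simp add: mem_cocycles_iff)
 have "f (\<gamma> r (d r x)) = \<zero>\<^sub>W" if x: "x : car (P (Suc r))" for x
  using f mod_hom_closed[OF g x] by (simp add: mem_cocycles_iff flip: gd[OF x])
 thus ?thesis
  using mod_hom_compose[OF g fh chain_complex_module[OF cP]] mod_hom_closed[OF chain_complex_diff[OF cP]]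
  by (simp add: mem_cocycles_iff compose_def)
qed

lemma pull_coboundary:
 assumes cP: "chain_complex (alg K M) P d" and g: "!!r. \<gamma> r : mod_hom (alg K M) (P r) (Q r)"
  and gd: "!!r x. x : car (P (Suc r)) ==> d' r (\<gamma> (Suc r) x) = \<gamma> r (d r x)"
  and f: "f : coboundaries K M Q d' W r"
 shows "compose (car (P r)) f (\<gamma> r) : coboundaries K M P d W r"
proof (cases r)
 case 0
 thus ?thesis
  using f mod_hom_closed[OF g] by (auto simp: compose_def fun_eq_iff restrict_def)
next
 case (Suc s)
 then obtain k where k: "k : mod_hom (alg K M) (Q s) W" "f = compose (car (Q r)) k (d' s)"
  using f by (auto simp: coboundaries_Suc)
 have "compose (car (P r)) f (\<gamma> r) = compose (car (P r)) (compose (car (P s)) k (\<gamma> s)) (d s)"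
  using k(2) Suc gd mod_hom_closed[OF g] mod_hom_closed[OF chain_complex_diff[OF cP]]
  by (auto simp: compose_def fun_eq_iff restrict_def)
 thus ?thesis
  using mod_hom_compose[OF g k(1) chain_complex_module[OF cP]] Suc by (auto simp: coboundaries_Suc)
qed

lemma coboundary_cong:
 assumes "chain_complex (alg K M) P d"
  "f : extensional (car (P r))" "g : coboundaries K M P d W r" "!!x. x : car (P r) ==> f x = g x"
 shows "f : coboundaries K M P d W r"
proof -
 have "g : cocycles K M P d W r"
  using coboundaries_subset_cocycles[OF assms(1)] assms(3) by blast
 hence "g : mod_hom (alg K M) (P r) W" by (simp add: mem_cocycles_iff)
 hence "g : extensional (car (P r))" by (rule mod_hom_extensional)
 hence "f = g" using assms(2,4) extensionalityI by blast
 with assms(3) show ?thesis by simp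
qed

end

text \<open>Ext does not depend on the projective resolution.\<close>

lemma Ext_comparison:
 fixes K :: "('k, 'e) ring_scheme" and M :: "('m, 'f) monoid_scheme" and W :: "('m => 'k, 'w, 'j) module_scheme"
 assumes K: "cring K" and M: "monoid M" and W: "left_module (alg K M) W"
  and V: "left_module (alg K M) V"
  and P: "projective_resolution (alg K M) P d e V"
  and Q: "projective_resolution (alg K M) Q d' e' V"
 shows "mod_iso K (Ext K M Q d' W r) (Ext K M P d W r)"
proof -
 let ?A = "alg K M"
 interpret W: left_module ?A W by fact
 note cP = projective_resolution_chain_complex[OF P] and cQ = projective_resolution_chain_complex[OF Q]
 note Pm = chain_complex_module[OF cP] and Qm = chain_complex_module[OF cQ]
 note Pd = chain_complex_diff[OF cP] and Qd = chain_complex_diff[OF cQ]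
 obtain \<alpha> where \<alpha>: "lifts_identity ?A P d e Q d' e' \<alpha>" using comparison_map_exists[OF V P Q] by blast
 obtain \<beta> where \<beta>: "lifts_identity ?A Q d' e' P d e \<beta>" using comparison_map_exists[OF V Q P] by blast
 have a: "\<alpha> r : mod_hom ?A (P r) (Q r)" "!!x. x : car (P (Suc r)) ==> d' r (\<alpha> (Suc r) x) = \<alpha> r (d r x)" for r
  using \<alpha> by (auto simp: lifts_identity_def)
 have b: "\<beta> r : mod_hom ?A (Q r) (P r)" "!!x. x : car (Q (Suc r)) ==> d r (\<beta> (Suc r) x) = \<beta> r (d' r x)" for r
  using \<beta> by (auto simp: lifts_identity_def)
 have ba: "lifts_identity ?A P d e P d e (%r. compose (car (P r)) (\<beta> r) (\<alpha> r))"
  using mod_hom_compose[OF a(1) b(1) Pm] \<alpha> \<beta> mod_hom_closed[OF a(1)] mod_hom_closed[OF Pd] b(2)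
  by (simp add: lifts_identity_def compose_def)
 have ab: "lifts_identity ?A Q d' e' Q d' e' (%r. compose (car (Q r)) (\<alpha> r) (\<beta> r))"
  using mod_hom_compose[OF b(1) a(1) Qm] \<alpha> \<beta> mod_hom_closed[OF b(1)] mod_hom_closed[OF Qd] a(2)
  by (simp add: lifts_identity_def compose_def)
 let ?ZQ = "hom_module K M (Q r) W\<lparr>carrier := cocycles K M Q d' W r\<rparr>"
 let ?ZP = "hom_module K M (P r) W\<lparr>carrier := cocycles K M P d W r\<rparr>"
 let ?\<Phi> = "\<lambda>f\<in>cocycles K M Q d' W r. compose (car (P r)) f (\<alpha> r)"
 have pa: "compose (car (P r)) f (\<alpha> r) : cocycles K M P d W r" if "f : cocycles K M Q d' W r" for f
  by (rule pull_cocycle[where \<gamma> = \<alpha>, OF K M W cP a(1)]) (use a(2) that in auto)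
 have pb: "compose (car (Q r)) f (\<beta> r) : cocycles K M Q d' W r" if "f : cocycles K M P d W r" for f
  by (rule pull_cocycle[where \<gamma> = \<beta>, OF K M W cQ b(1)]) (use b(2) that in auto)
 have ca: "compose (car (P r)) f (\<alpha> r) : coboundaries K M P d W r" if "f : coboundaries K M Q d' W r" for f
  by (rule pull_coboundary[where \<gamma> = \<alpha>, OF K M W cP a(1)]) (use a(2) that in auto)
 have cb: "compose (car (Q r)) f (\<beta> r) : coboundaries K M Q d' W r" if "f : coboundaries K M P d W r" for f
  by (rule pull_coboundary[where \<gamma> = \<beta>, OF K M W cQ b(1)]) (use b(2) that in auto)
 interpret ZQ: left_module K ?ZQ by (rule left_module_cocycles[OF K M W cQ])
 show ?thesis
  unfolding Ext_def
 proof (rule quot_module_iso_quot_module[OF left_module_cocycles[OF K M W cQ] submodule_coboundaries[OF K M W cQ]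
    left_module_cocycles[OF K M W cP] submodule_coboundaries[OF K M W cP]])
  show "?\<Phi> : mod_hom K ?ZQ ?ZP"
  proof (rule mod_homI)
   show "?\<Phi> : car ?ZQ \<rightarrow>\<^sub>E car ?ZP" using pa by simp
  next
   fix f g assume fg: "f : car ?ZQ" "g : car ?ZQ"
   thus "?\<Phi> (f \<oplus>\<^sub>?ZQ g) = ?\<Phi> f \<oplus>\<^sub>?ZP ?\<Phi> g"
    using ZQ.M.a_closed[OF fg] mod_hom_closed[OF a(1)]
    by (auto simp: compose_def fun_eq_iff restrict_def)
  next
   fix k f assume kf: "k : car K" "f : car ?ZQ"
   thus "?\<Phi> (k \<odot>\<^sub>?ZQ f) = k \<odot>\<^sub>?ZP ?\<Phi> f"
    using ZQ.smult_closed[OF kf] mod_hom_closed[OF a(1)]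
    by (auto simp: compose_def fun_eq_iff restrict_def)
  qed
 next
  fix f assume "f : car ?ZQ"
  hence f: "f : cocycles K M Q d' W r" by simp
  hence fh: "f : mod_hom ?A (Q r) W" by (simp add: mem_cocycles_iff)
  show "?\<Phi> f : coboundaries K M P d W r \<longleftrightarrow> f : coboundaries K M Q d' W r"
  proof
   assume "f : coboundaries K M Q d' W r"
   thus "?\<Phi> f : coboundaries K M P d W r" using ca f by simp
  next
   assume "?\<Phi> f : coboundaries K M P d W r"
   hence 1: "compose (car (Q r)) (compose (car (P r)) f (\<alpha> r)) (\<beta> r) : coboundaries K M Q d' W r"
    using cb f by simp
   from cocycle_lifts_identity[OF K M W V Q ab f] obtain h where h: "h : coboundaries K M Q d' W r"
    "!!x. x : car (Q r) ==> f x \<ominus>\<^sub>W f (compose (car (Q r)) (\<alpha> r) (\<beta> r) x) = h x" by blast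
   interpret B: submodule "coboundaries K M Q d' W r" K ?ZQ by (rule submodule_coboundaries[OF K M W cQ])
   have hz: "h : mod_hom ?A (Q r) W"
    using subsetD[OF coboundaries_subset_cocycles[OF K M W cQ] h(1)] by (simp add: mem_cocycles_iff)
   show "f : coboundaries K M Q d' W r"
   proof (rule coboundary_cong[OF K M W cQ mod_hom_extensional[OF fh]])
    show "h \<oplus>\<^sub>?ZQ compose (car (Q r)) (compose (car (P r)) f (\<alpha> r)) (\<beta> r) : coboundaries K M Q d' W r"
    using B.m_closed[OF h(1) 1] by simp
    fix x assume x: "x : car (Q r)"
    have "f x : car W" "f (\<alpha> r (\<beta> r x)) : car W"
    using x mod_hom_closed[OF fh] mod_hom_closed[OF a(1)] mod_hom_closed[OF b(1)] by auto
    thus "f x = (h \<oplus>\<^sub>?ZQ compose (car (Q r)) (compose (car (P r)) f (\<alpha> r)) (\<beta> r)) x"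
    using x mod_hom_closed[OF b(1)] by (simp add: compose_def h(2)[OF x, symmetric] W.M.minus_eq W.M.a_assoc W.M.l_neg)
   qed
  qed
 next
  fix y assume "y : car ?ZP"
  hence y: "y : cocycles K M P d W r" by simp
  let ?z = "compose (car (Q r)) y (\<beta> r)"
  have z: "?z : cocycles K M Q d' W r" by (rule pb[OF y])
  from cocycle_lifts_identity[OF K M W V P ba y] obtain h where h: "h : coboundaries K M P d W r"
   "!!x. x : car (P r) ==> y x \<ominus>\<^sub>W y (compose (car (P r)) (\<beta> r) (\<alpha> r) x) = h x" by blast
  have "y \<ominus>\<^sub>?ZP ?\<Phi> ?z : coboundaries K M P d W r"
  proof (rule coboundary_cong[OF K M W cP _ h(1)])
   have e: "y \<ominus>\<^sub>?ZP ?\<Phi> ?z = (\<lambda>x\<in>car (P r). y x \<ominus>\<^sub>W ?\<Phi> ?z x)"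
    using cocycles_diff[OF K M W cP y] pa[OF z] z by simp
   thus "y \<ominus>\<^sub>?ZP ?\<Phi> ?z : extensional (car (P r))" by simp
   show "(y \<ominus>\<^sub>?ZP ?\<Phi> ?z) x = h x" if x: "x : car (P r)" for x
    unfolding e using x z h(2)[OF x] mod_hom_closed[OF a(1) x] by (simp add: compose_def)
  qed
  with z show "\<exists>z\<in>car ?ZQ. y \<ominus>\<^sub>?ZP ?\<Phi> z : coboundaries K M P d W r" by auto
 qed
qed

section \<open>Merging adjacent blocks of ordered partitions\<close>

text \<open>The alternating sum over all ways to merge two adjacent blocks. Up to signs this is the
  boundary of the permutohedron; ordered partitions of a set correspond to chains of proper nonempty
  subsets, and merging two blocks to omitting a member of the chain.\<close>

fun delta :: "('a set list => int) => 'a set list => int" where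
 "delta f [] = 0"
| "delta f [P] = 0"
| "delta f (P # Q # qs) = f ((P Un Q) # qs) - delta (%t. f (P # t)) (Q # qs)"

text \<open>The alternating sum over all ways to insert the block \<open>c\<close>.\<close>

fun insert_block :: "'a set => ('a set list => int) => 'a set list => int" where
 "insert_block c f [] = f [c]"
| "insert_block c f (P # ps) = f (c # P # ps) - insert_block c (%t. f (P # t)) ps"

text \<open>If \<open>c\<close> is a proper part of a block, it is taken out of that block and inserted as a block at
  any later position.\<close>

fun extract_block :: "'a set => ('a set list => int) => 'a set list => int" where
 "extract_block c f [] = 0"
| "extract_block c f (P # ps) =
  (if P = c then 0
   else if c <= P then insert_block c (%t. f ((P - c) # t)) ps
   else - extract_block c (%t. f (P # t)) ps)"

lemma delta_linear:
 "delta (%t. 0) cl = 0"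
 "delta (%t. f t + g t) cl = delta f cl + delta g cl"
 "delta (%t. f t - g t) cl = delta f cl - delta g cl"
 "delta (%t. k * f t) cl = k * delta f cl"
 "delta (%t. - f t) cl = - delta f cl"
proof -
 show "delta (%t. 0) cl = 0"
  by (induction cl rule: induct_list012) auto
 show "delta (%t. f t + g t) cl = delta f cl + delta g cl"
  by (induction cl arbitrary: f g rule: induct_list012) auto
 show "delta (%t. f t - g t) cl = delta f cl - delta g cl"
  by (induction cl arbitrary: f g rule: induct_list012) auto
 show "delta (%t. k * f t) cl = k * delta f cl"
  by (induction cl arbitrary: f rule: induct_list012) (auto simp: right_diff_distrib)
 show "delta (%t. - f t) cl = - delta f cl"
  by (induction cl arbitrary: f rule: induct_list012) auto
qed

lemma insert_block_linear:
 "insert_block c (%t. 0) cl = 0"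
 "insert_block c (%t. f t + g t) cl = insert_block c f cl + insert_block c g cl"
 "insert_block c (%t. f t - g t) cl = insert_block c f cl - insert_block c g cl"
 "insert_block c (%t. k * f t) cl = k * insert_block c f cl"
 "insert_block c (%t. - f t) cl = - insert_block c f cl"
proof -
 show "insert_block c (%t. 0) cl = 0" by (induction cl) auto
 show "insert_block c (%t. f t + g t) cl = insert_block c f cl + insert_block c g cl"
  by (induction cl arbitrary: f g) auto
 show "insert_block c (%t. f t - g t) cl = insert_block c f cl - insert_block c g cl"
  by (induction cl arbitrary: f g) auto
 show "insert_block c (%t. k * f t) cl = k * insert_block c f cl"
  by (induction cl arbitrary: f) (auto simp: right_diff_distrib)
 show "insert_block c (%t. - f t) cl = - insert_block c f cl"
  by (induction cl arbitrary: f) auto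
qed

lemma extract_block_linear:
 "extract_block c (%t. 0) cl = 0"
 "extract_block c (%t. f t + g t) cl = extract_block c f cl + extract_block c g cl"
 "extract_block c (%t. k * f t) cl = k * extract_block c f cl"
 "extract_block c (%t. - f t) cl = - extract_block c f cl"
proof -
 show "extract_block c (%t. 0) cl = 0" by (induction cl) (auto simp: insert_block_linear)
 show "extract_block c (%t. f t + g t) cl = extract_block c f cl + extract_block c g cl"
  by (induction cl arbitrary: f g) (auto simp: insert_block_linear)
 show "extract_block c (%t. k * f t) cl = k * extract_block c f cl"
  by (induction cl arbitrary: f) (auto simp: insert_block_linear)
 show "extract_block c (%t. - f t) cl = - extract_block c f cl"
  by (induction cl arbitrary: f) (auto simp: insert_block_linear)
qed

lemma delta_cong_nonempty: "(!!t. t ~= [] ==> f t = g t) ==> delta f cl = delta g cl"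
 by (cases "(f, cl)" rule: delta.cases) auto

lemma insert_block_cong_nonempty: "(!!t. t ~= [] ==> f t = g t) ==> insert_block c f cl = insert_block c g cl"
 by (cases cl) auto

lemma delta_Cons:
 "t ~= [] ==> delta f (P # t) = f ((P Un hd t) # tl t) - delta (%t. f (P # t)) t"
 by (cases t) auto

lemma delta_merge_head:
 "delta f ((P Un Q) # qs) = delta (%t. f ((P Un hd t) # tl t)) (Q # qs)"
 by (cases qs) (simp_all add: Un_assoc)

text \<open>Merging at two places does not depend on the order of the places, and the two orders carry opposite signs.\<close>

lemma delta_delta: "delta (delta f) cl = 0"
proof (induction cl arbitrary: f)
 case (Cons P ps)
 show ?case
 proof (cases ps)
  case (Cons Q qs)
  have "delta (%t. delta f (P # t)) ps =
    delta (%t. f ((P Un hd t) # tl t) - delta (%t. f (P # t)) t) ps"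
   by (rule delta_cong_nonempty) (simp add: delta_Cons)
  also have "... = delta (%t. f ((P Un hd t) # tl t)) ps"
   by (simp add: delta_linear Cons.IH)
  finally show ?thesis using Cons by (simp add: delta_merge_head)
 qed simp
qed simp

lemma insert_block_delta: "insert_block c (delta f) cl = - delta (insert_block c f) cl"
proof (induction cl arbitrary: f)
 case (Cons Q qs)
 have "insert_block c (%t. delta f (Q # t)) qs =
   insert_block c (%t. f ((Q Un hd t) # tl t) - delta (%t. f (Q # t)) t) qs"
  by (rule insert_block_cong_nonempty) (simp add: delta_Cons)
 also have "... = insert_block c (%t. f ((Q Un hd t) # tl t)) qs + delta (insert_block c (%t. f (Q # t))) qs"
  by (simp add: insert_block_linear Cons.IH)
 finally show ?case
  by (cases qs) (simp_all add: delta_linear Un_ac)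
qed simp

text \<open>Exactly one block meets \<open>c\<close>, and it contains \<open>c\<close>.\<close>

fun covers :: "'a set => 'a set list => bool" where
 "covers c [] = False"
| "covers c (P # ps) \<longleftrightarrow> P ~= {} \<and>
  (c <= P & (\<forall>Q\<in>set ps. Q ~= {} & c Int Q = {}) \<or> c Int P = {} & covers c ps)"

text \<open>Taking \<open>c\<close> out of its block and merging it again with the neighbours cancels except at the place where \<open>c\<close> came from; what remains is the identity, up to the terms in which \<open>c\<close> was a block already.\<close>

lemma extract_block_homotopy:
 assumes "covers c cl" "c ~= {}"
 shows "delta (extract_block c f) cl + extract_block c (delta f) cl =
  f cl - (if hd cl = c then insert_block c f (tl cl) else 0)"
 using assms(1)
proof (induction cl arbitrary: f)
 case (Cons P ps)
 show ?case
 proof (cases "c <= P")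
  case True
  hence ps: "!!Q. Q : set ps ==> Q ~= {} & c Int Q = {}"
   using Cons.prems assms(2) by auto
  show ?thesis
  proof (cases "P = c")
   case P: True
   show ?thesis
   proof (cases ps)
    case Q: (Cons Q qs)
    hence "c Un Q ~= c" "c Un Q - c = Q" using ps by auto
    thus ?thesis using P Q by (simp add: delta_linear)
   qed (use P in simp)
  next
   case P: False
   show ?thesis
   proof (cases ps)
    case Nil
    thus ?thesis using P True by (simp add: Un_absorb2 Un_Diff_cancel2)
   next
    case Q: (Cons Q qs)
    have *: "P Un Q ~= c" "c <= P Un Q" "P Un Q - c = (P - c) Un Q" "(P - c) Un c = P"
    using True P Q ps[of Q] by auto
    have "insert_block c (%t. delta f ((P - c) # t)) ps =
    insert_block c (%t. f ((P - c Un hd t) # tl t) - delta (%t. f ((P - c) # t)) t) ps"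
    by (rule insert_block_cong_nonempty) (simp add: delta_Cons)
    also have "... = insert_block c (%t. f ((P - c Un hd t) # tl t)) ps
    + delta (insert_block c (%t. f ((P - c) # t))) ps"
    by (simp add: insert_block_linear insert_block_delta)
    finally show ?thesis using Q P True * by simp
   qed
  qed
 next
  case False
  with Cons.prems have P: "c Int P = {}" "P ~= {}" and ps: "covers c ps" by auto
  then obtain Q qs where Q: "ps = Q # qs" by (cases ps) auto
  have Pc: "P ~= c" using P by auto
  have IH: "delta (extract_block c (%t. f (P # t))) ps + extract_block c (delta (%t. f (P # t))) ps =
    f (P # ps) - (if Q = c then insert_block c (%t. f (P # t)) qs else 0)"
   using Cons.IH[OF ps, of "%t. f (P # t)"] Q by simp
  have 1: "delta (extract_block c f) (P # ps) =
    extract_block c f ((P Un Q) # qs) + delta (extract_block c (%t. f (P # t))) ps"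
   using Pc False by (simp add: Q delta_linear)
  have nonempty: "extract_block c g ps = extract_block c h ps" if "!!t. t ~= [] ==> g t = h t" for g h
   unfolding Q using that by simp
  have "extract_block c (%t. delta f (P # t)) ps =
    extract_block c (%t. f ((P Un hd t) # tl t) + - delta (%t. f (P # t)) t) ps"
   by (rule nonempty) (simp add: delta_Cons)
  also have "... = extract_block c (%t. f ((P Un hd t) # tl t)) ps + extract_block c (%t. - delta (%t. f (P # t)) t) ps"
   by (rule extract_block_linear(2))
  also have "... = extract_block c (%t. f ((P Un hd t) # tl t)) ps - extract_block c (delta (%t. f (P # t))) ps"
   by (simp only: extract_block_linear(4))
  finally have 2: "extract_block c (delta f) (P # ps) = - extract_block c (%t. f ((P Un hd t) # tl t)) ps
    + extract_block c (delta (%t. f (P # t))) ps"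
   using Pc False by simp
  have 3: "extract_block c f ((P Un Q) # qs) - extract_block c (%t. f ((P Un hd t) # tl t)) ps =
    (if Q = c then insert_block c (%t. f (P # t)) qs else 0)"
  proof (cases "c <= Q")
   case True
   hence "P Un Q ~= c" "c <= P Un Q" "P Un Q - c = P Un (Q - c)" "Q = c ==> P Un Q - c = P"
    using P by auto
   thus ?thesis using True by (simp add: Q)
  next
   case F: False
   hence "c Int Q = {}" using ps Q by auto
   hence "~ c <= P Un Q" "P Un Q ~= c" using P assms(2) by auto
   thus ?thesis using F by (auto simp: Q)
  qed
  show ?thesis using IH 1 2 3 Pc by simp
 qed
qed simp

section \<open>A contracting homotopy\<close>

fun contraction :: "'a set list => ('a set list => int) => 'a set list => int" where
 "contraction [] f cl = 0"
| "contraction (c # cs) f cl = extract_block c f cl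
  - (case cl of [] => 0 | P # rh => if P = c then contraction cs (insert_block c f) rh else 0)"

fun alternating_insertions :: "'a set list => ('a set list => int) => int" where
 "alternating_insertions [] f = f []"
| "alternating_insertions (c # cs) f = alternating_insertions cs (insert_block c f)"

lemma contraction_linear:
 "contraction cs (%t. 0) cl = 0"
 "contraction cs (%t. f t + g t) cl = contraction cs f cl + contraction cs g cl"
 "contraction cs (%t. k * f t) cl = k * contraction cs f cl"
 "contraction cs (%t. - f t) cl = - contraction cs f cl"
proof -
 have eta: "insert_block c (%t. 0) = (%t. 0)" "insert_block c (%t. f t + g t) = (%t. insert_block c f t + insert_block c g t)"
  "insert_block c (%t. k * f t) = (%t. k * insert_block c f t)" "insert_block c (%t. - f t) = (%t. - insert_block c f t)"
  for c :: "'a set" and f g k by (simp_all add: insert_block_linear fun_eq_iff)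
 show "contraction cs (%t. 0) cl = 0"
  by (induction cs arbitrary: cl) (auto simp: extract_block_linear eta split: list.split)
 show "contraction cs (%t. f t + g t) cl = contraction cs f cl + contraction cs g cl"
  by (induction cs arbitrary: cl f g) (auto simp: extract_block_linear eta split: list.split)
 show "contraction cs (%t. k * f t) cl = k * contraction cs f cl"
  by (induction cs arbitrary: cl f) (auto simp: extract_block_linear eta right_diff_distrib split: list.split)
 show "contraction cs (%t. - f t) cl = - contraction cs f cl"
  by (induction cs arbitrary: cl f) (auto simp: extract_block_linear eta split: list.split)
qed

text \<open>The ordered partitions of \<open>\<Union>A\<close> into unions of members of \<open>A\<close>.\<close>

fun cell :: "'a set set => 'a set list => bool" where
 "cell A [] \<longleftrightarrow> A = {}"
| "cell A (P # ps) \<longleftrightarrow> (\<exists>B\<subseteq>A. B ~= {} & P = \<Union>B & cell (A - B) ps)"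

definition atoms :: "'a set set => bool" where
 "atoms A \<longleftrightarrow> {} ~: A & disjoint A"

lemma atoms_subset: "atoms A ==> B <= A ==> atoms B"
 by (auto simp: atoms_def intro: pairwise_subset)

lemma atoms_disjoint:
 assumes "atoms A" "c : A" "B <= A" "c ~: B"
 shows "c Int \<Union>B = {}"
proof -
 have "c Int b = {}" if "b : B" for b
  using assms that disjointD[of A c b] by (auto simp: atoms_def)
 thus ?thesis by blast
qed

lemma atoms_Diff:
 assumes "atoms A" "B <= A" "c : B"
 shows "\<Union>B - c = \<Union>(B - {c})"
proof -
 have "\<Union>B = c Un \<Union>(B - {c})" using assms(3) by blast
 moreover have "c Int \<Union>(B - {c}) = {}" using atoms_disjoint[of A c "B - {c}"] assms by auto
 ultimately show ?thesis by blast
qed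

lemma atoms_Union_nonempty: "atoms A ==> B <= A ==> B ~= {} ==> \<Union>B ~= {}"
 by (force simp: atoms_def)

lemma atoms_subset_Union:
 assumes "atoms A" "c : A" "B <= A"
 shows "c <= \<Union>B \<longleftrightarrow> c : B"
proof
 assume "c <= \<Union>B"
 moreover have "c ~= {}" using assms by (auto simp: atoms_def)
 ultimately show "c : B" using atoms_disjoint[OF assms] by blast
qed blast

lemma atoms_Union_inject:
 assumes "atoms A" "B <= A" "C <= A" "\<Union>B = \<Union>C" shows "B = C"
proof -
 have "x : B \<longleftrightarrow> x : C" if "x : A" for x
  using atoms_subset_Union[OF assms(1) that assms(2)] atoms_subset_Union[OF assms(1) that assms(3)] assms(4) by simp
 thus ?thesis using assms(2,3) by blast
qed

lemma atoms_Union_eq: "atoms A ==> c : A ==> B <= A ==> \<Union>B = c \<longleftrightarrow> B = {c}"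
 using atoms_Union_inject[of A B "{c}"] by auto

lemma cell_ConsI: "B <= A ==> B ~= {} ==> P = \<Union>B ==> cell (A - B) ps ==> cell A (P # ps)"
 unfolding cell.simps by (rule exI[of _ B]) simp

lemma cell_mem: "cell A cl ==> P : set cl ==> \<exists>B\<subseteq>A. B ~= {} & P = \<Union>B"
proof (induction cl arbitrary: A)
 case (Cons Q ps)
 then obtain B where B: "B <= A" "B ~= {}" "Q = \<Union>B" "cell (A - B) ps" by auto
 show ?case
 proof (cases "P = Q")
  case False
  hence "P : set ps" using Cons.prems by simp
  from Cons.IH[OF B(4) this] show ?thesis by auto
 qed (use B in auto)
qed simp

lemma cell_covers: "atoms A ==> cell A cl ==> c : A ==> covers c cl"
proof (induction cl arbitrary: A)
 case (Cons P ps)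
 then obtain B where B: "B <= A" "B ~= {}" "P = \<Union>B" "cell (A - B) ps" by auto
 have P: "P ~= {}" using B atoms_Union_nonempty[OF Cons.prems(1)] by simp
 show ?case
 proof (cases "c : B")
  case True
  have "Q ~= {} & c Int Q = {}" if "Q : set ps" for Q
  proof -
   from cell_mem[OF B(4) that] obtain C where C: "C <= A - B" "C ~= {}" "Q = \<Union>C" by auto
   moreover from C True have "C <= A" "c ~: C" by auto
   ultimately show ?thesis
    using atoms_disjoint[OF Cons.prems(1,3)] atoms_Union_nonempty[OF Cons.prems(1)] by simp
  qed
  thus ?thesis using P True B(3) by auto
 next
  case False
  hence "covers c ps" using Cons.IH[OF atoms_subset[OF Cons.prems(1)] B(4)] Cons.prems(3) by auto
  thus ?thesis using P atoms_disjoint[OF Cons.prems(1,3) B(1) False] B(3) by simp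
 qed
qed auto

lemma delta_head_restriction:
 assumes "covers c cl" "c ~= {}"
 shows "delta (%cl. case cl of [] => 0 | P # rh => if P = c then h rh else 0) cl =
  (case cl of [] => 0 | P # rh => if P = c then - delta h rh else 0)"
proof (cases "(h, cl)" rule: delta.cases)
 case (3 f P Q qs)
 hence "P Un Q ~= c" using assms by auto
 thus ?thesis using 3 by (auto simp: delta_linear)
qed (auto split: if_splits)

text \<open>Induction on the blocks: \<open>extract_block_homotopy\<close> for the first block \<open>c\<close> reduces to the faces that start with \<open>c\<close>, and these form a permutohedron with fewer atoms.\<close>

lemma contraction_homotopy:
 assumes "atoms (set cs)" "distinct cs" "cell (set cs) cl"
 shows "delta (contraction cs f) cl + contraction cs (delta f) cl =
  f cl - (if cl = cs then alternating_insertions cs f else 0)"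
 using assms
proof (induction cs arbitrary: cl f)
 case Nil
 hence "cl = []" by (cases cl) auto
 thus ?case by simp
next
 case (Cons c cs)
 have c: "covers c cl" "c ~= {}"
  using cell_covers[OF Cons.prems(1,3)] Cons.prems(1) by (auto simp: atoms_def)
 let ?g = "insert_block c f"
 let ?H = "%h cl. case cl of [] => 0 | P # rh => if P = c then h rh else (0::int)"
 have dg: "insert_block c (delta f) = (%t. - delta ?g t)" by (simp add: insert_block_delta fun_eq_iff)
 have "contraction (c # cs) f = (%cl. extract_block c f cl - ?H (contraction cs ?g) cl)"
  by (simp add: fun_eq_iff)
 hence 1: "delta (contraction (c # cs) f) cl = delta (extract_block c f) cl
   - ?H (%rh. - delta (contraction cs ?g) rh) cl"
  by (simp only: delta_linear delta_head_restriction[OF c])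
 have 2: "contraction (c # cs) (delta f) cl = extract_block c (delta f) cl - ?H (%rh. - contraction cs (delta ?g) rh) cl"
  by (simp add: dg contraction_linear split: list.split)
 have IH: "delta (contraction cs ?g) rh + contraction cs (delta ?g) rh =
   ?g rh - (if rh = cs then alternating_insertions cs ?g else 0)" if rh: "cl = c # rh" for rh
 proof -
  from Cons.prems(3) rh obtain B where B: "B <= set (c # cs)" "c = \<Union>B" "cell (set (c # cs) - B) rh" by auto
  hence "B = {c}" using atoms_Union_eq[OF Cons.prems(1), of c B] by simp
  hence "set (c # cs) - B = set cs" using Cons.prems(2) by auto
  hence "cell (set cs) rh" using B(3) by simp
  moreover have "atoms (set cs)" by (rule atoms_subset[OF Cons.prems(1)]) auto
  ultimately show ?thesis using Cons.prems(2) by (intro Cons.IH) simp_all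
 qed
 obtain P rh where cl: "cl = P # rh" using c(1) by (cases cl) auto
 note h = extract_block_homotopy[OF c, of f]
 show ?case
 proof (cases "P = c")
  case True
  thus ?thesis
   using h IH[of rh] cl unfolding 1 2
   by (cases "rh = cs"; simp del: extract_block.simps delta.simps; linarith)
 next
  case False
  thus ?thesis using h cl unfolding 1 2 by (simp del: extract_block.simps delta.simps)
 qed
qed

lemma delta_local:
 assumes "cell A cl" "!!t. cell A t ==> f t = g t"
 shows "delta f cl = delta g cl"
 using assms
proof (induction f cl arbitrary: A g rule: delta.induct)
 case (3 f P Q qs)
 then obtain B C where B: "B <= A" "B ~= {}" "P = \<Union>B" "C <= A - B" "C ~= {}" "Q = \<Union>C" "cell (A - B - C) qs"
  by auto
 have "A - (B Un C) = A - B - C" by auto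
 hence "cell A ((P Un Q) # qs)" using B by (intro cell_ConsI[of "B Un C"]) auto
 moreover have "delta (%t. f (P # t)) (Q # qs) = delta (%t. g (P # t)) (Q # qs)"
 proof (rule 3(1)[of "A - B"])
  show "cell (A - B) (Q # qs)" using B(4-7) by (intro cell_ConsI)
  fix t assume t: "cell (A - B) t"
  have "cell A (P # t)" using t B(1-3) by (intro cell_ConsI)
  thus "f (P # t) = g (P # t)" by (rule 3(3))
 qed
 ultimately show ?case using 3(3) by simp
qed auto

lemma insert_block_local:
 assumes "cell A cl" "c ~: A" "!!t. cell (insert c A) t ==> f t = g t"
 shows "insert_block c f cl = insert_block c g cl"
 using assms
proof (induction cl arbitrary: A f g)
 case Nil
 hence "cell (insert c A) [c]" by (intro cell_ConsI[of "{c}"]) auto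
 thus ?case using Nil(3) by simp
next
 case (Cons P ps)
 then obtain B where B: "B <= A" "B ~= {}" "P = \<Union>B" "cell (A - B) ps" by auto
 have "insert c A - {c} = A" using Cons.prems(2) by auto
 hence "cell (insert c A - {c}) (P # ps)" using Cons.prems(1) by (simp only:)
 hence "cell (insert c A) (c # P # ps)" by (rule cell_ConsI[of "{c}", rotated -1]) auto
 moreover have "insert_block c (%t. f (P # t)) ps = insert_block c (%t. g (P # t)) ps"
 proof (rule Cons.IH[OF B(4)])
  show "c ~: A - B" using Cons.prems(2) by simp
  fix t assume t: "cell (insert c (A - B)) t"
  have "insert c A - B = insert c (A - B)" using Cons.prems(2) B(1) by auto
  hence "cell (insert c A) (P # t)" using t B by (intro cell_ConsI[of B]) auto
  thus "f (P # t) = g (P # t)" by (rule Cons.prems(3))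
 qed
 ultimately show ?case using Cons.prems(3) by simp
qed

lemma extract_block_local:
 assumes "atoms A" "cell A cl" "c : A" "!!t. cell A t ==> f t = g t"
 shows "extract_block c f cl = extract_block c g cl"
 using assms
proof (induction cl arbitrary: A f g)
 case (Cons P ps)
 then obtain B where B: "B <= A" "B ~= {}" "P = \<Union>B" "cell (A - B) ps" by auto
 show ?case
 proof (cases "c : B")
  case True
  have "insert_block c (%t. f ((P - c) # t)) ps = insert_block c (%t. g ((P - c) # t)) ps" if "P ~= c"
  proof (rule insert_block_local[OF B(4)])
   show "c ~: A - B" using True by simp
   fix t assume t: "cell (insert c (A - B)) t"
   have "A - (B - {c}) = insert c (A - B)" using True B(1) by blast
   moreover have "B - {c} ~= {}"
   proof
    assume "B - {c} = {}"
    hence "B = {c}" using True by blast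
    thus False using that B(3) by simp
   qed
   moreover have "P - c = \<Union>(B - {c})" using atoms_Diff[OF Cons.prems(1) B(1) True] B by simp
   ultimately have "cell A ((P - c) # t)" using t B(1) by (intro cell_ConsI[of "B - {c}"]) auto
   thus "f ((P - c) # t) = g ((P - c) # t)" by (rule Cons.prems(4))
  qed
  moreover have "c <= P" using True B(3) by blast
  ultimately show ?thesis by simp
 next
  case False
  have "extract_block c (%t. f (P # t)) ps = extract_block c (%t. g (P # t)) ps"
  proof (rule Cons.IH[OF atoms_subset[OF Cons.prems(1)] B(4)])
   show "c : A - B" using False Cons.prems(3) by simp
   fix t assume "cell (A - B) t"
   hence "cell A (P # t)" using B by (intro cell_ConsI)
   thus "f (P # t) = g (P # t)" by (rule Cons.prems(4))
  qed auto
  moreover have "~ c <= P" using False B(3) atoms_subset_Union[OF Cons.prems(1,3) B(1)] by simp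
  ultimately show ?thesis by simp
 qed
qed simp

lemma contraction_local:
 assumes "atoms (set cs)" "distinct cs" "cell (set cs) cl" "!!t. cell (set cs) t ==> f t = g t"
 shows "contraction cs f cl = contraction cs g cl"
 using assms
proof (induction cs arbitrary: cl f g)
 case (Cons c cs)
 have "contraction cs (insert_block c f) rh = contraction cs (insert_block c g) rh" if rh: "cl = c # rh" for rh
 proof (rule Cons.IH)
  from Cons.prems(3) rh obtain B where B: "B <= set (c # cs)" "c = \<Union>B" "cell (set (c # cs) - B) rh" by auto
  hence "B = {c}" using atoms_Union_eq[OF Cons.prems(1), of c B] by simp
  thus "cell (set cs) rh" using B(3) Cons.prems(2) by simp
  show "insert_block c f t = insert_block c g t" if "cell (set cs) t" for t
   by (rule insert_block_local[OF that]) (use Cons.prems in auto)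
 qed (use Cons.prems atoms_subset[OF Cons.prems(1)] in auto)
 moreover have "extract_block c f cl = extract_block c g cl"
  by (rule extract_block_local[OF Cons.prems(1,3)]) (use Cons.prems in auto)
 ultimately show ?case by (auto split: list.split)
qed simp

lemma insert_block_length: "(!!t. length t = Suc (length cl) ==> f t = 0) ==> insert_block c f cl = 0"
 by (induction cl arbitrary: f) auto

lemma extract_block_length: "(!!t. length t = Suc (length cl) ==> f t = 0) ==> extract_block c f cl = 0"
 by (induction cl arbitrary: f) (auto intro!: insert_block_length)

lemma contraction_length: "(!!t. length t = Suc (length cl) ==> f t = 0) ==> contraction cs f cl = 0"
proof (induction cs arbitrary: cl f)
 case (Cons c cs)
 have "contraction cs (insert_block c f) rh = 0" if "cl = c # rh" for rh
  by (rule Cons.IH) (use Cons.prems that in "auto intro!: insert_block_length")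
 thus ?case using extract_block_length[of cl f c] Cons.prems by (auto split: list.split)
qed simp

lemma alternating_insertions_length:
 "(!!t. length t = length cs ==> f t = 0) ==> alternating_insertions cs f = 0"
proof (induction cs arbitrary: f)
 case (Cons c cs)
 have "insert_block c f t = 0" if "length t = length cs" for t
  by (rule insert_block_length) (use Cons.prems that in simp)
 thus ?case using Cons.IH by simp
qed simp

section \<open>Incidence numbers\<close>

definition unit_fun :: "'b => 'b => int" where
 "unit_fun x y = (if x = y then 1 else 0)"

text \<open>A linear operator that looks at finitely many arguments only is given by a matrix.\<close>

lemma linear_local_expansion:
 fixes T :: "('b => int) => int"
 assumes zero: "T (%t. 0) = 0" and add: "!!f g. T (%t. f t + g t) = T f + T g"
  and scale: "!!k f. T (%t. k * f t) = k * T f"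
  and C: "finite C" and local: "!!f g. (!!t. t : C ==> f t = g t) ==> T f = T g"
 shows "T f = (\<Sum>x\<in>C. T (unit_fun x) * f x)"
proof -
 have sum: "T (%t. \<Sum>x\<in>D. f x * unit_fun x t) = (\<Sum>x\<in>D. T (unit_fun x) * f x)" if "finite D" for D
  using that
 proof (induction D)
  case (insert d D)
  thus ?case by (simp add: add scale)
 qed (simp add: zero)
 have "T f = T (%t. \<Sum>x\<in>C. f x * unit_fun x t)"
  by (rule local) (use C in "simp add: unit_fun_def if_distrib cong: if_cong")
 also have "... = (\<Sum>x\<in>C. T (unit_fun x) * f x)" by (rule sum[OF C])
 finally show ?thesis .
qed

lemma cell_length: "finite A ==> cell A cl ==> length cl <= card A"
proof (induction cl arbitrary: A)
 case (Cons P ps)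
 then obtain B where B: "B <= A" "B ~= {}" "cell (A - B) ps" by auto
 hence "length ps <= card (A - B)" using Cons by simp
 moreover have "card (A - B) < card A" using B Cons.prems(1) by (intro psubset_card_mono) auto
 ultimately show ?case by simp
qed simp

lemma finite_cells: "finite A ==> finite {cl. cell A cl}"
proof (rule finite_subset)
 assume A: "finite A"
 show "{cl. cell A cl} <= {cl. set cl <= Union ` Pow A & length cl <= card A}"
  using cell_length[OF A] cell_mem by fastforce
 show "finite {cl. set cl <= Union ` Pow A & length cl <= card A}"
  using A by (intro finite_lists_length_le) simp
qed

lemma cell_atoms: "atoms (set cs) ==> distinct cs ==> cell (set cs) cs"
proof (induction cs)
 case (Cons c cs)
 have "set (c # cs) - {c} = set cs" using Cons.prems(2) by auto
 moreover have "cell (set cs) cs"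
  using Cons.IH[OF atoms_subset[OF Cons.prems(1)]] Cons.prems(2) by auto
 ultimately show ?case by (intro cell_ConsI[of "{c}"]) auto
qed simp

section \<open>Ordered set partitions\<close>

lemma carrier_ordered_partitions:
 "ps : car (OP n) \<longleftrightarrow> distinct ps & partition_on {1..n} (set ps)"
 by (simp add: ordered_partitions_def)

lemma ordered_partitionD:
 assumes "ps : car (OP n)"
 shows "distinct ps" "partition_on {1..n} (set ps)" "!!P. P : set ps ==> P ~= {}"
  "!!P Q. [|P : set ps; Q : set ps; P ~= Q|] ==> P Int Q = {}" "!!P. P : set ps ==> P <= {1..n}"
 using assms by (auto simp: carrier_ordered_partitions partition_on_def dest: disjointD)

definition intersections :: "'a set list => 'a set list => 'a set list" where
 "intersections ps qs = concat (map (%P. map (%Q. P Int Q) qs) ps)"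

lemma mult_ordered_partitions: "ps \<otimes>\<^sub>(OP n) qs = omit_empty (intersections ps qs)"
 by (simp add: ordered_partitions_def intersections_def)

lemma intersections_simps [simp]:
 "intersections [] qs = []" "intersections (P # ps) qs = map (%Q. P Int Q) qs @ intersections ps qs"
 by (simp_all add: intersections_def)

lemma omit_empty_append [simp]: "omit_empty (ps @ qs) = omit_empty ps @ omit_empty qs"
 by (simp add: omit_empty_def)

lemma omit_empty_map: "(!!Q. Q : set qs ==> P Int Q = {}) ==> omit_empty (map (%Q. P Int Q) qs) = []"
 by (induction qs) (auto simp: omit_empty_def)

lemma omit_empty_map_omit: "omit_empty (map (%Q. P Int Q) (omit_empty qs)) = omit_empty (map (%Q. P Int Q) qs)"
 by (induction qs) (auto simp: omit_empty_def)

lemma intersections_omit_l: "omit_empty (intersections (omit_empty ps) qs) = omit_empty (intersections ps qs)"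
proof (induction ps)
 case (Cons P ps)
 thus ?case
  using omit_empty_map[of qs "{}"] by (cases "P = {}") (auto simp: omit_empty_def)
qed (simp add: omit_empty_def)

lemma intersections_omit_r: "omit_empty (intersections ps (omit_empty qs)) = omit_empty (intersections ps qs)"
 by (induction ps) (simp_all add: omit_empty_map_omit)

lemma intersections_append: "intersections (ps @ ps') qs = intersections ps qs @ intersections ps' qs"
 by (induction ps) auto

lemma intersections_assoc: "intersections (intersections ps qs) rs = intersections ps (intersections qs rs)"
proof (induction ps)
 case (Cons P ps)
 have "intersections (map (%Q. P Int Q) qs) rs = map (%R. P Int R) (intersections qs rs)"
  by (induction qs) (auto simp: Int_assoc)
 thus ?case using Cons by (simp add: intersections_append)
qed simp

lemma set_product: "set (ps \<otimes>\<^sub>(OP n) qs) = {P Int Q | P Q. P : set ps & Q : set qs} - {{}}"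
 by (auto simp: mult_ordered_partitions omit_empty_def intersections_def)

lemma distinct_product:
 assumes "distinct ps" "disjoint (set ps)" "distinct qs" "disjoint (set qs)"
 shows "distinct (omit_empty (intersections ps qs))"
 using assms(1,2)
proof (induction ps)
 case (Cons P ps)
 have "omit_empty (map (%Q. P Int Q) qs) = map (%Q. P Int Q) (filter (%Q. P Int Q ~= {}) qs)"
  by (simp add: omit_empty_def filter_map o_def)
 moreover have "inj_on (%Q. P Int Q) (set (filter (%Q. P Int Q ~= {}) qs))"
 proof (rule inj_onI)
  fix Q Q' assume *: "Q : set (filter (%Q. P Int Q ~= {}) qs)" "Q' : set (filter (%Q. P Int Q ~= {}) qs)" "P Int Q = P Int Q'"
  hence "Q Int Q' ~= {}" by auto
  thus "Q = Q'" using * disjointD[OF assms(4), of Q Q'] by auto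
 qed
 ultimately have 1: "distinct (omit_empty (map (%Q. P Int Q) qs))"
  using assms(3) by (simp add: distinct_map)
 have 2: "distinct (omit_empty (intersections ps qs))"
  using Cons.IH Cons.prems by (simp add: pairwise_insert)
 have "set (omit_empty (map (%Q. P Int Q) qs)) Int set (omit_empty (intersections ps qs)) = {}"
 proof -
  have False if "A : set (omit_empty (map (%Q. P Int Q) qs))" "A : set (omit_empty (intersections ps qs))" for A
  proof -
   from that obtain P' where P': "P' : set ps" "A <= P'" "A <= P" "A ~= {}"
    by (auto simp: omit_empty_def intersections_def)
   hence "P ~= P'" using Cons.prems(1) by auto
   hence "P Int P' = {}" using disjointD[OF Cons.prems(2), of P P'] P'(1) by auto
   thus False using P' by auto
  qed
  thus ?thesis by blast
 qed
 with 1 2 show ?case by simp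
qed (simp add: omit_empty_def)

lemma product_closed:
 assumes "ps : car (OP n)" "qs : car (OP n)"
 shows "ps \<otimes>\<^sub>(OP n) qs : car (OP n)"
proof -
 note p = ordered_partitionD[OF assms(1)] and q = ordered_partitionD[OF assms(2)]
 have "distinct (ps \<otimes>\<^sub>(OP n) qs)"
  unfolding mult_ordered_partitions using p(1,2) q(1,2) by (intro distinct_product) (auto simp: partition_on_def)
 moreover have "partition_on {1..n} (set (ps \<otimes>\<^sub>(OP n) qs))"
 proof (rule partition_onI)
  show "\<Union> (set (ps \<otimes>\<^sub>(OP n) qs)) = {1..n}"
  proof
   show "\<Union> (set (ps \<otimes>\<^sub>(OP n) qs)) <= {1..n}"
    unfolding set_product using p(5) by blast
   show "{1..n} <= \<Union> (set (ps \<otimes>\<^sub>(OP n) qs))"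
   proof
    fix x assume "x : {1..n}"
    then obtain P Q where "P : set ps" "Q : set qs" "x : P" "x : Q"
    using partition_onD1[OF p(2)] partition_onD1[OF q(2)] by blast
    thus "x : \<Union> (set (ps \<otimes>\<^sub>(OP n) qs))" unfolding set_product by blast
   qed
  qed
  fix A B assume A: "A : set (ps \<otimes>\<^sub>(OP n) qs)" and B: "B : set (ps \<otimes>\<^sub>(OP n) qs)" and AB: "A ~= B"
  from A obtain P Q where 1: "P : set ps" "Q : set qs" "A = P Int Q" unfolding set_product by blast
  from B obtain P' Q' where 2: "P' : set ps" "Q' : set qs" "B = P' Int Q'" unfolding set_product by blast
  from 1 2 AB have "P ~= P' \<or> Q ~= Q'" by auto
  thus "disjnt A B" using 1 2 p(4)[of P P'] q(4)[of Q Q'] by (auto simp: disjnt_def)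
 qed (auto simp: set_product)
 ultimately show ?thesis by (simp add: carrier_ordered_partitions)
qed

lemma refines_product_iff:
 assumes "ps : car (OP n)" "qs : car (OP n)"
 shows "refines {1..n} Z (set (ps \<otimes>\<^sub>(OP n) qs)) \<longleftrightarrow>
  refines {1..n} Z (set ps) & refines {1..n} Z (set qs)"
proof -
 note p = ordered_partitionD[OF assms(1)] and q = ordered_partitionD[OF assms(2)]
  and pq = ordered_partitionD[OF product_closed[OF assms]]
 have 1: "refines {1..n} (set (ps \<otimes>\<^sub>(OP n) qs)) (set ps)"
  "refines {1..n} (set (ps \<otimes>\<^sub>(OP n) qs)) (set qs)"
  unfolding refines_def using p(2) q(2) pq(2) by (auto simp: set_product)
 have 2: "refines {1..n} Z (set (ps \<otimes>\<^sub>(OP n) qs))"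
  if Z: "refines {1..n} Z (set ps)" "refines {1..n} Z (set qs)"
  unfolding refines_def
 proof (intro conjI ballI)
  show "partition_on {1..n} Z" using Z by (simp add: refines_def)
  fix A assume A: "A : Z"
  then obtain P Q where PQ: "P : set ps" "Q : set qs" "A <= P" "A <= Q" using Z unfolding refines_def by blast
  moreover have "A ~= {}" using A Z by (auto simp: refines_def partition_on_def)
  ultimately show "\<exists>B\<in>set (ps \<otimes>\<^sub>(OP n) qs). A <= B"
   unfolding set_product by (intro bexI[of _ "P Int Q"]) auto
 qed (rule pq(2))
 show ?thesis using 1 2 refines_trans by blast
qed

lemma filter_subset_intersections:
 assumes "!!Q. Q : set qs ==> Q ~= {} & (Q <= T \<or> T Int Q = {})"
 shows "omit_empty (map (%Q. T Int Q) qs) = filter (%Q. Q <= T) qs"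
 using assms
proof (induction qs)
 case (Cons Q qs)
 hence "Q ~= {}" "Q <= T \<or> T Int Q = {}" by auto
 thus ?case using Cons by (auto simp: omit_empty_def Int_absorb1)
qed (simp add: omit_empty_def)

lemma refines_subset_or_disjoint:
 assumes "refines S X Y" "Q : X" "T : Y"
 shows "Q ~= {} & (Q <= T \<or> T Int Q = {})"
proof -
 from assms obtain T' where "T' : Y" "Q <= T'" by (auto simp: refines_def)
 moreover have "T = T' \<or> T Int T' = {}"
  using assms \<open>T' : Y\<close> by (auto simp: refines_def partition_on_def dest: disjointD)
 moreover have "Q ~= {}" using assms by (auto simp: refines_def partition_on_def)
 ultimately show ?thesis by auto
qed

text \<open>If the blocks of \<open>qs\<close> are finer than those of \<open>ts\<close>, then \<open>ts\<close> sorts the blocks of \<open>qs\<close>.\<close>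

lemma product_sorts:
 assumes "refines {1..n} (set qs) (set ts)"
 shows "ts \<otimes>\<^sub>(OP n) qs = concat (map (%T. filter (%Q. Q <= T) qs) ts)"
proof -
 have "set ts' <= set ts ==> omit_empty (intersections ts' qs) = concat (map (%T. filter (%Q. Q <= T) qs) ts')" for ts'
 proof (induction ts')
  case (Cons T ts')
  have "omit_empty (map (%Q. T Int Q) qs) = filter (%Q. Q <= T) qs"
   by (rule filter_subset_intersections) (use refines_subset_or_disjoint[OF assms] Cons.prems in auto)
  thus ?case using Cons by simp
 qed (simp add: omit_empty_def)
 thus ?thesis by (simp add: mult_ordered_partitions)
qed

lemma product_absorb:
 assumes ps: "ps : car (OP n)" and r: "refines {1..n} (set ps) (set ts)" and ts: "distinct ts"
 shows "ps \<otimes>\<^sub>(OP n) ts = ps"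
proof -
 have "omit_empty (map (%T. P Int T) ts) = [P]" if P: "P : set ps" for P
 proof -
  from P r obtain T where T: "T : set ts" "P <= T" by (auto simp: refines_def)
  then obtain us vs where uv: "ts = us @ T # vs" using split_list by fastforce
  have "P Int T' = {}" if "T' : set us Un set vs" for T'
  proof -
   have "T' ~= T" "T' : set ts" using that uv ts by auto
   hence "T Int T' = {}" using r T(1) by (auto simp: refines_def partition_on_def dest: disjointD)
   thus ?thesis using T(2) by auto
  qed
  hence "omit_empty (map (%T. P Int T) us) = []" "omit_empty (map (%T. P Int T) vs) = []"
   by (auto intro: omit_empty_map)
  moreover have "P Int T = P" "P ~= {}" using T ordered_partitionD(3)[OF ps P] by auto
  ultimately show ?thesis unfolding uv by (simp add: omit_empty_def)
 qed
 hence "set ps' <= set ps ==> omit_empty (intersections ps' ts) = ps'" for ps'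
  by (induction ps') (auto simp: omit_empty_def)
 thus ?thesis by (simp add: mult_ordered_partitions)
qed

lemma set_product_refined:
 assumes "refines {1..n} (set qs) (set ts)"
 shows "set (ts \<otimes>\<^sub>(OP n) qs) = set qs"
 unfolding product_sorts[OF assms] using assms by (auto simp: refines_def)

lemma one_ordered_partitions: "\<one>\<^sub>(OP n) = omit_empty [{1..n}]"
 by (simp add: ordered_partitions_def)

lemma refines_one:
 assumes "partition_on {1..n} X" shows "refines {1..n} X (set \<one>\<^sub>(OP n))"
proof (cases "n = 0")
 case True
 thus ?thesis using assms by (auto simp: refines_def one_ordered_partitions omit_empty_def partition_on_def)
next
 case False
 hence "set \<one>\<^sub>(OP n) = {{1..n}}" by (auto simp: one_ordered_partitions omit_empty_def)
 thus ?thesis using assms False by (auto simp: refines_def partition_on_def)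
qed

lemma monoid_ordered_partitions: "monoid (OP n)"
proof (rule monoidI)
 show one: "\<one>\<^sub>(OP n) : car (OP n)"
  by (auto simp: carrier_ordered_partitions one_ordered_partitions omit_empty_def partition_on_def)
 fix ps assume ps: "ps : car (OP n)"
 show "ps \<otimes>\<^sub>(OP n) \<one>\<^sub>(OP n) = ps"
  by (rule product_absorb[OF ps refines_one]) (use ps one in "auto simp: carrier_ordered_partitions")
 have "omit_empty (map (%Q. {1..n} Int Q) qs) = qs" if "set qs <= set ps" for qs
  using that ordered_partitionD(3,5)[OF ps] by (induction qs) (auto simp: omit_empty_def Int_absorb1)
 thus "\<one>\<^sub>(OP n) \<otimes>\<^sub>(OP n) ps = ps"
  by (simp add: mult_ordered_partitions one_ordered_partitions intersections_omit_l)
qed (simp_all add: product_closed, simp add: mult_ordered_partitions intersections_omit_l intersections_omit_r intersections_assoc)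

lemma finite_ordered_partitions: "finite (car (OP n))"
proof (rule finite_subset)
 show "car (OP n) <= {ps. set ps <= Pow {1..n} & distinct ps}"
 proof
  fix ps assume ps: "ps : car (OP n)"
  have "set ps <= Pow {1..n}" using ordered_partitionD(5)[OF ps] by blast
  thus "ps : {ps. set ps <= Pow {1..n} & distinct ps}" using ordered_partitionD(1)[OF ps] by simp
 qed
qed (simp add: finite_subset_distinct)

section \<open>Ordered G-partitions\<close>

lemma const_on_blocks_refines: "const_on_blocks Y g ==> refines S X Y ==> const_on_blocks X g"
 unfolding const_on_blocks_def refines_def by (meson subsetD)

lemma carrier_hsiao_monoid:
 "m : car (hsiao_monoid n G) \<longleftrightarrow> fst m : car (OP n) \<and>
  snd m : car (product_group {1..n} (%_. G)) & const_on_blocks (set (fst m)) (snd m)"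
 by (cases m) (auto simp: hsiao_monoid_def DirProd_def)

lemma mult_hsiao_monoid:
 "m \<otimes>\<^sub>(hsiao_monoid n G) m' =
  (fst m \<otimes>\<^sub>(OP n) fst m', snd m \<otimes>\<^sub>(product_group {1..n} (%_. G)) snd m')"
 by (cases m; cases m') (simp add: hsiao_monoid_def DirProd_def)

lemma one_hsiao_monoid:
 "\<one>\<^sub>(hsiao_monoid n G) = (\<one>\<^sub>(OP n), \<one>\<^sub>(product_group {1..n} (%_. G)))"
 by (simp add: hsiao_monoid_def DirProd_def)

lemma const_on_blocks_mult:
 assumes "const_on_blocks X g" "const_on_blocks X h" "\<Union>X <= {1..n}"
 shows "const_on_blocks X (g \<otimes>\<^sub>(product_group {1..n} (%_. G)) h)"
 unfolding const_on_blocks_def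
proof (intro ballI)
 fix B i j assume B: "B : X" "i : B" "j : B"
 hence "i : {1..n}" "j : {1..n}" using assms(3) by blast+
 moreover have "g i = g j" "h i = h j" using assms(1,2) B unfolding const_on_blocks_def by blast+
 ultimately show "(g \<otimes>\<^sub>(product_group {1..n} (%_. G)) h) i = (g \<otimes>\<^sub>(product_group {1..n} (%_. G)) h) j"
  by simp
qed

lemma const_on_blocks_one: "\<Union>X <= {1..n} ==> const_on_blocks X \<one>\<^sub>(product_group {1..n} (%_. G))"
 unfolding const_on_blocks_def
proof (intro ballI)
 fix B i j assume X: "\<Union>X <= {1..n}" and B: "B : X" "i : B" "j : B"
 hence "i : {1..n}" "j : {1..n}" by blast+
 thus "\<one>\<^sub>(product_group {1..n} (%_. G)) i = \<one>\<^sub>(product_group {1..n} (%_. G)) j" by simp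
qed

lemma ordered_partition_Union: "ps : car (OP n) ==> \<Union>(set ps) <= {1..n}"
 using ordered_partitionD(5) by blast

lemma carrier_block_group:
 "g : car (block_group n G X) \<longleftrightarrow> g : car (product_group {1..n} (%_. G)) & const_on_blocks X g"
 by (simp add: block_group_def)

lemma block_group_simps [simp]:
 "monoid.mult (block_group n G X) = monoid.mult (product_group {1..n} (%_. G))"
 "\<one>\<^sub>(block_group n G X) = \<one>\<^sub>(product_group {1..n} (%_. G))"
 by (simp_all add: block_group_def)

context
 fixes n :: nat and G :: "'g monoid"
 assumes G: "group G"
begin

interpretation Gn: group "product_group {1..n} (%_. G)"
 using G by simp

lemma monoid_hsiao_monoid: "monoid (hsiao_monoid n G)"
proof -
 interpret S: monoid "OP n" by (rule monoid_ordered_partitions)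
 show ?thesis
 proof (rule monoidI)
  fix m m' assume m: "m : car (hsiao_monoid n G)" "m' : car (hsiao_monoid n G)"
  hence s: "fst m : car (OP n)" "fst m' : car (OP n)"
   by (auto simp: carrier_hsiao_monoid)
  let ?ps = "fst m \<otimes>\<^sub>(OP n) fst m'"
  have p: "?ps : car (OP n)" using s by simp
  have r: "refines {1..n} (set ?ps) (set (fst m))" "refines {1..n} (set ?ps) (set (fst m'))"
   using refines_product_iff[OF s, of "set ?ps"] refines_refl[OF ordered_partitionD(2)[OF p]] by auto
  have "const_on_blocks (set ?ps) (snd m)" "const_on_blocks (set ?ps) (snd m')"
   using const_on_blocks_refines[OF _ r(1)] const_on_blocks_refines[OF _ r(2)] m by (auto simp: carrier_hsiao_monoid)
  hence "const_on_blocks (set ?ps) (snd m \<otimes>\<^sub>(product_group {1..n} (%_. G)) snd m')"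
   by (rule const_on_blocks_mult[OF _ _ ordered_partition_Union[OF p]])
  moreover have "snd m \<otimes>\<^sub>(product_group {1..n} (%_. G)) snd m' : car (product_group {1..n} (%_. G))"
   using m by (intro Gn.m_closed) (auto simp: carrier_hsiao_monoid)
  ultimately show "m \<otimes>\<^sub>(hsiao_monoid n G) m' : car (hsiao_monoid n G)"
   unfolding carrier_hsiao_monoid mult_hsiao_monoid fst_conv snd_conv using p by blast
 next
  show "\<one>\<^sub>(hsiao_monoid n G) : car (hsiao_monoid n G)"
   unfolding carrier_hsiao_monoid one_hsiao_monoid fst_conv snd_conv
   using const_on_blocks_one[OF ordered_partition_Union[OF S.one_closed]] Gn.one_closed S.one_closed by blast
 next
  fix x y z assume "x : car (hsiao_monoid n G)" "y : car (hsiao_monoid n G)" "z : car (hsiao_monoid n G)"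
  thus "x \<otimes>\<^sub>(hsiao_monoid n G) y \<otimes>\<^sub>(hsiao_monoid n G) z = x \<otimes>\<^sub>(hsiao_monoid n G) (y \<otimes>\<^sub>(hsiao_monoid n G) z)"
   unfolding carrier_hsiao_monoid mult_hsiao_monoid fst_conv snd_conv using S.m_assoc Gn.m_assoc by simp
 next
  fix x assume x: "x : car (hsiao_monoid n G)"
  thus "\<one>\<^sub>(hsiao_monoid n G) \<otimes>\<^sub>(hsiao_monoid n G) x = x" "x \<otimes>\<^sub>(hsiao_monoid n G) \<one>\<^sub>(hsiao_monoid n G) = x"
   unfolding carrier_hsiao_monoid mult_hsiao_monoid one_hsiao_monoid fst_conv snd_conv
   using S.l_one S.r_one Gn.l_one Gn.r_one by (metis prod.collapse)+
 qed
qed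

lemma group_block_group:
 assumes X: "\<Union>X <= {1..n}"
 shows "group (block_group n G X)"
proof -
 have "subgroup {g : car (product_group {1..n} (%_. G)). const_on_blocks X g} (product_group {1..n} (%_. G))"
 proof (rule Gn.subgroupI)
  show "{g : car (product_group {1..n} (%_. G)). const_on_blocks X g} ~= {}"
   using const_on_blocks_one[OF X, of G] Gn.one_closed by blast
  fix g assume g: "g : {g : car (product_group {1..n} (%_. G)). const_on_blocks X g}"
  hence gc: "g : car (product_group {1..n} (%_. G))" and cg: "const_on_blocks X g" by auto
  have "inv\<^bsub>product_group {1..n} (%_. G)\<^esub> g = (\<lambda>i\<in>{1..n}. inv\<^bsub>G\<^esub> g i)"
   using gc G by (intro inv_product_group) auto
  moreover have "const_on_blocks X (\<lambda>i\<in>{1..n}. inv\<^bsub>G\<^esub> g i)"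
   unfolding const_on_blocks_def
  proof (intro ballI)
   fix B i j assume B: "B : X" "i : B" "j : B"
   hence "i : {1..n}" "j : {1..n}" using X by blast+
   moreover have "g i = g j" using cg B unfolding const_on_blocks_def by blast
   ultimately show "(\<lambda>i\<in>{1..n}. inv\<^bsub>G\<^esub> g i) i = (\<lambda>i\<in>{1..n}. inv\<^bsub>G\<^esub> g i) j" by simp
  qed
  ultimately show "inv\<^bsub>product_group {1..n} (%_. G)\<^esub> g : {g : car (product_group {1..n} (%_. G)). const_on_blocks X g}"
   using Gn.inv_closed[OF gc] by simp
 next
  fix g h assume gh: "g : {g : car (product_group {1..n} (%_. G)). const_on_blocks X g}"
   "h : {g : car (product_group {1..n} (%_. G)). const_on_blocks X g}"
  hence "g \<otimes>\<^sub>(product_group {1..n} (%_. G)) h : car (product_group {1..n} (%_. G))" by (intro Gn.m_closed) simp_all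
  with gh show "g \<otimes>\<^sub>(product_group {1..n} (%_. G)) h : {g : car (product_group {1..n} (%_. G)). const_on_blocks X g}"
   using const_on_blocks_mult[OF _ _ X, of g h G] by blast
 qed blast
 thus ?thesis
  unfolding block_group_def by (rule Gn.subgroup_imp_group)
qed

lemma block_group_mono: "refines {1..n} X Y ==> car (block_group n G Y) <= car (block_group n G X)"
 using const_on_blocks_refines by (auto simp: carrier_block_group)

lemma finite_block_group: "finite (car G) ==> finite (car (block_group n G X))"
 by (rule finite_subset[of _ "\<Pi>\<^sub>E i\<in>{1..n}. car G"]) (simp_all add: carrier_block_group subset_iff finite_PiE)

text \<open>The maximal subgroup of \<open>\<Sigma>\<^sub>n\<^sup>G\<close> at the idempotent \<open>(l, \<one>)\<close>.\<close>

lemma block_group_embedding: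
 assumes l: "l : car (OP n)" and r: "refines {1..n} (set l) Z"
 shows "g : car (block_group n G Z) ==> (l, g) : car (hsiao_monoid n G)"
  and "(l, g \<otimes>\<^sub>(block_group n G Z) h) = (l, g) \<otimes>\<^sub>(hsiao_monoid n G) (l, h)"
 using l const_on_blocks_refines[OF _ r] product_absorb[OF l refines_refl[OF ordered_partitionD(2)[OF l]] ordered_partitionD(1)[OF l]]
 by (auto simp: carrier_hsiao_monoid carrier_block_group mult_hsiao_monoid)

end

section \<open>The permutohedral complex and the action of ordered partitions\<close>

lemma cell_iff:
 assumes "atoms A"
 shows "cell A cl \<longleftrightarrow> distinct cl & {} ~: set cl & disjoint (set cl) & \<Union>(set cl) = \<Union>A & (\<forall>a\<in>A. \<exists>P\<in>set cl. a <= P)"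
 using assms
proof (induction cl arbitrary: A)
 case Nil
 thus ?case by (auto simp: atoms_def)
next
 case (Cons P ps)
 have IH: "cell (A - B) ps \<longleftrightarrow> distinct ps & {} ~: set ps & disjoint (set ps) & \<Union>(set ps) = \<Union>(A - B) & (\<forall>a\<in>A - B. \<exists>P\<in>set ps. a <= P)" for B
  by (rule Cons.IH[OF atoms_subset[OF Cons.prems]]) auto
 have dj: "\<Union>B Int \<Union>(A - B) = {}" if "B <= A" for B
 proof -
  have "b Int \<Union>(A - B) = {}" if "b : B" for b
   using atoms_disjoint[OF Cons.prems, of b "A - B"] that \<open>B <= A\<close> by auto
  thus ?thesis by blast
 qed
 show ?case
 proof
  assume "cell A (P # ps)"
  then obtain B where B: "B <= A" "B ~= {}" "P = \<Union>B" "cell (A - B) ps" by auto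
  note c = B(4)[unfolded IH]
  have P0: "P ~= {}" using atoms_Union_nonempty[OF Cons.prems B(1,2)] B(3) by simp
  have dP: "P Int Q = {}" if "Q : set ps" for Q using dj[OF B(1)] B(3) c that by blast
  have "P ~: set ps" using dP P0 by blast
  moreover have "\<Union>(set (P # ps)) = \<Union>A" using c B by auto
  moreover have "\<exists>Q\<in>set (P # ps). a <= Q" if "a : A" for a
   using that c B(3) by (cases "a : B") auto
  moreover have "disjoint (set (P # ps))" using c dP by (auto simp: pairwise_insert disjnt_def)
  ultimately show "distinct (P # ps) & {} ~: set (P # ps) & disjoint (set (P # ps)) & \<Union>(set (P # ps)) = \<Union>A & (\<forall>a\<in>A. \<exists>Q\<in>set (P # ps). a <= Q)"
   using c P0 by simp
 next
  assume r: "distinct (P # ps) & {} ~: set (P # ps) & disjoint (set (P # ps)) & \<Union>(set (P # ps)) = \<Union>A & (\<forall>a\<in>A. \<exists>Q\<in>set (P # ps). a <= Q)"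
  hence dP: "P Int Q = {}" if "Q : set ps" for Q using that disjointD[of "set (P # ps)" P Q] by auto
  have U: "\<Union>(set (P # ps)) = \<Union>A" using r by blast
  define B where "B = {a : A. a <= P}"
  have rest: "\<exists>Q\<in>set ps. a <= Q" if "a : A - B" for a using that r by (auto simp: B_def)
  have P: "P = \<Union>B"
  proof
   show "P <= \<Union>B"
   proof
    fix x assume x: "x : P"
    hence "x : \<Union>A" unfolding U[symmetric] by simp
    then obtain a where a: "a : A" "x : a" by blast
    have "a : B" using rest[of a] a dP x by blast
    thus "x : \<Union>B" using a by blast
   qed
  qed (auto simp: B_def)
  have "\<Union>(set ps) = \<Union>(A - B)"
  proof
   show "\<Union>(set ps) <= \<Union>(A - B)"
   proof
    fix x assume "x : \<Union>(set ps)"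
    then obtain Q where Q: "Q : set ps" "x : Q" by blast
    hence "x : \<Union>A" unfolding U[symmetric] by auto
    then obtain a where a: "a : A" "x : a" by blast
    have "a ~: B" using a Q dP[OF Q(1)] by (auto simp: B_def)
    thus "x : \<Union>(A - B)" using a by blast
   qed
   show "\<Union>(A - B) <= \<Union>(set ps)" using rest by blast
  qed
  hence "cell (A - B) ps" unfolding IH using r rest by (auto simp: pairwise_insert)
  moreover have "B ~= {}" using P r by auto
  moreover have "B <= A" by (auto simp: B_def)
  ultimately show "cell A (P # ps)" using cell_ConsI[OF _ _ P] by blast
 qed
qed

lemma partition_on_atoms: "partition_on S X ==> atoms X"
 by (auto simp: partition_on_def atoms_def)

lemma cell_iff_ordered_partition:
 assumes X: "partition_on {1..n} X"
 shows "cell X cl \<longleftrightarrow> cl : car (OP n) & refines {1..n} X (set cl)"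
 unfolding cell_iff[OF partition_on_atoms[OF X]] carrier_ordered_partitions refines_def
 using X by (auto simp: partition_on_def)

lemma delta_nonzero:
 "delta f cl' ~= 0 ==> \<exists>us Q R vs. cl' = us @ Q # R # vs & f (us @ (Q Un R) # vs) ~= 0"
proof (induction f cl' rule: delta.induct)
 case (3 f P Q qs)
 show ?case
 proof (cases "f ((P Un Q) # qs) = 0")
  case True
  hence "delta (%t. f (P # t)) (Q # qs) ~= 0" using 3(2) by simp
  from 3(1)[OF this] obtain us Q' R' vs where "Q # qs = us @ Q' # R' # vs" "f (P # us @ (Q' Un R') # vs) ~= 0" by blast
  thus ?thesis by (intro exI[of _ "P # us"] exI[of _ Q'] exI[of _ R'] exI[of _ vs]) simp
 next
  case False
  thus ?thesis by (intro exI[of _ "[]"] exI[of _ P] exI[of _ Q] exI[of _ qs]) simp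
 qed
qed auto

lemma delta_unit_merge:
 assumes "distinct (us @ Q # R # vs)" "{} ~: set (us @ Q # R # vs)" "disjoint (set (us @ Q # R # vs))"
 shows "delta (unit_fun (us @ (Q Un R) # vs)) (us @ Q # R # vs) = (-1) ^ length us"
 using assms
proof (induction us)
 case Nil
 hence "Q Int R = {}" using disjointD[of _ Q R] by auto
 hence "Q Un R ~= Q" using Nil by auto
 hence "unit_fun ((Q Un R) # vs) (Q # t) = 0" for t by (simp add: unit_fun_def)
 thus ?case by (simp add: delta_linear) (simp add: unit_fun_def)
next
 case (Cons P us)
 let ?w = "us @ Q # R # vs"
 obtain B xs where B: "?w = B # xs" by (cases ?w) auto
 have "B : set ?w" unfolding B by simp
 hence "B ~= {}" "P ~= B" using Cons.prems by auto
 hence "P Int B = {}" using Cons.prems(3) disjointD[of _ P B] \<open>B : set ?w\<close> by auto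
 hence "P Un B ~= P" using \<open>B ~= {}\<close> by auto
 hence 1: "unit_fun (P # us @ (Q Un R) # vs) ((P Un B) # xs) = 0" by (simp add: unit_fun_def)
 have 2: "(%t. unit_fun (P # us @ (Q Un R) # vs) (P # t)) = unit_fun (us @ (Q Un R) # vs)"
  by (simp add: unit_fun_def fun_eq_iff)
 have "delta (unit_fun (us @ (Q Un R) # vs)) ?w = (-1) ^ length us"
  by (rule Cons.IH) (use Cons.prems in "auto simp: pairwise_insert")
 thus ?case using 1 2 unfolding append_Cons B by simp
qed

text \<open>The sign of the permutation that sorts a list.\<close>

fun inversion_sign :: "nat list => int" where
 "inversion_sign [] = 1"
| "inversion_sign (x # xs) = (-1) ^ length (filter (%y. y < x) xs) * inversion_sign xs"

lemma inversion_sign_square: "inversion_sign xs * inversion_sign xs = 1"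
proof (induction xs)
 case (Cons x xs)
 have "inversion_sign (x # xs) * inversion_sign (x # xs) =
  ((-1) ^ length (filter (%y. y < x) xs) * (-1) ^ length (filter (%y. y < x) xs)) * (inversion_sign xs * inversion_sign xs)"
  by simp
 also have "... = 1" by (simp only: Cons.IH flip: power_add mult_2) simp
 finally show ?case .
qed simp

lemma inversion_sign_remove:
 "inversion_sign (as @ r # bs) = inversion_sign (as @ bs) *
  (-1) ^ (length (filter (%a. r < a) as) + length (filter (%b. b < r) bs))"
 by (induction as) (simp_all add: power_add mult_ac)

definition block_sign :: "nat set list => int" where
 "block_sign cl = inversion_sign (map Min cl)"

definition incidence :: "nat set list => nat set list => int" where
 "incidence cl' cl = block_sign cl' * block_sign cl * delta (unit_fun cl) cl'"

lemma length_filter_linear_order: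
 fixes r :: nat
 assumes "r ~: set as"
 shows "length as = length (filter (%a. a < r) as) + length (filter (%a. r < a) as)"
 using assms by (induction as) auto

text \<open>The sign does not depend on the order of the blocks other than \<open>Q\<close> and \<open>R\<close>: it is
  determined by the orientation in which the linear forms \<open>x\<^sub>B\<close> of the blocks are
  ordered by minima.\<close>

lemma incidence_split:
 assumes d: "distinct (us @ Q # R # vs)" and ne: "{} ~: set (us @ Q # R # vs)" and dj: "disjoint (set (us @ Q # R # vs))"
  and fin: "!!B. B : set (us @ Q # R # vs) ==> finite B"
 shows "incidence (us @ Q # R # vs) (us @ (Q Un R) # vs) =
  (if Min Q < Min R then 1 else -1) * (-1) ^ length (filter (%B. Min B < max (Min Q) (Min R)) (us @ vs))"
proof -
 let ?as = "map Min us" and ?bs = "map Min vs" and ?q = "Min Q" and ?r = "Min R"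
 have Min_inj: "Min B ~= Min C" if "B : set (us @ Q # R # vs)" "C : set (us @ Q # R # vs)" "B ~= C" for B C
 proof
  assume eq: "Min B = Min C"
  have "B ~= {}" "C ~= {}" using that ne by metis+
  hence "Min B : B" "Min C : C" using that fin by (auto intro: Min_in)
  moreover have "B Int C = {}" using disjointD[OF dj that] .
  ultimately show False using eq by auto
 qed
 have nas: "?q ~: set ?as" "?r ~: set ?as" using Min_inj d by auto
 have qr: "?q ~= ?r" using Min_inj[of Q R] d by auto
 have QR: "Q ~= {}" "R ~= {}" "finite Q" "finite R" using ne fin by auto
 have Min_Un: "Min (Q Un R) = min ?q ?r" using QR by (simp add: Min_Un)
 have sq: "x * ((y :: int) * x * z) = y * z" if "x * x = 1" for x y z using that by (metis mult.assoc mult.commute mult.left_neutral)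
 have filt: "length (filter (%B. Min B < m) ws) = length (filter (%a. a < m) (map Min ws))" for m :: nat and ws :: "nat set list"
  by (simp add: filter_map o_def)
 have par: "(-1 :: int) ^ (a + a + b) = (-1) ^ b" for a b :: nat
  by (simp add: power_add flip: power_mult_distrib)
 show ?thesis
 proof (cases "?q < ?r")
  case True
  have "inversion_sign (?as @ ?q # ?r # ?bs) = inversion_sign ((?as @ [?q]) @ ?bs) *
    (-1) ^ (length (filter (%a. ?r < a) (?as @ [?q])) + length (filter (%b. b < ?r) ?bs))"
   using inversion_sign_remove[of "?as @ [?q]" ?r ?bs] by simp
  hence s: "block_sign (us @ Q # R # vs) = block_sign (us @ (Q Un R) # vs) *
    (-1) ^ (length (filter (%a. ?r < a) ?as) + length (filter (%b. b < ?r) ?bs))"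
   using True by (simp add: block_sign_def Min_Un)
  have "incidence (us @ Q # R # vs) (us @ (Q Un R) # vs) =
    (-1) ^ (length (filter (%a. ?r < a) ?as) + length (filter (%b. b < ?r) ?bs)) * (-1) ^ length ?as"
   unfolding incidence_def s delta_unit_merge[OF d ne dj]
   using inversion_sign_square[of "map Min (us @ (Q Un R) # vs)"] by (simp add: block_sign_def mult_ac sq)
  also have "... = (-1) ^ (length (filter (%a. ?r < a) ?as) + length (filter (%a. ?r < a) ?as) +
    (length (filter (%a. a < ?r) ?as) + length (filter (%b. b < ?r) ?bs)))"
   by (subst length_filter_linear_order[OF nas(2)]) (simp add: power_add mult_ac)
  finally show ?thesis using True by (simp only: par filt if_True max.absorb2 less_imp_le map_append filter_append length_append mult_1)
 next
  case False
  hence lt: "?r < ?q" using qr by auto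
  have "inversion_sign (?as @ ?q # ?r # ?bs) = inversion_sign (?as @ ?r # ?bs) *
    (-1) ^ (length (filter (%a. ?q < a) ?as) + length (filter (%b. b < ?q) (?r # ?bs)))"
   by (rule inversion_sign_remove)
  hence s: "block_sign (us @ Q # R # vs) = block_sign (us @ (Q Un R) # vs) *
    (-1) ^ (length (filter (%a. ?q < a) ?as) + Suc (length (filter (%b. b < ?q) ?bs)))"
   using lt by (simp add: block_sign_def Min_Un)
  have "incidence (us @ Q # R # vs) (us @ (Q Un R) # vs) =
    (-1) ^ (length (filter (%a. ?q < a) ?as) + Suc (length (filter (%b. b < ?q) ?bs))) * (-1) ^ length ?as"
   unfolding incidence_def s delta_unit_merge[OF d ne dj]
   using inversion_sign_square[of "map Min (us @ (Q Un R) # vs)"] by (simp add: block_sign_def mult_ac sq)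
  also have "... = - ((-1) ^ (length (filter (%a. ?q < a) ?as) + length (filter (%a. ?q < a) ?as) +
    (length (filter (%a. a < ?q) ?as) + length (filter (%b. b < ?q) ?bs))))"
   by (subst length_filter_linear_order[OF nas(1)]) (simp add: power_add mult_ac)
  finally show ?thesis using False lt
   by (simp only: par filt if_False max.absorb1 less_imp_le map_append filter_append length_append)
 qed
qed

lemma incidence_nonzero:
 assumes "incidence cl' cl ~= 0"
 obtains us Q R vs where "cl' = us @ Q # R # vs" "cl = us @ (Q Un R) # vs"
proof -
 have "delta (unit_fun cl) cl' ~= 0" using assms by (auto simp: incidence_def)
 from delta_nonzero[OF this] show thesis using that by (auto simp: unit_fun_def split: if_splits)
qed

lemma incidence_length: "incidence cl' cl ~= 0 ==> length cl' = Suc (length cl)"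
 by (elim incidence_nonzero) simp

lemma append_Cons_inject:
 "x ~: set xs ==> x ~: set ys ==> xs @ x # xs' = ys @ x # ys' ==> xs = ys & xs' = ys'"
proof (induction xs arbitrary: ys)
 case Nil
 thus ?case by (cases ys) auto
next
 case (Cons a xs)
 thus ?case by (cases ys) auto
qed

lemma incidence_split_cong:
 assumes d: "distinct (us @ Q # R # vs)" and ne: "{} ~: set (us @ Q # R # vs)" and dj: "disjoint (set (us @ Q # R # vs))"
  and fin: "!!B. B : set (us @ Q # R # vs) ==> finite B"
  and d': "distinct (as @ Q # R # bs)" and eq: "set (as @ Q # R # bs) = set (us @ Q # R # vs)"
 shows "incidence (as @ Q # R # bs) (as @ (Q Un R) # bs) = incidence (us @ Q # R # vs) (us @ (Q Un R) # vs)"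
proof -
 have 1: "set (as @ bs) = set (as @ Q # R # bs) - {Q, R}" and 2: "set (us @ vs) = set (us @ Q # R # vs) - {Q, R}"
  using d d' by auto
 have s: "set (as @ bs) = set (us @ vs)" unfolding 1 2 eq ..
 have "length (filter p (as @ bs)) = length (filter p (us @ vs))" for p
  using distinct_length_filter[of "as @ bs" p] distinct_length_filter[of "us @ vs" p] d d' s by simp
 moreover have "incidence (us @ Q # R # vs) (us @ (Q Un R) # vs) =
   (if Min Q < Min R then 1 else -1) * (-1) ^ length (filter (%B. Min B < max (Min Q) (Min R)) (us @ vs))"
  by (rule incidence_split[OF d ne dj]) (rule fin)
 moreover have "incidence (as @ Q # R # bs) (as @ (Q Un R) # bs) =
   (if Min Q < Min R then 1 else -1) * (-1) ^ length (filter (%B. Min B < max (Min Q) (Min R)) (as @ bs))"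
  by (rule incidence_split[OF d' ne[folded eq] dj[folded eq]]) (rule fin[folded eq])
 ultimately show ?thesis by (simp only:)
qed

lemma incidence_swap:
 assumes d: "distinct (us @ Q # R # vs)" and ne: "{} ~: set (us @ Q # R # vs)" and dj: "disjoint (set (us @ Q # R # vs))"
  and fin: "!!B. B : set (us @ Q # R # vs) ==> finite B"
 shows "incidence (us @ R # Q # vs) (us @ (Q Un R) # vs) = - incidence (us @ Q # R # vs) (us @ (Q Un R) # vs)"
proof -
 have e: "set (us @ R # Q # vs) = set (us @ Q # R # vs)" by auto
 have d': "distinct (us @ R # Q # vs)" using d by auto
 have "Q ~= {}" "R ~= {}" "finite Q" "finite R" using ne fin by auto
 hence "Min Q : Q" "Min R : R" by auto
 moreover have "Q Int R = {}" using disjointD[OF dj, of Q R] d by auto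
 ultimately have "Min Q ~= Min R" by auto
 moreover note incidence_split[OF d ne dj fin] incidence_split[OF d' ne[folded e] dj[folded e] fin[folded e]]
 ultimately show ?thesis by (auto simp: Un_commute max.commute)
qed

text \<open>The matrix of the action of an ordered partition \<open>ta\<close> on the permutohedral complex.\<close>

definition action :: "nat => nat set list => nat set list => nat set list => int" where
 "action n ta cl' cl =
  (if refines {1..n} (set cl) (set ta) & ta \<otimes>\<^sub>(OP n) cl = cl' then 1 else 0)"

lemma product_within_block:
 assumes ta: "ta : car (OP n)" and T: "T : set ta"
 obtains pre post where
  "!!xs. [|!!Q. Q : set xs ==> Q <= T; refines {1..n} (set (as @ xs @ bs)) (set ta)|] ==>
   ta \<otimes>\<^sub>(OP n) (as @ xs @ bs) = pre @ xs @ post"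
proof -
 obtain ta1 ta2 where t: "ta = ta1 @ T # ta2" using split_list[OF T] by blast
 show thesis
 proof (rule that)
  fix xs assume xs: "!!Q. Q : set xs ==> Q <= T" and r: "refines {1..n} (set (as @ xs @ bs)) (set ta)"
  have no: "filter (%Q. Q <= T') xs = []" if "T' : set ta1 Un set ta2" for T'
  proof -
   have "T' ~= T" "T' : set ta" using that ordered_partitionD(1)[OF ta] t by auto
   hence "T Int T' = {}" using ordered_partitionD(4)[OF ta T] by auto
   thus ?thesis
    using xs refines_subset_or_disjoint[OF r _ T] by (fastforce simp: filter_empty_conv)
  qed
  have all: "filter (%Q. Q <= T) xs = xs" using xs by (simp add: filter_id_conv)
  have 1: "concat (map (%T'. filter (%Q. Q <= T') (as @ xs @ bs)) ta') = concat (map (%T'. filter (%Q. Q <= T') (as @ bs)) ta')"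
   if "set ta' <= set ta1 Un set ta2" for ta'
   using that no by (induction ta') auto
  show "ta \<otimes>\<^sub>(OP n) (as @ xs @ bs) =
   (concat (map (%T'. filter (%Q. Q <= T') (as @ bs)) ta1) @ filter (%Q. Q <= T) as) @ xs @
   (filter (%Q. Q <= T) bs @ concat (map (%T'. filter (%Q. Q <= T') (as @ bs)) ta2))"
   unfolding product_sorts[OF r] unfolding t by (simp add: 1[of ta1, simplified] 1[of ta2, simplified] all)
 qed
qed

text \<open>The boundary commutes with \<open>ta\<close>. If \<open>ta\<close> separates the two parts \<open>Q\<close>, \<open>R\<close> of a block that is
  split, then the splittings \<open>Q, R\<close> and \<open>R, Q\<close> have the same image under \<open>ta\<close> and cancel.\<close>

lemma incidence_equivariant:
 assumes X: "partition_on {1..n} X" and ta: "ta : car (OP n)"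
  and cl': "cell X cl'" and cl: "cell X cl"
 shows "(\<Sum>rh | cell X rh. incidence cl' rh * action n ta rh cl) = (\<Sum>rh | cell X rh. action n ta cl' rh * incidence rh cl)"
proof -
 let ?m = "monoid.mult (OP n)"
 have finX: "finite X" using X by (rule finite_elements[rotated]) simp
 have fin: "finite {rh. cell X rh}" by (rule finite_cells[OF finX])
 have op: "rh : car (OP n)" "refines {1..n} X (set rh)" if "cell X rh" for rh
  using that by (auto simp: cell_iff_ordered_partition[OF X])
 have cellI: "cell X rh" if "distinct rh" "cell X rh'" "set rh = set rh'" for rh rh'
  using that by (auto simp: cell_iff_ordered_partition[OF X] carrier_ordered_partitions)
 have good: "distinct rh" "{} ~: set rh" "disjoint (set rh)" "!!B. B : set rh ==> finite B" if "cell X rh" for rh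
 proof -
  note o = ordered_partitionD[OF op(1)[OF that]]
  show "distinct rh" "{} ~: set rh" "disjoint (set rh)" using o(1,2) by (auto simp: partition_on_def)
  show "finite B" if "B : set rh" for B using finite_subset[OF o(5)[OF that]] by simp
 qed
 have split_refines: "refines {1..n} (set (as @ Q # R # bs)) (set (as @ (Q Un R) # bs))"
  if "cell X (as @ Q # R # bs)" "cell X (as @ (Q Un R) # bs)" for as Q R bs
  unfolding refines_def using ordered_partitionD(2)[OF op(1)[OF that(1)]] ordered_partitionD(2)[OF op(1)[OF that(2)]] by auto
 have split_notin: "Q Un R ~: set (as @ Q # R # bs)" if "cell X (as @ Q # R # bs)" for as Q R bs
 proof
  assume *: "Q Un R : set (as @ Q # R # bs)"
  note g = good[OF that]
  have 1: "Q ~= {}" "R ~= {}" "Q ~= R" using g(1,2) by auto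
  hence 2: "Q Int R = {}" using disjointD[OF g(3), of Q R] by auto
  have "Q Un R = Q" using disjointD[OF g(3) *, of Q] 1 by auto
  thus False using 1 2 by auto
 qed
 show ?thesis
 proof (cases "refines {1..n} (set cl) (set ta)")
  case r: True
  have act: "cell X (?m ta cl)"
   by (rule cellI[OF _ cl set_product_refined[OF r]]) (use ordered_partitionD(1)[OF product_closed[OF ta op(1)[OF cl]]] in simp)
  have "(\<Sum>rh | cell X rh. incidence cl' rh * action n ta rh cl) = (\<Sum>rh | cell X rh. if rh = ?m ta cl then incidence cl' (?m ta cl) else 0)"
   by (rule sum.cong) (use r in "auto simp: action_def")
  hence L: "(\<Sum>rh | cell X rh. incidence cl' rh * action n ta rh cl) = incidence cl' (?m ta cl)"
   using act fin by simp
  have key: "?m ta rh = pre @ Q # R # post & ?m ta cl = pre @ (Q Un R) # post & action n ta (?m ta rh) rh = 1 \<and>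
    incidence (?m ta rh) (?m ta cl) = incidence rh cl"
   if rh: "cell X rh" "rh = as @ Q # R # bs" "cl = as @ (Q Un R) # bs"
    and pp: "!!xs. [|!!Q. Q : set xs ==> Q <= T; refines {1..n} (set (as @ xs @ bs)) (set ta)|] ==> ?m ta (as @ xs @ bs) = pre @ xs @ post"
    and T: "T : set ta" "Q Un R <= T" for rh as Q R bs T pre post
  proof -
   have rrh: "refines {1..n} (set rh) (set ta)"
    using refines_trans[OF split_refines r[unfolded rh(3)]] rh cl by simp
   have 1: "?m ta cl = pre @ (Q Un R) # post" using pp[of "[Q Un R]"] T r rh(3) by simp
   have 2: "?m ta rh = pre @ Q # R # post" using pp[of "[Q, R]"] T rrh rh(2) by auto
   have d: "distinct (?m ta rh)" using ordered_partitionD(1)[OF product_closed[OF ta op(1)[OF rh(1)]]] .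
   have "incidence (pre @ Q # R # post) (pre @ (Q Un R) # post) = incidence (as @ Q # R # bs) (as @ (Q Un R) # bs)"
   proof (rule incidence_split_cong)
    show "distinct (as @ Q # R # bs)" "{} ~: set (as @ Q # R # bs)" "disjoint (set (as @ Q # R # bs))"
    "!!B. B : set (as @ Q # R # bs) ==> finite B" using good[OF rh(1)] unfolding rh(2) by blast+
    show "distinct (pre @ Q # R # post)" using d unfolding 2 .
    show "set (pre @ Q # R # post) = set (as @ Q # R # bs)" by (metis 2 rh(2) set_product_refined[OF rrh])
   qed
   thus ?thesis using 1 2 rrh rh by (simp add: action_def)
  qed
  have ex: "\<exists>as Q R bs T pre post. rh = as @ Q # R # bs & cl = as @ (Q Un R) # bs & T : set ta & Q Un R <= T \<and>
    ?m ta rh = pre @ Q # R # post & ?m ta cl = pre @ (Q Un R) # post & action n ta (?m ta rh) rh = 1 \<and>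
    incidence (?m ta rh) (?m ta cl) = incidence rh cl & (cell X (as @ R # Q # bs) --> ?m ta (as @ R # Q # bs) = pre @ R # Q # post)"
   if rh: "cell X rh" "incidence rh cl ~= 0" for rh
  proof -
   from rh(2) obtain as Q R bs where s: "rh = as @ Q # R # bs" "cl = as @ (Q Un R) # bs" by (rule incidence_nonzero)
   then obtain T where T: "T : set ta" "Q Un R <= T" using r by (auto simp: refines_def)
   obtain pre post where pp: "!!xs. [|!!Q. Q : set xs ==> Q <= T; refines {1..n} (set (as @ xs @ bs)) (set ta)|] ==> ?m ta (as @ xs @ bs) = pre @ xs @ post"
    using product_within_block[OF ta T(1), of as bs] by blast
   have sw: "?m ta (as @ R # Q # bs) = pre @ R # Q # post" if c: "cell X (as @ R # Q # bs)"
   proof -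
    have "cl = as @ (R Un Q) # bs" using s by (simp add: Un_commute)
    thus ?thesis using key[OF c refl _ pp T(1)] T(2) by blast
   qed
   show ?thesis using key[OF rh(1) s pp T] s T sw by blast
  qed
  have R: "(\<Sum>rh | cell X rh. action n ta cl' rh * incidence rh cl) = incidence cl' (?m ta cl)"
  proof (cases "\<exists>rh. cell X rh & action n ta cl' rh * incidence rh cl ~= 0")
   case True
   then obtain rh where rh: "cell X rh" "action n ta cl' rh ~= 0" "incidence rh cl ~= 0" by auto
   hence m: "?m ta rh = cl'" by (auto simp: action_def split: if_splits)
   from ex[OF rh(1,3)] obtain as Q R bs pre post where s: "rh = as @ Q # R # bs" "cl = as @ (Q Un R) # bs"
    "?m ta rh = pre @ Q # R # post" "action n ta (?m ta rh) rh = 1" "incidence (?m ta rh) (?m ta cl) = incidence rh cl"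
    "cell X (as @ R # Q # bs) --> ?m ta (as @ R # Q # bs) = pre @ R # Q # post" by blast
   have "action n ta cl' rh' * incidence rh' cl = (if rh' = rh then incidence rh cl else 0)" if rh': "cell X rh'" for rh'
   proof (cases "action n ta cl' rh' * incidence rh' cl = 0")
    case True
    thus ?thesis using rh by auto
   next
    case False
    hence nz: "incidence rh' cl ~= 0" and m': "?m ta rh' = cl'" and r': "refines {1..n} (set rh') (set ta)"
    by (auto simp: action_def split: if_splits)
    have rrh: "refines {1..n} (set rh) (set ta)" using rh(2) by (auto simp: action_def split: if_splits)
    have seteq: "set rh' = set rh" using set_product_refined[OF r'] set_product_refined[OF rrh] m m' by simp
    from nz obtain as' Q' R' bs' where s': "rh' = as' @ Q' # R' # bs'" "cl = as' @ (Q' Un R') # bs'" by (rule incidence_nonzero)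
    have "Q' Un R' = Q Un R"
    proof (rule ccontr)
    assume "Q' Un R' ~= Q Un R"
    moreover have "Q Un R : set (as' @ (Q' Un R') # bs')" unfolding s'(2)[symmetric] s(2) by simp
    ultimately have "Q Un R : set rh'" unfolding s'(1) by auto
    thus False using split_notin[of as Q R bs] rh(1) s(1) seteq by simp
    qed
    moreover have "Q' Un R' ~: set as'" "Q' Un R' ~: set as"
    using split_notin[of as' Q' R' bs'] split_notin[of as Q R bs] rh(1) rh' s(1) s'(1) calculation by auto
    ultimately have ab: "as' = as" "bs' = bs"
    using append_Cons_inject[of "Q Un R" as' as bs' bs] s(2) s'(2) by auto
    have "{Q', R'} = set rh' - (set as Un set bs)" using good(1)[OF rh'] s'(1) ab by auto
    moreover have "{Q, R} = set rh - (set as Un set bs)" using good(1)[OF rh(1)] s(1) by auto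
    ultimately have "{Q', R'} = {Q, R}" using seteq by simp
    then consider "Q' = Q" "R' = R" | "Q' = R" "R' = Q" by (auto simp: doubleton_eq_iff)
    hence "rh' = rh"
    proof cases
    case 2
    hence e: "rh' = as @ R # Q # bs" using s'(1) ab by (simp only:)
    hence "?m ta (as @ R # Q # bs) = pre @ R # Q # post" using s(6) rh' by blast
    hence "pre @ R # Q # post = ?m ta rh'" unfolding e by (rule sym)
    also have "... = ?m ta rh" using m m' by (rule trans[OF _ sym, rotated])
    also have "... = pre @ Q # R # post" by (rule s(3))
    finally have "pre @ R # Q # post = pre @ Q # R # post" .
    hence "R # Q # post = Q # R # post" by (rule same_append_eq[THEN iffD1])
    hence "R = Q" by (rule list.inject[THEN iffD1, THEN conjunct1])
    thus ?thesis using e s(1) by (simp only:)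
    qed (use s(1) s'(1) ab in "simp only:")
    thus ?thesis using s(4) m by simp
   qed
   hence "(\<Sum>rh | cell X rh. action n ta cl' rh * incidence rh cl) = (\<Sum>rh' | cell X rh'. if rh' = rh then incidence rh cl else 0)"
    by (intro sum.cong) auto
   thus ?thesis using fin rh(1) s(5) m by simp
  next
   case none: False
   have "incidence cl' (?m ta cl) = 0"
   proof (rule ccontr)
    assume "incidence cl' (?m ta cl) ~= 0"
    then obtain us Q R vs where u: "cl' = us @ Q # R # vs" "?m ta cl = us @ (Q Un R) # vs" by (rule incidence_nonzero)
    hence "Q Un R : set cl" using set_product_refined[OF r] by auto
    then obtain as bs where ab: "cl = as @ (Q Un R) # bs" using split_list by fastforce
    obtain T where T: "T : set ta" "Q Un R <= T" using r ab by (auto simp: refines_def)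
    obtain pre post where pp: "!!xs. [|!!Q. Q : set xs ==> Q <= T; refines {1..n} (set (as @ xs @ bs)) (set ta)|] ==> ?m ta (as @ xs @ bs) = pre @ xs @ post"
    using product_within_block[OF ta T(1), of as bs] by blast
    have setab: "set as Un set bs = set us Un set vs"
    proof -
    have "set as Un set bs = set cl - {Q Un R}" using good(1)[OF cl] ab by auto
    also have "... = set (us @ (Q Un R) # vs) - {Q Un R}" using set_product_refined[OF r] u(2) by simp
    also have "... = set us Un set vs" using good(1)[OF act] u(2) by auto
    finally show ?thesis .
    qed
    let ?rh = "as @ Q # R # bs"
    have dd: "distinct ?rh" using good(1)[OF cl'] good(1)[OF cl] setab u(1) ab by auto
    have c: "cell X ?rh" by (rule cellI[OF dd cl']) (use setab u(1) in auto)
    note k = key[OF c refl ab pp T]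
    have "pre @ (Q Un R) # post = us @ (Q Un R) # vs" using k u(2) by simp
    moreover have "Q Un R ~: set us" using good(1)[OF act] u(2) by simp
    moreover have "Q Un R ~: set pre" using good(1)[OF act] k by simp
    ultimately have "pre = us" "post = vs" using append_Cons_inject[of "Q Un R" pre us post vs] by auto
    hence m: "?m ta ?rh = cl'" using k u(1) by simp
    have a: "action n ta (?m ta ?rh) ?rh = 1" using k by blast
    have i: "incidence (?m ta ?rh) (?m ta cl) = incidence ?rh cl" using k by blast
    have "action n ta cl' ?rh * incidence ?rh cl = incidence cl' (?m ta cl)"
    unfolding a[unfolded m] i[unfolded m] by simp
    thus False using none c \<open>incidence cl' (?m ta cl) ~= 0\<close> by metis
   qed
   moreover have "(\<Sum>rh | cell X rh. action n ta cl' rh * incidence rh cl) = 0" using none by (intro sum.neutral) auto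
   ultimately show ?thesis by simp
  qed
  show ?thesis using L R by simp
 next
  case nr: False
  have "(\<Sum>rh | cell X rh. incidence cl' rh * action n ta rh cl) = 0"
   using nr by (intro sum.neutral) (simp add: action_def)
  moreover have "(\<Sum>rh | cell X rh. action n ta cl' rh * incidence rh cl) = 0"
  proof (cases "\<exists>rh. cell X rh & action n ta cl' rh * incidence rh cl ~= 0")
   case True
   then obtain rh where rh: "cell X rh" "action n ta cl' rh ~= 0" "incidence rh cl ~= 0" by auto
   hence m: "?m ta rh = cl'" and rrh: "refines {1..n} (set rh) (set ta)" by (auto simp: action_def split: if_splits)
   from rh(3) obtain as Q R bs where s: "rh = as @ Q # R # bs" "cl = as @ (Q Un R) # bs" by (rule incidence_nonzero)
   note g = good[OF rh(1)]
   have bad: "~ Q Un R <= T" if "T : set ta" for T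
   proof
    assume "Q Un R <= T"
    hence "refines {1..n} (set cl) (set ta)"
    using rrh that ordered_partitionD(2)[OF op(1)[OF cl]] unfolding refines_def s by auto
    thus False using nr by blast
   qed
   obtain T1 T2 where T1: "T1 : set ta" "Q <= T1" and T2: "T2 : set ta" "R <= T2"
    using rrh unfolding refines_def s by auto
   have T12: "T1 Int T2 = {}" using ordered_partitionD(4)[OF ta T1(1) T2(1)] bad T1 T2 by blast
   have ne: "Q ~= {}" "R ~= {}" using g(2) s(1) by auto
   let ?rh' = "as @ R # Q # bs"
   have c': "cell X ?rh'" by (rule cellI[OF _ rh(1)]) (use g(1) s(1) in auto)
   have set': "set ?rh' = set rh" using s(1) by auto
   have "filter (%P. P <= T) ?rh' = filter (%P. P <= T) rh" if "T : set ta" for T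
    using bad[OF that] s(1) by auto
   hence m': "?m ta ?rh' = cl'"
    unfolding product_sorts[OF rrh[folded set']] m[symmetric] product_sorts[OF rrh]
    by (intro arg_cong[where f = concat] map_cong) auto
   have a: "action n ta cl' rh = 1" "action n ta cl' ?rh' = 1" using m m' rrh set' by (auto simp: action_def)
   have sw: "incidence ?rh' cl = - incidence rh cl" using incidence_swap[OF g[unfolded s(1)]] s by simp
   have neq: "?rh' ~= rh" using g(1) s(1) by auto
   have other: "action n ta cl' \<sigma> * incidence \<sigma> cl = 0" if \<sigma>: "cell X \<sigma>" "\<sigma> ~= rh" "\<sigma> ~= ?rh'" for \<sigma>
   proof (rule ccontr)
    assume "action n ta cl' \<sigma> * incidence \<sigma> cl ~= 0"
    hence nz: "incidence \<sigma> cl ~= 0" and r': "refines {1..n} (set \<sigma>) (set ta)"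
    by (auto simp: action_def split: if_splits)
    from nz obtain as' Q' R' bs' where s': "\<sigma> = as' @ Q' # R' # bs'" "cl = as' @ (Q' Un R') # bs'" by (rule incidence_nonzero)
    have eq: "Q' Un R' = Q Un R"
    proof (rule ccontr)
    assume "Q' Un R' ~= Q Un R"
    moreover have "Q Un R : set (as' @ (Q' Un R') # bs')" unfolding s'(2)[symmetric] s(2) by simp
    ultimately have "Q Un R : set \<sigma>" unfolding s'(1) by auto
    then obtain T where "T : set ta" "Q Un R <= T" using r' unfolding refines_def by blast
    thus False using bad by blast
    qed
    moreover have "Q' Un R' ~: set as'" "Q' Un R' ~: set as"
    using split_notin[of as' Q' R' bs'] split_notin[of as Q R bs] rh(1) \<sigma>(1) s(1) s'(1) calculation by auto
    ultimately have ab: "as' = as" "bs' = bs" using append_Cons_inject[of "Q Un R" as' as bs' bs] s(2) s'(2) by auto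
    obtain T1' T2' where T': "T1' : set ta" "Q' <= T1'" "T2' : set ta" "R' <= T2'"
    using r' unfolding refines_def s' by auto
    have ne': "Q' ~= {}" "R' ~= {}" using good(2)[OF \<sigma>(1)] s'(1) by auto
    have disj: "T Int T' = {}" if "T : set ta" "T' : set ta" "T ~= T'" for T T'
    by (rule ordered_partitionD(4)[OF ta that])
    have cases: "T = T1 \<or> T = T2" if "T : set ta" "A <= T" "A ~= {}" "A <= Q Un R" for T A
    proof (rule ccontr)
    assume "~ (T = T1 \<or> T = T2)"
    hence "T Int T1 = {}" "T Int T2 = {}" using disj[of T T1] disj[of T T2] that T1 T2 by auto
    thus False using that T1 T2 by blast
    qed
    have "T1' = T1 \<or> T1' = T2" by (rule cases[of T1' Q']) (use T' ne' eq in auto)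
    moreover have "T2' = T1 \<or> T2' = T2" by (rule cases[of T2' R']) (use T' ne' eq in auto)
    moreover have "T1' ~= T2'"
    proof
    assume "T1' = T2'"
    hence "Q Un R <= T1'" using T' eq by blast
    thus False using bad T'(1) by blast
    qed
    ultimately consider "T1' = T1" "T2' = T2" | "T1' = T2" "T2' = T1" by blast
    thus False
    proof cases
    case 1
    hence "Q' = Q" "R' = R" using T' eq T1 T2 T12 by blast+
    thus False using \<sigma>(2) s(1) s'(1) ab by auto
    next
    case 2
    hence "Q' = R" "R' = Q" using T' eq T1 T2 T12 by blast+
    thus False using \<sigma>(3) s'(1) ab by auto
    qed
   qed
   have "(\<Sum>\<sigma> | cell X \<sigma>. action n ta cl' \<sigma> * incidence \<sigma> cl) = (\<Sum>\<sigma>\<in>{rh, ?rh'}. action n ta cl' \<sigma> * incidence \<sigma> cl)"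
    by (rule sum.mono_neutral_right[OF fin]) (use rh(1) c' other in auto)
   also have "... = 0" using neq a sw by simp
   finally show ?thesis .
  qed (auto intro: sum.neutral)
  ultimately show ?thesis by simp
 qed
qed

lemma ordered_partition_atoms:
 "l : car (OP n) ==> atoms (set l) & distinct l & partition_on {1..n} (set l)"
 using partition_on_atoms by (auto simp: carrier_ordered_partitions)

definition boundary :: "nat set set => nat set list => nat set list => int" where
 "boundary X cl' cl = (if cell X cl' then incidence cl' cl else 0)"

definition homotopy :: "nat set list => nat set list => nat set list => int" where
 "homotopy l cl' cl = (if cell (set l) cl'
   then block_sign cl' * block_sign cl * contraction l (unit_fun cl) cl' else 0)"

definition vertex_projection :: "nat set list => nat set list => nat set list => int" where
 "vertex_projection l cl' cl = (if cl' = l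
   then block_sign l * block_sign cl * alternating_insertions l (unit_fun cl) else 0)"

lemma block_sign_square: "block_sign cl * block_sign cl = 1"
 by (simp add: block_sign_def inversion_sign_square)

lemma block_sign_cancel: "a * block_sign rh * x * (block_sign rh * b * y) = a * b * (x * y)"
proof -
 have "a * block_sign rh * x * (block_sign rh * b * y) = (block_sign rh * block_sign rh) * (a * b * (x * y))"
  by (simp only: mult_ac)
 thus ?thesis by (simp only: block_sign_square mult_1)
qed

context
 fixes n :: nat and l :: "nat set list"
 assumes l: "l : car (OP n)"
begin

private lemma at: "atoms (set l)" "distinct l" "partition_on {1..n} (set l)"
 using ordered_partition_atoms[OF l] by auto

lemma finite_set_cells: "finite {rh. cell (set l) rh}"
 by (rule finite_cells) simp

lemma delta_expansion:
 assumes "cell (set l) cl'"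
 shows "delta f cl' = (\<Sum>rh | cell (set l) rh. delta (unit_fun rh) cl' * f rh)"
proof (rule linear_local_expansion[where T = "%f. delta f cl'", OF _ _ _ finite_set_cells])
 show "delta f cl' = delta g cl'" if "!!t. t : {rh. cell (set l) rh} ==> f t = g t" for f g
  by (rule delta_local[OF assms]) (use that in blast)
qed (rule delta_linear)+

lemma contraction_expansion:
 assumes "cell (set l) cl'"
 shows "contraction l f cl' = (\<Sum>rh | cell (set l) rh. contraction l (unit_fun rh) cl' * f rh)"
proof (rule linear_local_expansion[where T = "%f. contraction l f cl'", OF _ _ _ finite_set_cells])
 show "contraction l f cl' = contraction l g cl'" if "!!t. t : {rh. cell (set l) rh} ==> f t = g t" for f g
  by (rule contraction_local[OF at(1,2) assms]) (use that in blast)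
qed (rule contraction_linear)+

lemma boundary_boundary:
 assumes "cell (set l) cl"
 shows "(\<Sum>rh | cell (set l) rh. boundary (set l) cl' rh * boundary (set l) rh cl) = 0"
proof (cases "cell (set l) cl'")
 case True
 hence "(\<Sum>rh | cell (set l) rh. boundary (set l) cl' rh * boundary (set l) rh cl) =
   (\<Sum>rh | cell (set l) rh. block_sign cl' * block_sign cl * (delta (unit_fun rh) cl' * delta (unit_fun cl) rh))"
  by (intro sum.cong refl) (simp add: boundary_def incidence_def block_sign_cancel)
 also have "... = block_sign cl' * block_sign cl * delta (delta (unit_fun cl)) cl'"
  by (simp only: delta_expansion[OF True, of "delta (unit_fun cl)"] sum_distrib_left)
 finally show ?thesis by (simp add: delta_delta)
qed (simp add: boundary_def)

text \<open>The identity \<open>\<partial> s + s \<partial> = 1 - p\<close> of \<open>contraction_homotopy\<close> in terms of matrices, where \<open>p\<close> is concentrated at the vertex \<open>l\<close>.\<close>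

lemma boundary_homotopy:
 assumes cl: "cell (set l) cl" and cl': "cell (set l) cl'"
 shows "(\<Sum>rh | cell (set l) rh. boundary (set l) cl' rh * homotopy l rh cl) +
   (\<Sum>rh | cell (set l) rh. homotopy l cl' rh * boundary (set l) rh cl) =
  (if cl' = cl then 1 else 0) - vertex_projection l cl' cl"
proof -
 let ?c = "block_sign cl' * block_sign cl"
 have "(\<Sum>rh | cell (set l) rh. boundary (set l) cl' rh * homotopy l rh cl) =
   (\<Sum>rh | cell (set l) rh. ?c * (delta (unit_fun rh) cl' * contraction l (unit_fun cl) rh))"
  using cl' by (intro sum.cong refl) (simp add: boundary_def incidence_def homotopy_def block_sign_cancel)
 also have "... = ?c * delta (contraction l (unit_fun cl)) cl'"
  by (simp only: delta_expansion[OF cl', of "contraction l (unit_fun cl)"] sum_distrib_left)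
 finally have 1: "(\<Sum>rh | cell (set l) rh. boundary (set l) cl' rh * homotopy l rh cl) = ?c * delta (contraction l (unit_fun cl)) cl'" .
 have "(\<Sum>rh | cell (set l) rh. homotopy l cl' rh * boundary (set l) rh cl) =
   (\<Sum>rh | cell (set l) rh. ?c * (contraction l (unit_fun rh) cl' * delta (unit_fun cl) rh))"
  using cl' by (intro sum.cong refl) (simp add: boundary_def incidence_def homotopy_def block_sign_cancel)
 also have "... = ?c * contraction l (delta (unit_fun cl)) cl'"
  by (simp only: contraction_expansion[OF cl', of "delta (unit_fun cl)"] sum_distrib_left)
 finally have 2: "(\<Sum>rh | cell (set l) rh. homotopy l cl' rh * boundary (set l) rh cl) = ?c * contraction l (delta (unit_fun cl)) cl'" .
 have "?c * delta (contraction l (unit_fun cl)) cl' + ?c * contraction l (delta (unit_fun cl)) cl' =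
   ?c * (unit_fun cl cl' - (if cl' = l then alternating_insertions l (unit_fun cl) else 0))"
  using contraction_homotopy[OF at(1,2) cl', of "unit_fun cl"] by (simp only: distrib_left[symmetric])
 also have "... = (if cl' = cl then 1 else 0) - vertex_projection l cl' cl"
  by (simp add: unit_fun_def vertex_projection_def right_diff_distrib block_sign_square)
 finally show ?thesis unfolding 1 2 .
qed

lemma boundary_length: "boundary (set l) cl' cl ~= 0 ==> length cl' = Suc (length cl)"
 by (auto simp: boundary_def incidence_length split: if_splits)

lemma homotopy_length:
 assumes "homotopy l cl' cl ~= 0" shows "length cl = Suc (length cl')"
proof (rule ccontr)
 assume ne: "length cl ~= Suc (length cl')"
 have "contraction l (unit_fun cl) cl' = 0"
  by (rule contraction_length) (use ne in "auto simp: unit_fun_def")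
 with assms show False by (simp add: homotopy_def split: if_splits)
qed

lemma vertex_projection_length:
 assumes "vertex_projection l cl' cl ~= 0" shows "cl' = l & length cl = length l"
proof -
 have "alternating_insertions l (unit_fun cl) = 0" if "length cl ~= length l"
  by (rule alternating_insertions_length) (use that in "auto simp: unit_fun_def")
 thus ?thesis using assms by (auto simp: vertex_projection_def split: if_splits)
qed

lemma cell_l: "cell (set l) l"
 by (rule cell_atoms[OF at(1,2)])

lemma cell_ordered_partition: "cell (set l) cl \<longleftrightarrow> cl : car (OP n) & refines {1..n} (set l) (set cl)"
 by (rule cell_iff_ordered_partition[OF at(3)])

lemma action_nonzeroD:
 assumes "action n ta cl' cl ~= 0" "ta : car (OP n)" "cell (set l) cl"
 shows "refines {1..n} (set cl) (set ta)" "cl' = ta \<otimes>\<^sub>(OP n) cl" "set cl' = set cl" "cell (set l) cl'"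
  "length cl' = length cl" "refines {1..n} (set l) (set ta)"
proof -
 note c = assms(3)[unfolded cell_ordered_partition]
 show r: "refines {1..n} (set cl) (set ta)" and e: "cl' = ta \<otimes>\<^sub>(OP n) cl"
  using assms(1) by (auto simp: action_def split: if_splits)
 show s: "set cl' = set cl" unfolding e by (rule set_product_refined[OF r])
 have o: "cl' : car (OP n)" unfolding e using product_closed[OF assms(2)] c by blast
 thus "cell (set l) cl'" using c s by (simp add: cell_ordered_partition)
 show "length cl' = length cl"
  using distinct_card[OF ordered_partitionD(1)[OF o]] distinct_card[of cl] ordered_partitionD(1)[of cl n] c s by simp
 show "refines {1..n} (set l) (set ta)" using refines_trans[OF conjunct2[OF c] r] .
qed

lemma action_one: "cell (set l) cl ==> action n \<one>\<^sub>(OP n) cl' cl = (if cl' = cl then 1 else 0)"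
 using refines_one[of n "set cl"] monoid.l_one[OF monoid_ordered_partitions, of cl] ordered_partitionD(2)[of cl n]
 by (auto simp: action_def cell_ordered_partition)

lemma action_product:
 assumes ta: "ta : car (OP n)" and ta': "ta' : car (OP n)" and cl: "cell (set l) cl"
 shows "(\<Sum>rh | cell (set l) rh. action n ta cl' rh * action n ta' rh cl) = action n (ta \<otimes>\<^sub>(OP n) ta') cl' cl"
proof (cases "refines {1..n} (set cl) (set ta')")
 case r: True
 let ?rh = "ta' \<otimes>\<^sub>(OP n) cl"
 have a: "action n ta' ?rh cl = 1" using r by (simp add: action_def)
 have "(\<Sum>rh | cell (set l) rh. action n ta cl' rh * action n ta' rh cl) = (\<Sum>rh | cell (set l) rh. if rh = ?rh then action n ta cl' ?rh else 0)"
  by (intro sum.cong refl) (use r in "auto simp: action_def")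
 also have "... = action n ta cl' ?rh"
  using finite_set_cells action_nonzeroD(4)[of ta' ?rh cl] a ta' cl by simp
 also have "... = action n (ta \<otimes>\<^sub>(OP n) ta') cl' cl"
  using monoid.m_assoc[OF monoid_ordered_partitions ta ta'] cl r refines_product_iff[OF ta ta', of "set cl"]
  by (simp add: action_def set_product_refined[OF r] cell_ordered_partition)
 finally show ?thesis .
next
 case False
 hence "action n (ta \<otimes>\<^sub>(OP n) ta') cl' cl = 0"
  using refines_product_iff[OF ta ta', of "set cl"] by (simp add: action_def)
 moreover have "action n ta' rh cl = 0" for rh using False by (simp add: action_def)
 ultimately show ?thesis by simp
qed

lemma boundary_equivariant:
 assumes ta: "ta : car (OP n)" and cl: "cell (set l) cl"
 shows "(\<Sum>rh | cell (set l) rh. boundary (set l) cl' rh * action n ta rh cl) =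
  (\<Sum>rh | cell (set l) rh. action n ta cl' rh * boundary (set l) rh cl)"
proof (cases "cell (set l) cl'")
 case True
 have "(\<Sum>rh | cell (set l) rh. action n ta cl' rh * boundary (set l) rh cl) = (\<Sum>rh | cell (set l) rh. action n ta cl' rh * incidence rh cl)"
  by (intro sum.cong refl) (simp add: boundary_def)
 thus ?thesis using incidence_equivariant[OF at(3) ta True cl] True by (simp add: boundary_def)
next
 case False
 have "action n ta cl' rh = 0" if "cell (set l) rh" for rh
  using action_nonzeroD(4)[of ta cl' rh] ta that False by auto
 thus ?thesis using False by (simp add: boundary_def)
qed

text \<open>The edges of the permutohedron have boundary \<open>0\<close> under the augmentation: act with \<open>l\<close>, which
  annihilates the edges and identifies the vertices.\<close>

text \<open>A coarsening with as many blocks is not a proper one.\<close>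

lemma cell_full_length:
 assumes rh: "cell (set l) rh" and len: "length rh = length l"
 shows "refines {1..n} (set rh) (set l)" "set rh = set l"
proof -
 note c = rh[unfolded cell_ordered_partition]
 have "card (set rh) = card (set l)"
  using distinct_card[of rh] distinct_card[of l] ordered_partitionD(1)[of rh n] c at(2) len by simp
 moreover have "\<exists>a\<in>set l. a <= P" if P: "P : set rh" for P
 proof -
  obtain B where "B <= set l" "B ~= {}" "P = \<Union>B" using cell_mem[OF rh P] by auto
  thus ?thesis by auto
 qed
 then obtain f where f: "!!P. P : set rh ==> f P : set l & f P <= P" by metis
 have inj: "inj_on f (set rh)"
 proof (rule inj_onI)
  fix P Q assume PQ: "P : set rh" "Q : set rh" "f P = f Q"
  have "f P ~= {}" using f[OF PQ(1)] at(1) by (auto simp: atoms_def)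
  moreover have "f P <= P Int Q" using f PQ by auto
  ultimately show "P = Q" using ordered_partitionD(4)[OF conjunct1[OF c] PQ(1,2)] by auto
 qed
 have fim: "f ` set rh = set l"
  using calculation f card_image[OF inj] by (intro card_subset_eq) auto
 have "P <= f P" if P: "P : set rh" for P
 proof
  fix x assume x: "x : P"
  obtain B where B: "B <= set l" "P = \<Union>B" using cell_mem[OF rh P] by auto
  then obtain b where b: "b : B" "x : b" using x by auto
  hence "b : f ` set rh" using fim B by auto
  then obtain Q where Q: "Q : set rh" "b = f Q" by blast
  hence "x : Q" using f b by auto
  hence "Q = P" using ordered_partitionD(4)[OF conjunct1[OF c] Q(1) P] x by auto
  thus "x : f P" using Q b by simp
 qed
 thus r: "refines {1..n} (set rh) (set l)"
  using f at(3) ordered_partitionD(2)[OF conjunct1[OF c]] unfolding refines_def by blast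
 show "set rh = set l" using refines_asym[OF r conjunct2[OF c]] by simp
qed

lemma boundary_augmentation:
 assumes cl: "cell (set l) cl" and len: "length cl < length l"
 shows "(\<Sum>rh | cell (set l) rh & length rh = length l. boundary (set l) rh cl) = 0"
proof -
 have nr: "~ refines {1..n} (set cl) (set l)"
 proof
  assume "refines {1..n} (set cl) (set l)"
  hence "set cl = set l" using refines_asym[OF _ conjunct2[OF cl[unfolded cell_ordered_partition]]] by simp
  hence "length cl = length l"
   using distinct_card[of cl] distinct_card[of l] ordered_partitionD(1)[of cl n] cl at(2) by (simp add: cell_ordered_partition)
  thus False using len by simp
 qed
 have a: "action n l l rh = (if length rh = length l then 1 else 0)" if rh: "cell (set l) rh" for rh
 proof (cases "length rh = length l")
  case True
  note c = rh[unfolded cell_ordered_partition]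
  have "refines {1..n} (set rh) (set l)" by (rule cell_full_length(1)[OF rh True])
  moreover have "l \<otimes>\<^sub>(OP n) rh = l"
   by (rule product_absorb[OF l conjunct2[OF c] ordered_partitionD(1)[OF conjunct1[OF c]]])
  ultimately show ?thesis using True by (simp add: action_def)
 next
  case False
  thus ?thesis using action_nonzeroD(5)[of l l rh] l rh by auto
 qed
 have "(\<Sum>rh | cell (set l) rh & length rh = length l. boundary (set l) rh cl) =
   (\<Sum>rh | cell (set l) rh. action n l l rh * boundary (set l) rh cl)"
  by (rule sum.mono_neutral_cong_left[OF finite_set_cells]) (auto simp: a)
 also have "... = (\<Sum>rh | cell (set l) rh. boundary (set l) l rh * action n l rh cl)"
  by (rule boundary_equivariant[OF l cl, symmetric])
 also have "... = 0" using nr by (simp add: action_def)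
 finally show ?thesis .
qed

end

section \<open>Integer matrices acting on functions into abelian groups\<close>

context abelian_group
begin

lemma int_scale_closed [simp, intro]: "x : car G ==> add_pow G (i::int) x : car G"
 using group.int_pow_closed[OF a_group, of x i] by (simp add: add_pow_def)

lemma int_scale_0 [simp]: "add_pow G (0::int) x = \<zero>"
 by (simp add: add_pow_def)

lemma int_scale_1 [simp]: "x : car G ==> add_pow G (1::int) x = x"
 using group.int_pow_1[OF a_group, of x] by (simp add: add_pow_def)

lemma int_scale_zero [simp]: "add_pow G (i::int) \<zero> = \<zero>"
 using group.int_pow_one[OF a_group, of i] by (simp add: add_pow_def)

lemma int_scale_add: "x : car G ==> add_pow G (i + j :: int) x = add_pow G i x \<oplus> add_pow G j x"
 using group.int_pow_mult[OF a_group, of x i j] by (simp add: add_pow_def)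

lemma int_scale_mult: "x : car G ==> add_pow G (i * j :: int) x = add_pow G i (add_pow G j x)"
 using group.int_pow_pow[OF a_group, of x j i] by (simp add: add_pow_def mult.commute)

lemma int_scale_distrib:
 "[|x : car G; y : car G|] ==> add_pow G (i::int) (x \<oplus> y) = add_pow G i x \<oplus> add_pow G i y"
 using group.int_pow_mult_distrib[OF a_group, of x y i] by (simp add: add_pow_def a_comm)

lemma int_scale_finsum:
 assumes "f : I \<rightarrow> car G"
 shows "add_pow G (i::int) (\<Oplus>k\<in>I. f k) = (\<Oplus>k\<in>I. add_pow G i (f k))"
 using assms by (induction I rule: infinite_finite_induct) (auto simp: int_scale_distrib Pi_def)

lemma int_scale_sum:
 assumes "x : car G"
 shows "add_pow G (\<Sum>k\<in>I. f k :: int) x = (\<Oplus>k\<in>I. add_pow G (f k) x)"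
proof (induction I rule: infinite_finite_induct)
 case (insert k I)
 thus ?case using assms by (simp add: int_scale_add Pi_def)
qed (use assms in auto)

lemma finsum_swap:
 assumes "!!i j. [|i : I; j : J|] ==> f i j : car G"
 shows "(\<Oplus>i\<in>I. \<Oplus>j\<in>J. f i j) = (\<Oplus>j\<in>J. \<Oplus>i\<in>I. f i j)"
 using assms
proof (induction I rule: infinite_finite_induct)
 case (insert i I)
 have "(\<Oplus>j\<in>J. f i j \<oplus> (\<Oplus>i\<in>I. f i j)) = (\<Oplus>j\<in>J. f i j) \<oplus> (\<Oplus>j\<in>J. \<Oplus>i\<in>I. f i j)"
  using insert.prems by (intro finsum_addf) auto
 moreover have "(\<Oplus>j\<in>J. \<Oplus>i\<in>insert i I. f i j) = (\<Oplus>j\<in>J. f i j \<oplus> (\<Oplus>i\<in>I. f i j))"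
  using insert by (intro finsum_cong') auto
 ultimately show ?case using insert by (simp add: Pi_def)
qed simp_all

end

lemma additive_int_scale:
 assumes U: "abelian_group U" and U': "abelian_group U'"
  and f: "!!x. x : car U ==> f x : car U'"
   "!!x y. [|x : car U; y : car U|] ==> f (x \<oplus>\<^sub>U y) = f x \<oplus>\<^sub>U' f y"
  and x: "x : car U"
 shows "f (add_pow U (i::int) x) = add_pow U' i (f x)"
proof -
 interpret h: group_hom "add_monoid U" "add_monoid U'" f
  using f by (auto simp: group_hom_def group_hom_axioms_def abelian_group.a_group U U' hom_def)
 show ?thesis using h.hom_int_pow[of x i] x by (simp add: add_pow_def)
qed

text \<open>Integer matrices act on functions into an abelian group, so that the identities between the matrices of the permutohedron hold with any coefficients.\<close>

definition mat_act ::
 "('u, 'e) ring_scheme => 'b set => ('b => 'b => int) => ('b => 'u) => 'b => 'u" where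
 "mat_act U C N f b' = (\<Oplus>\<^bsub>U\<^esub>b\<in>C. add_pow U (N b' b) (f b))"

context abelian_group
begin

lemma mat_act_closed [simp, intro]: "(!!b. b : C ==> f b : car G) ==> mat_act G C N f b' : car G"
 unfolding mat_act_def by (rule finsum_closed) auto

lemma mat_act_cong:
 assumes "!!b. b : C ==> N b' b = N' b' b" "!!b. b : C ==> N' b' b ~= 0 ==> f b = g b" "!!b. b : C ==> g b : car G"
 shows "mat_act G C N f b' = mat_act G C N' g b'"
 unfolding mat_act_def
proof (rule finsum_cong')
 show "add_pow G (N b' b) (f b) = add_pow G (N' b' b) (g b)" if "b : C" for b
  using assms that by (cases "N' b' b = 0") auto
qed (use assms in auto)

lemma mat_act_comp:
 assumes f: "!!b. b : C ==> f b : car G"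
 shows "mat_act G C N (mat_act G C N' f) b' = mat_act G C (%b' b. \<Sum>c\<in>C. N b' c * N' c b) f b'"
proof -
 have "mat_act G C N (mat_act G C N' f) b' = (\<Oplus>c\<in>C. \<Oplus>b\<in>C. add_pow G (N b' c * N' c b) (f b))"
  unfolding mat_act_def
  by (intro finsum_cong') (auto simp: int_scale_finsum Pi_def f int_scale_mult intro!: finsum_cong')
 also have "... = (\<Oplus>b\<in>C. \<Oplus>c\<in>C. add_pow G (N b' c * N' c b) (f b))"
  by (rule finsum_swap) (use f in auto)
 also have "... = mat_act G C (%b' b. \<Sum>c\<in>C. N b' c * N' c b) f b'"
  unfolding mat_act_def by (intro finsum_cong') (auto simp: int_scale_sum f)
 finally show ?thesis .
qed

lemma mat_act_add:
 assumes "!!b. b : C ==> f b : car G" "!!b. b : C ==> g b : car G"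
 shows "mat_act G C N (%b. f b \<oplus> g b) b' = mat_act G C N f b' \<oplus> mat_act G C N g b'"
proof -
 have "mat_act G C N (%b. f b \<oplus> g b) b' = (\<Oplus>b\<in>C. add_pow G (N b' b) (f b) \<oplus> add_pow G (N b' b) (g b))"
  unfolding mat_act_def by (intro finsum_cong') (auto simp: int_scale_distrib assms)
 also have "... = mat_act G C N f b' \<oplus> mat_act G C N g b'"
  unfolding mat_act_def by (rule finsum_addf) (auto simp: assms)
 finally show ?thesis .
qed

lemma mat_act_matrix_add:
 assumes "!!b. b : C ==> f b : car G"
 shows "mat_act G C (%b' b. N b' b + N' b' b) f b' = mat_act G C N f b' \<oplus> mat_act G C N' f b'"
proof -
 have "mat_act G C (%b' b. N b' b + N' b' b) f b' = (\<Oplus>b\<in>C. add_pow G (N b' b) (f b) \<oplus> add_pow G (N' b' b) (f b))"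
  unfolding mat_act_def by (intro finsum_cong') (auto simp: int_scale_add assms)
 also have "... = mat_act G C N f b' \<oplus> mat_act G C N' f b'"
  unfolding mat_act_def by (rule finsum_addf) (auto simp: assms)
 finally show ?thesis .
qed

lemma mat_act_zero: "(!!b. b : C ==> N b' b ~= 0 ==> f b = \<zero>) ==> mat_act G C N f b' = \<zero>"
 unfolding mat_act_def by (rule add.finprod_one_eqI) (metis int_scale_0 int_scale_zero)

lemma mat_act_identity:
 assumes "finite C" "b' : C" "!!b. b : C ==> f b : car G"
 shows "mat_act G C (%b' b. if b' = b then 1 else 0) f b' = f b'"
proof -
 have "mat_act G C (%b' b. if b' = b then 1 else 0) f b' = (\<Oplus>b\<in>C. if b' = b then f b else \<zero>)"
  unfolding mat_act_def by (intro finsum_cong') (use assms in auto)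
 also have "... = f b'" using finsum_singleton[of b' C f] assms by auto
 finally show ?thesis .
qed

lemma mat_act_single:
 assumes "finite C" "c : C" "u : car G"
 shows "mat_act G C N (%b. if b = c then u else \<zero>) b' = add_pow G (N b' c) u"
proof -
 have "mat_act G C N (%b. if b = c then u else \<zero>) b' = (\<Oplus>b\<in>C. if c = b then add_pow G (N b' b) u else \<zero>)"
  unfolding mat_act_def by (intro finsum_cong') (use assms in auto)
 also have "... = add_pow G (N b' c) u" using finsum_singleton[of c C "%b. add_pow G (N b' b) u"] assms by auto
 finally show ?thesis .
qed

end

lemma mat_act_natural:
 assumes U: "abelian_group U" and U': "abelian_group U'"
  and h: "!!x. x : car U ==> h x : car U'"
   "!!x y. [|x : car U; y : car U|] ==> h (x \<oplus>\<^sub>U y) = h x \<oplus>\<^sub>U' h y"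
  and f: "!!b. b : C ==> f b : car U"
 shows "h (mat_act U C N f b') = mat_act U' C N (%b. h (f b)) b'"
proof -
 interpret U: abelian_group U by fact
 interpret U': abelian_group U' by fact
 have h0: "h \<zero>\<^sub>U = \<zero>\<^sub>U'"
  using h(1)[of "\<zero>\<^sub>U"] h(2)[of "\<zero>\<^sub>U" "\<zero>\<^sub>U"] by (simp add: U'.add.r_cancel_one')
 have "D <= C ==> h (\<Oplus>\<^bsub>U\<^esub>b\<in>D. add_pow U (N b' b) (f b)) = (\<Oplus>\<^bsub>U'\<^esub>b\<in>D. add_pow U' (N b' b) (h (f b)))" for D
 proof (induction D rule: infinite_finite_induct)
  case (insert b D)
  thus ?case
   using f h by (simp add: Pi_def subset_iff additive_int_scale[OF U U'])
 qed (simp_all add: h0)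
 thus ?thesis unfolding mat_act_def by blast
qed

section \<open>Corner modules over the maximal subgroups\<close>

lemma single_mult_at:
 assumes K: "ring K" and M: "monoid M" and b: "b : finsupp K C" and k: "k : car K"
  and y: "!!y'. b y' ~= \<zero>\<^sub>K ==> x \<otimes>\<^sub>M y' = z \<longleftrightarrow> y' = y"
 shows "(single K x k \<otimes>\<^sub>(alg K M) b) z = k \<otimes>\<^sub>K b y"
proof -
 interpret K: ring K by fact
 have s: "single K x k : finsupp K {x}" using k by (simp add: K.single_finsupp)
 have "(single K x k \<otimes>\<^sub>(alg K M) b) z =
   (\<Oplus>\<^bsub>K\<^esub>p\<in>{p : {x} \<times> supp K b. fst p \<otimes>\<^sub>M snd p = z}. single K x k (fst p) \<otimes>\<^sub>K b (snd p))"
  by (rule mult_alg[OF K M s b _ supp_subset[OF s] finite_supp[OF b] order_refl]) simp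
 also have "... = k \<otimes>\<^sub>K b y"
 proof (cases "b y = \<zero>\<^sub>K")
  case True
  hence e: "{p : {x} \<times> supp K b. fst p \<otimes>\<^sub>M snd p = z} = {}" using y by (auto simp: supp_def)
  show ?thesis unfolding e using True k by simp
 next
  case False
  have "p : {p : {x} \<times> supp K b. fst p \<otimes>\<^sub>M snd p = z} \<longleftrightarrow> p = (x, y)" for p
   using y[of "snd p"] y[of y] False by (cases p) (auto simp: supp_def)
  hence e: "{p : {x} \<times> supp K b. fst p \<otimes>\<^sub>M snd p = z} = {(x, y)}" by blast
  show ?thesis unfolding e using k finsupp_closed[OF b] by (simp add: single_def)
 qed
 finally show ?thesis .
qed

lemma single_mult_outside:
 assumes K: "ring K" and M: "monoid M" and b: "b : finsupp K C" and k: "k : car K"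
  and y: "!!y'. b y' ~= \<zero>\<^sub>K ==> x \<otimes>\<^sub>M y' ~= z"
 shows "(single K x k \<otimes>\<^sub>(alg K M) b) z = \<zero>\<^sub>K"
proof -
 interpret K: ring K by fact
 have s: "single K x k : finsupp K {x}" using k by (simp add: K.single_finsupp)
 have "(single K x k \<otimes>\<^sub>(alg K M) b) z =
   (\<Oplus>\<^bsub>K\<^esub>p\<in>{p : {x} \<times> supp K b. fst p \<otimes>\<^sub>M snd p = z}. single K x k (fst p) \<otimes>\<^sub>K b (snd p))"
  by (rule mult_alg[OF K M s b _ supp_subset[OF s] finite_supp[OF b] order_refl]) simp
 moreover have e: "{p : {x} \<times> supp K b. fst p \<otimes>\<^sub>M snd p = z} = {}" using y by (auto simp: supp_def)
 ultimately show ?thesis unfolding e by simp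
qed

declare One_nat_def [simp del] one_product_group [simp del] mult_product_group [simp del] carrier_product_group [simp del]

locale hsiao_algebra =
 fixes n :: nat and G :: "'g monoid" and K :: "'k ring"
 assumes G: "group G" and finite_G: "finite (car G)" and K: "field K"
begin

abbreviation M where "M \<equiv> hsiao_monoid n G"
abbreviation A where "A \<equiv> alg K M"
abbreviation S where "S \<equiv> OP n"
abbreviation Gn where "Gn \<equiv> product_group {1..n} (%_. G)"
abbreviation H where "H \<equiv> block_group n G"
abbreviation leq where "leq \<equiv> refines {1..n}"

text \<open>\<open>elem N ta g k x\<close> is \<open>k \<cdot> (ta, g) \<cdot> x\<close> in the module \<open>N\<close>.\<close>

abbreviation elem :: "(nat set list \<times> (nat => 'g) => 'k, 'x) module => nat set list => (nat => 'g) => 'k => 'x => 'x" where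
 "elem N ta g k x \<equiv> single K (ta, g) k \<odot>\<^sub>N x"

sublocale K: field K by (rule K)
sublocale Gn: group Gn using G by simp
sublocale S: monoid S by (rule monoid_ordered_partitions)
sublocale M: monoid M by (rule monoid_hsiao_monoid[OF G])

lemma K_ring: "ring K" and K_cring: "cring K"
 by (rule K.ring_axioms) (rule K.is_cring)

lemma M_iff: "(ta, g) : car M \<longleftrightarrow> ta : car S & g : car (H (set ta))"
 by (simp add: carrier_hsiao_monoid carrier_block_group)

lemma M_mult: "(ta, g) \<otimes>\<^sub>M (ta', g') = (ta \<otimes>\<^sub>S ta', g \<otimes>\<^sub>Gn g')"
 by (simp add: mult_hsiao_monoid)

lemma H_group: "partition_on {1..n} Z ==> group (H Z)"
 by (rule group_block_group[OF G]) (auto simp: partition_on_def)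

lemma H_mono: "leq X Y ==> g : car (H Y) ==> g : car (H X)"
 using block_group_mono[OF G] by blast

lemma H_Gn: "g : car (H Z) ==> g : car Gn"
 by (simp add: carrier_block_group)

lemma H_one: "partition_on {1..n} Z ==> \<one>\<^sub>Gn : car (H Z)"
 using monoid.one_closed[OF group.is_monoid[OF H_group]] by simp

lemma H_mult: "partition_on {1..n} Z ==> g : car (H Z) ==> h : car (H Z) ==> g \<otimes>\<^sub>Gn h : car (H Z)"
 using monoid.m_closed[OF group.is_monoid[OF H_group], of Z g h] by simp

lemma S_part: "ta : car S ==> partition_on {1..n} (set ta)"
 by (rule ordered_partitionD(2))

lemma leq_part: "leq X Y ==> partition_on {1..n} X & partition_on {1..n} Y"
 by (simp add: refines_def)

lemma elem_in_M: "ta : car S ==> leq (set ta) Z ==> g : car (H Z) ==> (ta, g) : car M"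
 by (simp add: M_iff H_mono)

lemma one_in_M: "ta : car S ==> (ta, \<one>\<^sub>Gn) : car M"
 by (simp add: M_iff H_one S_part)

lemma S_idem: "ta : car S ==> ta \<otimes>\<^sub>S ta = ta"
 by (intro product_absorb refines_refl S_part ordered_partitionD(1))

lemma S_absorb: "ta : car S ==> leq (set ta) (set ta') ==> ta' : car S ==> ta \<otimes>\<^sub>S ta' = ta"
 by (intro product_absorb ordered_partitionD(1))

lemma S_leq_product:
 "ta : car S ==> ta' : car S ==> leq Z (set (ta \<otimes>\<^sub>S ta')) \<longleftrightarrow> leq Z (set ta) & leq Z (set ta')"
 by (rule refines_product_iff)

lemma S_regular: "ta : car S ==> ta' : car S ==> ta \<otimes>\<^sub>S ta' \<otimes>\<^sub>S ta = ta \<otimes>\<^sub>S ta'"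
 using S_leq_product[of ta ta' "set (ta \<otimes>\<^sub>S ta')"] refines_refl[OF S_part[OF S.m_closed]]
 by (intro S_absorb) auto

lemma elem_closed:
 assumes "left_module A N" "(ta, g) : car M" "k : car K" "x : car N"
 shows "elem N ta g k x : car N"
proof -
 interpret N: left_module A N by fact
 show ?thesis using assms(2-4) single_closed[OF K_ring M.monoid_axioms] by simp
qed

lemma elem_elem:
 assumes "left_module A N" "(ta, g) : car M" "k : car K" "(ta', g') : car M" "k' : car K" "x : car N"
 shows "elem N ta g k (elem N ta' g' k' x) = elem N (ta \<otimes>\<^sub>S ta') (g \<otimes>\<^sub>Gn g') (k \<otimes>\<^sub>K k') x"
proof -
 interpret N: left_module A N by fact
 show ?thesis
  using assms(2-6) single_closed[OF K_ring M.monoid_axioms]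
   N.smult_assoc1[of "single K (ta, g) k" "single K (ta', g') k'" x]
   mult_single_single[OF K_ring M.monoid_axioms, of k k' "(ta, g)" "(ta', g')"]
  by (simp add: M_mult)
qed

lemma elem_add:
 assumes "left_module A N" "(ta, g) : car M" "k : car K" "x : car N" "y : car N"
 shows "elem N ta g k (x \<oplus>\<^sub>N y) = elem N ta g k x \<oplus>\<^sub>N elem N ta g k y"
 using left_module.smult_r_distr[OF assms(1) single_closed[OF K_ring M.monoid_axioms assms(2,3)] assms(4,5)] .

lemma elem_zero:
 assumes "left_module A N" "(ta, g) : car M" "k : car K"
 shows "elem N ta g k \<zero>\<^sub>N = \<zero>\<^sub>N"
 using left_module.smult_r_null[OF assms(1) single_closed[OF K_ring M.monoid_axioms assms(2,3)]] .

lemma elem_neg: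
 assumes "left_module A N" "(ta, g) : car M" "k : car K" "x : car N"
 shows "elem N ta g k (\<ominus>\<^sub>N x) = \<ominus>\<^sub>N elem N ta g k x"
 using left_module.smult_r_minus[OF assms(1) single_closed[OF K_ring M.monoid_axioms assms(2,3)] assms(4)] .

lemma elem_hom:
 assumes "f : mod_hom A N N'" "(ta, g) : car M" "k : car K" "x : car N"
 shows "f (elem N ta g k x) = elem N' ta g k (f x)"
 using mod_hom_smult[OF assms(1) single_closed[OF K_ring M.monoid_axioms assms(2,3)] assms(4)] .

text \<open>The submodule over \<open>K G\<^sub>Z\<close> of a \<open>K\<Sigma>\<^sub>n\<^sup>G\<close>-module \<open>N\<close> on an additive subgroup \<open>C\<close> on which
  the idempotent \<open>(l, \<one>)\<close> acts as the identity; \<open>g\<close> acts as \<open>(l, g)\<close>.\<close>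

definition corner :: "(nat set list \<times> (nat => 'g) => 'k, 'x) module => nat set list => 'x set => ((nat => 'g) => 'k, 'x) module" where
 "corner N l C = restrict_scalars N C (alg_map K M (%g. (l, g)))"

lemma corner_simps [simp]:
 "car (corner N l C) = C" "\<zero>\<^sub>(corner N l C) = \<zero>\<^sub>N" "x \<oplus>\<^sub>(corner N l C) y = x \<oplus>\<^sub>N y"
 by (simp_all add: corner_def)

lemma
 assumes l: "l : car S" and lZ: "leq (set l) Z"
 shows corner_embedding: "!!g. g : car (H Z) ==> (l, g) : car M"
  and corner_embedding_mult: "!!g h. [|g : car (H Z); h : car (H Z)|] ==> (l, g \<otimes>\<^sub>(H Z) h) = (l, g) \<otimes>\<^sub>M (l, h)"
 using block_group_embedding[OF G l lZ] by blast+

lemma corner_elem: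
 assumes l: "l : car S" and lZ: "leq (set l) Z" and g: "g : car (H Z)" and k: "k : car K"
 shows "single K g k \<odot>\<^sub>(corner N l C) x = elem N l g k x"
proof -
 have "alg_map K M (%g. (l, g)) (single K g k) = single K (l, g) k"
  by (rule alg_map_single[OF K_ring M.monoid_axioms group.is_monoid[OF H_group] corner_embedding[OF l lZ] corner_embedding_mult[OF l lZ] g k])
   (use leq_part[OF lZ] in auto)
 thus ?thesis by (simp add: corner_def)
qed

lemma left_module_corner:
 assumes N: "left_module A N" and l: "l : car S" and lZ: "leq (set l) Z"
  and C: "C <= car N" "\<zero>\<^sub>N : C" "!!x y. [|x : C; y : C|] ==> x \<oplus>\<^sub>N y : C" "!!x. x : C ==> \<ominus>\<^sub>N x : C"
  and smult: "!!g k x. [|g : car (H Z); k : car K; x : C|] ==> elem N l g k x : C"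
  and one: "!!x. x : C ==> elem N l \<one>\<^sub>Gn \<one>\<^sub>K x = x"
 shows "left_module (alg K (H Z)) (corner N l C)"
proof -
 interpret N: left_module A N by fact
 interpret HZ: group "H Z" using H_group leq_part[OF lZ] by blast
 let ?h = "alg_map K M (%g. (l, g))"
 note em = corner_embedding[OF l lZ] corner_embedding_mult[OF l lZ]
 have hs: "?h (single K g k) = single K (l, g) k" if "g : car (H Z)" "k : car K" for g k
  by (rule alg_map_single[OF K_ring M.monoid_axioms HZ.is_monoid]) (use em that in auto)
 have hc: "?h a : car A" if "a : car (alg K (H Z))" for a
  by (rule alg_map_closed[OF K_ring M.monoid_axioms HZ.is_monoid]) (use em that in auto)
 have ha: "?h (%z. a z \<oplus>\<^sub>K b z) = (%z. ?h a z \<oplus>\<^sub>K ?h b z)"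
  if "a : finsupp K (car (H Z))" "b : finsupp K (car (H Z))" for a b
  by (rule alg_map_add[OF K_ring M.monoid_axioms HZ.is_monoid]) (use em that in auto)
 have hm: "?h (a \<otimes>\<^sub>(alg K (H Z)) b) = ?h a \<otimes>\<^sub>A ?h b"
  if "a : finsupp K (car (H Z))" "b : finsupp K (car (H Z))" for a b
  by (rule alg_map_mult[OF K_ring M.monoid_axioms HZ.is_monoid]) (use em that in auto)
 have hz: "?h (%_. \<zero>\<^sub>K) = (%_. \<zero>\<^sub>K)"
  by (rule alg_map_zero[OF K_ring M.monoid_axioms HZ.is_monoid]) (use em in auto)
 show ?thesis
  unfolding corner_def
 proof (rule left_module_restrict_scalars[OF N ring_alg[OF K_ring HZ.is_monoid] hc _ _ C])
  fix a b assume ab: "a : car (alg K (H Z))" "b : car (alg K (H Z))"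
  thus "?h (a \<oplus>\<^sub>(alg K (H Z)) b) = ?h a \<oplus>\<^sub>A ?h b"
   using ha[of a b] by (simp add: carrier_alg add_alg)
  show "?h (a \<otimes>\<^sub>(alg K (H Z)) b) = ?h a \<otimes>\<^sub>A ?h b"
   using hm[of a b] ab by (simp add: carrier_alg)
 next
  fix a x assume a: "a : car (alg K (H Z))" and x: "x : C"
  hence xc: "x : car N" using C(1) by auto
  from a have "a : finsupp K (car (H Z))" by (simp add: carrier_alg)
  thus "?h a \<odot>\<^sub>N x : C"
  proof (induction a rule: K.finsupp_induct)
   case zero
   show ?case using N.smult_l_null[OF xc] C(2) hz by (simp add: zero_alg)
  next
   case (single g k)
   thus ?case using smult x by (simp add: hs)
  next
   case (add a b)
   hence "?h a : car A" "?h b : car A" using hc by (simp_all add: carrier_alg)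
   hence "?h (%i. a i \<oplus>\<^sub>K b i) \<odot>\<^sub>N x = ?h a \<odot>\<^sub>N x \<oplus>\<^sub>N ?h b \<odot>\<^sub>N x"
    using ha[OF add(1,2)] N.smult_l_distr[of "?h a" "?h b" x] xc by (simp add: add_alg)
   thus ?case using add(3,4) C(3) by simp
  qed
 next
  fix x assume "x : C"
  thus "?h \<one>\<^sub>(alg K (H Z)) \<odot>\<^sub>N x = x"
   using one hs[OF HZ.one_closed K.one_closed] by (simp add: one_alg)
 qed auto
qed

definition fixed_part :: "(nat set list \<times> (nat => 'g) => 'k, 'x) module => nat set list => 'x set" where
 "fixed_part N l = {x : car N. elem N l \<one>\<^sub>Gn \<one>\<^sub>K x = x}"

text \<open>The part of \<open>N\<close> that generates a submodule all of whose elements are annihilated by the ordered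
  partitions that do not coarsen \<open>l\<close>.\<close>

definition apex_part :: "(nat set list \<times> (nat => 'g) => 'k, 'x) module => nat set list => 'x set" where
 "apex_part N l = {x : fixed_part N l.
   \<forall>ta\<in>car S. ~ leq (set l) (set ta) --> elem N ta \<one>\<^sub>Gn \<one>\<^sub>K x = \<zero>\<^sub>N}"

lemma left_module_fixed_part:
 assumes N: "left_module A N" and l: "l : car S" and lZ: "leq (set l) Z"
 shows "left_module (alg K (H Z)) (corner N l (fixed_part N l))"
proof -
 interpret N: left_module A N by fact
 note lm = one_in_M[OF l]
 note rules = elem_closed[OF N] elem_add[OF N] elem_zero[OF N] elem_neg[OF N] elem_elem[OF N]
 show ?thesis
 proof (rule left_module_corner[OF N l lZ])
  fix g k x assume g: "g : car (H Z)" and k: "k : car K" and x: "x : fixed_part N l"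
  have lg: "(l, g) : car M" by (rule elem_in_M[OF l lZ g])
  have "elem N l \<one>\<^sub>Gn \<one>\<^sub>K (elem N l g k x) = elem N l g k x"
   using rules(5)[OF lm K.one_closed lg k] x k H_Gn[OF g] by (simp add: fixed_part_def S_idem l)
  thus "elem N l g k x : fixed_part N l" using rules(1)[OF lg k] x by (simp add: fixed_part_def)
 qed (use lm in "auto simp: fixed_part_def rules")
qed

lemma left_module_apex_part:
 assumes N: "left_module A N" and l: "l : car S" and lZ: "leq (set l) Z"
 shows "left_module (alg K (H Z)) (corner N l (apex_part N l))"
proof -
 interpret N: left_module A N by fact
 note lm = one_in_M[OF l]
 note rules = elem_closed[OF N] elem_add[OF N] elem_zero[OF N] elem_neg[OF N] elem_elem[OF N]
 show ?thesis
 proof (rule left_module_corner[OF N l lZ])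
  fix g k x assume g: "g : car (H Z)" and k: "k : car K" and x: "x : apex_part N l"
  have lg: "(l, g) : car M" by (rule elem_in_M[OF l lZ g])
  have xc: "x : car N" using x by (simp add: apex_part_def fixed_part_def)
  have "elem N l \<one>\<^sub>Gn \<one>\<^sub>K (elem N l g k x) = elem N l g k x"
   using rules(5)[OF lm K.one_closed lg k xc] k H_Gn[OF g] by (simp add: S_idem l)
  moreover have "elem N ta \<one>\<^sub>Gn \<one>\<^sub>K (elem N l g k x) = \<zero>\<^sub>N" if ta: "ta : car S" "~ leq (set l) (set ta)" for ta
  proof -
   note tm = one_in_M[OF ta(1)]
   have tlg: "(ta \<otimes>\<^sub>S l, g) : car M"
    using M.m_closed[OF tm lg] H_Gn[OF g] by (simp add: M_mult)
   have tl: "ta \<otimes>\<^sub>S l : car S" "~ leq (set l) (set (ta \<otimes>\<^sub>S l))"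
    using ta l S_leq_product[OF ta(1) l] by auto
   have "elem N ta \<one>\<^sub>Gn \<one>\<^sub>K (elem N l g k x) = elem N (ta \<otimes>\<^sub>S l) g k x"
    using rules(5)[OF tm K.one_closed lg k xc] k H_Gn[OF g] by simp
   also have "... = elem N (ta \<otimes>\<^sub>S l) g k (elem N (ta \<otimes>\<^sub>S l) \<one>\<^sub>Gn \<one>\<^sub>K x)"
    using rules(5)[OF tlg k one_in_M[OF tl(1)] K.one_closed xc] k H_Gn[OF g] tl(1)
    by (simp add: S_idem)
   also have "... = \<zero>\<^sub>N" using x tl rules(3)[OF tlg k] by (simp add: apex_part_def)
   finally show ?thesis .
  qed
  ultimately show "elem N l g k x : apex_part N l" using rules(1)[OF lg k xc] by (simp add: apex_part_def fixed_part_def)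
 qed (use lm one_in_M in "auto simp: apex_part_def fixed_part_def rules")
qed

text \<open>The functor \<open>apex_part\<close> is exact: a preimage is corrected by \<open>x \<mapsto> x - ta x\<close> for one \<open>ta\<close>
  after the other. If \<open>ta'\<close> annihilates \<open>x\<close>, then it annihilates \<open>x - ta x\<close>, for \<open>ta' ta ta' = ta' ta\<close>.\<close>

lemma apex_part_surj:
 assumes N: "left_module A N" and N': "left_module A N'" and q: "q : mod_hom A N' N"
  and l: "l : car S" and y: "y : apex_part N l" and yq: "y : q ` car N'"
 shows "y : q ` apex_part N' l"
proof -
 interpret N: left_module A N by fact
 interpret N': left_module A N' by fact
 let ?e = "%N ta. elem N ta \<one>\<^sub>Gn \<one>\<^sub>K"
 have ee: "?e N' ta (?e N' ta' x) = ?e N' (ta \<otimes>\<^sub>S ta') x" if "ta : car S" "ta' : car S" "x : car N'" for ta ta' x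
  using elem_elem[OF N' one_in_M K.one_closed one_in_M K.one_closed] that by simp
 have ec: "?e N' ta x : car N'" if "ta : car S" "x : car N'" for ta x
  using elem_closed[OF N' one_in_M K.one_closed] that by blast
 have e0: "?e N' ta \<zero>\<^sub>N' = \<zero>\<^sub>N'" if "ta : car S" for ta
  using elem_zero[OF N' one_in_M K.one_closed] that by blast
 have ediff: "?e N' ta (x \<ominus>\<^sub>N' x') = ?e N' ta x \<ominus>\<^sub>N' ?e N' ta x'" if "ta : car S" "x : car N'" "x' : car N'" for ta x x'
  using elem_add[OF N' one_in_M K.one_closed] elem_neg[OF N' one_in_M K.one_closed] that by (simp add: N'.M.minus_eq)
 have eq: "q (?e N' ta x) = ?e N ta (q x)" if "ta : car S" "x : car N'" for ta x
  using elem_hom[OF q one_in_M K.one_closed] that by blast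
 have yc: "y : car N" "?e N l y = y" and yk: "!!ta. [|ta : car S; ~ leq (set l) (set ta)|] ==> ?e N ta y = \<zero>\<^sub>N"
  using y by (auto simp: apex_part_def fixed_part_def)
 have "\<exists>x\<in>car N'. q x = y & (\<forall>ta\<in>T. ?e N' ta x = \<zero>\<^sub>N')"
  if "finite T" "T <= {ta : car S. ~ leq (set l) (set ta)}" for T
  using that
 proof (induction T)
  case empty
  thus ?case using yq by auto
 next
  case (insert ta T)
  then obtain x where x: "x : car N'" "q x = y" "!!ta'. ta' : T ==> ?e N' ta' x = \<zero>\<^sub>N'" by auto
  have ta: "ta : car S" "~ leq (set l) (set ta)" using insert.prems by auto
  let ?x = "x \<ominus>\<^sub>N' ?e N' ta x"
  have 1: "?e N' ta ?x = \<zero>\<^sub>N'"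
   using ediff[OF ta(1) x(1) ec[OF ta(1) x(1)]] ee[OF ta(1) ta(1) x(1)] ec[OF ta(1) x(1)]
   by (simp add: S_idem[OF ta(1)] N'.M.minus_eq N'.M.r_neg)
  have 2: "?e N' ta' ?x = \<zero>\<^sub>N'" if t: "ta' : T" for ta'
  proof -
   have ta': "ta' : car S" using t insert.prems by auto
   have "?e N' (ta' \<otimes>\<^sub>S ta) x = ?e N' (ta' \<otimes>\<^sub>S ta) (?e N' ta' x)"
    using ta ta' x(1) by (simp add: ee S_regular)
   also have "... = \<zero>\<^sub>N'" using x(3)[OF t] ta ta' by (simp add: e0)
   finally show ?thesis
    using ediff[OF ta' x(1) ec[OF ta(1) x(1)]] ee[OF ta' ta(1) x(1)] x(3)[OF t] by (simp add: N'.M.minus_eq)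
  qed
  have "q ?x = y"
   using mod_hom_diff[OF q N'.M.abelian_group_axioms N.M.abelian_group_axioms x(1) ec[OF ta(1) x(1)]] eq[OF ta(1) x(1)] x(2) yk[OF ta] yc(1)
   by (simp add: N.M.minus_eq)
  moreover have "?x : car N'" using x(1) ec[OF ta(1) x(1)] by simp
  ultimately show ?case using 1 2 by auto
 qed
 from this[of "{ta : car S. ~ leq (set l) (set ta)}"] obtain x where x: "x : car N'" "q x = y"
  "!!ta. [|ta : car S; ~ leq (set l) (set ta)|] ==> ?e N' ta x = \<zero>\<^sub>N'" using finite_ordered_partitions by auto
 have "?e N' l x : apex_part N' l"
  using x l ec S_leq_product[OF _ l] by (auto simp: apex_part_def fixed_part_def ee S_idem)
 moreover have "q (?e N' l x) = y" using eq[OF l x(1)] x(2) yc(2) by simp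
 ultimately show ?thesis by (metis image_eqI)
qed

lemma finite_M: "finite (car M)"
proof (rule finite_subset)
 show "car M <= car S \<times> (\<Pi>\<^sub>E i\<in>{1..n}. car G)"
  by (rule subsetI) (simp add: mem_Times_iff carrier_hsiao_monoid carrier_product_group)
 show "finite (car S \<times> (\<Pi>\<^sub>E i\<in>{1..n}. car G))"
  using finite_ordered_partitions finite_G by (simp add: finite_PiE)
qed

end

context hsiao_algebra
begin

text \<open>Left multiplication by the group \<open>G\<^sub>Z\<close> on \<open>(l, \<one>) \<Sigma>\<^sub>n\<^sup>G\<close> is free. Hence \<open>(l, \<one>) K\<Sigma>\<^sub>n\<^sup>G\<close> is a free
  \<open>K G\<^sub>Z\<close>-module, with a transversal of the \<open>G\<^sub>Z\<close>-orbits as a basis. The function \<open>r\<close> chooses the orbit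
  representatives, and \<open>h = q h \<cdot> r h\<close>.\<close>

lemma transversal_exists:
 assumes Z: "partition_on {1..n} Z"
 shows "\<exists>r q. (\<forall>h\<in>car Gn. r h : car Gn & q h : car (H Z) & q h \<otimes>\<^sub>Gn r h = h & r (r h) = r h) \<and>
  (\<forall>g\<in>car (H Z). \<forall>h\<in>car Gn. r (g \<otimes>\<^sub>Gn h) = r h & q (g \<otimes>\<^sub>Gn h) = g \<otimes>\<^sub>Gn q h)"
proof -
 interpret HZ: group "H Z" by (rule H_group[OF Z])
 define orb where "orb h = {g \<otimes>\<^sub>Gn h | g. g : car (H Z)}" for h
 define r where "r h = (SOME t. t : orb h)" for h
 have invc: "inv\<^bsub>H Z\<^esub> g : car (H Z)" "inv\<^bsub>H Z\<^esub> g \<otimes>\<^sub>Gn g = \<one>\<^sub>Gn" if "g : car (H Z)" for g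
  using HZ.inv_closed[OF that] HZ.l_inv[OF that] by simp_all
 have r: "r h : orb h" if "h : car Gn" for h
 proof -
  have "\<one>\<^sub>Gn \<otimes>\<^sub>Gn h : orb h" unfolding orb_def using H_one[OF Z] by blast
  thus ?thesis unfolding r_def by (rule someI[where P="%t. t : orb h"])
 qed
 have orb_Gn: "orb h <= car Gn" if h: "h : car Gn" for h
  using Gn.m_closed[OF H_Gn h] by (auto simp: orb_def)
 have rc: "r h : car Gn" if "h : car Gn" for h
  using subsetD[OF orb_Gn[OF that] r[OF that]] .
 have orb: "orb (g \<otimes>\<^sub>Gn h) = orb h" if g: "g : car (H Z)" and h: "h : car Gn" for g h
 proof -
  have "g' \<otimes>\<^sub>Gn (g \<otimes>\<^sub>Gn h) : orb h" if "g' : car (H Z)" for g'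
   using that g h H_mult[OF Z that g] Gn.m_assoc[OF H_Gn[OF that] H_Gn[OF g] h] unfolding orb_def by (intro CollectI exI[of _ "g' \<otimes>\<^sub>Gn g"]) simp
  moreover have "g' \<otimes>\<^sub>Gn h : orb (g \<otimes>\<^sub>Gn h)" if g': "g' : car (H Z)" for g'
  proof -
   let ?k = "g' \<otimes>\<^sub>Gn inv\<^bsub>H Z\<^esub> g"
   have k: "?k : car (H Z)" using H_mult[OF Z g'] invc[OF g] by blast
   have "?k \<otimes>\<^sub>Gn (g \<otimes>\<^sub>Gn h) = g' \<otimes>\<^sub>Gn ((inv\<^bsub>H Z\<^esub> g \<otimes>\<^sub>Gn g) \<otimes>\<^sub>Gn h)"
    using h H_Gn[OF g'] H_Gn[OF g] H_Gn[OF invc(1)[OF g]] by (simp add: Gn.m_assoc)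
   also have "... = g' \<otimes>\<^sub>Gn h" using invc[OF g] h by simp
   finally show ?thesis using k unfolding orb_def by (intro CollectI exI[of _ ?k]) simp
  qed
  ultimately show ?thesis unfolding orb_def by blast
 qed
 have rr: "r (g \<otimes>\<^sub>Gn h) = r h" if "g : car (H Z)" "h : car Gn" for g h
  unfolding r_def orb[OF that] ..
 have "\<exists>g. g : car (H Z) & g \<otimes>\<^sub>Gn r h = h" if h: "h : car Gn" for h
 proof -
  from r[OF h] obtain g where g: "g : car (H Z)" "r h = g \<otimes>\<^sub>Gn h" unfolding orb_def by blast
  have "inv\<^bsub>H Z\<^esub> g \<otimes>\<^sub>Gn r h = (inv\<^bsub>H Z\<^esub> g \<otimes>\<^sub>Gn g) \<otimes>\<^sub>Gn h"
   unfolding g(2) using h H_Gn[OF g(1)] H_Gn[OF invc(1)[OF g(1)]] by (simp add: Gn.m_assoc)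
  thus ?thesis using invc[OF g(1)] h by (intro exI[of _ "inv\<^bsub>H Z\<^esub> g"]) simp
 qed
 then obtain q where q: "!!h. h : car Gn ==> q h : car (H Z)" "!!h. h : car Gn ==> q h \<otimes>\<^sub>Gn r h = h"
  by metis
 have qq: "q (g \<otimes>\<^sub>Gn h) = g \<otimes>\<^sub>Gn q h" if g: "g : car (H Z)" and h: "h : car Gn" for g h
 proof -
  have gh: "g \<otimes>\<^sub>Gn h : car Gn" using H_Gn[OF g] h by simp
  have "q (g \<otimes>\<^sub>Gn h) \<otimes>\<^sub>Gn r h = g \<otimes>\<^sub>Gn h" using q(2)[OF gh] rr[OF g h] by simp
  also have "... = (g \<otimes>\<^sub>Gn q h) \<otimes>\<^sub>Gn r h"
   using Gn.m_assoc[OF H_Gn[OF g] H_Gn[OF q(1)[OF h]] rc[OF h]] q(2)[OF h] by simp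
  finally show ?thesis
   using Gn.right_cancel[of "r h" "q (g \<otimes>\<^sub>Gn h)" "g \<otimes>\<^sub>Gn q h"] rc[OF h] H_Gn[OF q(1)[OF gh]] H_Gn[OF g] H_Gn[OF q(1)[OF h]] by simp
 qed
 have rrr: "r (r h) = r h" if h: "h : car Gn" for h
 proof -
  from r[OF h] obtain g where g: "g : car (H Z)" "r h = g \<otimes>\<^sub>Gn h" unfolding orb_def by blast
  thus ?thesis using rr[OF g(1) h] by simp
 qed
 show ?thesis by (rule exI[of _ r], rule exI[of _ q]) (use rc q rrr rr qq in auto)
qed

lemma elem_translate:
 assumes l: "l : car S" and lZ: "leq (set l) Z" and g: "g : car (H Z)" and k: "k : car K"
  and a: "a : car A" "!!ta h. a (ta, h) ~= \<zero>\<^sub>K ==> l \<otimes>\<^sub>S ta = ta" and h: "h : car Gn"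
 shows "(single K (l, g) k \<otimes>\<^sub>A a) (ta, h) = k \<otimes>\<^sub>K a (ta, inv\<^bsub>Gn\<^esub> g \<otimes>\<^sub>Gn h)"
proof (rule single_mult_at[OF K_ring M.monoid_axioms _ k])
 show fa: "a : finsupp K (car M)" using a by (simp add: carrier_alg)
 fix y assume y: "a y ~= \<zero>\<^sub>K"
 obtain ta' h' where y': "y = (ta', h')" by (cases y)
 have gc: "g : car Gn" by (rule H_Gn[OF g])
 have "y : car M" using y finsupp_zero[OF fa] by blast
 hence "h' : car Gn" by (auto simp: y' M_iff dest: H_Gn)
 hence "g \<otimes>\<^sub>Gn h' = h \<longleftrightarrow> h' = inv\<^bsub>Gn\<^esub> g \<otimes>\<^sub>Gn h"
  using gc h Gn.inv_solve_left[of h' g h] by auto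
 thus "(l, g) \<otimes>\<^sub>M y = (ta, h) \<longleftrightarrow> y = (ta, inv\<^bsub>Gn\<^esub> g \<otimes>\<^sub>Gn h)"
  using a(2)[of ta' h'] y by (simp add: y' M_mult)
qed

lemma H_translate:
 assumes Z: "partition_on {1..n} Z" and g: "g : car (H Z)" and k: "k : car K"
  and b: "b : car (alg K (H Z))" and h: "h : car Gn"
 shows "(single K g k \<otimes>\<^sub>(alg K (H Z)) b) h = k \<otimes>\<^sub>K b (inv\<^bsub>Gn\<^esub> g \<otimes>\<^sub>Gn h)"
proof (rule single_mult_at[OF K_ring group.is_monoid[OF H_group[OF Z]] _ k])
 show fb: "b : finsupp K (car (H Z))" using b by (simp add: carrier_alg)
 fix y assume "b y ~= \<zero>\<^sub>K"
 hence "y : car Gn" using finsupp_zero[OF fb] H_Gn by blast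
 thus "g \<otimes>\<^sub>(H Z) y = h \<longleftrightarrow> y = inv\<^bsub>Gn\<^esub> g \<otimes>\<^sub>Gn h"
  using H_Gn[OF g] h Gn.inv_solve_left[of y g h] by auto
qed

lemma H_inv: "partition_on {1..n} Z ==> g : car (H Z) ==> inv\<^bsub>Gn\<^esub> g : car (H Z)"
proof -
 assume Z: "partition_on {1..n} Z" and g: "g : car (H Z)"
 interpret HZ: group "H Z" by (rule H_group[OF Z])
 have "inv\<^bsub>H Z\<^esub> g \<otimes>\<^sub>Gn g = \<one>\<^sub>Gn" using HZ.l_inv[OF g] by simp
 hence "inv\<^bsub>Gn\<^esub> g = inv\<^bsub>H Z\<^esub> g"
  using Gn.inv_equality H_Gn[OF g] H_Gn[OF HZ.inv_closed[OF g]] by blast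
 thus ?thesis using HZ.inv_closed[OF g] by simp
qed

text \<open>Start from a retraction of a free module onto \<open>P\<close> and restrict it to \<open>(l, \<one>)\<close>. The free module on \<open>I\<close> becomes a free \<open>K G\<^sub>Z\<close>-module: each coefficient, a function on pairs \<open>(ta, h)\<close> with \<open>l ta = ta\<close>, is cut into functions on the orbits of \<open>G\<^sub>Z\<close>.\<close>

lemma projective_fixed_part:
 fixes P :: "(nat set list \<times> (nat => 'g) => 'k, 'p) module"
 assumes P: "projective_module A P" and l: "l : car S" and lZ: "leq (set l) Z"
 shows "projective_module (alg K (H Z)) (corner P l (fixed_part P l))"
proof -
 let ?KH = "alg K (H Z)" and ?U = "corner P l (fixed_part P l)"
 have Z: "partition_on {1..n} Z" using leq_part[OF lZ] by simp
 interpret P: left_module A P using P by (rule projective_module_left_module)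
 interpret HZ: group "H Z" by (rule H_group[OF Z])
 interpret U: left_module ?KH ?U by (rule left_module_fixed_part[OF P.left_module_axioms l lZ])
 from transversal_exists[OF Z] obtain r q where
  rq: "\<forall>h\<in>car Gn. r h : car Gn & q h : car (H Z) & q h \<otimes>\<^sub>Gn r h = h & r (r h) = r h"
  and rq': "\<forall>g\<in>car (H Z). \<forall>h\<in>car Gn. r (g \<otimes>\<^sub>Gn h) = r h & q (g \<otimes>\<^sub>Gn h) = g \<otimes>\<^sub>Gn q h" by (elim exE conjE)
 have rc: "!!h. h : car Gn ==> r h : car Gn" and qc: "!!h. h : car Gn ==> q h : car (H Z)"
  and qr: "!!h. h : car Gn ==> q h \<otimes>\<^sub>Gn r h = h" and rr: "!!h. h : car Gn ==> r (r h) = r h"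
  and rg: "!!g h. [|g : car (H Z); h : car Gn|] ==> r (g \<otimes>\<^sub>Gn h) = r h"
  and qg: "!!g h. [|g : car (H Z); h : car Gn|] ==> q (g \<otimes>\<^sub>Gn h) = g \<otimes>\<^sub>Gn q h"
  using rq rq' by simp_all
 from P obtain I :: "'p set" and i p where i: "i : mod_hom A P (free A I)"
  and p: "p : mod_hom A (free A I) P" and pi: "!!x. x : car P ==> p (i x) = x"
  unfolding projective_module_def by blast
 have ringA: "ring A" and ringKH: "ring ?KH"
  using P.R.ring_axioms U.R.ring_axioms by auto
 let ?F = "free A I"
 interpret F: left_module A ?F by (rule ring.left_module_free_module[OF ringA])
 define J where "J = I \<times> (car S \<times> car Gn)"
 let ?FJ = "free ?KH J"
 interpret FJ: left_module ?KH ?FJ by (rule ring.left_module_free_module[OF ringKH])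
 have finGn: "finite (car Gn)" using finite_G by (simp add: carrier_product_group finite_PiE)
 have fin_fun: "a : finsupp K X" if "!!z. a z : car K" "!!z. z ~: X ==> a z = \<zero>\<^sub>K" "finite X" for a and X :: "'z set"
  using that by (intro finsuppI[of _ _ X]) auto
 have finH: "finite (car (H Z))" by (rule finite_block_group[OF G finite_G])
 have ixc: "i x \<iota> : car A" if "x : car P" for x \<iota>
  using mod_hom_closed[OF i that] by (auto simp: free_module_def intro: finsupp_closed)
 have ixK: "i x \<iota> m : car K" if "x : car P" for x \<iota> m
  using ixc[OF that, of \<iota>] by (auto simp: carrier_alg intro: finsupp_closed)
 have ix0: "i x \<iota> m = \<zero>\<^sub>K" if "x : car P" "m ~: car M" for x \<iota> m
  using ixc[OF that(1), of \<iota>] that(2) by (auto simp: carrier_alg intro: finsupp_zero)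
 have Uc: "x : car P" "elem P l \<one>\<^sub>Gn \<one>\<^sub>K x = x" if "x : fixed_part P l" for x
  using that by (auto simp: fixed_part_def)
 have i_elem: "i (elem P ta g k x) \<iota> = single K (ta, g) k \<otimes>\<^sub>A i x \<iota>" if "(ta, g) : car M" "k : car K" "x : car P" for ta g k x \<iota>
  using elem_hom[OF i that] by (simp add: free_module_def)
 have fixed: "l \<otimes>\<^sub>S ta = ta" if x: "x : fixed_part P l" and nz: "i x \<iota> (ta, h) ~= \<zero>\<^sub>K" for x \<iota> ta h
 proof (rule ccontr)
  assume ne: "l \<otimes>\<^sub>S ta ~= ta"
  have fa: "i x \<iota> : finsupp K (car M)" using ixc[OF Uc(1)[OF x]] by (simp add: carrier_alg)
  have "(single K (l, \<one>\<^sub>Gn) \<one>\<^sub>K \<otimes>\<^sub>A i x \<iota>) (ta, h) = \<zero>\<^sub>K"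
  proof (rule single_mult_outside[OF K_ring M.monoid_axioms fa K.one_closed])
   fix y assume y: "i x \<iota> y ~= \<zero>\<^sub>K"
   obtain ta' h' where y': "y = (ta', h')" by (cases y)
   have "y : car M" using y ix0[OF Uc(1)[OF x]] by blast
   hence t': "ta' : car S" by (simp add: y' M_iff)
   have "l \<otimes>\<^sub>S (l \<otimes>\<^sub>S ta') = l \<otimes>\<^sub>S ta'" using S.m_assoc[OF l l t'] S_idem[OF l] by simp
   thus "(l, \<one>\<^sub>Gn) \<otimes>\<^sub>M y ~= (ta, h)" using ne by (auto simp: y' M_mult)
  qed
  thus False
   using i_elem[OF one_in_M[OF l] K.one_closed Uc(1)[OF x], of \<iota>] Uc(2)[OF x] nz by simp
 qed
 define i' where "i' = (\<lambda>x\<in>fixed_part P l. %j g. case j of (\<iota>, ta, t) =>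
  if g : car (H Z) & t : car Gn & r t = t then i x \<iota> (ta, g \<otimes>\<^sub>Gn t) else \<zero>\<^sub>K)"
 have i': "i' x (\<iota>, ta, t) g = (if g : car (H Z) & t : car Gn & r t = t then i x \<iota> (ta, g \<otimes>\<^sub>Gn t) else \<zero>\<^sub>K)"
  if "x : fixed_part P l" for x \<iota> ta t g using that by (simp add: i'_def)
 have i'c: "i' x j : car ?KH" if "x : fixed_part P l" for x j
  unfolding carrier_alg
  by (cases j, rule fin_fun[OF _ _ finH]) (use ixK[OF Uc(1)[OF that]] in "auto simp: i'[OF that]")
 have i'F: "i' x : car ?FJ" if x: "x : fixed_part P l" for x
 proof -
  have ix: "i x : finsupp A I" using mod_hom_closed[OF i Uc(1)[OF x]] by (simp add: free_module_def)
  have "i' x : finsupp ?KH J"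
  proof (rule finsuppI)
   show "finite (supp A (i x) \<times> (car S \<times> car Gn))"
    using finite_supp[OF ix] finGn finite_ordered_partitions by simp
   show "supp A (i x) \<times> (car S \<times> car Gn) <= J" unfolding J_def using supp_subset[OF ix] by blast
   fix j assume j: "j ~: supp A (i x) \<times> (car S \<times> car Gn)"
   obtain \<iota> ta t where jj: "j = (\<iota>, ta, t)" by (cases j)
   have "i' x j g = \<zero>\<^sub>K" for g
   proof (cases "\<iota> : supp A (i x)")
    case False
    hence "i x \<iota> = (%_. \<zero>\<^sub>K)" by (simp add: supp_def zero_alg)
    thus ?thesis by (simp add: jj i'[OF x])
   next
    case True
    hence "ta ~: car S \<or> t ~: car Gn" using j jj by blast
    thus ?thesis using ix0[OF Uc(1)[OF x], of "(ta, g \<otimes>\<^sub>Gn t)"] by (auto simp: jj i'[OF x] M_iff)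
   qed
   thus "i' x j = \<zero>\<^sub>?KH" by (auto simp: zero_alg)
  qed (rule i'c[OF x])
  thus ?thesis by (simp add: free_module_def)
 qed
 define \<Psi> where "\<Psi> \<phi> \<iota> = (%(ta, h). if (ta, h) : car M & l \<otimes>\<^sub>S ta = ta then \<phi> (\<iota>, ta, r h) (q h) else \<zero>\<^sub>K)"
  for \<phi> :: "'p \<times> nat set list \<times> (nat => 'g) => (nat => 'g) => 'k" and \<iota>
 have \<phi>c: "\<phi> j : car ?KH" "\<phi> j g : car K" if "\<phi> : car ?FJ" for \<phi> j g
  using that finsupp_closed[of \<phi> ?KH J j] finsupp_closed[of "\<phi> j" K "car (H Z)" g]
  by (simp_all add: free_module_def carrier_alg)
 have \<Psi>A: "\<Psi> \<phi> \<iota> : car A" if "\<phi> : car ?FJ" for \<phi> \<iota>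
  unfolding carrier_alg
  by (rule fin_fun[OF _ _ finite_M]) (use \<phi>c(2)[OF that] in \<open>auto simp: \<Psi>_def\<close>)
 have \<Psi>F: "\<Psi> \<phi> : car ?F" if \<phi>: "\<phi> : car ?FJ" for \<phi>
 proof -
  have f: "\<phi> : finsupp ?KH J" using \<phi> by (simp add: free_module_def)
  have "\<Psi> \<phi> : finsupp A I"
  proof (rule finsuppI)
   show "finite (fst ` supp ?KH \<phi>)" using finite_supp[OF f] by simp
   show "fst ` supp ?KH \<phi> <= I" using supp_subset[OF f] by (auto simp: J_def)
   fix \<iota> assume "\<iota> ~: fst ` supp ?KH \<phi>"
   hence "\<phi> (\<iota>, x) = (%_. \<zero>\<^sub>K)" for x
    by (metis (mono_tags, lifting) fst_conv image_eqI mem_Collect_eq supp_def zero_alg)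
   thus "\<Psi> \<phi> \<iota> = \<zero>\<^sub>A" by (auto simp: \<Psi>_def zero_alg fun_eq_iff)
  qed (rule \<Psi>A[OF \<phi>])
  thus ?thesis by (simp add: free_module_def)
 qed
 have \<Psi>_fixed: "l \<otimes>\<^sub>S ta = ta" if "\<Psi> \<phi> \<iota> (ta, h) ~= \<zero>\<^sub>K" for \<phi> \<iota> ta h
  using that by (auto simp: \<Psi>_def split: if_splits)
 have lg: "(l, g) : car M" if "g : car (H Z)" for g by (rule elem_in_M[OF l lZ that])
 have \<Psi>_elem: "\<Psi> (single K g k \<odot>\<^sub>?FJ \<phi>) = elem ?F l g k (\<Psi> \<phi>)"
  if g: "g : car (H Z)" and k: "k : car K" and \<phi>: "\<phi> : car ?FJ" for g k \<phi>
 proof (intro ext)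
  fix \<iota> and m :: "nat set list \<times> (nat => 'g)"
  obtain ta h where m: "m = (ta, h)" by (cases m)
  have R: "elem ?F l g k (\<Psi> \<phi>) \<iota> = single K (l, g) k \<otimes>\<^sub>A \<Psi> \<phi> \<iota>" by (simp add: free_module_def)
  have L: "(single K g k \<odot>\<^sub>?FJ \<phi>) j = single K g k \<otimes>\<^sub>?KH \<phi> j" for j by (simp add: free_module_def)
  have ig: "inv\<^bsub>Gn\<^esub> g : car (H Z)" by (rule H_inv[OF Z g])
  show "\<Psi> (single K g k \<odot>\<^sub>?FJ \<phi>) \<iota> m = elem ?F l g k (\<Psi> \<phi>) \<iota> m"
  proof (cases "(ta, h) : car M & l \<otimes>\<^sub>S ta = ta")
   case True
   hence t: "ta : car S" and h: "h : car Gn" using H_Gn by (auto simp: M_iff)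
   have "leq (set ta) (set l)"
    using S_leq_product[OF l t, of "set ta"] True refines_refl[OF S_part[OF t]] by simp
   hence "inv\<^bsub>Gn\<^esub> g : car (H (set ta))" using H_mono refines_trans lZ ig by blast
   hence m': "(ta, inv\<^bsub>Gn\<^esub> g \<otimes>\<^sub>Gn h) : car M" using True H_mult[OF S_part[OF t]] by (simp add: M_iff)
   have "elem ?F l g k (\<Psi> \<phi>) \<iota> m = k \<otimes>\<^sub>K \<Psi> \<phi> \<iota> (ta, inv\<^bsub>Gn\<^esub> g \<otimes>\<^sub>Gn h)"
    unfolding R m by (rule elem_translate[OF l lZ g k \<Psi>A[OF \<phi>] \<Psi>_fixed h])
   also have "... = k \<otimes>\<^sub>K \<phi> (\<iota>, ta, r h) (inv\<^bsub>Gn\<^esub> g \<otimes>\<^sub>Gn q h)"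
    using m' True rg[OF ig h] qg[OF ig h] by (simp add: \<Psi>_def)
   also have "... = (single K g k \<otimes>\<^sub>?KH \<phi> (\<iota>, ta, r h)) (q h)"
    by (rule H_translate[OF Z g k \<phi>c(1)[OF \<phi>] H_Gn[OF qc[OF h]], symmetric])
   also have "... = \<Psi> (single K g k \<odot>\<^sub>?FJ \<phi>) \<iota> m" using True by (simp add: \<Psi>_def m L)
   finally show ?thesis by (rule sym)
  next
   case False
   have fa: "\<Psi> \<phi> \<iota> : finsupp K (car M)" using \<Psi>A[OF \<phi>] by (simp add: carrier_alg)
   have "(single K (l, g) k \<otimes>\<^sub>A \<Psi> \<phi> \<iota>) (ta, h) = \<zero>\<^sub>K"
   proof (rule single_mult_outside[OF K_ring M.monoid_axioms fa k])
    fix y assume y: "\<Psi> \<phi> \<iota> y ~= \<zero>\<^sub>K"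
    obtain ta' h' where y': "y = (ta', h')" by (cases y)
    have "y : car M" using y finsupp_zero[OF fa] by blast
    hence "(l, g) \<otimes>\<^sub>M y : car M" using lg[OF g] by simp
    moreover have "l \<otimes>\<^sub>S ta' = ta'" using \<Psi>_fixed y y' by blast
    ultimately show "(l, g) \<otimes>\<^sub>M y ~= (ta, h)" using False by (auto simp: y' M_mult)
   qed
   moreover have "\<Psi> (single K g k \<odot>\<^sub>?FJ \<phi>) \<iota> (ta, h) = \<zero>\<^sub>K" using False by (auto simp: \<Psi>_def)
   ultimately show ?thesis by (simp only: R m)
  qed
 qed
 have p\<Psi>: "p (\<Psi> \<phi>) : fixed_part P l" if \<phi>: "\<phi> : car ?FJ" for \<phi>
 proof -
  have one: "single K \<one>\<^sub>Gn \<one>\<^sub>K \<odot>\<^sub>?FJ \<phi> = \<phi>"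
   using FJ.smult_one[OF \<phi>] by (simp add: one_alg)
  have "elem ?F l \<one>\<^sub>Gn \<one>\<^sub>K (\<Psi> \<phi>) = \<Psi> \<phi>"
   using \<Psi>_elem[OF H_one[OF Z] K.one_closed \<phi>] one by simp
  thus ?thesis
   using elem_hom[OF p lg[OF H_one[OF Z]] K.one_closed \<Psi>F[OF \<phi>]] mod_hom_closed[OF p \<Psi>F[OF \<phi>]]
   by (simp add: fixed_part_def)
 qed
 define p' where "p' = (\<lambda>\<phi>\<in>car ?FJ. p (\<Psi> \<phi>))"
 show ?thesis
 proof (rule retract_free_projective[OF U.left_module_axioms])
  show "i' : mod_hom ?KH ?U ?FJ"
  proof (rule mod_hom_algI[OF K_ring HZ.is_monoid U.left_module_axioms FJ.left_module_axioms])
   show "i' : car ?U \<rightarrow>\<^sub>E car ?FJ" using i'F by (auto simp: i'_def PiE_iff)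
  next
   fix x y assume xy: "x : car ?U" "y : car ?U"
   hence xy': "x : fixed_part P l" "y : fixed_part P l" "x \<oplus>\<^sub>P y : fixed_part P l"
    using U.M.a_closed[OF xy] by simp_all
   have "i (x \<oplus>\<^sub>P y) \<iota> m = i x \<iota> m \<oplus>\<^sub>K i y \<iota> m" for \<iota> m
    using mod_hom_add[OF i Uc(1)[OF xy'(1)] Uc(1)[OF xy'(2)]] by (simp add: free_module_def add_alg)
   thus "i' (x \<oplus>\<^sub>?U y) = i' x \<oplus>\<^sub>?FJ i' y"
    using xy' by (auto simp: i' free_module_def add_alg fun_eq_iff)
  next
   fix g k x assume g: "g : car (H Z)" and k: "k : car K" and "x : car ?U"
   hence x: "x : fixed_part P l" by simp
   have x': "elem P l g k x : fixed_part P l"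
    using U.smult_closed[OF single_closed[OF K_ring HZ.is_monoid g k] \<open>x : car ?U\<close>] by (simp add: corner_elem[OF l lZ g k])
   have ig: "inv\<^bsub>Gn\<^esub> g : car (H Z)" by (rule H_inv[OF Z g])
   have "i' (elem P l g k x) j h = (single K g k \<otimes>\<^sub>?KH i' x j) h" for j h
   proof -
    obtain \<iota> ta t where j: "j = (\<iota>, ta, t)" by (cases j)
    show ?thesis
    proof (cases "h : car (H Z)")
    case h: True
    have ih: "inv\<^bsub>Gn\<^esub> g \<otimes>\<^sub>Gn h : car (H Z)" by (rule H_mult[OF Z ig h])
    have R: "(single K g k \<otimes>\<^sub>?KH i' x j) h = k \<otimes>\<^sub>K i' x j (inv\<^bsub>Gn\<^esub> g \<otimes>\<^sub>Gn h)"
    by (rule H_translate[OF Z g k i'c[OF x] H_Gn[OF h]])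
    show ?thesis
    proof (cases "t : car Gn & r t = t")
    case True
    have ht: "h \<otimes>\<^sub>Gn t : car Gn" using True H_Gn[OF h] by simp
    have "i' (elem P l g k x) j h = (single K (l, g) k \<otimes>\<^sub>A i x \<iota>) (ta, h \<otimes>\<^sub>Gn t)"
    using True h i_elem[OF lg[OF g] k Uc(1)[OF x]] by (simp add: j i'[OF x'])
    also have "... = k \<otimes>\<^sub>K i x \<iota> (ta, inv\<^bsub>Gn\<^esub> g \<otimes>\<^sub>Gn (h \<otimes>\<^sub>Gn t))"
    by (rule elem_translate[OF l lZ g k ixc[OF Uc(1)[OF x]] fixed[OF x] ht])
    also have "... = k \<otimes>\<^sub>K i' x j (inv\<^bsub>Gn\<^esub> g \<otimes>\<^sub>Gn h)"
    using True ih Gn.m_assoc[OF H_Gn[OF ig] H_Gn[OF h], of t] by (simp add: j i'[OF x])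
    finally show ?thesis using R by simp
    next
    case False
    thus ?thesis using R k by (auto simp: j i'[OF x] i'[OF x'])
    qed
    next
    case False
    have "single K g k \<otimes>\<^sub>?KH i' x j : finsupp K (car (H Z))"
    using U.R.m_closed[OF single_closed[OF K_ring HZ.is_monoid g k] i'c[OF x]] by (simp add: carrier_alg)
    from finsupp_zero[OF this False] show ?thesis using False by (simp add: j i'[OF x'])
    qed
   qed
   thus "i' (single K g k \<odot>\<^sub>?U x) = single K g k \<odot>\<^sub>?FJ i' x"
    by (simp add: corner_elem[OF l lZ g k] free_module_def fun_eq_iff)
  qed
  show "p' : mod_hom ?KH ?FJ ?U"
  proof (rule mod_hom_algI[OF K_ring HZ.is_monoid FJ.left_module_axioms U.left_module_axioms])
   show "p' : car ?FJ \<rightarrow>\<^sub>E car ?U" using p\<Psi> by (auto simp: p'_def)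
  next
   fix \<phi> \<psi> assume *: "\<phi> : car ?FJ" "\<psi> : car ?FJ"
   have "\<Psi> (\<phi> \<oplus>\<^sub>?FJ \<psi>) = \<Psi> \<phi> \<oplus>\<^sub>?F \<Psi> \<psi>"
    by (auto simp: \<Psi>_def free_module_def add_alg fun_eq_iff)
   thus "p' (\<phi> \<oplus>\<^sub>?FJ \<psi>) = p' \<phi> \<oplus>\<^sub>?U p' \<psi>"
    using * FJ.M.a_closed[OF *] mod_hom_add[OF p \<Psi>F[OF *(1)] \<Psi>F[OF *(2)]] by (simp add: p'_def)
  next
   fix g k \<phi> assume g: "g : car (H Z)" and k: "k : car K" and \<phi>: "\<phi> : car ?FJ"
   thus "p' (single K g k \<odot>\<^sub>?FJ \<phi>) = single K g k \<odot>\<^sub>?U p' \<phi>"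
    using FJ.smult_closed[OF single_closed[OF K_ring HZ.is_monoid g k] \<phi>] \<Psi>_elem[OF g k \<phi>]
    elem_hom[OF p lg[OF g] k \<Psi>F[OF \<phi>]] by (simp add: p'_def corner_elem[OF l lZ g k])
  qed
  show "p' (i' x) = x" if "x : car ?U" for x
  proof -
   have x: "x : fixed_part P l" using that by simp
   have "\<Psi> (i' x) \<iota> (ta, h) = i x \<iota> (ta, h)" for \<iota> ta h
   proof (cases "(ta, h) : car M & l \<otimes>\<^sub>S ta = ta")
    case True
    hence h: "h : car Gn" using H_Gn by (auto simp: M_iff)
    show ?thesis using True rc[OF h] qc[OF h] rr[OF h] qr[OF h] by (simp add: \<Psi>_def i'[OF x])
   next
    case False
    hence "i x \<iota> (ta, h) = \<zero>\<^sub>K" using ix0[OF Uc(1)[OF x], of "(ta, h)" \<iota>] fixed[OF x, of \<iota> ta h] by argo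
    thus ?thesis using False by (auto simp: \<Psi>_def)
   qed
   hence "\<Psi> (i' x) = i x" by (simp add: fun_eq_iff)
   thus ?thesis using i'F[OF x] pi[OF Uc(1)[OF x]] by (simp add: p'_def)
  qed
 qed
qed

end

section \<open>The total complex\<close>

locale apex_resolution = hsiao_algebra n G K for n :: nat and G :: "'g monoid" and K :: "'k ring" +
 fixes l :: "nat set list"
  and P :: "nat => (nat set list \<times> (nat => 'g) => 'k, 'p) module" and d :: "nat => 'p => 'p"
  and e :: "'p => 'v" and V :: "(nat set list \<times> (nat => 'g) => 'k, 'v) module"
 assumes l: "l : car S" and resolution: "projective_resolution A P d e V" and V: "left_module A V"
  and V_apex: "[|(ta, h) : car M; k : car K; v : car V|] ==>
   elem V ta h k v = (if leq (set l) (set ta) then elem V l h k v else \<zero>\<^sub>V)"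
  and V_one: "v : car V ==> elem V l \<one>\<^sub>Gn \<one>\<^sub>K v = v"
begin

abbreviation X where "X \<equiv> set l"
abbreviation C where "C \<equiv> {cl. cell (set l) cl}"
abbreviation U where "U j \<equiv> fixed_part (P j) l"
abbreviation act where "act j h k x \<equiv> elem (P j) l h k x"

lemma P_module: "left_module A (P j)"
 by (rule resolution_module[OF resolution])

lemma P_group: "abelian_group (P j)"
 by (rule left_module_group[OF P_module])

lemma d_hom: "d j : mod_hom A (P (Suc j)) (P j)"
 by (rule resolution_diff[OF resolution])

lemma X_refl: "leq X X"
 by (rule refines_refl[OF S_part[OF l]])

lemma X_M: "h : car (H X) ==> (l, h) : car M"
 by (rule elem_in_M[OF l X_refl])

lemma U_module: "left_module (alg K (H X)) (corner (P j) l (U j))"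
 by (rule left_module_fixed_part[OF P_module l X_refl])

lemma U_closed: "x : U j ==> x : car (P j)"
 by (simp add: fixed_part_def)

lemma U_zero: "\<zero>\<^sub>(P j) : U j"
 using abelian_monoid.zero_closed[OF ag_monoid[OF left_module_group[OF U_module[of j]]]] by simp

lemma U_add: "[|x : U j; y : U j|] ==> x \<oplus>\<^sub>(P j) y : U j"
 using abelian_monoid.a_closed[OF ag_monoid[OF left_module_group[OF U_module[of j]]], of x y] by simp

lemma act_closed: "[|h : car (H X); k : car K; x : car (P j)|] ==> act j h k x : car (P j)"
 by (rule elem_closed[OF P_module X_M])

lemma act_add: "[|h : car (H X); k : car K; x : car (P j); y : car (P j)|] ==>
  act j h k (x \<oplus>\<^sub>(P j) y) = act j h k x \<oplus>\<^sub>(P j) act j h k y"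
 by (rule elem_add[OF P_module X_M])

lemma act_zero: "[|h : car (H X); k : car K|] ==> act j h k \<zero>\<^sub>(P j) = \<zero>\<^sub>(P j)"
 by (rule elem_zero[OF P_module X_M])

lemma act_act: "[|h : car (H X); k : car K; h' : car (H X); k' : car K; x : car (P j)|] ==>
  act j h k (act j h' k' x) = act j (h \<otimes>\<^sub>Gn h') (k \<otimes>\<^sub>K k') x"
 using elem_elem[OF P_module X_M _ X_M, of h k h' k' x j] by (simp add: S_idem[OF l])

lemma X_one: "\<one>\<^sub>Gn : car (H X)"
 by (rule H_one[OF S_part[OF l]])

lemma U_act: "[|h : car (H X); k : car K; x : car (P j)|] ==> act j h k x : U j"
 using act_act[OF X_one K.one_closed, of h k x j] by (simp add: fixed_part_def act_closed H_Gn)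

lemma act_one: "x : U j ==> act j \<one>\<^sub>Gn \<one>\<^sub>K x = x"
 by (simp add: fixed_part_def)

lemma act_scalar_add: "[|h : car (H X); k : car K; k' : car K; x : car (P j)|] ==>
  act j h (k \<oplus>\<^sub>K k') x = act j h k x \<oplus>\<^sub>(P j) act j h k' x"
proof -
 assume *: "h : car (H X)" "k : car K" "k' : car K" "x : car (P j)"
 have "single K (l, h) (k \<oplus>\<^sub>K k') = single K (l, h) k \<oplus>\<^sub>A single K (l, h) k'"
  by (auto simp: single_def add_alg)
 thus ?thesis
  using left_module.smult_l_distr[OF P_module] single_closed[OF K_ring M.monoid_axioms X_M] * by simp
qed

lemma act_scalar_zero: "x : car (P j) ==> act j h \<zero>\<^sub>K x = \<zero>\<^sub>(P j)"
proof -
 assume x: "x : car (P j)"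
 have "single K (l, h) \<zero>\<^sub>K = \<zero>\<^sub>A" by (auto simp: single_def zero_alg)
 thus ?thesis using left_module.smult_l_null[OF P_module x] by simp
qed

lemma d_closed: "x : car (P (Suc j)) ==> d j x : car (P j)"
 by (rule mod_hom_closed[OF d_hom])

lemma d_add: "[|x : car (P (Suc j)); y : car (P (Suc j))|] ==> d j (x \<oplus>\<^sub>(P (Suc j)) y) = d j x \<oplus>\<^sub>(P j) d j y"
 by (rule mod_hom_add[OF d_hom])

lemma d_zero: "d j \<zero>\<^sub>(P (Suc j)) = \<zero>\<^sub>(P j)"
 by (rule mod_hom_zero[OF d_hom P_group P_group])

lemma d_act: "[|h : car (H X); k : car K; x : car (P (Suc j))|] ==> d j (act (Suc j) h k x) = act j h k (d j x)"
 by (rule elem_hom[OF d_hom X_M])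

lemma U_d: "x : U (Suc j) ==> d j x : U j"
 using d_act[OF X_one K.one_closed, of x j] d_closed[of x j] by (simp add: fixed_part_def)

lemma d_d: "x : car (P (Suc (Suc j))) ==> d j (d (Suc j) x) = \<zero>\<^sub>(P j)"
 using resolution_exact[OF resolution d_closed, of x j] by blast

lemma act_mat:
 assumes "h : car (H X)" "k : car K" "!!b. b : C ==> f b : car (P j)"
 shows "act j h k (mat_act (P j) C N f b') = mat_act (P j) C N (%b. act j h k (f b)) b'"
 by (rule mat_act_natural[OF P_group P_group]) (use assms in "auto simp: act_closed act_add")

lemma d_mat:
 assumes "!!b. b : C ==> f b : car (P (Suc j))"
 shows "d j (mat_act (P (Suc j)) C N f b') = mat_act (P j) C N (%b. d j (f b)) b'"
 by (rule mat_act_natural[OF P_group P_group]) (use assms in "auto simp: d_closed d_add")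

lemma U_mat:
 assumes "!!b. b : C ==> f b : U j"
 shows "mat_act (P j) C N f b' : U j"
proof -
 interpret Pj: abelian_group "P j" by (rule P_group)
 have c: "f b : car (P j)" if "b : C" for b using assms[OF that] by (rule U_closed)
 have "act j \<one>\<^sub>Gn \<one>\<^sub>K (mat_act (P j) C N f b') = mat_act (P j) C N f b'"
 proof -
  have "act j \<one>\<^sub>Gn \<one>\<^sub>K (mat_act (P j) C N f b') = mat_act (P j) C N (%b. act j \<one>\<^sub>Gn \<one>\<^sub>K (f b)) b'"
   by (rule act_mat) (use X_one c in auto)
  also have "... = mat_act (P j) C N f b'" by (rule Pj.mat_act_cong) (use assms c act_one in auto)
  finally show ?thesis .
 qed
 thus ?thesis using Pj.mat_act_closed[of C f N b'] c by (simp add: fixed_part_def)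
qed

lemma finite_C: "finite C"
 by (rule finite_set_cells[OF l])

lemma C_iff: "cl : C \<longleftrightarrow> cl : car S & leq X (set cl)"
 using cell_ordered_partition[OF l] by simp

lemma length_l: "length l = card X"
 using l by (simp add: carrier_ordered_partitions distinct_card)

text \<open>An ordered partition \<open>cl\<close> that coarsens \<open>X\<close> carries a copy of \<open>U j\<close> in the total degree
  \<open>j + |X| - |cl|\<close>. Elements of the total complex are functions on all pairs \<open>j, cl\<close>.\<close>

definition tot :: "nat => (nat => nat set list => 'p) set" where
 "tot r = {F. \<forall>j cl. F j cl : U j & (~ (cl : C & r + length cl = length l + j) --> F j cl = \<zero>\<^sub>(P j))}"

definition plus :: "(nat => nat set list => 'p) => (nat => nat set list => 'p) => nat => nat set list => 'p" where
 "plus F F' = (%j cl. F j cl \<oplus>\<^sub>(P j) F' j cl)"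

definition null :: "nat => nat set list => 'p" where
 "null = (%j cl. \<zero>\<^sub>(P j))"

definition scale :: "(nat => 'g) => 'k => (nat => nat set list => 'p) => nat => nat set list => 'p" where
 "scale h k F = (%j cl. act j h k (F j cl))"

definition mat :: "(nat => nat set list => nat set list => int) => (nat => nat set list => 'p) => nat => nat set list => 'p" where
 "mat N F = (%j. mat_act (P j) C (N j) (F j))"

definition vert :: "(nat => nat set list => 'p) => nat => nat set list => 'p" where
 "vert F = (%j cl. d j (F (Suc j) cl))"

definition dirac :: "nat => nat set list => 'p => nat => nat set list => 'p" where
 "dirac j cl u = (%j' cl'. if j' = j & cl' = cl then u else \<zero>\<^sub>(P j'))"

text \<open>The sign \<open>(-1)\<^sup>j\<close> stands at the cellular boundary, so that the differential at a vertex is \<open>d\<close> itself.\<close>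

definition tot_diff :: "(nat => nat set list => 'p) => nat => nat set list => 'p" where
 "tot_diff F = plus (mat (%j cl' cl. (-1) ^ j * boundary X cl' cl) F) (vert F)"

lemma totD: "F : tot r ==> F j cl : U j"
 and tot_closed: "F : tot r ==> F j cl : car (P j)"
 and tot_zero: "F : tot r ==> ~ (cl : C & r + length cl = length l + j) ==> F j cl = \<zero>\<^sub>(P j)"
 unfolding tot_def by (blast intro: U_closed)+

lemma totI: "(!!j cl. F j cl : U j) ==>
  (!!j cl. ~ (cl : C & r + length cl = length l + j) ==> F j cl = \<zero>\<^sub>(P j)) ==> F : tot r"
 unfolding tot_def by blast

lemma null_tot: "null : tot r"
 by (rule totI) (simp_all add: null_def U_zero)

lemma plus_tot: "[|F : tot r; F' : tot r|] ==> plus F F' : tot r"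
proof (rule totI)
 assume F: "F : tot r" "F' : tot r"
 fix j cl
 interpret Pj: abelian_group "P j" by (rule P_group)
 show "plus F F' j cl : U j" unfolding plus_def by (intro U_add totD[OF F(1)] totD[OF F(2)])
 show "plus F F' j cl = \<zero>\<^sub>(P j)" if "~ (cl : C & r + length cl = length l + j)"
  unfolding plus_def tot_zero[OF F(1) that] tot_zero[OF F(2) that] by simp
qed

lemma scale_tot: "[|h : car (H X); k : car K; F : tot r|] ==> scale h k F : tot r"
 by (rule totI) (simp_all add: scale_def U_act tot_closed tot_zero[of F r] act_zero del: mem_Collect_eq)

lemma vert_tot: "F : tot (Suc r) ==> vert F : tot r"
proof (rule totI)
 assume F: "F : tot (Suc r)"
 show "vert F j cl : U j" for j cl unfolding vert_def by (rule U_d[OF totD[OF F]])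
 fix j cl assume "~ (cl : C & r + length cl = length l + j)"
 hence "F (Suc j) cl = \<zero>\<^sub>(P (Suc j))" by (intro tot_zero[OF F]) simp
 thus "vert F j cl = \<zero>\<^sub>(P j)" by (simp add: vert_def d_zero)
qed

lemma mat_tot:
 assumes F: "F : tot r"
  and N: "!!j cl' cl. [|N j cl' cl ~= 0; cl : C|] ==> cl' : C & r' + length cl' = r + length cl"
 shows "mat N F : tot r'"
proof (rule totI)
 show "mat N F j cl : U j" for j cl unfolding mat_def by (rule U_mat) (rule totD[OF F])
 fix j cl' assume n: "~ (cl' : C & r' + length cl' = length l + j)"
 show "mat N F j cl' = \<zero>\<^sub>(P j)"
  unfolding mat_def
 proof (rule abelian_group.mat_act_zero[OF P_group])
  fix cl assume "cl : C" "N j cl' cl ~= 0"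
  thus "F j cl = \<zero>\<^sub>(P j)" using N[of j cl' cl] n by (intro tot_zero[OF F]) auto
 qed
qed

lemma dirac_tot: "[|cl : C; r + length cl = length l + j; u : U j|] ==> dirac j cl u : tot r"
 by (rule totI) (auto simp: dirac_def U_zero)

lemma boundary_C: "[|(-1) ^ j * boundary X cl' cl ~= 0; cl : C|] ==> cl' : C & r + length cl' = Suc r + length cl"
 using boundary_length[OF l, of cl' cl] by (simp add: boundary_def split: if_splits)

lemma tot_diff_tot: "F : tot (Suc r) ==> tot_diff F : tot r"
 unfolding tot_diff_def by (intro plus_tot vert_tot mat_tot[where r = "Suc r"] boundary_C)

lemma plus_ac:
 assumes "F : tot r" "F' : tot r"
 shows "plus F F' = plus F' F" "plus null F = F" "plus F null = F"
  "F'' : tot r ==> plus (plus F F') F'' = plus F (plus F' F'')"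
 unfolding plus_def null_def
 by (intro ext; use assms in "simp add: tot_closed abelian_groupE(3,4) abelian_monoid.a_comm[OF ag_monoid[OF P_group]]
   abelian_monoid.r_zero[OF ag_monoid[OF P_group]] abelian_monoid.l_zero[OF ag_monoid[OF P_group]]
   abelian_monoid.a_assoc[OF ag_monoid[OF P_group]]")+

lemma mat_plus: "[|F : tot r; F' : tot r|] ==> mat N (plus F F') = plus (mat N F) (mat N F')"
 unfolding mat_def plus_def by (intro ext abelian_group.mat_act_add[OF P_group] tot_closed)

lemma vert_plus: "[|F : tot r; F' : tot r|] ==> vert (plus F F') = plus (vert F) (vert F')"
 unfolding vert_def plus_def by (intro ext d_add tot_closed)

lemma scale_plus: "[|h : car (H X); k : car K; F : tot r; F' : tot r|] ==>
  scale h k (plus F F') = plus (scale h k F) (scale h k F')"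
 unfolding scale_def plus_def by (intro ext act_add tot_closed)

lemma mat_mat: "F : tot r ==> mat N (mat N' F) = mat (%j cl' cl. \<Sum>rh\<in>C. N j cl' rh * N' j rh cl) F"
 unfolding mat_def by (intro ext abelian_group.mat_act_comp[OF P_group] tot_closed)

lemma mat_cong: "[|F : tot r; !!j cl' cl. cl : C ==> N j cl' cl = N' j cl' cl|] ==> mat N F = mat N' F"
 unfolding mat_def by (intro ext abelian_group.mat_act_cong[OF P_group] tot_closed refl)

lemma mat_matrix_add: "F : tot r ==> plus (mat N F) (mat N' F) = mat (%j cl' cl. N j cl' cl + N' j cl' cl) F"
 unfolding mat_def plus_def by (intro ext abelian_group.mat_act_matrix_add[OF P_group, symmetric] tot_closed)

lemma mat_zero_matrix: "(!!j cl' cl. cl : C ==> N j cl' cl = 0) ==> mat N F = null"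
 unfolding mat_def null_def by (intro ext abelian_group.mat_act_zero[OF P_group]) simp

lemma mat_identity:
 assumes F: "F : tot r" shows "mat (%_ a b. if a = b then 1 else 0) F = F"
proof (intro ext)
 fix j cl
 show "mat (%_ a b. if a = b then 1 else 0) F j cl = F j cl"
 proof (cases "cl : C")
  case True
  thus ?thesis unfolding mat_def
   by (intro abelian_group.mat_act_identity[OF P_group finite_C] tot_closed[OF F])
 next
  case False
  have "mat (%_ a b. if a = b then 1 else 0) F j cl = \<zero>\<^sub>(P j)" unfolding mat_def
   by (rule abelian_group.mat_act_zero[OF P_group]) (use False in "auto split: if_splits")
  thus ?thesis using tot_zero[OF F, of cl j] False by simp
 qed
qed

lemma scale_mat: "[|h : car (H X); k : car K; F : tot r|] ==> scale h k (mat N F) = mat N (scale h k F)"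
 unfolding mat_def scale_def by (intro ext act_mat tot_closed)

lemma vert_mat: "F : tot r ==> vert (mat N F) = mat (%j. N (Suc j)) (vert F)"
 unfolding mat_def vert_def by (intro ext d_mat tot_closed)

lemma scale_vert: "[|h : car (H X); k : car K; F : tot r|] ==> scale h k (vert F) = vert (scale h k F)"
 unfolding scale_def vert_def by (intro ext d_act[symmetric] tot_closed)

lemma scale_scale: "[|h : car (H X); k : car K; h' : car (H X); k' : car K; F : tot r|] ==>
  scale h k (scale h' k' F) = scale (h \<otimes>\<^sub>Gn h') (k \<otimes>\<^sub>K k') F"
 unfolding scale_def by (intro ext act_act tot_closed)

lemma scale_one: "F : tot r ==> scale \<one>\<^sub>Gn \<one>\<^sub>K F = F"
 unfolding scale_def by (intro ext act_one totD)

definition tot_space :: "nat => ('k, nat => nat set list => 'p) module" where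
 "tot_space r = \<lparr>carrier = tot r, monoid.mult = undefined, one = undefined, ring.zero = null, ring.add = plus,
   smult = scale \<one>\<^sub>Gn\<rparr>"

lemma left_module_tot_space: "left_module K (tot_space r)"
proof (rule left_moduleI[OF K_ring])
 note o = X_one
 show "abelian_group (tot_space r)"
 proof (rule abelian_groupI)
  fix F assume "F : car (tot_space r)"
  hence F: "F : tot r" by (simp add: tot_space_def)
  have "plus (scale \<one>\<^sub>Gn (\<ominus>\<^sub>K \<one>\<^sub>K) F) (scale \<one>\<^sub>Gn \<one>\<^sub>K F) = null"
   unfolding plus_def scale_def null_def using tot_closed[OF F]
   by (intro ext) (simp add: act_scalar_add[OF o, symmetric] act_scalar_zero K.l_neg)
  thus "\<exists>F'\<in>car (tot_space r). F' \<oplus>\<^sub>(tot_space r) F = \<zero>\<^sub>(tot_space r)"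
   using scale_tot[OF o _ F, of "\<ominus>\<^sub>K \<one>\<^sub>K"] scale_one[OF F] by (simp add: tot_space_def) metis
 next
  show "\<zero>\<^sub>(tot_space r) : car (tot_space r)" by (simp add: tot_space_def null_tot)
 next
  fix F F' assume "F : car (tot_space r)" "F' : car (tot_space r)"
  hence F: "F : tot r" "F' : tot r" by (simp_all add: tot_space_def)
  show "F \<oplus>\<^sub>(tot_space r) F' : car (tot_space r)" using plus_tot[OF F] by (simp add: tot_space_def)
  show "F \<oplus>\<^sub>(tot_space r) F' = F' \<oplus>\<^sub>(tot_space r) F" using plus_ac(1)[OF F] by (simp add: tot_space_def)
  show "\<zero>\<^sub>(tot_space r) \<oplus>\<^sub>(tot_space r) F = F" using plus_ac(2)[OF F] by (simp add: tot_space_def)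
  fix F'' assume "F'' : car (tot_space r)"
  thus "F \<oplus>\<^sub>(tot_space r) F' \<oplus>\<^sub>(tot_space r) F'' = F \<oplus>\<^sub>(tot_space r) (F' \<oplus>\<^sub>(tot_space r) F'')"
   using plus_ac(4)[OF F] by (simp add: tot_space_def)
 qed
 show "a \<odot>\<^sub>(tot_space r) F : car (tot_space r)" if "a : car K" "F : car (tot_space r)" for a F
  using that by (simp add: tot_space_def scale_tot[OF o])
 show "(a \<oplus>\<^sub>K b) \<odot>\<^sub>(tot_space r) F = a \<odot>\<^sub>(tot_space r) F \<oplus>\<^sub>(tot_space r) b \<odot>\<^sub>(tot_space r) F"
  if "a : car K" "b : car K" "F : car (tot_space r)" for a b F
  using that by (simp add: tot_space_def scale_def plus_def act_scalar_add[OF o] tot_closed)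
 show "a \<odot>\<^sub>(tot_space r) (F \<oplus>\<^sub>(tot_space r) F') = a \<odot>\<^sub>(tot_space r) F \<oplus>\<^sub>(tot_space r) a \<odot>\<^sub>(tot_space r) F'"
  if "a : car K" "F : car (tot_space r)" "F' : car (tot_space r)" for a F F'
  using that by (simp add: tot_space_def scale_plus[OF o])
 show "(a \<otimes>\<^sub>K b) \<odot>\<^sub>(tot_space r) F = a \<odot>\<^sub>(tot_space r) (b \<odot>\<^sub>(tot_space r) F)"
  if "a : car K" "b : car K" "F : car (tot_space r)" for a b F
  using that by (simp add: tot_space_def scale_scale[OF o _ o])
 show "\<one>\<^sub>K \<odot>\<^sub>(tot_space r) F = F" if "F : car (tot_space r)" for F
  using that by (simp add: tot_space_def scale_one)
qed

text \<open>The action of \<open>(ta, h)\<close>: by \<open>ta\<close> on the faces and by \<open>(l, h)\<close> on the coefficients. The second makes sense only if \<open>ta\<close> coarsens \<open>X\<close>; otherwise \<open>ta\<close> fixes no face and the action has to be zero.\<close>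

definition translate :: "nat set list \<times> (nat => 'g) => (nat => nat set list => 'p) => nat => nat set list => 'p" where
 "translate m F = (if leq X (set (fst m)) then mat (%_. action n (fst m)) (scale (snd m) \<one>\<^sub>K F) else null)"

definition Tot :: "nat => (nat set list \<times> (nat => 'g) => 'k, nat => nat set list => 'p) module" where
 "Tot r = rep_module K (tot_space r) translate"

lemma Tot_simps [simp]:
 "car (Tot r) = tot r" "\<zero>\<^sub>(Tot r) = null" "F \<oplus>\<^sub>(Tot r) F' = plus F F'"
 by (simp_all add: Tot_def carrier_rep_module zero_rep_module add_rep_module) (simp_all add: tot_space_def)

lemma action_tot: "ta : car S ==> F : tot r ==> mat (%_. action n ta) F : tot r"
 by (rule mat_tot) (use action_nonzeroD[OF l, of ta] in auto)

lemma scale_null: "[|h : car (H X); k : car K|] ==> scale h k null = null"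
 by (simp add: scale_def null_def act_zero)

lemma mat_null: "mat N null = null"
 unfolding mat_def null_def by (intro ext abelian_group.mat_act_zero[OF P_group] refl)

lemma
 shows left_module_Tot: "left_module A (Tot r)"
  and Tot_elem: "[|(ta, h) : car M; k : car K; F : tot r|] ==>
   elem (Tot r) ta h k F = (if leq X (set ta) then mat (%_. action n ta) (scale h k F) else null)"
proof -
 have MX: "ta : car S & (leq X (set ta) --> h : car (H X))" if "(ta, h) : car M" for ta h
  using that by (auto simp: M_iff intro: H_mono)
 have null': "translate m null = null" if "m : car M" for m
  using MX[of "fst m" "snd m"] that by (simp add: translate_def scale_null mat_null)
 have closed: "translate m F : tot r" if "m : car M" "F : tot r" for m F
  using MX[of "fst m" "snd m"] that by (simp add: translate_def scale_tot action_tot null_tot)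
 have add: "translate m (plus F F') = plus (translate m F) (translate m F')" if "m : car M" "F : tot r" "F' : tot r" for m F F'
  using MX[of "fst m" "snd m"] that by (simp add: translate_def scale_plus mat_plus[OF scale_tot scale_tot] plus_ac(2)[OF null_tot null_tot])
 have sm: "translate m (scale \<one>\<^sub>Gn k F) = scale \<one>\<^sub>Gn k (translate m F)"
  and sm': "leq X (set (fst m)) ==> scale \<one>\<^sub>Gn k (translate m F) = mat (%_. action n (fst m)) (scale (snd m) k F)"
  if "m : car M" "k : car K" "F : tot r" for m k F
 proof -
  have h: "fst m : car S" "leq X (set (fst m)) ==> snd m : car (H X)" using MX[of "fst m" "snd m"] that by auto
  have e: "snd m \<otimes>\<^sub>Gn \<one>\<^sub>Gn = snd m" "\<one>\<^sub>Gn \<otimes>\<^sub>Gn snd m = snd m" if "leq X (set (fst m))"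
   using Gn.l_one[OF H_Gn[OF h(2)[OF that]]] Gn.r_one[OF H_Gn[OF h(2)[OF that]]] by blast+
  show "translate m (scale \<one>\<^sub>Gn k F) = scale \<one>\<^sub>Gn k (translate m F)"
   using h that by (simp add: translate_def scale_mat[OF X_one _ scale_tot] scale_scale[OF X_one] scale_scale[OF _ _ X_one] scale_null[OF X_one] e)
  show "scale \<one>\<^sub>Gn k (translate m F) = mat (%_. action n (fst m)) (scale (snd m) k F)" if "leq X (set (fst m))"
   using h that \<open>k : car K\<close> \<open>F : tot r\<close> by (simp add: translate_def scale_mat[OF X_one _ scale_tot] scale_scale[OF X_one] e)
 qed
 have mult: "translate (m \<otimes>\<^sub>M m') F = translate m (translate m' F)" if m: "m : car M" "m' : car M" and F: "F : tot r" for m m' F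
 proof -
  obtain ta h ta' h' where mm: "m = (ta, h)" "m' = (ta', h')" by (cases m, cases m')
  have S: "ta : car S" "ta' : car S" using m MX by (auto simp: mm)
  show ?thesis
  proof (cases "leq X (set ta')")
   case r': True
   show ?thesis
   proof (cases "leq X (set ta)")
    case r: True
    have h: "h : car (H X)" "h' : car (H X)" using m MX r r' by (auto simp: mm)
    have "translate m (translate m' F) = mat (%_. action n ta) (mat (%_. action n ta') (scale (h \<otimes>\<^sub>Gn h') \<one>\<^sub>K F))"
    using r r' h F by (simp add: translate_def mm scale_mat[OF _ _ scale_tot] scale_scale)
    also have "... = mat (%_. action n (ta \<otimes>\<^sub>S ta')) (scale (h \<otimes>\<^sub>Gn h') \<one>\<^sub>K F)"
    proof -
    have c: "scale (h \<otimes>\<^sub>Gn h') \<one>\<^sub>K F : tot r" using h F by (simp add: scale_tot H_mult[OF S_part[OF l]])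
    show ?thesis
    unfolding mat_mat[OF c] by (rule mat_cong[OF c]) (use action_product[OF l S] in simp)
    qed
    finally show ?thesis using r r' S_leq_product[OF S] by (simp add: translate_def mm M_mult)
   next
    case False
    thus ?thesis using S_leq_product[OF S, of X] by (simp add: translate_def mm M_mult)
   qed
  next
   case False
   hence "translate m' F = null" "translate (m \<otimes>\<^sub>M m') F = null"
    using S_leq_product[OF S, of X] by (simp_all add: translate_def mm M_mult)
   thus ?thesis using null'[OF m(1)] by simp
  qed
 qed
 have one: "translate \<one>\<^sub>M F = F" if F: "F : tot r" for F
 proof -
  have "mat (%_. action n \<one>\<^sub>S) F = mat (%_ a b. if a = b then 1 else 0) F"
   by (rule mat_cong[OF F]) (use action_one[OF l] in simp)
  hence "mat (%_. action n \<one>\<^sub>S) F = F" by (simp only: mat_identity[OF F])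
  moreover have "leq X (set \<one>\<^sub>S)" using refines_one[OF S_part[OF l]] by simp
  ultimately show ?thesis by (simp add: translate_def one_hsiao_monoid scale_one[OF F])
 qed
 note rep = K_cring M.monoid_axioms left_module_tot_space
 note ops = tot_space_def
 show "left_module A (Tot r)" unfolding Tot_def
  by (rule left_module_rep_module[OF rep]) (simp_all add: ops closed add sm mult one)
 have "single K m k \<odot>\<^sub>(Tot r) F = k \<odot>\<^sub>(tot_space r) translate m F" if "m : car M" "k : car K" "F : tot r" for m k F
  unfolding Tot_def by (rule rep_module_single[OF rep]) (use that in "simp_all add: ops closed add sm mult one")
 thus "elem (Tot r) ta h k F = (if leq X (set ta) then mat (%_. action n ta) (scale h k F) else null)"
  if "(ta, h) : car M" "k : car K" "F : tot r"
  using that sm'[of "(ta, h)" k F] by (simp add: ops) (simp add: translate_def scale_null X_one)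
qed

end

context apex_resolution
begin

lemma length_C: "cl : C ==> length cl <= length l"
 using cell_length[of "set l" cl] length_l by simp

lemma P_zero: "\<zero>\<^sub>(P j) : car (P j)"
 and P_l_zero: "x : car (P j) ==> \<zero>\<^sub>(P j) \<oplus>\<^sub>(P j) x = x"
 and P_r_zero: "x : car (P j) ==> x \<oplus>\<^sub>(P j) \<zero>\<^sub>(P j) = x"
 using ag_monoid[OF P_group[of j]]
 by (blast intro: abelian_monoid.zero_closed abelian_monoid.l_zero abelian_monoid.r_zero)+

lemma mat_dirac:
 assumes "cl : C" "u : car (P j)"
 shows "mat N (dirac j cl u) = (%j' cl'. if j' = j then add_pow (P j) (N j cl' cl) u else \<zero>\<^sub>(P j'))"
proof (intro ext)
 fix j' cl'
 show "mat N (dirac j cl u) j' cl' = (if j' = j then add_pow (P j) (N j cl' cl) u else \<zero>\<^sub>(P j'))"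
 proof (cases "j' = j")
  case True
  thus ?thesis
   using abelian_group.mat_act_single[OF P_group finite_C assms, of "N j" cl'] by (simp add: mat_def dirac_def)
 next
  case False
  have "mat N (dirac j cl u) j' cl' = \<zero>\<^sub>(P j')" unfolding mat_def
   by (rule abelian_group.mat_act_zero[OF P_group]) (use False in "simp add: dirac_def")
  thus ?thesis using False by simp
 qed
qed

lemma scale_dirac: "[|h : car (H X); k : car K|] ==> scale h k (dirac j cl u) = dirac j cl (act j h k u)"
 by (auto simp: scale_def dirac_def fun_eq_iff act_zero)

lemma dirac_add: "[|u : car (P j); v : car (P j)|] ==> dirac j cl (u \<oplus>\<^sub>(P j) v) = plus (dirac j cl u) (dirac j cl v)"
 by (auto simp: dirac_def plus_def fun_eq_iff P_l_zero P_zero)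

lemma Tot_elem_dirac:
 assumes m: "(ta, h) : car M" and k: "k : car K" and cl: "cl : C" and r: "r + length cl = length l + j" and u: "u : U j"
 shows "elem (Tot r) ta h k (dirac j cl u) =
  (if leq (set cl) (set ta) then dirac j (ta \<otimes>\<^sub>S cl) (act j h k u) else null)"
proof (cases "leq X (set ta)")
 case True
 have h: "h : car (H X)" using m True by (auto simp: M_iff intro: H_mono)
 have c: "act j h k u : car (P j)" by (rule act_closed[OF h k U_closed[OF u]])
 have "elem (Tot r) ta h k (dirac j cl u) = mat (%_. action n ta) (dirac j cl (act j h k u))"
  using Tot_elem[OF m k dirac_tot[OF cl r u]] True by (simp add: scale_dirac[OF h k])
 also have "... = (if leq (set cl) (set ta) then dirac j (ta \<otimes>\<^sub>S cl) (act j h k u) else null)"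
  unfolding mat_dirac[OF cl c]
  using c by (auto simp: action_def dirac_def null_def fun_eq_iff abelian_group.int_scale_0[OF P_group] abelian_group.int_scale_1[OF P_group])
 finally show ?thesis .
next
 case False
 hence "~ leq (set cl) (set ta)" using cl refines_trans[of "{1..n}" X "set cl" "set ta"] by (auto simp: C_iff simp del: mem_Collect_eq)
 thus ?thesis using False Tot_elem[OF m k dirac_tot[OF cl r u]] by simp
qed

text \<open>An additive statement about the total complex holds as soon as it holds for the functions that
  are supported at one point.\<close>

lemma tot_induct:
 assumes F: "F : tot r" and zero: "Q null"
  and plus: "!!F F'. [|F : tot r; F' : tot r; Q F; Q F'|] ==> Q (plus F F')"
  and dirac: "!!j cl u. [|cl : C; r + length cl = length l + j; u : U j|] ==> Q (dirac j cl u)"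
 shows "Q F"
proof -
 have "\<forall>F\<in>tot r. (\<forall>j cl. cl ~: I --> F j cl = \<zero>\<^sub>(P j)) --> Q F" if "finite I" "I <= C" for I
  using that
 proof (induction I)
  case empty
  have "F = null" if "\<forall>j cl. F j cl = \<zero>\<^sub>(P j)" for F using that by (simp add: null_def fun_eq_iff)
  thus ?case using zero by auto
 next
  case (insert cl I)
  show ?case
  proof (intro ballI impI)
   fix F assume F: "F : tot r" and z: "\<forall>j cl'. cl' ~: insert cl I --> F j cl' = \<zero>\<^sub>(P j)"
   have cl: "cl : C" using insert.prems by blast
   let ?F = "%j cl'. if cl' = cl then \<zero>\<^sub>(P j) else F j cl'"
   have F': "?F : tot r" by (rule totI) (use totD[OF F] tot_zero[OF F] U_zero in auto)
   have Q': "Q ?F" using insert.IH insert.prems F' z by auto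
   show "Q F"
   proof (cases "length l <= r + length cl")
    case True
    define j where "j = r + length cl - length l"
    have j: "r + length cl = length l + j" using True by (simp add: j_def)
    have zj: "F j' cl = \<zero>\<^sub>(P j')" if "j' ~= j" for j' by (rule tot_zero[OF F]) (use j that in auto)
    have dt: "dirac j cl (F j cl) : tot r" by (rule dirac_tot[OF cl j totD[OF F]])
    have "F = plus ?F (dirac j cl (F j cl))"
    proof (intro ext)
    fix j' cl'
    show "F j' cl' = plus ?F (dirac j cl (F j cl)) j' cl'"
    using tot_closed[OF F, of j' cl'] zj[of j'] by (auto simp: plus_def dirac_def P_l_zero P_r_zero P_zero)
    qed
    thus ?thesis using plus[OF F' dt Q' dirac[OF cl j totD[OF F]]] by simp
   next
    case False
    have "F j cl = \<zero>\<^sub>(P j)" for j by (rule tot_zero[OF F]) (use False in auto)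
    hence "?F = F" by (auto simp: fun_eq_iff)
    thus ?thesis using Q' by simp
   qed
  qed
 qed
 from this[OF finite_C order_refl] show ?thesis using F tot_zero[OF F] by blast
qed

lemma plus_swap:
 assumes "a : tot r" "b : tot r" "c : tot r" "c' : tot r"
 shows "plus (plus a b) (plus c c') = plus (plus a c) (plus b c')"
proof (intro ext)
 fix j cl
 interpret Pj: abelian_group "P j" by (rule P_group)
 show "plus (plus a b) (plus c c') j cl = plus (plus a c) (plus b c') j cl"
  unfolding plus_def using assms[THEN tot_closed] by (simp add: Pj.a_ac)
qed

lemma null_null: "plus null null = null"
 by (rule plus_ac(2)[OF null_tot null_tot])

lemma sign_cancel: "(-1) ^ j * x * ((-1) ^ j * y) = x * (y::int)"
 by (cases "even j") auto

abbreviation bd where "bd \<equiv> %j cl' cl. (-1) ^ j * boundary X cl' cl"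

lemma bd_tot: "F : tot (Suc r) ==> mat bd F : tot r"
 by (intro mat_tot[where r = "Suc r"] boundary_C)

lemma tot_diff_plus:
 assumes "F : tot (Suc r)" "F' : tot (Suc r)"
 shows "tot_diff (plus F F') = plus (tot_diff F) (tot_diff F')"
 unfolding tot_diff_def mat_plus[OF assms] vert_plus[OF assms]
 by (rule plus_swap[OF bd_tot bd_tot vert_tot vert_tot]) (rule assms)+

lemma tot_diff_null: "tot_diff null = null"
proof -
 have "vert null = null" by (auto simp: vert_def null_def d_zero)
 thus ?thesis by (simp add: tot_diff_def mat_null null_null)
qed

text \<open>The two parts of the differential anticommute because of the sign of the first.\<close>

lemma bd_vert:
 assumes "F : tot r" "vert F : tot r'" and N: "!!j cl' cl. N (Suc j) cl' cl = - N j cl' cl"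
 shows "plus (mat N (vert F)) (vert (mat N F)) = null"
 unfolding vert_mat[OF assms(1)] mat_matrix_add[OF assms(2)] by (rule mat_zero_matrix) (simp add: N)

lemma tot_diff_tot_diff:
 assumes F: "F : tot (Suc (Suc r))"
 shows "tot_diff (tot_diff F) = null"
proof -
 note bF = bd_tot[OF F] and vF = vert_tot[OF F]
 have "tot_diff (tot_diff F) = plus (plus (mat bd (mat bd F)) (mat bd (vert F))) (plus (vert (mat bd F)) (vert (vert F)))"
  by (simp add: tot_diff_def mat_plus[OF bF vF] vert_plus[OF bF vF])
 also have "mat bd (mat bd F) = null"
  unfolding mat_mat[OF F] by (rule mat_zero_matrix) (use boundary_boundary[OF l] in "simp add: sign_cancel")
 also have "vert (vert F) = null"
  unfolding vert_def null_def by (intro ext d_d tot_closed[OF F])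
 also have "plus (plus null (mat bd (vert F))) (plus (vert (mat bd F)) null) = plus (mat bd (vert F)) (vert (mat bd F))"
  by (simp only: plus_ac(2)[OF bd_tot[OF vF] null_tot] plus_ac(3)[OF vert_tot[OF bF] null_tot])
 also have "... = null" by (rule bd_vert[OF F vF]) simp
 finally show ?thesis .
qed

lemma action_bd:
 assumes ta: "ta : car S" and F: "F : tot r"
 shows "mat bd (mat (%_. action n ta) F) = mat (%_. action n ta) (mat bd F)"
 unfolding mat_mat[OF F]
proof (rule mat_cong[OF F])
 fix j cl' cl assume "cl : C"
 hence "(-1) ^ j * (\<Sum>rh\<in>C. boundary X cl' rh * action n ta rh cl) = (-1) ^ j * (\<Sum>rh\<in>C. action n ta cl' rh * boundary X rh cl)"
  using boundary_equivariant[OF l ta, of cl cl'] by simp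
 thus "(\<Sum>rh\<in>C. bd j cl' rh * action n ta rh cl) = (\<Sum>rh\<in>C. action n ta cl' rh * bd j rh cl)"
  by (simp add: sum_distrib_left mult_ac)
qed

definition D :: "nat => (nat => nat set list => 'p) => nat => nat set list => 'p" where
 "D r = restrict tot_diff (tot (Suc r))"

lemma D_hom: "D r : mod_hom A (Tot (Suc r)) (Tot r)"
proof (rule mod_hom_algI[OF K_ring M.monoid_axioms left_module_Tot left_module_Tot])
 show "D r : car (Tot (Suc r)) \<rightarrow>\<^sub>E car (Tot r)" by (simp add: D_def tot_diff_tot)
next
 fix F F' assume "F : car (Tot (Suc r))" "F' : car (Tot (Suc r))"
 thus "D r (F \<oplus>\<^sub>(Tot (Suc r)) F') = D r F \<oplus>\<^sub>(Tot r) D r F'" by (simp add: D_def plus_tot tot_diff_plus)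
next
 fix m k F assume m: "m : car M" and k: "k : car K" and "F : car (Tot (Suc r))"
 hence F: "F : tot (Suc r)" by simp
 obtain ta h where mm: "m = (ta, h)" by (cases m)
 have ta: "ta : car S" using m by (simp add: mm M_iff)
 have c: "single K m k \<odot>\<^sub>(Tot (Suc r)) F : tot (Suc r)"
  using elem_closed[OF left_module_Tot m[unfolded mm] k, of F "Suc r"] F by (simp add: mm)
 have "tot_diff (elem (Tot (Suc r)) ta h k F) = elem (Tot r) ta h k (tot_diff F)"
 proof (cases "leq X (set ta)")
  case True
  have h: "h : car (H X)" using m True by (auto simp: mm M_iff intro: H_mono)
  note sF = scale_tot[OF h k F]
  have "elem (Tot r) ta h k (tot_diff F) = mat (%_. action n ta) (scale h k (plus (mat bd F) (vert F)))"
   using Tot_elem[OF m[unfolded mm] k tot_diff_tot[OF F]] True by (simp add: tot_diff_def)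
  also have "... = mat (%_. action n ta) (plus (mat bd (scale h k F)) (vert (scale h k F)))"
   by (simp only: scale_plus[OF h k bd_tot[OF F] vert_tot[OF F]] scale_mat[OF h k F] scale_vert[OF h k F])
  also have "... = plus (mat bd (mat (%_. action n ta) (scale h k F))) (vert (mat (%_. action n ta) (scale h k F)))"
   by (simp only: mat_plus[OF bd_tot[OF sF] vert_tot[OF sF]] action_bd[OF ta sF] vert_mat[OF sF])
  also have "... = tot_diff (elem (Tot (Suc r)) ta h k F)"
   using Tot_elem[OF m[unfolded mm] k F] True by (simp add: tot_diff_def)
  finally show ?thesis by (rule sym)
 next
  case False
  thus ?thesis
   using Tot_elem[OF m[unfolded mm] k F] Tot_elem[OF m[unfolded mm] k tot_diff_tot[OF F]] by (simp add: tot_diff_null)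
 qed
 thus "D r (single K m k \<odot>\<^sub>(Tot (Suc r)) F) = single K m k \<odot>\<^sub>(Tot r) D r F"
  using F c by (simp add: D_def mm)
qed

lemma bd_dirac_l:
 assumes u: "u : U j" shows "mat bd (dirac j l u) = null"
proof -
 have "boundary X cl' l = 0" for cl'
 proof (rule ccontr)
  assume b: "boundary X cl' l ~= 0"
  hence "cl' : C" by (simp add: boundary_def split: if_splits)
  thus False using length_C boundary_length[OF l b] by fastforce
 qed
 thus ?thesis
  using u cell_l[OF l] by (simp add: mat_dirac U_closed null_def abelian_group.int_scale_0[OF P_group] fun_eq_iff)
qed

lemma vert_dirac: "vert (dirac (Suc j) cl u) = dirac j cl (d j u)" "vert (dirac 0 cl u) = null"
 by (auto simp: vert_def dirac_def null_def fun_eq_iff d_zero)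

lemma tot_diff_dirac_l:
 assumes u: "u : U (Suc j)" shows "tot_diff (dirac (Suc j) l u) = dirac j l (d j u)"
proof -
 have "dirac j l (d j u) : tot j" using U_d[OF u] cell_l[OF l] by (intro dirac_tot) auto
 from plus_ac(2)[OF this null_tot] show ?thesis by (simp add: tot_diff_def bd_dirac_l[OF u] vert_dirac)
qed

lemma tot_0:
 assumes F: "F : tot 0" shows "mat bd F = null" "vert F = null"
proof -
 have z: "F j cl = \<zero>\<^sub>(P j)" if "~ (j = 0 & length cl = length l)" for j cl
  by (rule tot_zero[OF F]) (use length_C[of cl] that in auto)
 show "vert F = null" unfolding vert_def null_def by (intro ext) (simp add: z d_zero)
 show "mat bd F = null" unfolding mat_def null_def
 proof (intro ext abelian_group.mat_act_zero[OF P_group] z)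
  fix j cl' cl assume "cl : C" "bd j cl' cl ~= 0"
  thus "~ (j = 0 & length cl = length l)" using boundary_C[of j cl' cl 0] length_C[of cl'] by auto
 qed
qed

abbreviation ht where "ht \<equiv> %j cl' cl. (-1) ^ j * homotopy l cl' cl"

lemma ht_tot: "F : tot r ==> mat ht F : tot (Suc r)"
proof (rule mat_tot)
 fix j cl' cl assume "ht j cl' cl ~= 0"
 thus "cl' : C & Suc r + length cl' = r + length cl"
  using homotopy_length[OF l, of cl' cl] by (simp add: homotopy_def split: if_splits)
qed

text \<open>A cycle is homologous to its projection to the component at \<open>l\<close>, which is a cycle of the
  complex of the \<open>U j\<close>.\<close>

lemma cycle_decomposition:
 assumes F: "F : tot r" and cycle: "tot_diff F = null"
 shows "\<exists>x\<in>U r. F = plus (tot_diff (mat ht F)) (dirac r l x)"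
proof -
 let ?\<Phi> = "mat (%_. vertex_projection l) F"
 have \<Phi>: "?\<Phi> : tot r"
  by (rule mat_tot[OF F]) (use vertex_projection_length[OF l] cell_l[OF l] in auto)
 have "?\<Phi> j cl = \<zero>\<^sub>(P j)" if "~ (j = r & cl = l)" for j cl
 proof (cases "cl = l")
  case True
  thus ?thesis using that by (intro tot_zero[OF \<Phi>]) auto
 next
  case False
  thus ?thesis unfolding mat_def
   by (intro abelian_group.mat_act_zero[OF P_group]) (simp add: vertex_projection_def)
 qed
 hence \<Phi>_eq: "?\<Phi> = dirac r l (?\<Phi> r l)" by (auto simp: dirac_def fun_eq_iff)
 have "\<exists>r'. mat bd F : tot r' & vert F : tot r'"
  using F tot_0[of F] null_tot[of 0] bd_tot[of F] vert_tot[of F] by (cases r) auto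
 then obtain r' where r': "mat bd F : tot r'" "vert F : tot r'" by blast
 have a: "plus (mat ht (mat bd F)) (mat ht (vert F)) = null"
  unfolding mat_plus[OF r', symmetric] using cycle by (simp add: tot_diff_def mat_null)
 have b: "plus (mat ht (vert F)) (vert (mat ht F)) = null" by (rule bd_vert[OF F r'(2)]) simp
 have c: "plus (plus (mat bd (mat ht F)) (mat ht (mat bd F))) ?\<Phi> = F"
  unfolding mat_mat[OF F] mat_matrix_add[OF F]
 proof (subst mat_identity[OF F, symmetric], rule mat_cong[OF F])
  fix j cl' cl assume cl: "cl : C"
  show "(\<Sum>rh\<in>C. bd j cl' rh * ht j rh cl) + (\<Sum>rh\<in>C. ht j cl' rh * bd j rh cl) + vertex_projection l cl' cl = (if cl' = cl then 1 else 0)"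
   unfolding sign_cancel
  proof (cases "cl' : C")
   case True
   thus "(\<Sum>rh\<in>C. boundary X cl' rh * homotopy l rh cl) + (\<Sum>rh\<in>C. homotopy l cl' rh * boundary X rh cl) + vertex_projection l cl' cl = (if cl' = cl then 1 else 0)"
    using boundary_homotopy[OF l, of cl cl'] cl by simp
  next
   case False
   hence "cl' ~= l" "cl' ~= cl" using cell_l[OF l] cl by auto
   thus "(\<Sum>rh\<in>C. boundary X cl' rh * homotopy l rh cl) + (\<Sum>rh\<in>C. homotopy l cl' rh * boundary X rh cl) + vertex_projection l cl' cl = (if cl' = cl then 1 else 0)"
    using False by (simp add: boundary_def homotopy_def vertex_projection_def)
  qed
 qed
 have "F = plus (plus (mat bd (mat ht F)) (vert (mat ht F))) ?\<Phi>"
 proof (intro ext)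
  fix j cl
  interpret Pj: abelian_group "P j" by (rule P_group)
  have mc: "mat N F' j cl : car (P j)" if "F' : tot s" for N F' s
   unfolding mat_def using tot_closed[OF that] by (intro Pj.mat_act_closed)
  note cl = mc[OF r'(1), of ht] mc[OF r'(2), of ht] tot_closed[OF vert_tot[OF ht_tot[OF F]], of j cl]
  have "mat ht (mat bd F) j cl \<oplus>\<^sub>(P j) mat ht (vert F) j cl = \<zero>\<^sub>(P j)"
   "vert (mat ht F) j cl \<oplus>\<^sub>(P j) mat ht (vert F) j cl = \<zero>\<^sub>(P j)"
   using fun_cong[OF fun_cong[OF a], of j cl] fun_cong[OF fun_cong[OF b], of j cl] cl by (simp_all add: plus_def null_def Pj.a_comm)
  hence "mat ht (mat bd F) j cl = vert (mat ht F) j cl"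
   using cl by (metis Pj.minus_equality Pj.a_comm)
  thus "F j cl = plus (plus (mat bd (mat ht F)) (vert (mat ht F))) ?\<Phi> j cl"
   using fun_cong[OF fun_cong[OF c], of j cl] by (simp add: plus_def)
 qed
 thus ?thesis using \<Phi>_eq totD[OF \<Phi>] unfolding tot_diff_def by metis
qed

definition aug :: "(nat => nat set list => 'p) => 'v" where
 "aug = (\<lambda>F\<in>tot 0. e (\<Oplus>\<^bsub>P 0\<^esub>cl\<in>C. F 0 cl))"

lemma e_hom: "e : mod_hom A (P 0) V"
 by (rule resolution_aug[OF resolution])

lemma V_group: "abelian_group V"
 by (rule left_module_group[OF V])

lemma P_finsum: "F : tot r ==> (\<Oplus>\<^bsub>P j\<^esub>cl\<in>C. F j cl) : car (P j)"
 by (rule abelian_monoid.finsum_closed[OF ag_monoid[OF P_group]]) (simp add: tot_closed)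

lemma aug_closed: "F : tot 0 ==> aug F : car V"
 using mod_hom_closed[OF e_hom P_finsum[of F 0 0]] by (simp add: aug_def)

lemma aug_plus: "[|F : tot 0; F' : tot 0|] ==> aug (plus F F') = aug F \<oplus>\<^sub>V aug F'"
proof -
 assume F: "F : tot 0" "F' : tot 0"
 interpret P0: abelian_group "P 0" by (rule P_group)
 have "(\<Oplus>\<^bsub>P 0\<^esub>cl\<in>C. plus F F' 0 cl) = (\<Oplus>\<^bsub>P 0\<^esub>cl\<in>C. F 0 cl) \<oplus>\<^sub>(P 0) (\<Oplus>\<^bsub>P 0\<^esub>cl\<in>C. F' 0 cl)"
  unfolding plus_def by (rule P0.finsum_addf) (use tot_closed[OF F(1)] tot_closed[OF F(2)] in auto)
 thus ?thesis
  using F plus_tot[OF F] mod_hom_add[OF e_hom P_finsum[OF F(1)] P_finsum[OF F(2)]] by (simp add: aug_def)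
qed

lemma aug_null: "aug null = \<zero>\<^sub>V"
 using mod_hom_zero[OF e_hom P_group V_group] abelian_monoid.finsum_zero[OF ag_monoid[OF P_group]]
 by (simp add: aug_def null_tot) (simp add: null_def abelian_monoid.finsum_zero[OF ag_monoid[OF P_group]])

lemma aug_dirac:
 assumes "cl : C" "length cl = length l" "u : U 0"
 shows "aug (dirac 0 cl u) = e u"
proof -
 interpret P0: abelian_group "P 0" by (rule P_group)
 have "(\<Oplus>\<^bsub>P 0\<^esub>cl'\<in>C. dirac 0 cl u 0 cl') = (\<Oplus>\<^bsub>P 0\<^esub>cl'\<in>C. if cl = cl' then u else \<zero>\<^sub>(P 0))"
  by (rule P0.finsum_cong') (use U_closed[OF assms(3)] in "auto simp: dirac_def")
 also have "... = u" using P0.finsum_singleton[OF assms(1) finite_C, of "%_. u"] U_closed[OF assms(3)] by simp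
 finally show ?thesis using dirac_tot[of cl 0 0 u] assms by (simp add: aug_def)
qed

lemma tot_0_support: "[|cl : C; 0 + length cl = length l + j|] ==> j = 0 & length cl = length l & set cl = X"
proof -
 assume cl: "cl : C" and j: "0 + length cl = length l + j"
 have *: "j = 0" "length cl = length l" using length_C[OF cl] j by auto
 have "set cl = X" using cell_full_length(2)[OF l _ *(2)] cl by simp
 thus ?thesis using * by blast
qed

lemma aug_hom: "aug : mod_hom A (Tot 0) V"
proof (rule mod_hom_algI[OF K_ring M.monoid_axioms left_module_Tot V])
 show "aug : car (Tot 0) \<rightarrow>\<^sub>E car V" using aug_closed by (auto simp: PiE_iff) (simp add: aug_def)
next
 fix F F' assume "F : car (Tot 0)" "F' : car (Tot 0)"
 thus "aug (F \<oplus>\<^sub>(Tot 0) F') = aug F \<oplus>\<^sub>V aug F'" by (simp add: aug_plus)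
next
 fix m k F assume m: "m : car M" and k: "k : car K" and "F : car (Tot 0)"
 hence F: "F : tot 0" by simp
 obtain ta h where mm: "m = (ta, h)" by (cases m)
 note m' = m[unfolded mm]
 note ec = elem_closed[OF left_module_Tot m' k, unfolded Tot_simps]
 show "aug (single K m k \<odot>\<^sub>(Tot 0) F) = single K m k \<odot>\<^sub>V aug F"
  unfolding mm
 proof (induction rule: tot_induct[OF F])
  case 1
  show ?case using elem_zero[OF left_module_Tot m' k, of 0] elem_zero[OF V m' k] by (simp add: aug_null)
 next
  case (2 F F')
  thus ?case using elem_add[OF left_module_Tot m' k, of F 0 F'] elem_add[OF V m' k aug_closed aug_closed, of F F'] ec
   by (simp add: aug_plus)
 next
  case (3 j cl u)
  have j: "j = 0" "length cl = length l" "set cl = X" using tot_0_support[OF 3(1,2)] by auto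
  have eu: "e u : car V" using mod_hom_closed[OF e_hom] U_closed[OF 3(3)] j by simp
  show ?case
  proof (cases "leq X (set ta)")
   case True
   have h: "h : car (H X)" using m' True by (auto simp: M_iff intro: H_mono)
   have p: "ta \<otimes>\<^sub>S cl : C & length (ta \<otimes>\<^sub>S cl) = length cl"
    using action_nonzeroD[OF l, of ta "ta \<otimes>\<^sub>S cl" cl] True 3(1) m' j by (simp add: action_def M_iff)
   have "aug (elem (Tot 0) ta h k (dirac j cl u)) = e (act 0 h k u)"
    using Tot_elem_dirac[OF m' k 3] True j p aug_dirac[of "ta \<otimes>\<^sub>S cl" "act 0 h k u"] U_act[OF h k] U_closed 3(3) by simp
   also have "... = elem V ta h k (e u)"
    using elem_hom[OF e_hom X_M[OF h] k] U_closed 3(3) j V_apex[OF m' k eu] True by simp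
   finally show ?thesis using aug_dirac[OF 3(1) j(2)] 3(3) j by simp
  next
   case False
   thus ?thesis
    using Tot_elem_dirac[OF m' k 3] j V_apex[OF m' k eu] aug_dirac[OF 3(1) j(2)] 3(3) by (simp add: aug_null)
  qed
 qed
qed

text \<open>On an edge this is \<open>boundary_augmentation\<close>; on a vertex it is \<open>e d = 0\<close>.\<close>

lemma aug_tot_diff:
 assumes F: "F : tot (Suc 0)" shows "aug (tot_diff F) = \<zero>\<^sub>V"
proof (induction rule: tot_induct[OF F])
 case 1
 show ?case by (simp add: tot_diff_null aug_null)
next
 case (2 F F')
 thus ?case
  using tot_diff_plus[OF 2(1,2)] aug_plus[OF tot_diff_tot[OF 2(1)] tot_diff_tot[OF 2(2)]]
   abelian_monoid.r_zero[OF ag_monoid[OF V_group]] abelian_monoid.zero_closed[OF ag_monoid[OF V_group]]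
  by simp
next
 case (3 j cl u)
 interpret P0: abelian_group "P 0" by (rule P_group)
 have t: "tot_diff (dirac j cl u) : tot 0" by (rule tot_diff_tot[OF dirac_tot[OF 3]])
 have uc: "u : car (P j)" by (rule U_closed[OF 3(3)])
 show ?case
 proof (cases j)
  case 0
  have len: "length cl < length l" using 3(2) 0 by simp
  have "tot_diff (dirac 0 cl u) = mat bd (dirac 0 cl u)"
   using plus_ac(3)[OF bd_tot[OF dirac_tot[OF 3]] null_tot] by (simp add: tot_diff_def vert_dirac 0)
  hence e1: "tot_diff (dirac 0 cl u) 0 cl' = add_pow (P 0) (boundary X cl' cl) u" for cl'
   using mat_dirac[OF 3(1) uc, of bd] 0 by simp
  have "(\<Oplus>\<^bsub>P 0\<^esub>cl'\<in>C. tot_diff (dirac 0 cl u) 0 cl') = add_pow (P 0) (\<Sum>cl'\<in>C. boundary X cl' cl) u"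
   unfolding e1 using uc 0 by (simp add: P0.int_scale_sum)
  also have "(\<Sum>cl'\<in>C. boundary X cl' cl) = (\<Sum>cl' | cell X cl' & length cl' = length l. boundary X cl' cl)"
  proof (rule sum.mono_neutral_right[OF finite_C])
   show "\<forall>i\<in>C - {cl'. cell X cl' & length cl' = length l}. boundary X i cl = 0"
    using boundary_length[OF l, of _ cl] 3(2) 0 by fastforce
  qed auto
  also have "... = 0" by (rule boundary_augmentation[OF l _ len]) (use 3(1) in simp)
  finally show ?thesis using t 0 mod_hom_zero[OF e_hom P_group V_group] by (simp add: aug_def)
 next
  case (Suc j')
  hence j': "j' = 0" "length cl = length l" using 3(2) length_C[OF 3(1)] by auto
  have "boundary X cl' cl = 0" for cl'
  proof (rule ccontr)
   assume b: "boundary X cl' cl ~= 0"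
   hence "cl' : C" by (simp add: boundary_def split: if_splits)
   thus False using length_C boundary_length[OF l b] j' by fastforce
  qed
  hence "mat bd (dirac j cl u) = null"
   unfolding mat_dirac[OF 3(1) uc] by (simp add: null_def abelian_group.int_scale_0[OF P_group] fun_eq_iff)
  moreover have ud: "d 0 u : U 0" using U_d[of u 0] 3(3) Suc j' by simp
  moreover have "dirac 0 cl (d 0 u) : tot 0" by (rule dirac_tot[OF 3(1) _ ud]) (simp add: j')
  ultimately have "tot_diff (dirac j cl u) = dirac 0 cl (d 0 u)"
   using plus_ac(2)[OF _ null_tot] by (simp add: tot_diff_def vert_dirac Suc j')
  moreover have "e (d 0 u) = \<zero>\<^sub>V"
   using resolution_exact0[OF resolution d_closed] uc Suc j' by auto
  ultimately show ?thesis using aug_dirac[OF 3(1) j'(2) ud] by simp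
 qed
qed

text \<open>After subtracting a boundary the cycle sits at the vertex \<open>l\<close>, where exactness of \<open>P\<close> applies; a preimage in \<open>P\<close> is moved into \<open>U\<close> by \<open>(l, \<one>)\<close>.\<close>

lemma exact_at:
 assumes F: "F : tot r" and cycle: "tot_diff F = null" and a: "r = 0 ==> aug F = \<zero>\<^sub>V"
 shows "F : tot_diff ` tot (Suc r)"
proof -
 from cycle_decomposition[OF F cycle] obtain x where x: "x : U r" and Fx: "F = plus (tot_diff (mat ht F)) (dirac r l x)" by blast
 note hF = ht_tot[OF F]
 have lC: "l : C" using cell_l[OF l] by simp
 have dl: "dirac r l x : tot r" by (rule dirac_tot[OF lC _ x]) simp
 have "x : d r ` car (P (Suc r))"
 proof (cases r)
  case 0
  have "aug F = aug (dirac r l x)"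
   using aug_plus[OF tot_diff_tot[OF hF, unfolded 0] dl[unfolded 0]] Fx[unfolded 0] aug_tot_diff hF 0
    mod_hom_closed[OF aug_hom, of "dirac 0 l x"] dl abelian_monoid.l_zero[OF ag_monoid[OF V_group]] by simp
  hence "e x = \<zero>\<^sub>V" using a 0 aug_dirac[OF lC, of x] x by simp
  thus ?thesis using resolution_exact0[OF resolution] U_closed[OF x] 0 by simp
 next
  case (Suc s)
  have "tot_diff F = plus (tot_diff (tot_diff (mat ht F))) (tot_diff (dirac r l x))"
   using tot_diff_plus[OF tot_diff_tot[OF hF, unfolded Suc] dl[unfolded Suc]] Fx by (simp add: Suc)
  hence "plus null (dirac s l (d s x)) = null"
   using tot_diff_tot_diff[OF hF[unfolded Suc]] tot_diff_dirac_l x cycle by (simp add: Suc)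
  hence "plus null (dirac s l (d s x)) s l = null s l" by simp
  hence "d s x = \<zero>\<^sub>(P s)"
   using d_closed[of x s] U_closed[OF x] Suc by (simp add: plus_def null_def dirac_def P_l_zero)
  thus ?thesis using resolution_exact[OF resolution] U_closed[OF x] Suc by simp
 qed
 then obtain y where y: "y : car (P (Suc r))" "x = d r y" by blast
 let ?y = "act (Suc r) \<one>\<^sub>Gn \<one>\<^sub>K y"
 have yU: "?y : U (Suc r)" by (rule U_act[OF X_one K.one_closed y(1)])
 have dy: "d r ?y = x" using d_act[OF X_one K.one_closed y(1)] y(2) act_one[OF x] by simp
 have dly: "dirac (Suc r) l ?y : tot (Suc r)" by (rule dirac_tot[OF lC _ yU]) simp
 have "F = tot_diff (plus (mat ht F) (dirac (Suc r) l ?y))"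
  unfolding tot_diff_plus[OF hF dly] tot_diff_dirac_l[OF yU] dy by (rule Fx)
 thus ?thesis using plus_tot[OF hF dly] by blast
qed

end

lemma mod_hom_inverse:
 assumes M: "left_module R M" and f: "f : mod_hom R M N" "bij_betw f (car M) (car N)"
 shows "restrict (inv_into (car M) f) (car N) : mod_hom R N M"
proof -
 interpret M: left_module R M by fact
 note [simp] = bij_betw_inv_into_right[OF f(2)]
 have c: "inv_into (car M) f y : car M" if "y : car N" for y
  using bij_betwE[OF bij_betw_inv_into[OF f(2)]] that by blast
 have inj: "x = y" if "x : car M" "y : car M" "f x = f y" for x y
  using f(2) that by (auto simp: bij_betw_def inj_on_def)
 have fc: "f x : car N" if "x : car M" for x using mod_hom_closed[OF f(1) that] .
 show ?thesis
 proof (rule mod_homI)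
  show "restrict (inv_into (car M) f) (car N) : car N \<rightarrow>\<^sub>E car M" using c by auto
 next
  fix x y assume xy: "x : car N" "y : car N"
  let ?s = "inv_into (car M) f x \<oplus>\<^sub>M inv_into (car M) f y"
  have s: "?s : car M" "f ?s = x \<oplus>\<^sub>N y" using xy c mod_hom_add[OF f(1) c c] by simp_all
  hence "x \<oplus>\<^sub>N y : car N" using fc by metis
  with s show "restrict (inv_into (car M) f) (car N) (x \<oplus>\<^sub>N y) =
    restrict (inv_into (car M) f) (car N) x \<oplus>\<^sub>M restrict (inv_into (car M) f) (car N) y"
   using xy c by (auto intro: inj)
 next
  fix a x assume a: "a : car R" and x: "x : car N"
  let ?s = "a \<odot>\<^sub>M inv_into (car M) f x"
  have s: "?s : car M" "f ?s = a \<odot>\<^sub>N x" using a x c mod_hom_smult[OF f(1) a c] by simp_all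
  hence "a \<odot>\<^sub>N x : car N" using fc by metis
  with s show "restrict (inv_into (car M) f) (car N) (a \<odot>\<^sub>N x) =
    a \<odot>\<^sub>M restrict (inv_into (car M) f) (car N) x"
   using x c by (auto intro: inj)
 qed
qed

context hsiao_algebra
begin

definition rep :: "nat set set => nat set list" where
 "rep Z = (SOME ta. ta : car S & set ta = Z)"

lemma rep: "partition_on {1..n} Z ==> rep Z : car S & set (rep Z) = Z"
proof -
 assume Z: "partition_on {1..n} Z"
 have "finite Z" by (rule finite_elements[OF _ Z]) simp
 then obtain ta where "set ta = Z" "distinct ta" using finite_distinct_list by blast
 hence "ta : car S & set ta = Z" using Z by (simp add: carrier_ordered_partitions)
 thus ?thesis unfolding rep_def by (rule someI)
qed

lemma S_length: "ta : car S ==> length ta = card (set ta)"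
 by (simp add: carrier_ordered_partitions distinct_card)

lemma corner_mod_hom:
 assumes q: "q : mod_hom A N' N" and l: "l : car S" and lZ: "leq (set l) Z"
  and C': "left_module (alg K (H Z)) (corner N' l C')" "C' <= car N'"
  and C: "left_module (alg K (H Z)) (corner N l C)" and im: "q ` C' <= C"
 shows "restrict q C' : mod_hom (alg K (H Z)) (corner N' l C') (corner N l C)"
proof -
 have Z: "partition_on {1..n} Z" using leq_part[OF lZ] by simp
 interpret HZ: group "H Z" by (rule H_group[OF Z])
 interpret C': left_module "alg K (H Z)" "corner N' l C'" by (rule C'(1))
 show ?thesis
 proof (rule mod_hom_algI[OF K_ring HZ.is_monoid C'(1) C])
  show "restrict q C' : car (corner N' l C') \<rightarrow>\<^sub>E car (corner N l C)" using im by auto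
 next
  fix x y assume *: "x : car (corner N' l C')" "y : car (corner N' l C')"
  thus "restrict q C' (x \<oplus>\<^sub>(corner N' l C') y) = restrict q C' x \<oplus>\<^sub>(corner N l C) restrict q C' y"
   using C'.M.a_closed[OF *] mod_hom_add[OF q, of x y] C'(2) by auto
 next
  fix g k x assume g: "g : car (H Z)" and k: "k : car K" and x: "x : car (corner N' l C')"
  have "single K g k \<odot>\<^sub>(corner N' l C') x : C'"
   using C'.smult_closed[OF single_closed[OF K_ring HZ.is_monoid g k] x] by simp
  thus "restrict q C' (single K g k \<odot>\<^sub>(corner N' l C') x) = single K g k \<odot>\<^sub>(corner N l C) restrict q C' x"
   using x C'(2) elem_hom[OF q elem_in_M[OF l lZ g] k, of x] by (auto simp: corner_elem[OF l lZ g k])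
 qed
qed

end

context apex_resolution
begin

lemma C_elem: "cl : C ==> cl : car S" and C_leq: "cl : C ==> leq X (set cl)"
 using C_iff by auto

lemma C_I: "cl : car S ==> leq X (set cl) ==> cl : C"
 using C_iff by auto

lemma C_rep:
 assumes "leq X Z" shows "rep Z : C" "set (rep Z) = Z" "length (rep Z) = card Z" "rep Z : car S"
proof -
 have r: "rep Z : car S" "set (rep Z) = Z" using rep[of Z] leq_part[OF assms] by auto
 show "set (rep Z) = Z" "rep Z : car S" "length (rep Z) = card Z" using r S_length[OF r(1)] by simp_all
 show "rep Z : C" using assms by (intro C_I r) (simp add: r)
qed

abbreviation UZ where "UZ j \<equiv> corner (P j) l (U j)"

text \<open>Homomorphisms from the total complex: the generators \<open>dirac j cl u\<close> with \<open>set cl = Z\<close> are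
  the translates of those with \<open>cl = rep Z\<close>, and these are annihilated by all \<open>ta\<close> that do
  not coarsen \<open>Z\<close>. So they can be sent to the values of any homomorphism \<open>\<theta> Z\<close> into \<open>apex_part\<close>.\<close>

lemma tot_hom_extension:
 assumes N: "left_module A N"
  and \<theta>: "!!Z j. [|leq X Z; r + card Z = length l + j|] ==>
   \<theta> Z : mod_hom (alg K (H Z)) (UZ j) (corner N (rep Z) (apex_part N (rep Z)))"
 shows "\<exists>f\<in>mod_hom A (Tot r) N. \<forall>j cl u. cl : C --> r + length cl = length l + j --> u : U j -->
  f (dirac j cl u) = elem N cl \<one>\<^sub>Gn \<one>\<^sub>K (\<theta> (set cl) u)"
proof -
 interpret N: left_module A N by fact
 define Cr where "Cr = {cl : C. length l <= r + length cl}"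
 define dg where "dg cl = r + length cl - length l" for cl :: "nat set list"
 define t where "t F cl = elem N cl \<one>\<^sub>Gn \<one>\<^sub>K (\<theta> (set cl) (F (dg cl) cl))" for F cl
 have Cr: "cl : C" "r + length cl = length l + dg cl" "r + card (set cl) = length l + dg cl" "(cl, \<one>\<^sub>Gn) : car M"
  if "cl : Cr" for cl
 proof -
  show cl: "cl : C" and r: "r + length cl = length l + dg cl" using that by (simp_all add: Cr_def dg_def)
  show "r + card (set cl) = length l + dg cl" using r S_length[OF C_elem[OF cl]] by simp
  show "(cl, \<one>\<^sub>Gn) : car M" by (rule one_in_M[OF C_elem[OF cl]])
 qed
 have \<theta>c: "\<theta> Z u : apex_part N (rep Z)" "\<theta> Z u : car N"
  if "leq X Z" "r + card Z = length l + j" "u : U j" for Z u j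
  using mod_hom_closed[OF \<theta>[OF that(1,2)], of u] that(3) by (simp_all add: apex_part_def fixed_part_def)
 have \<theta>add: "\<theta> Z (u \<oplus>\<^sub>(P j) v) = \<theta> Z u \<oplus>\<^sub>N \<theta> Z v"
  if "leq X Z" "r + card Z = length l + j" "u : U j" "v : U j" for Z u v j
  using mod_hom_add[OF \<theta>[OF that(1,2)], of u v] that(3,4) by simp
 have \<theta>zero: "\<theta> Z \<zero>\<^sub>(P j) = \<zero>\<^sub>N" if Z: "leq X Z" "r + card Z = length l + j" for Z j
 proof -
  have "abelian_group (UZ j)" by (rule left_module_group[OF U_module])
  moreover have "leq (set (rep Z)) Z"
   using refines_refl[OF S_part[OF C_rep(4)[OF Z(1)]]] unfolding C_rep(2)[OF Z(1)] .
  hence "abelian_group (corner N (rep Z) (apex_part N (rep Z)))"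
   by (intro left_module_group[OF left_module_apex_part[OF N C_rep(4)[OF Z(1)]]])
  ultimately show ?thesis using mod_hom_zero[OF \<theta>[OF Z]] by simp
 qed
 have \<theta>act: "\<theta> Z (act j g k u) = elem N (rep Z) g k (\<theta> Z u)"
  if Z: "leq X Z" "r + card Z = length l + j" and u: "u : U j" and g: "g : car (H Z)" and k: "k : car K" for Z u j g k
 proof -
  have Zp: "partition_on {1..n} Z" using leq_part[OF Z(1)] by simp
  have r: "leq (set (rep Z)) Z"
   using refines_refl[OF Zp] unfolding C_rep(2)[OF Z(1)] .
  have "single K g k : car (alg K (H Z))"
   by (rule single_closed[OF K_ring group.is_monoid[OF H_group[OF Zp]] g k])
  from mod_hom_smult[OF \<theta>[OF Z] this, of u] show ?thesis
   using u by (simp add: corner_elem[OF l Z(1) g k] corner_elem[OF C_rep(4)[OF Z(1)] r g k])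
 qed
 have tc: "t F cl : car N" if "cl : Cr" "F : tot r" for F cl
  unfolding t_def
  by (rule elem_closed[OF N Cr(4)[OF that(1)] K.one_closed \<theta>c(2)[OF C_leq[OF Cr(1)[OF that(1)]] Cr(3)[OF that(1)] totD[OF that(2)]]])
 define f where "f = (\<lambda>F\<in>tot r. \<Oplus>\<^bsub>N\<^esub>cl\<in>Cr. t F cl)"
 have fc: "f F : car N" if "F : tot r" for F
  using that tc[OF _ that] by (simp add: f_def Pi_def)
 have fadd: "f (plus F F') = f F \<oplus>\<^sub>N f F'" if F: "F : tot r" "F' : tot r" for F F'
 proof -
  have "t (plus F F') cl = t F cl \<oplus>\<^sub>N t F' cl" if cl: "cl : Cr" for cl
   unfolding t_def plus_def \<theta>add[OF C_leq[OF Cr(1)[OF cl]] Cr(3)[OF cl] totD[OF F(1)] totD[OF F(2)]]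
   by (rule elem_add[OF N Cr(4)[OF cl] K.one_closed \<theta>c(2)[OF C_leq[OF Cr(1)[OF cl]] Cr(3)[OF cl] totD[OF F(1)]]
    \<theta>c(2)[OF C_leq[OF Cr(1)[OF cl]] Cr(3)[OF cl] totD[OF F(2)]]])
  hence "(\<Oplus>\<^bsub>N\<^esub>cl\<in>Cr. t (plus F F') cl) = (\<Oplus>\<^bsub>N\<^esub>cl\<in>Cr. t F cl \<oplus>\<^sub>N t F' cl)"
   by (intro N.M.finsum_cong') (use tc F in auto)
  also have "... = (\<Oplus>\<^bsub>N\<^esub>cl\<in>Cr. t F cl) \<oplus>\<^sub>N (\<Oplus>\<^bsub>N\<^esub>cl\<in>Cr. t F' cl)"
   by (rule N.M.finsum_addf) (use tc F in auto)
  finally show ?thesis using F plus_tot[OF F] by (simp add: f_def)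
 qed
 have t0: "t F cl = \<zero>\<^sub>N" if "cl : Cr" "F (dg cl) cl = \<zero>\<^bsub>P (dg cl)\<^esub>" for F cl
  unfolding t_def that(2) \<theta>zero[OF C_leq[OF Cr(1)[OF that(1)]] Cr(3)[OF that(1)]]
  by (rule elem_zero[OF N Cr(4)[OF that(1)] K.one_closed])
 have fnull: "f null = \<zero>\<^sub>N"
 proof -
  have "(\<Oplus>\<^bsub>N\<^esub>cl\<in>Cr. t null cl) = \<zero>\<^sub>N"
   by (rule N.M.add.finprod_one_eqI) (rule t0, auto simp: null_def)
  thus ?thesis using null_tot by (simp add: f_def)
 qed
 have fdirac: "f (dirac j cl u) = elem N cl \<one>\<^sub>Gn \<one>\<^sub>K (\<theta> (set cl) u)"
  if cl: "cl : C" "r + length cl = length l + j" "u : U j" for j cl u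
 proof -
  have dt: "dirac j cl u : tot r" by (rule dirac_tot[OF that])
  have cl': "cl : Cr" "dg cl = j" using cl by (auto simp: Cr_def dg_def)
  have fin: "finite Cr" unfolding Cr_def by (rule finite_subset[OF _ finite_C]) auto
  have "(\<Oplus>\<^bsub>N\<^esub>cl'\<in>Cr. t (dirac j cl u) cl') = (\<Oplus>\<^bsub>N\<^esub>cl'\<in>Cr. if cl = cl' then t (dirac j cl u) cl else \<zero>\<^sub>N)"
   by (rule N.M.finsum_cong') (use tc[OF _ dt] cl' in "auto intro!: t0 simp: dirac_def")
  also have "... = t (dirac j cl u) cl"
   using N.M.finsum_singleton[OF cl'(1) fin, of "%_. t (dirac j cl u) cl"] tc[OF cl'(1) dt] by simp
  finally show ?thesis using dt cl' by (simp add: f_def t_def dirac_def)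
 qed
 have "f : mod_hom A (Tot r) N"
 proof (rule mod_hom_algI[OF K_ring M.monoid_axioms left_module_Tot N])
  show "f : car (Tot r) \<rightarrow>\<^sub>E car N" using fc by (auto simp: PiE_iff) (simp add: f_def)
 next
  fix F F' assume "F : car (Tot r)" "F' : car (Tot r)"
  thus "f (F \<oplus>\<^sub>(Tot r) F') = f F \<oplus>\<^sub>N f F'" by (simp add: fadd)
 next
  fix m k F assume m: "m : car M" and k: "k : car K" and "F : car (Tot r)"
  hence F: "F : tot r" by simp
  obtain ta h where mm: "m = (ta, h)" by (cases m)
  note m' = m[unfolded mm]
  have ta: "ta : car S" and hG: "h : car Gn" using m' by (auto simp: M_iff dest: H_Gn)
  note ec = elem_closed[OF left_module_Tot m' k, unfolded Tot_simps]
  show "f (single K m k \<odot>\<^sub>(Tot r) F) = single K m k \<odot>\<^sub>N f F"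
   unfolding mm
  proof (induction rule: tot_induct[OF F])
   case 1
   show ?case using elem_zero[OF left_module_Tot m' k, of r] elem_zero[OF N m' k] by (simp add: fnull)
  next
   case (2 F F')
   thus ?case using elem_add[OF left_module_Tot m' k, of F r F'] elem_add[OF N m' k fc fc, of F F'] ec
    by (simp add: fadd)
  next
   case (3 j cl u)
   let ?Z = "set cl"
   have clS: "cl : car S" by (rule C_elem[OF 3(1)])
   have Z: "leq X ?Z" "r + card ?Z = length l + j" using C_leq[OF 3(1)] 3(2) S_length[OF clS] by simp_all
   note \<theta>u = \<theta>c[OF Z 3(3)]
   have lZ: "rep ?Z : car S" "set (rep ?Z) = ?Z" by (rule C_rep[OF Z(1)])+
   have clM: "(cl, \<one>\<^sub>Gn) : car M" by (rule one_in_M[OF clS])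
   have R: "elem N ta h k (f (dirac j cl u)) = elem N (ta \<otimes>\<^sub>S cl) h k (\<theta> ?Z u)"
    unfolding fdirac[OF 3] using elem_elem[OF N m' k clM K.one_closed \<theta>u(2)] k hG by simp
   have tp: "(ta \<otimes>\<^sub>S cl, h) : car M" using M.m_closed[OF m' clM] hG by (simp add: M_mult)
   have tS: "ta \<otimes>\<^sub>S cl : car S" using ta clS by simp
   show ?case
   proof (cases "leq ?Z (set ta)")
    case True
    have h: "h : car (H ?Z)" using m' H_mono[OF True] by (simp add: M_iff)
    have hX: "h : car (H X)" by (rule H_mono[OF Z(1) h])
    have p: "ta \<otimes>\<^sub>S cl : C & length (ta \<otimes>\<^sub>S cl) = length cl & set (ta \<otimes>\<^sub>S cl) = ?Z"
    using action_nonzeroD[OF l, of ta "ta \<otimes>\<^sub>S cl" cl] True 3(1) ta by (simp add: action_def)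
    have lh: "(rep ?Z, h) : car M" using lZ h by (simp add: M_iff)
    have "f (elem (Tot r) ta h k (dirac j cl u)) = elem N (ta \<otimes>\<^sub>S cl) \<one>\<^sub>Gn \<one>\<^sub>K (\<theta> ?Z (act j h k u))"
    using Tot_elem_dirac[OF m' k 3] True p fdirac[of "ta \<otimes>\<^sub>S cl" j "act j h k u"] U_act[OF hX k U_closed[OF 3(3)]] 3(2) by simp
    also have "... = elem N (ta \<otimes>\<^sub>S cl \<otimes>\<^sub>S rep ?Z) h k (\<theta> ?Z u)"
    using \<theta>act[OF Z 3(3) h k] elem_elem[OF N one_in_M[OF tS] K.one_closed lh k \<theta>u(2)] k H_Gn[OF h] by simp
    also have "ta \<otimes>\<^sub>S cl \<otimes>\<^sub>S rep ?Z = ta \<otimes>\<^sub>S cl"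
    using S_absorb[OF tS _ lZ(1)] p lZ(2) refines_refl[OF S_part[OF clS]] by simp
    finally show ?thesis using R by simp
   next
    case False
    have nl: "~ leq (set (rep ?Z)) (set (ta \<otimes>\<^sub>S cl))" using False S_leq_product[OF ta clS, of ?Z] lZ(2) by simp
    have "elem N (ta \<otimes>\<^sub>S cl) h k (\<theta> ?Z u) = elem N (ta \<otimes>\<^sub>S cl) h k (elem N (ta \<otimes>\<^sub>S cl) \<one>\<^sub>Gn \<one>\<^sub>K (\<theta> ?Z u))"
    using elem_elem[OF N tp k one_in_M[OF tS] K.one_closed \<theta>u(2)] k hG by (simp add: S_idem[OF tS])
    also have "... = \<zero>\<^sub>N" using \<theta>u(1) nl tS elem_zero[OF N tp k] by (simp add: apex_part_def)
    finally show ?thesis using R False Tot_elem_dirac[OF m' k 3] fnull by simp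
   qed
  qed
 qed
 thus ?thesis using fdirac by blast
qed

lemma dirac_rep:
 assumes Z: "leq X Z" and r: "r + card Z = length l + j" and u: "u : U j"
 shows "dirac j (rep Z) u : tot r" "dirac j (rep Z) u : apex_part (Tot r) (rep Z)"
  "[|g : car (H Z); k : car K|] ==> elem (Tot r) (rep Z) g k (dirac j (rep Z) u) = dirac j (rep Z) (act j g k u)"
proof -
 note lZ = C_rep[OF Z]
 have r': "r + length (rep Z) = length l + j" using r lZ(3) by simp
 have refl: "leq Z Z" using leq_part[OF Z] refines_refl by blast
 show t: "dirac j (rep Z) u : tot r" by (rule dirac_tot[OF lZ(1) r' u])
 show e: "elem (Tot r) (rep Z) g k (dirac j (rep Z) u) = dirac j (rep Z) (act j g k u)"
  if "g : car (H Z)" "k : car K" for g k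
  using Tot_elem_dirac[OF _ that(2) lZ(1) r' u, of "rep Z" g] that(1) lZ refl by (simp add: M_iff S_idem)
 have "elem (Tot r) ta \<one>\<^sub>Gn \<one>\<^sub>K (dirac j (rep Z) u) = null" if "ta : car S" "~ leq Z (set ta)" for ta
  using Tot_elem_dirac[OF one_in_M[OF that(1)] K.one_closed lZ(1) r' u] that(2) lZ(2) by simp
 thus "dirac j (rep Z) u : apex_part (Tot r) (rep Z)"
  using t e[OF H_one K.one_closed] leq_part[OF Z] act_one[OF u] lZ(2) by (simp add: apex_part_def fixed_part_def)
qed

text \<open>The tautological cover is split on generators: \<open>dirac j (rep Z) u\<close> lies in the exact functor \<open>apex_part\<close>, so that the map \<open>u \<mapsto> dirac j (rep Z) u\<close> lifts to the cover, because \<open>U j\<close> is projective over \<open>K G\<^sub>Z\<close>.\<close>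

lemma projective_Tot: "projective_module A (Tot r)"
proof -
 let ?N = "free A (car (Tot r))" and ?q = "taut_cover A (Tot r)"
 note T = left_module_Tot[of r]
 note q = taut_cover_hom[OF T]
 have N: "left_module A ?N" by (rule ring.left_module_free_module[OF ring_alg[OF K_ring M.monoid_axioms]])
 have ex: "\<exists>\<theta>. \<theta> : mod_hom (alg K (H Z)) (UZ j) (corner ?N (rep Z) (apex_part ?N (rep Z))) \<and>
   (\<forall>u\<in>U j. ?q (\<theta> u) = dirac j (rep Z) u)" if Z: "leq X Z" and r: "r + card Z = length l + j" for Z j
 proof -
  let ?KH = "alg K (H Z)" and ?N' = "corner ?N (rep Z) (apex_part ?N (rep Z))"
   and ?T' = "corner (Tot r) (rep Z) (apex_part (Tot r) (rep Z))"
  note lZ = C_rep[OF Z]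
  have Zp: "partition_on {1..n} Z" using leq_part[OF Z] by simp
  have lZl: "leq (set (rep Z)) Z" using refines_refl[OF Zp] unfolding lZ(2) .
  have N': "left_module ?KH ?N'" by (rule left_module_apex_part[OF N lZ(4) lZl])
  have T': "left_module ?KH ?T'" by (rule left_module_apex_part[OF T lZ(4) lZl])
  have mono: "?q x : apex_part (Tot r) (rep Z)" if x: "x : apex_part ?N (rep Z)" for x
  proof -
   have xc: "x : car ?N" using x by (simp add: apex_part_def fixed_part_def)
   have e: "?q (elem ?N ta \<one>\<^sub>Gn \<one>\<^sub>K x) = elem (Tot r) ta \<one>\<^sub>Gn \<one>\<^sub>K (?q x)" if "ta : car S" for ta
    by (rule elem_hom[OF q one_in_M[OF that] K.one_closed xc])
   have z: "?q \<zero>\<^sub>?N = \<zero>\<^sub>(Tot r)"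
    by (rule mod_hom_zero[OF q left_module_group[OF N] left_module_group[OF T]])
   have "elem (Tot r) (rep Z) \<one>\<^sub>Gn \<one>\<^sub>K (?q x) = ?q x"
    using e[OF lZ(4)] x unfolding apex_part_def fixed_part_def by simp
   moreover have "elem (Tot r) ta \<one>\<^sub>Gn \<one>\<^sub>K (?q x) = \<zero>\<^sub>(Tot r)" if "ta : car S" "~ leq (set (rep Z)) (set ta)" for ta
   proof -
    have "elem ?N ta \<one>\<^sub>Gn \<one>\<^sub>K x = \<zero>\<^sub>?N" using x that unfolding apex_part_def by blast
    thus ?thesis using e[OF that(1)] z by simp
   qed
   ultimately show ?thesis using mod_hom_closed[OF q xc] unfolding apex_part_def fixed_part_def by blast
  qed
  have q': "restrict ?q (apex_part ?N (rep Z)) : mod_hom ?KH ?N' ?T'"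
  proof (rule corner_mod_hom[OF q lZ(4) lZl N' _ T'])
   show "apex_part ?N (rep Z) <= car ?N" unfolding apex_part_def fixed_part_def by blast
  qed (use mono in blast)
  let ?u = "\<lambda>u\<in>U j. dirac j (rep Z) u"
  interpret UZ: left_module ?KH "UZ j" by (rule left_module_fixed_part[OF P_module l Z])
  have u: "?u : mod_hom ?KH (UZ j) ?T'"
  proof (rule mod_hom_algI[OF K_ring group.is_monoid[OF H_group[OF Zp]] UZ.left_module_axioms T'])
   show "?u : car (UZ j) \<rightarrow>\<^sub>E car ?T'" using dirac_rep(2)[OF Z r] by auto
  next
   fix x y assume *: "x : car (UZ j)" "y : car (UZ j)"
   thus "?u (x \<oplus>\<^sub>(UZ j) y) = ?u x \<oplus>\<^sub>?T' ?u y"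
    using UZ.M.a_closed[OF *] by (simp add: dirac_add U_closed)
  next
   fix g k x assume g: "g : car (H Z)" and k: "k : car K" and x: "x : car (UZ j)"
   hence "act j g k x : U j" using U_act[OF H_mono[OF Z g] k] U_closed by simp
   thus "?u (single K g k \<odot>\<^sub>(UZ j) x) = single K g k \<odot>\<^sub>?T' ?u x"
    using x dirac_rep(3)[OF Z r _ g k] by (simp add: corner_elem[OF l Z g k] corner_elem[OF lZ(4) lZl g k])
  qed
  have "?u x : restrict ?q (apex_part ?N (rep Z)) ` car ?N'" if x: "x : car (UZ j)" for x
  proof -
   have "dirac j (rep Z) x : ?q ` apex_part ?N (rep Z)"
    using x dirac_rep[OF Z r, of x] by (intro apex_part_surj[OF T N q lZ(4)] taut_cover_surj[OF T]) auto
   thus ?thesis using x by auto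
  qed
  from projective_lift[OF projective_fixed_part[OF resolution_projective[OF resolution] l Z] N' T' q' u this]
  obtain \<theta> where \<theta>: "\<theta> : mod_hom ?KH (UZ j) ?N'"
   "!!x. x : car (UZ j) ==> restrict ?q (apex_part ?N (rep Z)) (\<theta> x) = ?u x" by blast
  have "?q (\<theta> x) = dirac j (rep Z) x" if "x : U j" for x
   using \<theta>(2)[of x] mod_hom_closed[OF \<theta>(1), of x] that by simp
  thus ?thesis using \<theta>(1) by blast
 qed
 define \<theta> where "\<theta> Z = (SOME \<theta>. \<theta> : mod_hom (alg K (H Z)) (UZ (r + card Z - length l)) (corner ?N (rep Z) (apex_part ?N (rep Z))) \<and>
   (\<forall>u\<in>U (r + card Z - length l). ?q (\<theta> u) = dirac (r + card Z - length l) (rep Z) u))" for Z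
 have \<theta>: "\<theta> Z : mod_hom (alg K (H Z)) (UZ j) (corner ?N (rep Z) (apex_part ?N (rep Z))) \<and>
   (\<forall>u\<in>U j. ?q (\<theta> Z u) = dirac j (rep Z) u)" if "leq X Z" "r + card Z = length l + j" for Z j
 proof -
  have j: "r + card Z - length l = j" using that(2) by simp
  show ?thesis unfolding \<theta>_def j by (rule someI_ex[OF ex[OF that]])
 qed
 have "\<exists>s\<in>mod_hom A (Tot r) ?N. \<forall>j cl u. cl : C --> r + length cl = length l + j --> u : U j -->
   s (dirac j cl u) = elem ?N cl \<one>\<^sub>Gn \<one>\<^sub>K (\<theta> (set cl) u)"
  by (rule tot_hom_extension[OF N]) (rule conjunct1[OF \<theta>])
 then obtain s where s: "s : mod_hom A (Tot r) ?N"
  "!!j cl u. [|cl : C; r + length cl = length l + j; u : U j|] ==> s (dirac j cl u) = elem ?N cl \<one>\<^sub>Gn \<one>\<^sub>K (\<theta> (set cl) u)" by blast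
 show ?thesis
 proof (rule projective_moduleI[OF T s(1)])
  fix F assume "F : car (Tot r)"
  hence F: "F : tot r" by simp
  show "?q (s F) = F"
  proof (induction rule: tot_induct[OF F])
   case 1
   show ?case using mod_hom_zero[OF s(1) left_module_group[OF T] left_module_group[OF N]]
    mod_hom_zero[OF q left_module_group[OF N] left_module_group[OF T]] by simp
  next
   case (2 F F')
   thus ?case using mod_hom_add[OF s(1), of F F'] mod_hom_add[OF q mod_hom_closed[OF s(1)] mod_hom_closed[OF s(1)], of F F'] by simp
  next
   case (3 j cl u)
   let ?Z = "set cl"
   have clS: "cl : car S" by (rule C_elem[OF 3(1)])
   have Z: "leq X ?Z" "r + card ?Z = length l + j" using C_leq[OF 3(1)] 3(2) S_length[OF clS] by simp_all
   note lZ = C_rep[OF Z(1)]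
   have "\<theta> ?Z u : apex_part ?N (rep ?Z)"
    using mod_hom_closed[OF conjunct1[OF \<theta>[OF Z]], of u] 3(3) by simp
   hence \<theta>u: "\<theta> ?Z u : car ?N" "?q (\<theta> ?Z u) = dirac j (rep ?Z) u"
    using \<theta>[OF Z] 3(3) unfolding apex_part_def fixed_part_def by blast+
   have refl: "leq ?Z ?Z" by (rule refines_refl[OF S_part[OF clS]])
   have "?q (s (dirac j cl u)) = elem (Tot r) cl \<one>\<^sub>Gn \<one>\<^sub>K (dirac j (rep ?Z) u)"
    using s(2)[OF 3] elem_hom[OF q one_in_M[OF clS] K.one_closed \<theta>u(1)] \<theta>u(2) by simp
   also have "... = dirac j (cl \<otimes>\<^sub>S rep ?Z) u"
    using Tot_elem_dirac[OF one_in_M[OF clS] K.one_closed lZ(1) _ 3(3), of r] Z(2) lZ refl act_one[OF 3(3)] by simp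
   also have "cl \<otimes>\<^sub>S rep ?Z = cl" using S_absorb[OF clS _ lZ(4)] lZ(2) refl by simp
   finally show ?case .
  qed
 qed
qed

theorem Tot_resolution: "projective_resolution A Tot D aug V"
 unfolding projective_resolution_def
proof (intro conjI allI)
 show "projective_module A (Tot r)" for r by (rule projective_Tot)
 show "D r : mod_hom A (Tot (Suc r)) (Tot r)" for r by (rule D_hom)
 show "aug : mod_hom A (Tot 0) V" by (rule aug_hom)
 have lC: "l : C" using cell_l[OF l] by simp
 show "aug ` car (Tot 0) = car V"
 proof
  show "aug ` car (Tot 0) <= car V" using aug_closed by auto
  show "car V <= aug ` car (Tot 0)"
  proof
   fix v assume v: "v : car V"
   then obtain x where x: "x : car (P 0)" "v = e x" using resolution_aug_surj[OF resolution] by blast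
   let ?x = "act 0 \<one>\<^sub>Gn \<one>\<^sub>K x"
   have u: "?x : U 0" by (rule U_act[OF X_one K.one_closed x(1)])
   have "v = aug (dirac 0 l ?x)"
    using aug_dirac[OF lC _ u] elem_hom[OF e_hom X_M[OF X_one] K.one_closed x(1)] V_one[OF v] x(2) by simp
   moreover have "dirac 0 l ?x : tot 0" by (rule dirac_tot[OF lC _ u]) simp
   ultimately show "v : aug ` car (Tot 0)" by simp
  qed
 qed
 have im: "D r ` car (Tot (Suc r)) = tot_diff ` tot (Suc r)" for r by (simp add: D_def)
 show "a_kernel (Tot 0) V aug = D 0 ` car (Tot (Suc 0))"
 proof -
  have c: "tot_diff F = null" if "F : tot 0" for F unfolding tot_diff_def tot_0[OF that] by (rule null_null)
  show ?thesis
   unfolding im using exact_at[of _ 0] c aug_tot_diff tot_diff_tot[of _ 0] by (auto simp: a_kernel_iff)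
 qed
 show "a_kernel (Tot (Suc r)) (Tot r) (D r) = D (Suc r) ` car (Tot (Suc (Suc r)))" for r
  unfolding im using exact_at[of _ "Suc r"] tot_diff_tot_diff tot_diff_tot by (auto simp: a_kernel_iff D_def)
qed

end

locale apex_coefficients = apex_resolution n G K l P d e V
 for n :: nat and G :: "'g monoid" and K :: "'k ring" and l
  and P :: "nat => (nat set list \<times> (nat => 'g) => 'k, 'p) module" and d e
  and V :: "(nat set list \<times> (nat => 'g) => 'k, 'v) module" +
 fixes Y :: "nat set set" and W :: "(nat set list \<times> (nat => 'g) => 'k, 'w) module"
  and W' :: "((nat => 'g) => 'k, 'w1) module" and w :: "'w => 'w1"
 assumes Y: "partition_on {1..n} Y" and W: "left_module A W" and W': "left_module (alg K (H Y)) W'"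
  and w_bij: "bij_betw w (car W) (car W')"
  and w_add: "[|x : car W; y : car W|] ==> w (x \<oplus>\<^sub>W y) = w x \<oplus>\<^sub>W' w y"
  and w_elem: "[|(ta, h) : car M; k : car K; x : car W|] ==>
   w (elem W ta h k x) = (if leq Y (set ta) then single K h k \<odot>\<^sub>W' w x else \<zero>\<^sub>W')"
begin

abbreviation KY where "KY \<equiv> alg K (H Y)"

lemma Y_refl: "leq Y Y"
 by (rule refines_refl[OF Y])

lemma HY: "monoid (H Y)"
 by (rule group.is_monoid[OF H_group[OF Y]])

lemma W_group: "abelian_group W" and W'_group: "abelian_group W'"
 using left_module_group W W' by blast+

lemma w_closed: "x : car W ==> w x : car W'"
 using w_bij bij_betwE by blast

lemma w_inj: "[|x : car W; y : car W; w x = w y|] ==> x = y"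
 using w_bij by (auto simp: bij_betw_def inj_on_def)

lemma w_zero: "w \<zero>\<^sub>W = \<zero>\<^sub>W'"
proof -
 interpret W: abelian_group W by (rule W_group)
 interpret W': abelian_group W' by (rule W'_group)
 show ?thesis using w_add[of "\<zero>\<^sub>W" "\<zero>\<^sub>W"] w_closed[of "\<zero>\<^sub>W"] by (simp add: W'.add.r_cancel_one')
qed

lemma W'_one: "y : car W' ==> single K \<one>\<^sub>Gn \<one>\<^sub>K \<odot>\<^sub>W' y = y"
 using left_module.smult_one[OF W', of y] by (simp add: one_alg)

lemma W_zero_elem: "[|(ta, h) : car M; k : car K; x : car W; ~ leq Y (set ta)|] ==> elem W ta h k x = \<zero>\<^sub>W"
 using w_elem w_zero elem_closed[OF W] by (intro w_inj) (auto intro: abelian_monoid.zero_closed ag_monoid[OF W_group])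

lemma W_fixed: "[|ta : car S; leq Y (set ta); x : car W|] ==> elem W ta \<one>\<^sub>Gn \<one>\<^sub>K x = x"
 using w_elem[OF one_in_M K.one_closed, of ta x] elem_closed[OF W one_in_M K.one_closed, of ta x] w_closed[of x]
 by (intro w_inj) (simp_all add: W'_one)

lemma apex_part_W: "[|ta : car S; set ta = Y|] ==> apex_part W ta = car W"
 using W_fixed[of ta] W_zero_elem[OF one_in_M K.one_closed] Y_refl unfolding apex_part_def fixed_part_def by blast

text \<open>A homomorphism \<open>f\<close> into a module with apex \<open>Y\<close> sees only the ordered partitions \<open>cl\<close> of
  \<open>Y\<close>. If \<open>set cl\<close> is not a refinement of this kind, then either \<open>(cl, \<one>)\<close> annihilates the
  target or \<open>(rep Y, \<one>)\<close> annihilates the generator.\<close>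

lemma hom_dirac:
 assumes f: "f : mod_hom A (Tot r) W" and cl: "cl : C" and r: "r + length cl = length l + j" and u: "u : U j"
 shows "set cl ~= Y ==> f (dirac j cl u) = \<zero>\<^sub>W"
  and "set cl = Y ==> f (dirac j cl u) = f (dirac j (rep Y) u)"
proof -
 have clS: "cl : car S" by (rule C_elem[OF cl])
 have refl: "leq (set cl) (set cl)" by (rule refines_refl[OF S_part[OF clS]])
 note t = dirac_tot[OF cl r u]
 have fc: "f (dirac j cl u) : car W" using mod_hom_closed[OF f] t by simp
 have e: "elem W ta \<one>\<^sub>Gn \<one>\<^sub>K (f (dirac j rh u)) = (if leq (set rh) (set ta) then f (dirac j (ta \<otimes>\<^sub>S rh) u) else f null)"
  if "ta : car S" "rh : C" "length rh = length cl" for ta rh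
  using elem_hom[OF f one_in_M[OF that(1)] K.one_closed, of "dirac j rh u"] dirac_tot[OF that(2) _ u, of r] r that(3)
   Tot_elem_dirac[OF one_in_M[OF that(1)] K.one_closed that(2) _ u, of r] act_one[OF u] by (simp split: if_splits)
 have fn: "f null = \<zero>\<^sub>W" using mod_hom_zero[OF f left_module_group[OF left_module_Tot] W_group] by simp
 show "f (dirac j cl u) = \<zero>\<^sub>W" if ne: "set cl ~= Y"
 proof (cases "leq Y (set cl)")
  case True
  have "~ leq (set cl) Y" using refines_asym[OF _ True] ne by blast
  thus ?thesis
   using e[of "rep Y" cl] cl rep[OF Y] W_fixed[of "rep Y", OF _ _ fc] Y_refl fn by simp
 next
  case False
  thus ?thesis
   using e[OF clS cl] refl W_zero_elem[OF one_in_M[OF clS] K.one_closed fc] S_idem[OF clS] by simp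
 qed
 show "f (dirac j cl u) = f (dirac j (rep Y) u)" if eq: "set cl = Y"
 proof -
  have XY: "leq X Y" using C_leq[OF cl] eq by simp
  note lY = C_rep[OF XY]
  have len: "length (rep Y) = length cl" using lY(3) S_length[OF clS] eq by simp
  have "cl \<otimes>\<^sub>S rep Y = cl" using S_absorb[OF clS _ lY(4)] lY(2) eq Y_refl by simp
  moreover have "f (dirac j (rep Y) u) : car W"
   using mod_hom_closed[OF f] dirac_tot[OF lY(1) _ u, of r] r len by simp
  ultimately show ?thesis
   using e[OF clS lY(1) len] W_fixed[OF clS] lY(2) eq Y_refl by simp
 qed
qed

lemma hom_null:
 assumes f: "f : mod_hom A (Tot r) W" shows "f null = \<zero>\<^sub>W"
 using mod_hom_zero[OF f left_module_group[OF left_module_Tot] W_group] by simp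

lemma hom_eqI:
 assumes f: "f : mod_hom A (Tot r) W" and f': "f' : mod_hom A (Tot r) W"
  and eq: "!!s u. [|leq X Y; r + card Y = length l + s; u : U s|] ==> f (dirac s (rep Y) u) = f' (dirac s (rep Y) u)"
 shows "f = f'"
proof (rule mod_hom_ext[OF f f'])
 fix F assume "F : car (Tot r)"
 hence F: "F : tot r" by simp
 show "f F = f' F"
 proof (induction rule: tot_induct[OF F])
  case 1
  show ?case using hom_null[OF f] hom_null[OF f'] by simp
 next
  case (2 F F')
  thus ?case using mod_hom_add[OF f, of F F'] mod_hom_add[OF f', of F F'] by simp
 next
  case (3 j cl u)
  show ?case
  proof (cases "set cl = Y")
   case True
   hence "leq X Y" "r + card Y = length l + j" using C_leq[OF 3(1)] S_length[OF C_elem[OF 3(1)]] 3(2) by auto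
   thus ?thesis using hom_dirac(2)[OF f 3 True] hom_dirac(2)[OF f' 3 True] eq 3(3) by simp
  next
   case False
   thus ?thesis using hom_dirac(1)[OF f 3] hom_dirac(1)[OF f' 3] by simp
  qed
 qed
qed

text \<open>Immediate from \<open>hom_dirac\<close> by additivity: \<open>f\<close> factors through the restriction of \<open>F\<close> to the faces over \<open>Y\<close>.\<close>

lemma hom_vanishes:
 assumes f: "f : mod_hom A (Tot r) W" and F: "F : tot r" and z: "!!j cl. [|cl : C; set cl = Y|] ==> F j cl = \<zero>\<^sub>(P j)"
 shows "f F = \<zero>\<^sub>W"
proof -
 define cut where "cut F = (%j cl. if set cl = Y then F j cl else \<zero>\<^sub>(P j))" for F :: "nat => nat set list => 'p"
 have ct: "cut F : tot r" if "F : tot r" for F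
  by (rule totI) (use totD[OF that] tot_zero[OF that] U_zero in "auto simp: cut_def")
 have "f F = f (cut F)"
 proof (induction rule: tot_induct[OF F])
  case 1
  have "cut null = null" by (auto simp: cut_def null_def)
  thus ?case by simp
 next
  case (2 F F')
  have "cut (plus F F') = plus (cut F) (cut F')"
   by (auto simp: cut_def plus_def fun_eq_iff P_l_zero P_zero)
  thus ?case using 2 mod_hom_add[OF f, of F F'] mod_hom_add[OF f, of "cut F" "cut F'"] ct by simp
 next
  case (3 j cl u)
  have "cut (dirac j cl u) = (if set cl = Y then dirac j cl u else null)"
   by (auto simp: cut_def dirac_def null_def fun_eq_iff)
  thus ?case using hom_dirac(1)[OF f 3] hom_null[OF f] by simp
 qed
 moreover have "cut F = null" using z tot_zero[OF F] by (auto simp: cut_def null_def fun_eq_iff)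
 ultimately show ?thesis using hom_null[OF f] by simp
qed

text \<open>The faces in the boundary of \<open>rep Y\<close> have more than \<open>|Y|\<close> blocks, so that \<open>f\<close> does not see them.\<close>

lemma hom_D_dirac:
 assumes f: "f : mod_hom A (Tot r) W" and XY: "leq X Y" and r: "r + card Y = length l + s" and u: "u : U (Suc s)"
 shows "f (D r (dirac (Suc s) (rep Y) u)) = f (dirac s (rep Y) (d s u))"
proof -
 note lY = C_rep[OF XY]
 have dt: "dirac (Suc s) (rep Y) u : tot (Suc r)" by (rule dirac_tot[OF lY(1) _ u]) (simp add: lY(3) r)
 have du: "dirac s (rep Y) (d s u) : tot r" by (rule dirac_tot[OF lY(1) _ U_d[OF u]]) (simp add: lY(3) r)
 note bt = bd_tot[OF dt]
 have "f (mat bd (dirac (Suc s) (rep Y) u)) = \<zero>\<^sub>W"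
 proof (rule hom_vanishes[OF f bt])
  fix j cl assume cl: "cl : C" "set cl = Y"
  have "boundary X cl (rep Y) = 0"
   using boundary_length[OF l, of cl "rep Y"] lY(3) S_length[OF C_elem[OF cl(1)]] cl(2) by auto
  thus "mat bd (dirac (Suc s) (rep Y) u) j cl = \<zero>\<^sub>(P j)"
   by (simp add: mat_dirac[OF lY(1) U_closed[OF u]] abelian_group.int_scale_0[OF P_group])
 qed
 moreover have "f (D r (dirac (Suc s) (rep Y) u)) = f (mat bd (dirac (Suc s) (rep Y) u)) \<oplus>\<^sub>W f (dirac s (rep Y) (d s u))"
  using mod_hom_add[OF f, of "mat bd (dirac (Suc s) (rep Y) u)" "dirac s (rep Y) (d s u)"] dt bt du
  by (simp add: D_def tot_diff_def vert_dirac)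
 ultimately show ?thesis
  using mod_hom_closed[OF f, of "dirac s (rep Y) (d s u)"] du abelian_monoid.l_zero[OF ag_monoid[OF W_group]] by simp
qed

text \<open>The restriction of a homomorphism to the face \<open>rep Y\<close>, with values in the \<open>K G\<^sub>Y\<close>-module \<open>W'\<close>.\<close>

definition transfer :: "nat => ((nat => nat set list => 'p) => 'w) => 'p => 'w1" where
 "transfer s f = (\<lambda>u\<in>U s. w (f (dirac s (rep Y) u)))"

abbreviation dU where "dU j \<equiv> restrict (d j) (U (Suc j))"

lemma UY_module: "leq X Y ==> left_module KY (UZ j)"
 by (rule left_module_fixed_part[OF P_module l])

lemma dU_hom: assumes XY: "leq X Y" shows "dU j : mod_hom KY (UZ (Suc j)) (UZ j)"
 by (rule corner_mod_hom[OF d_hom l XY UY_module[OF XY] _ UY_module[OF XY]]) (use U_closed U_d in blast)+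

lemma dU_complex: assumes XY: "leq X Y" shows "chain_complex KY UZ dU"
 unfolding chain_complex_def using UY_module[OF XY] dU_hom[OF XY] U_d U_closed d_d by simp

context
 fixes r s
 assumes XY: "leq X Y" and rs: "r + card Y = length l + s"
begin

lemma dirac_Y: "u : U s ==> dirac s (rep Y) u : tot r"
 by (rule dirac_rep(1)[OF XY rs])

lemma transfer_hom:
 assumes f: "f : mod_hom A (Tot r) W" shows "transfer s f : mod_hom KY (UZ s) W'"
proof (rule mod_hom_algI[OF K_ring HY UY_module[OF XY] W'])
 have fc: "f (dirac s (rep Y) u) : car W" if "u : U s" for u using mod_hom_closed[OF f] dirac_Y[OF that] by simp
 show "transfer s f : car (UZ s) \<rightarrow>\<^sub>E car W'" using fc w_closed by (auto simp: transfer_def)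
 fix x y assume "x : car (UZ s)" "y : car (UZ s)"
 thus "transfer s f (x \<oplus>\<^sub>(UZ s) y) = transfer s f x \<oplus>\<^sub>W' transfer s f y"
  using mod_hom_add[OF f, of "dirac s (rep Y) x" "dirac s (rep Y) y"] dirac_Y[of x] dirac_Y[of y] fc[of x] fc[of y]
  by (simp add: transfer_def U_add dirac_add U_closed w_add)
next
 fix g k x assume g: "g : car (H Y)" and k: "k : car K" and "x : car (UZ s)"
 hence x: "x : U s" by simp
 note lY = C_rep[OF XY]
 have m: "(rep Y, g) : car M" using lY g by (simp add: M_iff)
 have "act s g k x : U s" by (rule U_act[OF H_mono[OF XY g] k U_closed[OF x]])
 thus "transfer s f (single K g k \<odot>\<^sub>(UZ s) x) = single K g k \<odot>\<^sub>W' transfer s f x"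
  using x dirac_rep(3)[OF XY rs x g k, symmetric] elem_hom[OF f m k, of "dirac s (rep Y) x"] dirac_Y[OF x]
   w_elem[OF m k, of "f (dirac s (rep Y) x)"] mod_hom_closed[OF f, of "dirac s (rep Y) x"] lY(2) Y_refl
  by (simp add: transfer_def corner_elem[OF l XY g k])
qed

lemma transfer_inj:
 assumes f: "f : mod_hom A (Tot r) W" and f': "f' : mod_hom A (Tot r) W" and eq: "transfer s f = transfer s f'"
 shows "f = f'"
proof (rule hom_eqI[OF f f'])
 fix s' u assume s': "r + card Y = length l + s'" and u: "u : U s'"
 have "s' = s" using s' rs by simp
 hence u: "u : U s" using u by simp
 have "w (f (dirac s (rep Y) u)) = w (f' (dirac s (rep Y) u))" using fun_cong[OF eq, of u] u by (simp add: transfer_def)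
 thus "f (dirac s' (rep Y) u) = f' (dirac s' (rep Y) u)"
  unfolding \<open>s' = s\<close> by (intro w_inj) (use mod_hom_closed[OF f] mod_hom_closed[OF f'] dirac_Y[OF u] in simp_all)
qed

lemma transfer_surj:
 assumes y: "y : mod_hom KY (UZ s) W'" shows "\<exists>f\<in>mod_hom A (Tot r) W. transfer s f = y"
proof -
 define \<theta> where "\<theta> Z = (if Z = Y then (\<lambda>u\<in>U s. inv_into (car W) w (y u))
  else (\<lambda>u\<in>U (r + card Z - length l). \<zero>\<^sub>W))" for Z
 have inv: "inv_into (car W) w z : car W" "w (inv_into (car W) w z) = z" if "z : car W'" for z
  using bij_betwE[OF bij_betw_inv_into[OF w_bij]] bij_betw_inv_into_right[OF w_bij] that by auto
 have yc: "y u : car W'" if "u : U s" for u using mod_hom_closed[OF y] that by simp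
 note lY = C_rep[OF XY]
 have "\<theta> Z : mod_hom (alg K (H Z)) (UZ j) (corner W (rep Z) (apex_part W (rep Z)))"
  if Z: "leq X Z" and j: "r + card Z = length l + j" for Z j
 proof -
  note lZ = C_rep[OF Z]
  have Zp: "partition_on {1..n} Z" using leq_part[OF Z] by simp
  have lZl: "leq (set (rep Z)) Z" using refines_refl[OF Zp] unfolding lZ(2) .
  interpret UZj: left_module "alg K (H Z)" "UZ j" by (rule left_module_fixed_part[OF P_module l Z])
  have N': "left_module (alg K (H Z)) (corner W (rep Z) (apex_part W (rep Z)))" by (rule left_module_apex_part[OF W lZ(4) lZl])
  have jU: "act j g k u : U j" if "g : car (H Z)" "k : car K" "u : U j" for g k u
   by (rule U_act[OF H_mono[OF Z that(1)] that(2) U_closed[OF that(3)]])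
  show ?thesis
  proof (cases "Z = Y")
   case True
   hence js: "j = s" using j rs by simp
   have ap: "apex_part W (rep Y) = car W" by (rule apex_part_W[OF lY(4,2)])
   have \<theta>Y: "\<theta> Z u = inv_into (car W) w (y u)" if "u : U s" for u using that True by (simp add: \<theta>_def)
   show ?thesis
   proof (rule mod_hom_algI[OF K_ring group.is_monoid[OF H_group[OF Zp]] UZj.left_module_axioms N'])
    show "\<theta> Z : car (UZ j) \<rightarrow>\<^sub>E car (corner W (rep Z) (apex_part W (rep Z)))"
    using inv yc True js ap by (auto simp: \<theta>_def)
   next
    fix u v assume "u : car (UZ j)" "v : car (UZ j)"
    hence uv: "u : U s" "v : U s" using js by simp_all
    have "w (inv_into (car W) w (y (u \<oplus>\<^sub>(P s) v))) = w (inv_into (car W) w (y u) \<oplus>\<^sub>W inv_into (car W) w (y v))"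
    using inv yc uv U_add[OF uv] w_add mod_hom_add[OF y, of u v] yc[OF U_add[OF uv]] by simp
    hence "inv_into (car W) w (y (u \<oplus>\<^sub>(P s) v)) = inv_into (car W) w (y u) \<oplus>\<^sub>W inv_into (car W) w (y v)"
    by (rule w_inj[OF inv(1)[OF yc[OF U_add[OF uv]]] abelian_monoid.a_closed[OF ag_monoid[OF W_group]
    inv(1)[OF yc[OF uv(1)]] inv(1)[OF yc[OF uv(2)]]]])
    thus "\<theta> Z (u \<oplus>\<^sub>(UZ j) v) = \<theta> Z u \<oplus>\<^sub>(corner W (rep Z) (apex_part W (rep Z))) \<theta> Z v"
    using uv U_add[OF uv] js by (simp add: \<theta>Y)
   next
    fix g k u assume g: "g : car (H Z)" and k: "k : car K" and "u : car (UZ j)"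
    hence u: "u : U s" using js by simp
    have au: "act s g k u : U s" using jU[OF g k] u js by simp
    have gY: "g : car (H Y)" using g True by simp
    have m: "(rep Y, g) : car M" using lY gY by (simp add: M_iff)
    have "y (act s g k u) = single K g k \<odot>\<^sub>W' y u"
    using mod_hom_smult[OF y single_closed[OF K_ring HY gY k], of u] u by (simp add: corner_elem[OF l XY gY k])
    hence "w (inv_into (car W) w (y (act s g k u))) = w (elem W (rep Y) g k (inv_into (car W) w (y u)))"
    using inv yc[OF u] yc[OF au] w_elem[OF m k, of "inv_into (car W) w (y u)"] lY(2) Y_refl by simp
    hence "inv_into (car W) w (y (act s g k u)) = elem W (rep Y) g k (inv_into (car W) w (y u))"
    by (rule w_inj[OF inv(1)[OF yc[OF au]] elem_closed[OF W m k inv(1)[OF yc[OF u]]]])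
    thus "\<theta> Z (single K g k \<odot>\<^sub>(UZ j) u) = single K g k \<odot>\<^sub>(corner W (rep Z) (apex_part W (rep Z))) \<theta> Z u"
    unfolding corner_elem[OF l Z g k] corner_elem[OF lZ(4) lZl g k] js \<theta>Y[OF u] \<theta>Y[OF au] unfolding True .
   qed
  next
   case False
   hence \<theta>Z: "\<theta> Z = (\<lambda>u\<in>U j. \<zero>\<^sub>W)" using j by (simp add: \<theta>_def)
   interpret N': left_module "alg K (H Z)" "corner W (rep Z) (apex_part W (rep Z))" by (rule N')
   show ?thesis unfolding \<theta>Z
    using UZj.M.a_closed UZj.smult_closed N'.M.zero_closed N'.M.r_zero[OF N'.M.zero_closed] N'.smult_r_null
    by (intro mod_homI) auto
  qed
 qed
 hence "\<exists>f\<in>mod_hom A (Tot r) W. \<forall>j cl u. cl : C --> r + length cl = length l + j --> u : U j -->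
   f (dirac j cl u) = elem W cl \<one>\<^sub>Gn \<one>\<^sub>K (\<theta> (set cl) u)"
  by (rule tot_hom_extension[OF W])
 then obtain f where f: "f : mod_hom A (Tot r) W"
  "!!j cl u. [|cl : C; r + length cl = length l + j; u : U j|] ==> f (dirac j cl u) = elem W cl \<one>\<^sub>Gn \<one>\<^sub>K (\<theta> (set cl) u)" by blast
 have "transfer s f u = y u" if u: "u : U s" for u
  using f(2)[OF lY(1) _ u] rs lY(2,3) u inv[OF yc[OF u]] W_fixed[OF lY(4), of "inv_into (car W) w (y u)"] Y_refl
  by (simp add: transfer_def \<theta>_def)
 hence "transfer s f = y"
  using mod_hom_extensional[OF y] by (intro extensionalityI[of _ "U s"]) (auto simp: transfer_def)
 thus ?thesis using f(1) by blast
qed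

end

end

context apex_coefficients
begin

lemma Tot_complex: "chain_complex A Tot D"
 by (rule projective_resolution_chain_complex[OF Tot_resolution])

lemma zero_hom: "(\<lambda>F\<in>tot r. \<zero>\<^sub>W) : mod_hom A (Tot r) W"
proof -
 interpret H: left_module K "hom_module K M (Tot r) W" by (rule left_module_hom_module[OF K_cring M.monoid_axioms W left_module_Tot])
 show ?thesis using H.M.zero_closed by simp
qed

lemma zero_coboundary: "(\<lambda>F\<in>tot r. \<zero>\<^sub>W) : coboundaries K M Tot D W r"
 using additive_subgroup.zero_closed[OF submodule_additive_subgroup[OF submodule_coboundaries[OF K_cring M.monoid_axioms W Tot_complex, of r]]]
 by simp

lemma hom_no_cells:
 assumes f: "f : mod_hom A (Tot r) W" and no: "!!s. leq X Y ==> r + card Y ~= length l + s"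
 shows "f = (\<lambda>F\<in>tot r. \<zero>\<^sub>W)"
 by (rule hom_eqI[OF f zero_hom]) (use no in blast)

lemma Ext_Tot_trivial:
 assumes "~ (leq X Y & card X <= r + card Y)"
 shows "car (Ext K M Tot D W r) = {\<zero>\<^sub>(Ext K M Tot D W r)}"
proof (rule Ext_trivialI[OF K_cring M.monoid_axioms W Tot_complex])
 have "f = (\<lambda>F\<in>tot r. \<zero>\<^sub>W)" if "f : mod_hom A (Tot r) W" for f
  by (rule hom_no_cells[OF that]) (use assms length_l in auto)
 thus "cocycles K M Tot D W r <= coboundaries K M Tot D W r"
  using zero_coboundary[of r] unfolding mem_cocycles_iff subset_iff by metis
qed

text \<open>\<open>transfer\<close> is an isomorphism of cochain complexes up to a shift of degrees. In the lowest degree there are no coboundaries on either side, since one degree below no face over \<open>Y\<close> contributes.\<close>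

lemma Ext_Tot_iso:
 assumes XY: "leq X Y" and rs: "r + card Y = length l + s"
 shows "mod_iso K (Ext K M Tot D W r) (Ext K (H Y) UZ dU W' s)"
proof -
 note T = K_cring M.monoid_axioms W Tot_complex and UU = K_cring HY W' dU_complex[OF XY]
 have rs': "Suc r + card Y = length l + Suc s" using rs by simp
 have fc: "f (dirac s (rep Y) u) : car W" if "f : mod_hom A (Tot r) W" "u : U s" for f u
  using mod_hom_closed[OF that(1)] dirac_Y[OF XY rs that(2)] by simp
 have fD: "transfer s f (d s u) = w (f (D r (dirac (Suc s) (rep Y) u)))" if "f : mod_hom A (Tot r) W" "u : U (Suc s)" for f u
  using hom_D_dirac[OF that(1) XY rs that(2)] U_d[OF that(2)] by (simp add: transfer_def)
 have t0: "transfer s (\<lambda>F\<in>tot r. \<zero>\<^sub>W) = (\<lambda>u\<in>U s. \<zero>\<^sub>W')"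
  using dirac_Y[OF XY rs] by (auto simp: transfer_def w_zero intro!: restrict_ext)
 have cocycle: "f : cocycles K M Tot D W r \<longleftrightarrow> transfer s f : cocycles K (H Y) UZ dU W' s"
  if f: "f : mod_hom A (Tot r) W" for f
 proof
  assume "f : cocycles K M Tot D W r"
  thus "transfer s f : cocycles K (H Y) UZ dU W' s"
   using transfer_hom[OF XY rs f] fD[OF f] dirac_Y[OF XY rs'] by (simp add: mem_cocycles_iff w_zero)
 next
  assume t: "transfer s f : cocycles K (H Y) UZ dU W' s"
  have c: "compose (tot (Suc r)) f (D r) : mod_hom A (Tot (Suc r)) W"
   using mod_hom_compose[OF D_hom f left_module_Tot] by simp
  have "compose (tot (Suc r)) f (D r) = (\<lambda>F\<in>tot (Suc r). \<zero>\<^sub>W)"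
  proof (rule hom_eqI[OF c zero_hom])
   fix s' u assume s': "Suc r + card Y = length l + s'" and u: "u : U s'"
   have e: "s' = Suc s" using s' rs by simp
   hence u: "u : U (Suc s)" using u by simp
   note dt = dirac_Y[OF XY rs' u]
   have "w (f (D r (dirac (Suc s) (rep Y) u))) = \<zero>\<^sub>W'" using t u fD[OF f u] by (simp add: mem_cocycles_iff)
   moreover have "f (D r (dirac (Suc s) (rep Y) u)) : car W" using mod_hom_closed[OF c, of "dirac (Suc s) (rep Y) u"] dt by (simp add: compose_def)
   ultimately have "f (D r (dirac (Suc s) (rep Y) u)) = \<zero>\<^sub>W"
    by (intro w_inj) (simp_all add: w_zero abelian_monoid.zero_closed[OF ag_monoid[OF W_group]])
   thus "compose (tot (Suc r)) f (D r) (dirac s' (rep Y) u) = (\<lambda>F\<in>tot (Suc r). \<zero>\<^sub>W) (dirac s' (rep Y) u)"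
    using dt unfolding e by (simp add: compose_def)
  qed
  from fun_cong[OF this] have "f (D r F) = \<zero>\<^sub>W" if "F : tot (Suc r)" for F
   using that by (simp add: compose_def restrict_def) metis
  thus "f : cocycles K M Tot D W r" using f by (simp add: mem_cocycles_iff)
 qed
 have coboundary: "transfer s f : coboundaries K (H Y) UZ dU W' s \<longleftrightarrow> f : coboundaries K M Tot D W r"
  if f: "f : mod_hom A (Tot r) W" for f
 proof (cases s)
  case 0
  have "f : coboundaries K M Tot D W r \<longleftrightarrow> f = (\<lambda>F\<in>tot r. \<zero>\<^sub>W)"
  proof (cases r)
   case 0
   thus ?thesis by simp
  next
   case (Suc r')
   have "f = (\<lambda>F\<in>tot r. \<zero>\<^sub>W)" if fb: "f : coboundaries K M Tot D W r"
   proof -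
    obtain g where g: "g : mod_hom A (Tot r') W" "f = compose (tot r) g (D r')"
    using fb unfolding Suc coboundaries_Suc by auto
    have "g = (\<lambda>F\<in>tot r'. \<zero>\<^sub>W)" by (rule hom_no_cells[OF g(1)]) (use rs 0 Suc in simp)
    thus ?thesis
    using mod_hom_closed[OF D_hom, of _ r'] unfolding g(2) Suc by (auto simp: compose_def intro!: restrict_ext)
   qed
   thus ?thesis using zero_coboundary by blast
  qed
  moreover have "transfer s f = (\<lambda>u\<in>U s. \<zero>\<^sub>W') \<longleftrightarrow> f = (\<lambda>F\<in>tot r. \<zero>\<^sub>W)"
   using transfer_inj[OF XY rs f zero_hom] t0 by metis
  ultimately show ?thesis by (simp add: 0)
 next
  case (Suc s')
  note lY = C_rep[OF XY]
  obtain r' where r': "r = Suc r'" using rs Suc length_C[OF lY(1)] lY(3) by (cases r) auto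
  have rs'': "r' + card Y = length l + s'" using rs Suc r' by simp
  have tc: "transfer s (compose (tot r) g (D r')) = compose (U s) (transfer s' g) (dU s')"
   if g: "g : mod_hom A (Tot r') W" for g
  proof
   fix u
   show "transfer s (compose (tot r) g (D r')) u = compose (U s) (transfer s' g) (dU s') u"
    using dirac_Y[OF XY rs] hom_D_dirac[OF g XY rs'', of u] U_d[of u s']
    by (cases "u : U s") (simp_all add: transfer_def compose_def Suc r')
  qed
  show ?thesis
  proof
   assume "transfer s f : coboundaries K (H Y) UZ dU W' s"
   then obtain g' where g': "g' : mod_hom KY (UZ s') W'" "transfer s f = compose (U s) g' (dU s')"
    unfolding Suc coboundaries_Suc by auto
   obtain g where g: "g : mod_hom A (Tot r') W" "transfer s' g = g'" using transfer_surj[OF XY rs'' g'(1)] by blast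
   have c: "compose (tot r) g (D r') : mod_hom A (Tot r) W"
    using mod_hom_compose[OF D_hom g(1) left_module_Tot] by (simp add: r')
   have "f = compose (tot r) g (D r')" by (rule transfer_inj[OF XY rs f c]) (simp add: tc[OF g(1)] g(2) g'(2))
   thus "f : coboundaries K M Tot D W r" using g(1) unfolding r' coboundaries_Suc by simp
  next
   assume "f : coboundaries K M Tot D W r"
   then obtain g where g: "g : mod_hom A (Tot r') W" "f = compose (tot r) g (D r')"
    unfolding r' coboundaries_Suc by auto
   thus "transfer s f : coboundaries K (H Y) UZ dU W' s"
    using transfer_hom[OF XY rs'' g(1)] tc[OF g(1)] unfolding Suc coboundaries_Suc by auto
  qed
 qed
 let ?Z = "hom_module K M (Tot r) W\<lparr>carrier := cocycles K M Tot D W r\<rparr>"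
  and ?Z' = "hom_module K (H Y) (UZ s) W'\<lparr>carrier := cocycles K (H Y) UZ dU W' s\<rparr>"
 interpret Z': left_module K ?Z' by (rule left_module_cocycles[OF UU])
 interpret Z: left_module K ?Z by (rule left_module_cocycles[OF T])
 have Z: "f : car ?Z ==> f : mod_hom A (Tot r) W" for f by (simp add: mem_cocycles_iff)
 show ?thesis
  unfolding Ext_def
 proof (rule quot_module_iso_quot_module[OF left_module_cocycles[OF T] submodule_coboundaries[OF T]
    left_module_cocycles[OF UU] submodule_coboundaries[OF UU]])
  show "restrict (transfer s) (car ?Z) : mod_hom K ?Z ?Z'"
  proof (rule mod_homI)
   show "restrict (transfer s) (car ?Z) : car ?Z \<rightarrow>\<^sub>E car ?Z'"
    using cocycle by (auto simp: mem_cocycles_iff[of _ K M])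
  next
   fix f g assume fg: "f : car ?Z" "g : car ?Z"
   note c = fc[OF Z[OF fg(1)]] fc[OF Z[OF fg(2)]]
   have "transfer s (\<lambda>x\<in>tot r. f x \<oplus>\<^sub>W g x) = (\<lambda>x\<in>U s. transfer s f x \<oplus>\<^sub>W' transfer s g x)"
    using dirac_Y[OF XY rs] c w_add by (auto simp: transfer_def intro!: restrict_ext)
   thus "restrict (transfer s) (car ?Z) (f \<oplus>\<^sub>?Z g) =
    restrict (transfer s) (car ?Z) f \<oplus>\<^sub>?Z' restrict (transfer s) (car ?Z) g"
    using fg Z.M.a_closed[OF fg] by simp
  next
   fix k f assume k: "k : car K" and f: "f : car ?Z"
   have o: "(\<one>\<^sub>S, \<one>\<^sub>Gn) : car M" by (rule one_in_M[OF S.one_closed])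
   have "transfer s (\<lambda>x\<in>tot r. single K \<one>\<^sub>M k \<odot>\<^sub>W f x) = (\<lambda>x\<in>U s. single K \<one>\<^sub>Gn k \<odot>\<^sub>W' transfer s f x)"
    using dirac_Y[OF XY rs] fc[OF Z[OF f]] w_elem[OF o k] refines_one[OF Y]
    by (auto simp: transfer_def one_hsiao_monoid intro!: restrict_ext)
   thus "restrict (transfer s) (car ?Z) (k \<odot>\<^sub>?Z f) = k \<odot>\<^sub>?Z' restrict (transfer s) (car ?Z) f"
    using f Z.smult_closed[OF k f] by simp
  qed
  show "restrict (transfer s) (car ?Z) f : coboundaries K (H Y) UZ dU W' s \<longleftrightarrow> f : coboundaries K M Tot D W r"
   if "f : car ?Z" for f using coboundary[OF Z[OF that]] that by simp
  fix y assume y: "y : car ?Z'"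
  then obtain f where f: "f : mod_hom A (Tot r) W" "transfer s f = y"
   using transfer_surj[OF XY rs, of y] by (auto simp: mem_cocycles_iff)
  hence fz: "f : car ?Z" using cocycle y by simp
  have z: "y \<ominus>\<^sub>?Z' restrict (transfer s) (car ?Z) f = \<zero>\<^sub>?Z'"
   using fz f(2) y Z'.M.r_neg[OF y] by (simp add: a_minus_def)
  show "\<exists>f\<in>car ?Z. y \<ominus>\<^sub>?Z' restrict (transfer s) (car ?Z) f : coboundaries K (H Y) UZ dU W' s"
  proof (rule bexI[OF _ fz])
   show "y \<ominus>\<^sub>?Z' restrict (transfer s) (car ?Z) f : coboundaries K (H Y) UZ dU W' s"
    unfolding z by (rule additive_subgroup.zero_closed[OF submodule_additive_subgroup[OF submodule_coboundaries[OF UU]]])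
  qed
 qed
qed

end

context hsiao_algebra
begin

lemma left_module_block_group_mono:
 assumes V': "left_module (alg K (H X)) V'" and XZ: "leq X Z"
 shows "left_module (alg K (H Z)) V'"
proof -
 interpret V': left_module "alg K (H X)" V' by fact
 have Z: "partition_on {1..n} Z" using leq_part[OF XZ] by simp
 have c: "a : car (alg K (H X))" if "a : car (alg K (H Z))" for a
  using that H_mono[OF XZ] by (auto simp: carrier_alg finsupp_def)
 have ops: "monoid.mult (alg K (H Z)) = monoid.mult (alg K (H X))"
  "one (alg K (H Z)) = one (alg K (H X))"
  "add (alg K (H Z)) = add (alg K (H X))"
  by (simp_all add: monoid_algebra_def)
 show ?thesis
  by (rule left_moduleI[OF ring_alg[OF K_ring group.is_monoid[OF H_group[OF Z]]] V'.M.abelian_group_axioms])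
   (simp_all add: ops c V'.smult_l_distr V'.smult_r_distr V'.smult_assoc1)
qed

end

context apex_resolution
begin

text \<open>Multiplication by the idempotent \<open>(l, \<one>)\<close> is an exact functor, and it does not change \<open>V\<close>.\<close>

lemma U_resolution:
 assumes V': "left_module (alg K (H X)) V'" and XZ: "leq X Z"
  and v_bij: "bij_betw v (car V) (car V')"
  and v_add: "!!x y. [|x : car V; y : car V|] ==> v (x \<oplus>\<^sub>V y) = v x \<oplus>\<^sub>V' v y"
  and v_elem: "!!h k x. [|h : car (H X); k : car K; x : car V|] ==> v (elem V l h k x) = single K h k \<odot>\<^sub>V' v x"
 shows "projective_resolution (alg K (H Z)) UZ (%j. restrict (d j) (U (Suc j))) (\<lambda>u\<in>U 0. v (e u)) V'"
proof -
 let ?KZ = "alg K (H Z)"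
 have Zp: "partition_on {1..n} Z" using leq_part[OF XZ] by simp
 note UZm = left_module_fixed_part[OF P_module l XZ]
 have V'Z: "left_module ?KZ V'" by (rule left_module_block_group_mono[OF V' XZ])
 interpret V: abelian_group V by (rule V_group)
 interpret V': abelian_group V' by (rule left_module_group[OF V'])
 have vc: "v x : car V'" if "x : car V" for x using v_bij that bij_betwE by blast
 have v0: "v \<zero>\<^sub>V = \<zero>\<^sub>V'"
  using v_add[of "\<zero>\<^sub>V" "\<zero>\<^sub>V"] vc[of "\<zero>\<^sub>V"] by (simp add: V'.add.r_cancel_one')
 have vinj: "v x = \<zero>\<^sub>V' \<longleftrightarrow> x = \<zero>\<^sub>V" if "x : car V" for x
  using v_bij that V.zero_closed v0 by (metis bij_betw_def inj_onD)
 have ec: "e x : car V" if "x : U 0" for x using mod_hom_closed[OF e_hom U_closed[OF that]] .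
 have exact: "x : d j ` U (Suc j)" if x: "x : U j" "x : d j ` car (P (Suc j))" for x j
 proof -
  obtain y where y: "y : car (P (Suc j))" "x = d j y" using x(2) by blast
  have "x = d j (act (Suc j) \<one>\<^sub>Gn \<one>\<^sub>K y)"
   using d_act[OF X_one K.one_closed y(1)] act_one[OF x(1)] y(2) by simp
  thus ?thesis using U_act[OF X_one K.one_closed y(1)] by blast
 qed
 have exactP: "d j x = \<zero>\<^sub>(P j) \<longleftrightarrow> x : d (Suc j) ` U (Suc (Suc j))" if x: "x : U (Suc j)" for j x
  using resolution_exact[OF resolution U_closed[OF x]] exact[OF x] U_closed by blast
 have exact0: "e x = \<zero>\<^sub>V \<longleftrightarrow> x : d 0 ` U (Suc 0)" if x: "x : U 0" for x
  using resolution_exact0[OF resolution U_closed[OF x]] exact[OF x] U_closed by blast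
 show ?thesis
  unfolding projective_resolution_def
 proof (intro conjI allI)
  show "projective_module ?KZ (UZ j)" for j by (rule projective_fixed_part[OF resolution_projective[OF resolution] l XZ])
  show "restrict (d j) (U (Suc j)) : mod_hom ?KZ (UZ (Suc j)) (UZ j)" for j
   by (rule corner_mod_hom[OF d_hom l XZ UZm _ UZm]) (use U_closed U_d in blast)+
  show "(\<lambda>u\<in>U 0. v (e u)) : mod_hom ?KZ (UZ 0) V'"
  proof (rule mod_hom_algI[OF K_ring group.is_monoid[OF H_group[OF Zp]] UZm V'Z])
   show "(\<lambda>u\<in>U 0. v (e u)) : car (UZ 0) \<rightarrow>\<^sub>E car V'" using ec vc by auto
  next
   fix x y assume "x : car (UZ 0)" "y : car (UZ 0)"
   thus "(\<lambda>u\<in>U 0. v (e u)) (x \<oplus>\<^sub>(UZ 0) y) = (\<lambda>u\<in>U 0. v (e u)) x \<oplus>\<^sub>V' (\<lambda>u\<in>U 0. v (e u)) y"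
    using mod_hom_add[OF e_hom, of x y] by (simp add: U_add U_closed v_add ec)
  next
   fix g k x assume g: "g : car (H Z)" and k: "k : car K" and "x : car (UZ 0)"
   hence x: "x : U 0" by simp
   have gX: "g : car (H X)" by (rule H_mono[OF XZ g])
   show "(\<lambda>u\<in>U 0. v (e u)) (single K g k \<odot>\<^sub>(UZ 0) x) = single K g k \<odot>\<^sub>V' (\<lambda>u\<in>U 0. v (e u)) x"
    using x U_act[OF gX k U_closed[OF x]] elem_hom[OF e_hom X_M[OF gX] k U_closed[OF x]] v_elem[OF gX k ec[OF x]]
    by (simp add: corner_elem[OF l XZ g k])
  qed
  show "(\<lambda>u\<in>U 0. v (e u)) ` car (UZ 0) = car V'"
  proof
   show "(\<lambda>u\<in>U 0. v (e u)) ` car (UZ 0) <= car V'" using ec vc by auto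
   show "car V' <= (\<lambda>u\<in>U 0. v (e u)) ` car (UZ 0)"
   proof
    fix z assume "z : car V'"
    then obtain x where x: "x : car V" "z = v x" using v_bij by (auto simp: bij_betw_def)
    then obtain y where y: "y : car (P 0)" "x = e y" using resolution_aug_surj[OF resolution] by blast
    let ?y = "act 0 \<one>\<^sub>Gn \<one>\<^sub>K y"
    have "?y : U 0" by (rule U_act[OF X_one K.one_closed y(1)])
    moreover have "e ?y = x" using elem_hom[OF e_hom X_M[OF X_one] K.one_closed y(1)] V_one[OF x(1)] y(2) by simp
    ultimately show "z : (\<lambda>u\<in>U 0. v (e u)) ` car (UZ 0)" using x(2) by force
   qed
  qed
  show "a_kernel (UZ 0) V' (\<lambda>u\<in>U 0. v (e u)) = restrict (d 0) (U (Suc 0)) ` car (UZ (Suc 0))"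
   using exact0 vinj ec U_d by (auto simp: a_kernel_iff)
  show "a_kernel (UZ (Suc j)) (UZ j) (restrict (d j) (U (Suc j))) = restrict (d (Suc j)) (U (Suc (Suc j))) ` car (UZ (Suc (Suc j)))" for j
   using exactP U_d by (auto simp: a_kernel_iff)
 qed
qed

end

section \<open>Maschke's theorem\<close>

lemma (in abelian_group) finsum_add_pow:
 "finite I ==> x : car G ==> (\<Oplus>i\<in>I. x) = add_pow G (card I) x"
 using add.finprod_const[of x I] by (simp add: add_pow_def)

text \<open>Maschke: averaging a \<open>K\<close>-linear section over the group makes it equivariant.\<close>

lemma equivariant_section:
 fixes N :: "('m => 'k, 'x) module" and F :: "('m => 'k, 'y) module"
 assumes K: "ring K" and H: "group H" and fin: "finite (car H)"
  and c: "c : car K" "add_pow K (card (car H)) c = \<one>\<^sub>K"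
  and N: "left_module (alg K H) N" and F: "left_module (alg K H) F"
  and q: "q : mod_hom (alg K H) F N"
  and s: "!!x. x : car N ==> s x : car F" "!!x. x : car N ==> q (s x) = x"
   "!!x y. [|x : car N; y : car N|] ==> s (x \<oplus>\<^sub>N y) = s x \<oplus>\<^sub>F s y"
   "!!k x. [|k : car K; x : car N|] ==> s (single K \<one>\<^sub>H k \<odot>\<^sub>N x) = single K \<one>\<^sub>H k \<odot>\<^sub>F s x"
  and central: "!!k. k : car K ==> c \<otimes>\<^sub>K k = k \<otimes>\<^sub>K c"
 shows "\<exists>t\<in>mod_hom (alg K H) N F. \<forall>x\<in>car N. q (t x) = x"
proof -
 interpret K: ring K by fact
 interpret H: group H by fact
 interpret N: left_module "alg K H" N by fact
 interpret F: left_module "alg K H" F by fact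
 note KH = K H.is_monoid
 note sc = single_closed[OF KH]
 note ss = mult_single_single[OF KH]
 define t where "t = (\<lambda>x\<in>car N. \<Oplus>\<^bsub>F\<^esub>g\<in>car H. single K g c \<odot>\<^sub>F s (single K (inv\<^bsub>H\<^esub> g) \<one>\<^sub>K \<odot>\<^sub>N x))"
 have pi: "(%g. single K g c \<odot>\<^sub>F s (single K (inv\<^bsub>H\<^esub> g) \<one>\<^sub>K \<odot>\<^sub>N x)) : car H \<rightarrow> car F" if "x : car N" for x
  using that c(1) sc s(1) by simp
 have tc: "t x : car F" if "x : car N" for x using F.M.finsum_closed[OF pi[OF that]] that by (simp add: t_def)
 have "q (t x) = x" if x: "x : car N" for x
 proof -
  have "q (t x) = (\<Oplus>\<^bsub>N\<^esub>g\<in>car H. q (single K g c \<odot>\<^sub>F s (single K (inv\<^bsub>H\<^esub> g) \<one>\<^sub>K \<odot>\<^sub>N x)))"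
   using x mod_hom_finsum[OF q F.M.abelian_group_axioms N.M.abelian_group_axioms pi[OF x]] by (simp add: t_def)
  also have "... = (\<Oplus>\<^bsub>N\<^esub>g\<in>car H. single K \<one>\<^sub>H c \<odot>\<^sub>N x)"
  proof (rule N.M.finsum_cong')
   fix g assume g: "g : car H"
   have gi: "inv\<^bsub>H\<^esub> g : car H" using g by simp
   have xi: "single K (inv\<^bsub>H\<^esub> g) \<one>\<^sub>K \<odot>\<^sub>N x : car N" using sc[OF gi K.one_closed] x by simp
   have "q (single K g c \<odot>\<^sub>F s (single K (inv\<^bsub>H\<^esub> g) \<one>\<^sub>K \<odot>\<^sub>N x)) = single K g c \<odot>\<^sub>N (single K (inv\<^bsub>H\<^esub> g) \<one>\<^sub>K \<odot>\<^sub>N x)"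
    using mod_hom_smult[OF q sc[OF g c(1)] s(1)[OF xi]] s(2)[OF xi] by simp
   also have "... = single K \<one>\<^sub>H c \<odot>\<^sub>N x"
    using N.smult_assoc1[OF sc[OF g c(1)] sc[OF gi K.one_closed] x] ss[of c "\<one>\<^sub>K" g "inv\<^bsub>H\<^esub> g"] c(1) g by simp
   finally show "q (single K g c \<odot>\<^sub>F s (single K (inv\<^bsub>H\<^esub> g) \<one>\<^sub>K \<odot>\<^sub>N x)) = single K \<one>\<^sub>H c \<odot>\<^sub>N x" .
  qed (use sc c(1) x in auto)
  also have "... = single K \<one>\<^sub>H (add_pow K (card (car H)) c) \<odot>\<^sub>N x"
  proof -
   have "add_pow N m (single K \<one>\<^sub>H c \<odot>\<^sub>N x) = single K \<one>\<^sub>H (add_pow K m c) \<odot>\<^sub>N x" for m :: nat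
   proof (induction m)
    case 0
    have "single K \<one>\<^sub>H \<zero>\<^sub>K = \<zero>\<^sub>(alg K H)" by (auto simp: single_def zero_alg)
    thus ?case using N.smult_l_null[OF x] by simp
   next
    case (Suc m)
    have "single K \<one>\<^sub>H (add_pow K (Suc m) c) = single K \<one>\<^sub>H (add_pow K m c) \<oplus>\<^sub>(alg K H) single K \<one>\<^sub>H c"
    using c(1) by (auto simp: single_def add_alg)
    thus ?case
    using Suc N.smult_l_distr[OF sc sc x, of "\<one>\<^sub>H" "add_pow K m c" "\<one>\<^sub>H" c] c(1) by simp
   qed
   thus ?thesis using N.M.finsum_add_pow[OF fin, of "single K \<one>\<^sub>H c \<odot>\<^sub>N x"] sc c(1) x by simp
  qed
  also have "... = x" using c(2) N.smult_one[OF x] by (simp add: one_alg)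
  finally show ?thesis .
 qed
 moreover have "t : mod_hom (alg K H) N F"
 proof (rule mod_hom_algI[OF KH N F])
  show "t : car N \<rightarrow>\<^sub>E car F" using tc by (auto simp: PiE_iff) (simp add: t_def)
 next
  fix x y assume xy: "x : car N" "y : car N"
  have "(\<Oplus>\<^bsub>F\<^esub>g\<in>car H. single K g c \<odot>\<^sub>F s (single K (inv\<^bsub>H\<^esub> g) \<one>\<^sub>K \<odot>\<^sub>N (x \<oplus>\<^sub>N y))) =
   (\<Oplus>\<^bsub>F\<^esub>g\<in>car H. single K g c \<odot>\<^sub>F s (single K (inv\<^bsub>H\<^esub> g) \<one>\<^sub>K \<odot>\<^sub>N x) \<oplus>\<^sub>F single K g c \<odot>\<^sub>F s (single K (inv\<^bsub>H\<^esub> g) \<one>\<^sub>K \<odot>\<^sub>N y))"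
   by (rule F.M.finsum_cong') (use xy sc c(1) s(1) in "auto simp: N.smult_r_distr F.smult_r_distr s(3)")
  also have "... = t x \<oplus>\<^sub>F t y" using F.M.finsum_addf[OF pi[OF xy(1)] pi[OF xy(2)]] xy by (simp add: t_def)
  finally show "t (x \<oplus>\<^sub>N y) = t x \<oplus>\<^sub>F t y" using xy by (simp add: t_def)
 next
  fix h k x assume h: "h : car H" and k: "k : car K" and x: "x : car N"
  have hx: "single K h k \<odot>\<^sub>N x : car N" using sc[OF h k] x by simp
  let ?f = "%g. single K g c \<odot>\<^sub>F s (single K (inv\<^bsub>H\<^esub> g) \<one>\<^sub>K \<odot>\<^sub>N (single K h k \<odot>\<^sub>N x))"
  have summand: "?f (h \<otimes>\<^sub>H g) = single K h k \<odot>\<^sub>F (single K g c \<odot>\<^sub>F s (single K (inv\<^bsub>H\<^esub> g) \<one>\<^sub>K \<odot>\<^sub>N x))" if g: "g : car H" for g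
  proof -
   have gi: "inv\<^bsub>H\<^esub> g : car H" "inv\<^bsub>H\<^esub> (h \<otimes>\<^sub>H g) : car H" using g h by simp_all
   have xi: "single K (inv\<^bsub>H\<^esub> g) \<one>\<^sub>K \<odot>\<^sub>N x : car N" using sc[OF gi(1) K.one_closed] x by simp
   have e: "inv\<^bsub>H\<^esub> (h \<otimes>\<^sub>H g) \<otimes>\<^sub>H h = inv\<^bsub>H\<^esub> g" using g h by (simp add: H.inv_mult_group H.m_assoc)
   have "single K (inv\<^bsub>H\<^esub> (h \<otimes>\<^sub>H g)) \<one>\<^sub>K \<odot>\<^sub>N (single K h k \<odot>\<^sub>N x) = single K (inv\<^bsub>H\<^esub> g) k \<odot>\<^sub>N x"
    using N.smult_assoc1[OF sc[OF gi(2) K.one_closed] sc[OF h k] x] ss[of "\<one>\<^sub>K" k "inv\<^bsub>H\<^esub> (h \<otimes>\<^sub>H g)" h] k e by simp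
   also have "... = single K \<one>\<^sub>H k \<odot>\<^sub>N (single K (inv\<^bsub>H\<^esub> g) \<one>\<^sub>K \<odot>\<^sub>N x)"
    using N.smult_assoc1[OF sc[OF H.one_closed k] sc[OF gi(1) K.one_closed] x] ss[of k "\<one>\<^sub>K" "\<one>\<^sub>H" "inv\<^bsub>H\<^esub> g"] k gi by simp
   finally have "?f (h \<otimes>\<^sub>H g) = single K (h \<otimes>\<^sub>H g) c \<odot>\<^sub>F (single K \<one>\<^sub>H k \<odot>\<^sub>F s (single K (inv\<^bsub>H\<^esub> g) \<one>\<^sub>K \<odot>\<^sub>N x))"
    using s(4)[OF k xi] by simp
   also have "... = single K (h \<otimes>\<^sub>H g) (c \<otimes>\<^sub>K k) \<odot>\<^sub>F s (single K (inv\<^bsub>H\<^esub> g) \<one>\<^sub>K \<odot>\<^sub>N x)"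
    using F.smult_assoc1[OF sc[OF H.m_closed[OF h g] c(1)] sc[OF H.one_closed k] s(1)[OF xi]] ss[of c k "h \<otimes>\<^sub>H g" "\<one>\<^sub>H"] c(1) k h g by simp
   also have "... = single K h k \<odot>\<^sub>F (single K g c \<odot>\<^sub>F s (single K (inv\<^bsub>H\<^esub> g) \<one>\<^sub>K \<odot>\<^sub>N x))"
    using F.smult_assoc1[OF sc[OF h k] sc[OF g c(1)] s(1)[OF xi]] ss[of k c h g] c(1) k central[OF k] by simp
   finally show ?thesis .
  qed
  have "t (single K h k \<odot>\<^sub>N x) = (\<Oplus>\<^bsub>F\<^esub>g\<in>car H. ?f g)" using hx by (simp add: t_def)
  also have "... = (\<Oplus>\<^bsub>F\<^esub>g\<in>(%g. h \<otimes>\<^sub>H g) ` car H. ?f g)" using H.surj_const_mult[OF h] by simp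
  also have "... = (\<Oplus>\<^bsub>F\<^esub>g\<in>car H. ?f (h \<otimes>\<^sub>H g))"
   by (rule F.M.finsum_reindex) (use pi[OF hx] H.surj_const_mult[OF h] H.inj_on_multc[of h] h in "auto simp: inj_on_def")
  also have "... = (\<Oplus>\<^bsub>F\<^esub>g\<in>car H. single K h k \<odot>\<^sub>F (single K g c \<odot>\<^sub>F s (single K (inv\<^bsub>H\<^esub> g) \<one>\<^sub>K \<odot>\<^sub>N x)))"
   by (rule F.M.finsum_cong') (use summand pi[OF x] sc[OF h k] in "auto simp: Pi_iff")
  also have "... = single K h k \<odot>\<^sub>F t x"
   using F.finsum_smult[OF sc[OF h k] pi[OF x]] x by (simp add: t_def)
  finally show "t (single K h k \<odot>\<^sub>N x) = single K h k \<odot>\<^sub>F t x" .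
 qed
 ultimately show ?thesis by blast
qed

lemma left_module_scalars:
 fixes N :: "('m => 'k, 'x) module"
 assumes K: "ring K" and H: "monoid H" and N: "left_module (alg K H) N"
 defines "Nk \<equiv> restrict_scalars N (car N) (single K \<one>\<^sub>H)"
 shows "left_module K Nk"
proof -
 interpret K: ring K by fact
 interpret H: monoid H by fact
 interpret N: left_module "alg K H" N by fact
 note sc = single_closed[OF K H H.one_closed]
 show ?thesis unfolding Nk_def
 proof (rule left_module_restrict_scalars[OF N K sc])
  show "single K \<one>\<^sub>H (a \<oplus>\<^sub>K b) = single K \<one>\<^sub>H a \<oplus>\<^sub>(alg K H) single K \<one>\<^sub>H b"
   if "a : car K" "b : car K" for a b using that by (auto simp: single_def add_alg)
  show "single K \<one>\<^sub>H (a \<otimes>\<^sub>K b) = single K \<one>\<^sub>H a \<otimes>\<^sub>(alg K H) single K \<one>\<^sub>H b"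
   if "a : car K" "b : car K" for a b
   using mult_single_single[OF K H that, of "\<one>\<^sub>H" "\<one>\<^sub>H"] by simp
  show "single K \<one>\<^sub>H \<one>\<^sub>K \<odot>\<^sub>N x = x" if "x : car N" for x
   using N.smult_one[OF that] by (simp add: one_alg)
 qed (use sc in auto)
qed

lemma (in abelian_group) right_minus_eq:
 assumes "a : car G" "b : car G" shows "a \<ominus> b = \<zero> \<longleftrightarrow> a = b"
proof
 assume z: "a \<ominus> b = \<zero>"
 have "a = (a \<ominus> b) \<oplus> b" using assms by (simp add: minus_eq a_assoc l_neg)
 thus "a = b" using z assms by simp
qed (use assms in "simp add: minus_eq r_neg")

text \<open>A finite spanning set of minimal cardinality is a basis.\<close>

lemma finite_basis_exists:
 assumes K: "field K" and N: "left_module K N" and E0: "finite E0" "E0 <= car N"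
  and span: "car N <= lincomb K N (%y. y) ` finsupp K E0"
 shows "\<exists>E\<subseteq>car N. bij_betw (\<lambda>a\<in>car (free K E). lincomb K N (%y. y) a) (car (free K E)) (car N)"
proof -
 interpret K: field K by fact
 interpret N: left_module K N by fact
 let ?L = "lincomb K N (%y. y)"
 let ?Q = "%E. E <= E0 & car N <= ?L ` finsupp K E"
 obtain E where E: "?Q E" and min: "!!E'. ?Q E' ==> card E <= card E'"
  using ex_has_least_nat[of ?Q E0 card] span by auto
 have EN: "(%y. y) : E \<rightarrow> car N" using E E0 by auto
 have finE: "finite E" using E E0 finite_subset by blast
 interpret F: left_module K "free K E" by (rule K.left_module_free_module)
 let ?T = "\<lambda>a\<in>car (free K E). ?L a"
 have T: "?T : mod_hom K (free K E) N" by (rule N.lincomb_hom[OF EN])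
 have c: "car (free K E) = finsupp K E" by (simp add: free_module_def)
 have ker: "a = \<zero>\<^sub>(free K E)" if a: "a : car (free K E)" and Ta: "?T a = \<zero>\<^sub>N" for a
 proof (rule ccontr)
  assume "a ~= \<zero>\<^sub>(free K E)"
  then obtain y where y: "a y ~= \<zero>\<^sub>K" by (auto simp: free_module_def)
  have af: "a : finsupp K E" using a c by simp
  have yE: "y : E" using y finsupp_zero[OF af] by blast
  have ay: "a y : car K" "a i : car K" for i using finsupp_closed[OF af] by auto
  have "car N <= ?L ` finsupp K (E - {y})"
  proof
   fix x assume "x : car N"
   then obtain b where b: "b : car (free K E)" "x = ?L b" using E c by auto
   have bf: "b : finsupp K E" using b c by simp
   have bK: "b i : car K" for i using finsupp_closed[OF bf] .
   define t where "t = \<ominus>\<^sub>K (b y \<otimes>\<^sub>K inv\<^bsub>K\<^esub> a y)"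
   have iK: "inv\<^bsub>K\<^esub> a y : car K" "inv\<^bsub>K\<^esub> a y \<otimes>\<^sub>K a y = \<one>\<^sub>K"
    using K.field_Units y ay by auto
   have t: "t : car K" using bK iK by (simp add: t_def)
   let ?b = "b \<oplus>\<^sub>(free K E) t \<odot>\<^sub>(free K E) a"
   have bc: "?b : car (free K E)" using b(1) a t by simp
   have "?L ?b = x"
    using mod_hom_add[OF T b(1) F.smult_closed[OF t a]] mod_hom_smult[OF T t a] Ta bc b t a \<open>x : car N\<close> by simp
   moreover have "?b y = \<zero>\<^sub>K"
    using bK ay iK by (simp add: free_module_def t_def K.l_minus K.m_assoc K.r_neg)
   hence "?b : finsupp K (E - {y})" using bc unfolding c by (auto simp: finsupp_def supp_def)
   ultimately show "x : ?L ` finsupp K (E - {y})" by blast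
  qed
  hence "card E <= card (E - {y})" using E by (intro min) auto
  thus False using yE finE by (metis card_Diff1_less not_le)
 qed
 have "inj_on ?T (car (free K E))"
 proof (rule inj_onI)
  fix a b assume ab: "a : car (free K E)" "b : car (free K E)" "?T a = ?T b"
  have "?T (a \<ominus>\<^sub>(free K E) b) = \<zero>\<^sub>N"
   using mod_hom_diff[OF T F.M.abelian_group_axioms N.M.abelian_group_axioms ab(1,2)] ab mod_hom_closed[OF T ab(2)]
   by (simp only: N.M.right_minus_eq)
  thus "a = b" using ker[OF F.M.minus_closed[OF ab(1,2)]] ab F.M.right_minus_eq by blast
 qed
 moreover have "?T ` car (free K E) = car N"
 proof
  show "?T ` car (free K E) <= car N" using mod_hom_closed[OF T] by blast
  show "car N <= ?T ` car (free K E)"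
  proof
   fix x assume "x : car N"
   then obtain a where a: "a : car (free K E)" "x = ?L a" using E unfolding c by auto
   hence "x = ?T a" by simp
   thus "x : ?T ` car (free K E)" using a(1) by (rule image_eqI)
  qed
 qed
 ultimately show ?thesis using E E0 unfolding bij_betw_def by blast
qed

lemma linear_section_exists:
 assumes K: "field K" and N: "left_module K N" and F: "left_module K F" and E0: "finite E0" "E0 <= car N"
  and span: "car N <= lincomb K N (%y. y) ` finsupp K E0"
  and q: "q : mod_hom K F N" and surj: "!!y. y : car N ==> y : q ` car F"
 shows "\<exists>s\<in>mod_hom K N F. \<forall>x\<in>car N. q (s x) = x"
proof -
 interpret K: field K by fact
 interpret N: left_module K N by fact
 interpret F: left_module K F by fact
 from finite_basis_exists[OF K N E0 span] obtain E where E: "E <= car N"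
  and bij: "bij_betw (\<lambda>a\<in>car (free K E). lincomb K N (%y. y) a) (car (free K E)) (car N)" by blast
 interpret FE: left_module K "free K E" by (rule K.left_module_free_module)
 let ?T = "\<lambda>a\<in>car (free K E). lincomb K N (%y. y) a"
 have EN: "(%y. y) : E \<rightarrow> car N" using E by auto
 have T: "?T : mod_hom K (free K E) N" by (rule N.lincomb_hom[OF EN])
 let ?Ti = "restrict (inv_into (car (free K E)) ?T) (car N)"
 have Ti: "?Ti : mod_hom K N (free K E)" by (rule mod_hom_inverse[OF FE.left_module_axioms T bij])
 have "\<forall>y\<in>E. \<exists>z. z : car F & q z = y" using surj E by blast
 then obtain \<delta> where \<delta>: "!!y. y : E ==> \<delta> y : car F & q (\<delta> y) = y" by metis
 let ?L = "\<lambda>a\<in>car (free K E). lincomb K F \<delta> a"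
 have L: "?L : mod_hom K (free K E) F" by (rule F.lincomb_hom) (use \<delta> in auto)
 have qL: "compose (car (free K E)) q ?L a = ?T a" if a: "a : finsupp K E" for a
 proof (rule N.free_module_hom_eq[OF mod_hom_compose[OF L q FE.left_module_axioms] T _ a])
  fix y assume y: "y : E"
  have s: "single K y \<one>\<^sub>K : car (free K E)" using y by (simp add: free_module_def K.single_finsupp)
  show "compose (car (free K E)) q ?L (single K y \<one>\<^sub>K) = ?T (single K y \<one>\<^sub>K)"
   using s y E \<delta>[OF y] F.lincomb_single[of "\<one>\<^sub>K" \<delta> y] N.lincomb_single[of "\<one>\<^sub>K" "%y. y" y]
   by (auto simp: compose_def)
 qed
 have "q (compose (car N) ?L ?Ti x) = x" if x: "x : car N" for x
 proof -
  have a: "?Ti x : car (free K E)" by (rule mod_hom_closed[OF Ti x])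
  have "q (?L (?Ti x)) = ?T (?Ti x)" using qL[of "?Ti x"] a by (simp add: compose_def free_module_def)
  also have "... = x" using bij_betw_inv_into_right[OF bij x] x by simp
  finally show ?thesis unfolding compose_eq[OF x] .
 qed
 thus ?thesis using mod_hom_compose[OF Ti L N] by blast
qed

lemma maschke:
 fixes N :: "('m => 'k, 'x) module"
 assumes K: "field K" and H: "group H" "finite (car H)" and card: "add_pow K (card (car H)) \<one>\<^sub>K ~= \<zero>\<^sub>K"
  and N: "left_module (alg K H) N" and E0: "finite E0" "E0 <= car N"
  and span: "car N <= lincomb K (restrict_scalars N (car N) (single K \<one>\<^sub>H)) (%y. y) ` finsupp K E0"
 shows "projective_module (alg K H) N"
proof -
 interpret K: field K by fact
 interpret H: group H by (rule H(1))
 interpret N: left_module "alg K H" N by fact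
 let ?A = "alg K H" and ?q = "taut_cover (alg K H) N"
 let ?F = "free ?A (car N)"
 note KH = K.ring_axioms H.is_monoid
 have F: "left_module ?A ?F" by (rule N.R.left_module_free_module)
 note q = taut_cover_hom[OF N]
 let ?Nk = "restrict_scalars N (car N) (single K \<one>\<^sub>H)" and ?Fk = "restrict_scalars ?F (car ?F) (single K \<one>\<^sub>H)"
 have qk: "?q : mod_hom K ?Fk ?Nk"
  using mod_hom_closed[OF q] mod_hom_extensional[OF q] mod_hom_add[OF q] mod_hom_smult[OF q single_closed[OF KH H.one_closed]]
  by (intro mod_homI) (auto simp: PiE_iff)
 have "\<exists>s\<in>mod_hom K ?Nk ?Fk. \<forall>x\<in>car ?Nk. ?q (s x) = x"
  by (rule linear_section_exists[OF K left_module_scalars[OF KH N] left_module_scalars[OF KH F] E0(1) _ _ qk])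
   (use E0 span taut_cover_surj[OF N] in simp_all)
 then obtain s where s: "s : mod_hom K ?Nk ?Fk" "!!x. x : car N ==> ?q (s x) = x" by auto
 let ?m = "add_pow K (card (car H)) \<one>\<^sub>K"
 have m: "inv\<^bsub>K\<^esub> ?m : car K" "?m \<otimes>\<^sub>K inv\<^bsub>K\<^esub> ?m = \<one>\<^sub>K" using K.field_Units card by auto
 have "add_pow K (card (car H)) (inv\<^bsub>K\<^esub> ?m) = \<one>\<^sub>K"
  using K.add_pow_ldistr[OF K.one_closed m(1), of "card (car H)"] m by simp
 hence "\<exists>t\<in>mod_hom ?A N ?F. \<forall>x\<in>car N. ?q (t x) = x"
  by (rule equivariant_section[OF K.ring_axioms H(1,2) m(1) _ N F q])
   (use s mod_hom_closed[OF s(1)] mod_hom_add[OF s(1)] mod_hom_smult[OF s(1)] m(1) in "simp_all add: K.m_comm")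
 thus ?thesis using projective_moduleI[OF N] by blast
qed

text \<open>A simple module is generated by any nonzero vector, hence spanned over \<open>K\<close> by its finite orbit.\<close>

lemma simple_module_finite_span:
 fixes N :: "('m => 'k, 'x) module"
 assumes K: "ring K" and H: "monoid H" "finite (car H)" and N: "simple_module (alg K H) N"
 shows "\<exists>E. finite E & E <= car N \<and>
  car N <= lincomb K (restrict_scalars N (car N) (single K \<one>\<^sub>H)) (%y. y) ` finsupp K E"
proof -
 interpret K: ring K by fact
 interpret H: monoid H by (rule H(1))
 let ?A = "alg K H"
 interpret N: left_module ?A N using N by (simp add: simple_module_def)
 let ?Nk = "restrict_scalars N (car N) (single K \<one>\<^sub>H)"
 interpret Nk: left_module K ?Nk by (rule left_module_scalars[OF K H(1) N.left_module_axioms])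
 note sc = single_closed[OF K H(1)]
 obtain v where v: "v : car N" "v ~= \<zero>\<^sub>N" using N N.M.zero_closed unfolding simple_module_def by blast
 have sub: "submodule ((%a. a \<odot>\<^sub>N v) ` car ?A) ?A N"
 proof (rule left_submoduleI[OF N.left_module_axioms])
  show "\<zero>\<^sub>N : (%a. a \<odot>\<^sub>N v) ` car ?A" using N.smult_l_null[OF v(1)] N.R.zero_closed by (metis image_eqI)
  fix x y assume "x : (%a. a \<odot>\<^sub>N v) ` car ?A" "y : (%a. a \<odot>\<^sub>N v) ` car ?A"
  then obtain a b where ab: "a : car ?A" "b : car ?A" "x = a \<odot>\<^sub>N v" "y = b \<odot>\<^sub>N v" by blast
  thus "x \<oplus>\<^sub>N y : (%a. a \<odot>\<^sub>N v) ` car ?A"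
   using N.smult_l_distr[OF ab(1,2) v(1)] N.R.a_closed[OF ab(1,2)] by (metis image_eqI)
 next
  fix c x assume c: "c : car ?A" and "x : (%a. a \<odot>\<^sub>N v) ` car ?A"
  then obtain a where a: "a : car ?A" "x = a \<odot>\<^sub>N v" by blast
  thus "c \<odot>\<^sub>N x : (%a. a \<odot>\<^sub>N v) ` car ?A"
   using N.smult_assoc1[OF c a(1) v(1)] N.R.m_closed[OF c a(1)] by (metis image_eqI)
 qed (use v in auto)
 have "v : (%a. a \<odot>\<^sub>N v) ` car ?A" using N.smult_one[OF v(1)] N.R.one_closed by (metis image_eqI)
 hence cyc: "(%a. a \<odot>\<^sub>N v) ` car ?A = car N" using N sub v(2) unfolding simple_module_def by blast
 let ?E = "(%h. single K h \<one>\<^sub>K \<odot>\<^sub>N v) ` car H"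
 have EN: "(%y. y) : ?E \<rightarrow> car ?Nk" using sc v(1) by auto
 let ?T = "\<lambda>a\<in>car (free K ?E). lincomb K ?Nk (%y. y) a"
 interpret FE: left_module K "free K ?E" by (rule K.left_module_free_module)
 have T: "?T : mod_hom K (free K ?E) ?Nk" by (rule Nk.lincomb_hom[OF EN])
 have orbit_span: "a \<odot>\<^sub>N v : ?T ` car (free K ?E)" if "a : finsupp K (car H)" for a
  using that
 proof (induction a rule: K.finsupp_induct)
  case zero
  have e1: "(%_. \<zero>\<^sub>K) \<odot>\<^sub>N v = \<zero>\<^sub>N" using N.smult_l_null[OF v(1)] by (simp add: zero_alg)
  have e2: "?T \<zero>\<^sub>(free K ?E) = \<zero>\<^sub>?Nk"
   by (rule mod_hom_zero[OF T FE.M.abelian_group_axioms Nk.M.abelian_group_axioms])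
  have "(%_. \<zero>\<^sub>K) \<odot>\<^sub>N v = ?T \<zero>\<^sub>(free K ?E)" unfolding e1 e2 by simp
  thus ?case by (rule image_eqI[OF _ FE.M.zero_closed])
 next
  case (single h k)
  let ?y = "single K h \<one>\<^sub>K \<odot>\<^sub>N v"
  have y: "?y : ?E" "?y : car N" using single sc v(1) by auto
  have yc: "single K ?y k : car (free K ?E)"
   using K.single_finsupp[OF y(1), of k] single by (simp add: free_module_def)
  have "single K h k \<odot>\<^sub>N v = single K \<one>\<^sub>H k \<odot>\<^sub>N ?y"
   using N.smult_assoc1[OF sc sc v(1), of "\<one>\<^sub>H" k h "\<one>\<^sub>K"] mult_single_single[OF K H(1), of k "\<one>\<^sub>K" "\<one>\<^sub>H" h] single by simp
  also have "... = lincomb K ?Nk (%y. y) (single K ?y k)" using Nk.lincomb_single[of k "%y. y" ?y] single y by simp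
  also have "... = ?T (single K ?y k)" using yc by simp
  finally show ?case by (rule image_eqI[OF _ yc])
 next
  case (add a b)
  then obtain a' b' where ab: "a' : car (free K ?E)" "b' : car (free K ?E)"
   "a \<odot>\<^sub>N v = ?T a'" "b \<odot>\<^sub>N v = ?T b'" by blast
  have "(%i. a i \<oplus>\<^sub>K b i) \<odot>\<^sub>N v = ?T (a' \<oplus>\<^sub>(free K ?E) b')"
   using N.smult_l_distr[of a b v] add(1,2) v(1) ab(3,4) mod_hom_add[OF T ab(1,2)]
   by (simp add: carrier_alg add_alg)
  thus ?case using FE.M.a_closed[OF ab(1,2)] by (rule image_eqI)
 qed
 have "car N <= ?T ` car (free K ?E)"
 proof
  fix x assume "x : car N"
  hence "x : (%a. a \<odot>\<^sub>N v) ` car ?A" by (simp only: cyc)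
  then obtain a where a: "a : car ?A" "x = a \<odot>\<^sub>N v" by blast
  show "x : ?T ` car (free K ?E)"
   unfolding a(2) by (rule orbit_span) (use a(1) in "simp add: carrier_alg")
 qed
 hence "car N <= lincomb K ?Nk (%y. y) ` finsupp K ?E" by (auto simp: free_module_def)
 moreover have "finite ?E" "?E <= car N" using H(2) EN by auto
 ultimately show ?thesis by blast
qed

lemma projective_resolution_self:
 fixes V :: "('r, 'v) module"
 assumes V: "projective_module R V"
 shows "projective_resolution R (%r. if r = 0 then V else V\<lparr>carrier := {\<zero>\<^sub>V}\<rparr>) (%r. \<lambda>x\<in>{\<zero>\<^sub>V}. \<zero>\<^sub>V) (\<lambda>x\<in>car V. x) V"
proof -
 interpret V: left_module R V using V by (rule projective_module_left_module)
 let ?O = "V\<lparr>carrier := {\<zero>\<^sub>V}\<rparr>"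
 have "submodule {\<zero>\<^sub>V} R V" by (rule left_submoduleI[OF V.left_module_axioms]) auto
 hence O: "left_module R ?O" by (rule left_module_submodule[OF V.left_module_axioms])
 interpret O: left_module R ?O by (rule O)
 interpret FO: left_module R "free R (car ?O)" by (rule V.R.left_module_free_module)
 have "projective_module R ?O"
 proof (rule projective_moduleI[OF O])
  show "(\<lambda>x\<in>{\<zero>\<^sub>V}. \<zero>\<^sub>(free R (car ?O))) : mod_hom R ?O (free R (car ?O))"
   using FO.M.zero_closed FO.M.r_zero[OF FO.M.zero_closed] FO.smult_r_null V.smult_r_null by (intro mod_homI) auto
  fix x assume "x : car ?O"
  thus "taut_cover R ?O ((\<lambda>x\<in>{\<zero>\<^sub>V}. \<zero>\<^sub>(free R (car ?O))) x) = x"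
   using mod_hom_closed[OF taut_cover_hom[OF O] FO.M.zero_closed] by simp
 qed
 moreover have "(\<lambda>x\<in>{\<zero>\<^sub>V}. \<zero>\<^sub>V) : mod_hom R ?O V" "(\<lambda>x\<in>{\<zero>\<^sub>V}. \<zero>\<^sub>V) : mod_hom R ?O ?O"
  using V.smult_r_null by (auto intro!: mod_homI)
 ultimately show ?thesis
  unfolding projective_resolution_def using V mod_hom_id[OF V.left_module_axioms] by (auto simp: a_kernel_iff)
qed

lemma mod_iso_trivial:
 assumes iso: "mod_iso R M N" and M: "left_module R M" and N: "car N = {\<zero>\<^sub>N}"
 shows "car M = {\<zero>\<^sub>M}"
proof -
 interpret M: left_module R M by fact
 obtain f where f: "bij_betw f (car M) (car N)" using iso by (auto simp: mod_iso_def)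
 have "x = \<zero>\<^sub>M" if "x : car M" for x
 proof -
  have "f x = f \<zero>\<^sub>M" using bij_betwE[OF f] that M.M.zero_closed N by simp
  thus ?thesis using f that M.M.zero_closed unfolding bij_betw_def inj_on_def by blast
 qed
 thus ?thesis using M.M.zero_closed by blast
qed

text \<open>The cohomology of the complex of homomorphisms from a resolution concentrated in degree \<open>0\<close>.\<close>

lemma Ext_self:
 fixes V :: "('m => 'k, 'v) module" and W :: "('m => 'k, 'w) module"
 assumes K: "cring K" and M: "monoid M" and V: "projective_module (alg K M) V" and W: "left_module (alg K M) W"
 defines "Q \<equiv> %r::nat. if r = 0 then V else V\<lparr>carrier := {\<zero>\<^sub>V}\<rparr>" and "d \<equiv> %r::nat. \<lambda>x\<in>{\<zero>\<^sub>V}. \<zero>\<^sub>V"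
 shows "mod_iso K (Ext K M Q d W 0) (hom_module K M V W)"
  and "car (Ext K M Q d W (Suc s)) = {\<zero>\<^sub>(Ext K M Q d W (Suc s))}"
proof -
 have cc: "chain_complex (alg K M) Q d"
  unfolding Q_def d_def by (rule projective_resolution_chain_complex[OF projective_resolution_self[OF V]])
 note T = K M W cc
 have Vm: "left_module (alg K M) V" by (rule projective_module_left_module[OF V])
 have f0: "f \<zero>\<^sub>V = \<zero>\<^sub>W" if "f : mod_hom (alg K M) (Q r) W" for f r
  using mod_hom_zero[OF that left_module_group[OF chain_complex_module[OF cc]] left_module_group[OF W]]
  by (auto simp: Q_def split: if_splits)
 have coc: "cocycles K M Q d W 0 = mod_hom (alg K M) V W"
  using f0[of _ 0] by (auto simp: mem_cocycles_iff Q_def d_def)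
 let ?Z = "hom_module K M (Q 0) W\<lparr>carrier := cocycles K M Q d W 0\<rparr>"
 interpret Z: left_module K ?Z by (rule left_module_cocycles[OF T])
 show "mod_iso K (Ext K M Q d W 0) (hom_module K M V W)"
  unfolding Ext_def
 proof (rule quot_module_iso[OF left_module_cocycles[OF T] submodule_coboundaries[OF T]])
  show "(\<lambda>f\<in>car ?Z. f) : mod_hom K ?Z (hom_module K M V W)"
  proof (rule mod_homI)
   show "(\<lambda>f\<in>car ?Z. f) : car ?Z \<rightarrow>\<^sub>E car (hom_module K M V W)" by (auto simp: coc)
   show "(\<lambda>f\<in>car ?Z. f) (f \<oplus>\<^sub>?Z g) = (\<lambda>f\<in>car ?Z. f) f \<oplus>\<^sub>(hom_module K M V W) (\<lambda>f\<in>car ?Z. f) g"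
    if "f : car ?Z" "g : car ?Z" for f g using that Z.M.a_closed[OF that] by (simp add: Q_def)
   show "(\<lambda>f\<in>car ?Z. f) (k \<odot>\<^sub>?Z f) = k \<odot>\<^sub>(hom_module K M V W) (\<lambda>f\<in>car ?Z. f) f"
    if "k : car K" "f : car ?Z" for k f using that Z.smult_closed[OF that] by (simp add: Q_def)
  qed
  show "car (hom_module K M V W) <= (\<lambda>f\<in>car ?Z. f) ` car ?Z" by (auto simp: coc)
  show "((\<lambda>f\<in>car ?Z. f) f = (\<lambda>f\<in>car ?Z. f) g) = (f \<ominus>\<^sub>?Z g : coboundaries K M Q d W 0)"
   if "f : car ?Z" "g : car ?Z" for f g
  proof -
   have "f \<ominus>\<^sub>?Z g : coboundaries K M Q d W 0 \<longleftrightarrow> f \<ominus>\<^sub>?Z g = \<zero>\<^sub>?Z" by simp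
   thus ?thesis using Z.M.right_minus_eq[OF that] that by simp
  qed
 qed
 show "car (Ext K M Q d W (Suc s)) = {\<zero>\<^sub>(Ext K M Q d W (Suc s))}"
 proof (rule Ext_trivialI[OF T], rule subsetI)
  fix f assume f: "f : cocycles K M Q d W (Suc s)"
  hence fh: "f : mod_hom (alg K M) (Q (Suc s)) W" by (simp add: mem_cocycles_iff)
  have "f = \<zero>\<^sub>(hom_module K M (Q (Suc s)) W)"
   using mod_hom_extensional[OF fh] f0[OF fh] by (intro extensionalityI[of _ "car (Q (Suc s))"]) (auto simp: Q_def)
  thus "f : coboundaries K M Q d W (Suc s)"
   using additive_subgroup.zero_closed[OF submodule_additive_subgroup[OF submodule_coboundaries[OF T, of "Suc s"]]] by simp
 qed
qed

context hsiao_algebra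
begin

lemma inflate_elem:
 assumes V': "left_module (alg K (H X)) V'" and X: "partition_on {1..n} X"
  and m: "(ta, h) : car M" and k: "k : car K" and y: "y : car V'"
 shows "single K (ta, h) k \<odot>\<^sub>(inflate n K X V') y = (if leq X (set ta) then single K h k \<odot>\<^sub>V' y else \<zero>\<^sub>V')"
proof -
 interpret V': left_module "alg K (H X)" V' by fact
 let ?I = "{p : supp K (single K (ta, h) k). leq X (set (fst p))}"
 have e: "single K (ta, h) k \<odot>\<^sub>(inflate n K X V') y = (\<Oplus>\<^bsub>V'\<^esub>p\<in>?I. single K (snd p) (single K (ta, h) k p) \<odot>\<^sub>V' y)"
  by (simp add: inflate_def)
 show ?thesis
 proof (cases "leq X (set ta)")
  case True
  have h: "h : car (H X)" using m H_mono[OF True] by (simp add: M_iff)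
  have hy: "single K h k \<odot>\<^sub>V' y : car V'"
   using single_closed[OF K_ring group.is_monoid[OF H_group[OF X]] h k] y by simp
  show ?thesis
  proof (cases "k = \<zero>\<^sub>K")
   case k0: True
   have I: "?I = {}" using k0 by (auto simp: supp_def single_def)
   have z: "single K h \<zero>\<^sub>K = \<zero>\<^sub>(alg K (H X))" by (auto simp: single_def zero_alg)
   have "single K h k \<odot>\<^sub>V' y = \<zero>\<^sub>V'" unfolding k0 z by (rule V'.smult_l_null[OF y])
   thus ?thesis unfolding e I using True by simp
  next
   case False
   hence I: "?I = {(ta, h)}" using True by (auto simp: supp_def single_def split: if_splits)
   have "single K (ta, h) k (ta, h) = k" by (simp add: single_def)
   thus ?thesis unfolding e I using True hy by simp
  qed
 next
  case False
  hence I: "?I = {}" by (auto simp: supp_def single_def split: if_splits)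
  show ?thesis unfolding e I using False by simp
 qed
qed

text \<open>Only the isomorphism between \<open>V\<close> and the inflation of \<open>V'\<close> matters, in the form of its effect on the action of \<open>k \<cdot> (ta, h)\<close>.\<close>

lemma simple_with_apexD:
 assumes V: "simple_with_apex n K G X V' V"
 shows "partition_on {1..n} X" "left_module (alg K (H X)) V'" "left_module A V"
  "\<exists>v. bij_betw v (car V) (car V') \<and>
   (\<forall>x\<in>car V. \<forall>y\<in>car V. v (x \<oplus>\<^sub>V y) = v x \<oplus>\<^sub>V' v y) \<and>
   (\<forall>ta h k. \<forall>x\<in>car V. (ta, h) : car M --> k : car K -->
    v (elem V ta h k x) = (if leq X (set ta) then single K h k \<odot>\<^sub>V' v x else \<zero>\<^sub>V'))"
proof -
 show X: "partition_on {1..n} X" and V': "left_module (alg K (H X)) V'" and Vm: "left_module A V"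
  using V by (auto simp: simple_with_apex_def simple_module_def)
 obtain v where v: "v : mod_hom A V (inflate n K X V')" "bij_betw v (car V) (car (inflate n K X V'))"
  using V by (auto simp: simple_with_apex_def mod_iso_def)
 have c: "car (inflate n K X V') = car V'" by (simp add: inflate_def)
 have "v (elem V ta h k x) = (if leq X (set ta) then single K h k \<odot>\<^sub>V' v x else \<zero>\<^sub>V')"
  if "x : car V" "(ta, h) : car M" "k : car K" for ta h k x
  using elem_hom[OF v(1) that(2,3,1)] inflate_elem[OF V' X that(2,3)] mod_hom_closed[OF v(1) that(1)] by (simp add: c)
 thus "\<exists>v. bij_betw v (car V) (car V') \<and>
   (\<forall>x\<in>car V. \<forall>y\<in>car V. v (x \<oplus>\<^sub>V y) = v x \<oplus>\<^sub>V' v y) \<and>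
   (\<forall>ta h k. \<forall>x\<in>car V. (ta, h) : car M --> k : car K -->
    v (elem V ta h k x) = (if leq X (set ta) then single K h k \<odot>\<^sub>V' v x else \<zero>\<^sub>V'))"
  using v(2) mod_hom_add[OF v(1)] by (intro exI[of _ v]) (auto simp: c inflate_def)
qed

lemma add_pow_one_mult: "add_pow K (a * b :: nat) \<one>\<^sub>K = add_pow K a \<one>\<^sub>K \<otimes>\<^sub>K add_pow K b \<one>\<^sub>K"
proof -
 have "add_pow K a \<one>\<^sub>K \<otimes>\<^sub>K add_pow K b \<one>\<^sub>K = add_pow K a (add_pow K b \<one>\<^sub>K)"
  using K.add_pow_ldistr[OF K.one_closed, of "add_pow K b \<one>\<^sub>K" a] by simp
 also have "... = add_pow K (b * a) \<one>\<^sub>K" using K.add.nat_pow_pow[of "\<one>\<^sub>K" a b] by simp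
 finally show ?thesis by (simp add: mult.commute)
qed

text \<open>The order of \<open>G\<^sub>Y\<close> divides a power of \<open>|G|\<close>.\<close>

lemma card_block_group_nonzero:
 assumes ch: "~ characteristic K dvd card (car G)" and Y: "partition_on {1..n} Y"
 shows "add_pow K (card (car (H Y))) \<one>\<^sub>K ~= \<zero>\<^sub>K"
proof -
 have G0: "add_pow K (card (car G)) \<one>\<^sub>K ~= \<zero>\<^sub>K"
  using ch group.pow_eq_id[OF abelian_group.a_group[OF K.abelian_group_axioms], of "\<one>\<^sub>K" "card (car G)"]
  by (simp add: characteristic_def add_pow_def)
 have pow: "add_pow K (card (car G) ^ m) \<one>\<^sub>K ~= \<zero>\<^sub>K" for m
 proof (induction m)
  case (Suc m)
  thus ?case using G0 K.integral by (auto simp: add_pow_one_mult)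
 qed simp
 have "subgroup (car (H Y)) Gn"
  by (rule Gn.subgroupI) (use H_Gn H_one[OF Y] H_mult[OF Y] H_inv[OF Y] in auto)
 hence "card (rcosets\<^bsub>Gn\<^esub> car (H Y)) * card (car (H Y)) = order Gn" by (rule Gn.lagrange)
 also have "order Gn = card (car G) ^ n"
  by (simp add: order_def carrier_product_group card_PiE)
 finally show ?thesis using pow[of n] add_pow_one_mult by (metis K.r_null add_pow_one_mult K.add.nat_pow_closed K.one_closed)
qed

lemma projective_over_block_group:
 fixes V' :: "((nat => 'g) => 'k, 'v1) module"
 assumes ch: "~ characteristic K dvd card (car G)" and V': "simple_module (alg K (H X)) V'" and XY: "leq X Y"
 shows "projective_module (alg K (H Y)) V'"
proof -
 have X: "partition_on {1..n} X" and Y: "partition_on {1..n} Y" using leq_part[OF XY] by auto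
 have fin: "finite (car (H Z))" for Z by (rule finite_block_group[OF G finite_G])
 have one: "\<one>\<^sub>(H X) = \<one>\<^sub>(H Y)" by simp
 have "left_module (alg K (H X)) V'" using V' by (simp add: simple_module_def)
 from left_module_block_group_mono[OF this XY] have V'Y: "left_module (alg K (H Y)) V'" .
 from simple_module_finite_span[OF K_ring group.is_monoid[OF H_group[OF X]] fin V'] obtain E where
  E: "finite E" "E <= car V'" "car V' <= lincomb K (restrict_scalars V' (car V') (single K \<one>\<^sub>(H X))) (%y. y) ` finsupp K E"
  by blast
 show ?thesis
  by (rule maschke[OF K H_group[OF Y] fin card_block_group_nonzero[OF ch Y] V'Y E(1,2) E(3)[unfolded one]])
qed

end

context apex_coefficients
begin

lemma Ext_P_Tot: "mod_iso K (Ext K M P d W r) (Ext K M Tot D W r)"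
 by (rule Ext_comparison[OF K_cring M.monoid_axioms W V Tot_resolution resolution])

lemma Ext_module: "left_module K (Ext K M P d W r)"
 by (rule left_module_Ext[OF K_cring M.monoid_axioms W projective_resolution_chain_complex[OF resolution]])

text \<open>No face over \<open>Y\<close> occurs in degree \<open>r\<close>.\<close>

theorem Ext_vanishes:
 assumes "~ (leq X Y & card X <= r + card Y)"
 shows "car (Ext K M P d W r) = {\<zero>\<^sub>(Ext K M P d W r)}"
 by (rule mod_iso_trivial[OF Ext_P_Tot Ext_module Ext_Tot_trivial[OF assms]])

theorem Ext_iso_block_group:
 assumes XY: "leq X Y" and r: "card X <= r + card Y"
  and V': "left_module (alg K (H X)) V'"
  and v_bij: "bij_betw v (car V) (car V')"
  and v_add: "!!x y. [|x : car V; y : car V|] ==> v (x \<oplus>\<^sub>V y) = v x \<oplus>\<^sub>V' v y"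
  and v_elem: "!!h k x. [|h : car (H X); k : car K; x : car V|] ==> v (elem V l h k x) = single K h k \<odot>\<^sub>V' v x"
  and Q: "projective_resolution KY Q d' e' V'"
 shows "mod_iso K (Ext K M P d W r) (Ext K (H Y) Q d' W' (r + card Y - card X))"
proof -
 let ?s = "r + card Y - card X"
 have rs: "r + card Y = length l + ?s" using r length_l by simp
 note UR = U_resolution[OF V' XY v_bij v_add v_elem]
 have "mod_iso K (Ext K (H Y) UZ dU W' ?s) (Ext K (H Y) Q d' W' ?s)"
  by (rule Ext_comparison[OF K_cring HY W' left_module_block_group_mono[OF V' XY] Q UR])
 hence "mod_iso K (Ext K M Tot D W r) (Ext K (H Y) Q d' W' ?s)"
  by (rule mod_iso_trans[OF Ext_Tot_iso[OF XY rs] _ left_module_Ext[OF K_cring M.monoid_axioms W Tot_complex]])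
 thus ?thesis by (rule mod_iso_trans[OF Ext_P_Tot _ Ext_module])
qed

end

theorem corollary3p8:
  fixes n r :: nat
    and G :: "'g monoid"
    and K :: "'k ring"
    and X Y :: "nat set set"
    and V :: "(nat set list \<times> (nat \<Rightarrow> 'g) \<Rightarrow> 'k, 'v) module"
    and W :: "(nat set list \<times> (nat \<Rightarrow> 'g) \<Rightarrow> 'k, 'w) module"
    and V' :: "((nat \<Rightarrow> 'g) \<Rightarrow> 'k, 'v1) module"
    and W' :: "((nat \<Rightarrow> 'g) \<Rightarrow> 'k, 'w1) module"
    and P :: "nat \<Rightarrow> (nat set list \<times> (nat \<Rightarrow> 'g) \<Rightarrow> 'k, 'p) module"
    and d :: "nat \<Rightarrow> 'p \<Rightarrow> 'p"
    and e :: "'p \<Rightarrow> 'v"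
  assumes "group G" and "finite (carrier G)"
    and "field K"
    and "simple_with_apex n K G X V' V"
    and "simple_with_apex n K G Y W' W"
    and "projective_resolution (monoid_algebra K (hsiao_monoid n G)) P d e V"
  shows
    "(\<not> (refines {1..n} X Y \<and> card X \<le> r + card Y) \<longrightarrow>
        carrier (Ext K (hsiao_monoid n G) P d W r) = {\<zero>\<^bsub>Ext K (hsiao_monoid n G) P d W r\<^esub>}) \<and>
     (refines {1..n} X Y \<and> card X \<le> r + card Y \<longrightarrow>
        (\<forall>(Q :: nat \<Rightarrow> ((nat \<Rightarrow> 'g) \<Rightarrow> 'k, 'q) module) d' e'.
           projective_resolution (monoid_algebra K (block_group n G Y)) Q d' e' V' \<longrightarrow>
           mod_iso K (Ext K (hsiao_monoid n G) P d W r) (Ext K (block_group n G Y) Q d' W' (r + card Y - card X)))) \<and>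
     (\<not> characteristic K dvd card (carrier G) \<longrightarrow>
        (\<not> (refines {1..n} X Y \<and> r + card Y = card X) \<longrightarrow>
           carrier (Ext K (hsiao_monoid n G) P d W r) = {\<zero>\<^bsub>Ext K (hsiao_monoid n G) P d W r\<^esub>}) \<and>
        (refines {1..n} X Y \<and> r + card Y = card X \<longrightarrow>
           mod_iso K (Ext K (hsiao_monoid n G) P d W r) (hom_module K (block_group n G Y) V' W')))"
proof -
 interpret hsiao_algebra n G K by (rule hsiao_algebra.intro[OF assms(1-3)])
 note Vs = simple_with_apexD[OF assms(4)] and Ws = simple_with_apexD[OF assms(5)]
 from Vs(4) obtain v where v_bij: "bij_betw v (car V) (car V')"
  and v_add: "!!x y. [|x : car V; y : car V|] ==> v (x \<oplus>\<^sub>V y) = v x \<oplus>\<^sub>V' v y"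
  and v_elem: "!!ta h k x. [|(ta, h) : car M; k : car K; x : car V|] ==>
   v (elem V ta h k x) = (if leq X (set ta) then single K h k \<odot>\<^sub>V' v x else \<zero>\<^sub>V')" by (elim exE conjE) simp
 from Ws(4) obtain w where w_bij: "bij_betw w (car W) (car W')"
  and w_add: "!!x y. [|x : car W; y : car W|] ==> w (x \<oplus>\<^sub>W y) = w x \<oplus>\<^sub>W' w y"
  and w_elem: "!!ta h k x. [|(ta, h) : car M; k : car K; x : car W|] ==>
   w (elem W ta h k x) = (if leq Y (set ta) then single K h k \<odot>\<^sub>W' w x else \<zero>\<^sub>W')" by (elim exE conjE) simp
 interpret Vg: abelian_group V by (rule left_module_group[OF Vs(3)])
 interpret V'g: abelian_group V' by (rule left_module_group[OF Vs(2)])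
 have vc: "v x : car V'" if "x : car V" for x using v_bij that bij_betwE by blast
 have v_inj: "x = y" if "x : car V" "y : car V" "v x = v y" for x y
  using v_bij that by (auto simp: bij_betw_def inj_on_def)
 have v0: "v \<zero>\<^sub>V = \<zero>\<^sub>V'"
  using v_add[of "\<zero>\<^sub>V" "\<zero>\<^sub>V"] vc[of "\<zero>\<^sub>V"] by (simp add: V'g.add.r_cancel_one')
 define l where "l = rep X"
 have lX: "l : car S" "set l = X" using rep[OF Vs(1)] by (simp_all add: l_def)
 have refl: "leq X X" by (rule refines_refl[OF Vs(1)])
 have l_M: "(l, h) : car M" if "h : car (H X)" for h using that lX by (simp add: M_iff)
 interpret apex_resolution n G K l P d e V
 proof (intro apex_resolution.intro apex_resolution_axioms.intro hsiao_algebra_axioms)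
  show "l : car S" by (rule lX(1))
  show "projective_resolution A P d e V" by (rule assms(6))
  show "left_module A V" by (rule Vs(3))
  show "elem V ta h k x = (if leq (set l) (set ta) then elem V l h k x else \<zero>\<^sub>V)"
   if m: "(ta, h) : car M" and k: "k : car K" and x: "x : car V" for ta h k x
  proof (cases "leq X (set ta)")
   case True
   have h: "h : car (H X)" using m H_mono[OF True] by (simp add: M_iff)
   have "elem V ta h k x = elem V l h k x"
    by (rule v_inj[OF elem_closed[OF Vs(3) m k x] elem_closed[OF Vs(3) l_M[OF h] k x]])
    (simp add: v_elem[OF m k x] v_elem[OF l_M[OF h] k x] True lX(2) refl)
   thus ?thesis using True lX(2) by simp
  next
   case False
   have "elem V ta h k x = \<zero>\<^sub>V"
    by (rule v_inj[OF elem_closed[OF Vs(3) m k x] Vg.zero_closed]) (simp add: v_elem[OF m k x] False v0)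
   thus ?thesis using False lX(2) by simp
  qed
  show "elem V l \<one>\<^sub>Gn \<one>\<^sub>K x = x" if x: "x : car V" for x
  proof -
   note o = l_M[OF H_one[OF Vs(1)]]
   have "single K \<one>\<^sub>Gn \<one>\<^sub>K \<odot>\<^sub>V' v x = v x"
    using left_module.smult_one[OF Vs(2) vc[OF x]] by (simp add: one_alg)
   thus ?thesis
    by (intro v_inj[OF elem_closed[OF Vs(3) o K.one_closed x] x]) (simp add: v_elem[OF o K.one_closed x] lX(2) refl)
  qed
 qed
 interpret apex_coefficients n G K l P d e V Y W W' w
  by (intro apex_coefficients.intro apex_resolution_axioms apex_coefficients_axioms.intro Ws(1-3) w_bij w_add w_elem)
 have vl: "v (elem V l h k x) = single K h k \<odot>\<^sub>V' v x" if "h : car (H (set l))" "k : car K" "x : car V" for h k x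
  using v_elem[OF l_M that(2,3)] that(1) lX(2) refl by simp
 have iso_q: "mod_iso K (Ext K M P d W r) (Ext K (H Y) Q d' W' (r + card Y - card X))"
  if XY: "leq X Y" "card X <= r + card Y" and Q: "projective_resolution (alg K (H Y)) Q d' e' V'"
  for Q :: "nat => ((nat => 'g) => 'k, 'q) module" and d' e'
  using Ext_iso_block_group[OF _ _ _ v_bij v_add vl Q] XY Vs(2) by (simp add: lX(2))
 have iso_v1: "mod_iso K (Ext K M P d W r) (Ext K (H Y) Q d' W' (r + card Y - card X))"
  if XY: "leq X Y" "card X <= r + card Y" and Q: "projective_resolution (alg K (H Y)) Q d' e' V'"
  for Q :: "nat => ((nat => 'g) => 'k, 'v1) module" and d' e'
  using Ext_iso_block_group[OF _ _ _ v_bij v_add vl Q] XY Vs(2) by (simp add: lX(2))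
 have zero: "car (Ext K M P d W r) = {\<zero>\<^sub>(Ext K M P d W r)}" if "~ (leq X Y & card X <= r + card Y)"
  using Ext_vanishes[of r] that by (simp add: lX(2))
 have semisimple: "(r + card Y = card X --> mod_iso K (Ext K M P d W r) (hom_module K (H Y) V' W')) \<and>
   (r + card Y ~= card X --> car (Ext K M P d W r) = {\<zero>\<^sub>(Ext K M P d W r)})"
  if ch: "~ characteristic K dvd card (car G)" and XY: "leq X Y" "card X <= r + card Y"
 proof -
  have "simple_module (alg K (H X)) V'" using assms(4) by (simp add: simple_with_apex_def)
  from projective_over_block_group[OF ch this XY(1)] have pV: "projective_module (alg K (H Y)) V'" .
  note self = Ext_self[OF K_cring HY pV W'] and i = iso_v1[OF XY projective_resolution_self[OF pV]]
  show ?thesis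
  proof (cases "r + card Y - card X")
   case 0
   hence "r + card Y = card X" using XY(2) by simp
   moreover have "mod_iso K (Ext K M P d W r) (hom_module K (H Y) V' W')"
    by (rule mod_iso_trans[OF i[unfolded 0] self(1) Ext_module])
   ultimately show ?thesis by simp
  next
   case (Suc s)
   hence "r + card Y ~= card X" by simp
   moreover have "car (Ext K M P d W r) = {\<zero>\<^sub>(Ext K M P d W r)}"
    by (rule mod_iso_trivial[OF i[unfolded Suc] Ext_module self(2)])
   ultimately show ?thesis by simp
  qed
 qed
 show ?thesis
 proof (intro conjI impI allI)
  show "car (Ext K M P d W r) = {\<zero>\<^sub>(Ext K M P d W r)}" if "~ (leq X Y & card X <= r + card Y)" by (rule zero[OF that])
  show "car (Ext K M P d W r) = {\<zero>\<^sub>(Ext K M P d W r)}"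
   if ch: "~ characteristic K dvd card (car G)" and "~ (leq X Y & r + card Y = card X)"
   using zero semisimple[OF ch] that(2) by blast
  show "mod_iso K (Ext K M P d W r) (hom_module K (H Y) V' W')"
   if ch: "~ characteristic K dvd card (car G)" and "leq X Y & r + card Y = card X"
   using semisimple[OF ch] that(2) by simp
 qed (use iso_q in blast)
qed

end
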